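(* Let $s$ be a string of length $n$ over $\Sigma=[0,\sigma-1]$, $\sigma\le n$, and let $T$ be a full binary tree of height $\mathcal{O}(\log\sigma)$ with $\sigma$ leaves, each assigned a distinct character of $\Sigma$. Then the $T$-shaped wavelet tree of $s$ (i.e., the bitmasks $B_v$ for all internal nodes $v$ of $T$) can be constructed in $\mathcal{O}(n\log\sigma/\sqrt{\log n})$ time.
   Context: Model: word RAM with machine words of $\log n$ bits; $s$ is given in packed form ($\log\sigma$ bits per character). A full binary tree is a rooted tree in which every node has $0$ or $2$ children. The $T$-shaped wavelet tree of $s$ assigns to every internal node $v$ of $T$ a bitmask $B_v$ defined as follows: let $S_v$ be the subsequence of $s$ consisting of the characters whose assigned leaves lie in the subtree of $v$; then $B_v$ has length $|S_v|$ and $B_v[i]=0$ if the leaf of $S_v[i]$ is in the left subtree of $v$ and $B_v[i]=1$ if it is in the right subtree. *)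

theory Defs
  imports "HOL-Library.Log_Nat"
begin

unbundle bit_operations_syntax

section \<open>Full binary trees and their wavelet trees\<close>

text \<open>A full binary tree with characters at the leaves: every node has no child (\<open>Lf\<close>) or
  exactly two (\<open>Nd\<close>). A node is identified with the subtree rooted at it.\<close>

datatype ctree = Lf nat | Nd ctree ctree

fun leaves :: "ctree \<Rightarrow> nat list" where
  "leaves (Lf a) = [a]"
| "leaves (Nd l r) = leaves l @ leaves r"

text \<open>The height counts edges, so a single leaf has height 0.\<close>

fun height :: "ctree \<Rightarrow> nat" where
  "height (Lf a) = 0"
| "height (Nd l r) = 1 + max (height l) (height r)"

text \<open>\<open>T\<close> has exactly \<open>\<sigma>\<close> leaves, labelled by distinct characters of the alphabet
  \<open>{0..<\<sigma>}\<close>.\<close>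

definition shape_for :: "nat \<Rightarrow> ctree \<Rightarrow> bool" where
  "shape_for \<sigma> T \<longleftrightarrow>
     length (leaves T) = \<sigma> \<and> distinct (leaves T) \<and> set (leaves T) \<subseteq> {0..<\<sigma>}"

definition node_string :: "nat list \<Rightarrow> ctree \<Rightarrow> nat list" where
  "node_string s v = filter (\<lambda>a. a \<in> set (leaves v)) s"

text \<open>The bitmask of the internal node with children \<open>l\<close> and \<open>r\<close>; \<open>False\<close> stands for 0 (left)
  and \<open>True\<close> for 1 (right).\<close>

definition bitmask :: "nat list \<Rightarrow> ctree \<Rightarrow> ctree \<Rightarrow> bool list" where
  "bitmask s l r = map (\<lambda>a. a \<in> set (leaves r)) (node_string s (Nd l r))"


section \<open>The word RAM\<close>

text \<open>Words are natural numbers below \<open>2 ^ w\<close>, where the word length \<open>w\<close> is a parameter of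
  the semantics and not of the program. Addresses are words as well, so that only the cells with
  an address below \<open>2 ^ w\<close> can be reached. Programs are structured, and a program text mentions
  only finitely many registers.\<close>

datatype binop = Add | Sub | Mul | Div | Mod | And | Or | Xor | Shl | Shr | Eq | Less

fun word_op :: "nat \<Rightarrow> binop \<Rightarrow> nat \<Rightarrow> nat \<Rightarrow> nat" where
  "word_op w Add x y = (x + y) mod 2 ^ w"
| "word_op w Sub x y = nat ((int x - int y) mod 2 ^ w)"
| "word_op w Mul x y = (x * y) mod 2 ^ w"
| "word_op w Div x y = x div y"
| "word_op w Mod x y = x mod y"
| "word_op w And x y = x AND y"
| "word_op w Or x y = x OR y"
| "word_op w Xor x y = x XOR y"
| "word_op w Shl x y = push_bit y x mod 2 ^ w"
| "word_op w Shr x y = drop_bit y x"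
| "word_op w Eq x y = of_bool (x = y)"
| "word_op w Less x y = of_bool (x < y)"

type_synonym reg = nat

datatype com =
    Skip
  | Const reg nat
  | Op reg binop reg reg
  | Load reg reg       \<comment> \<open>target register, register holding the address\<close>
  | Store reg reg      \<comment> \<open>register holding the address, source register\<close>
  | Seq com com
  | If reg com com     \<comment> \<open>the test succeeds if the register is nonzero\<close>
  | While reg com

text \<open>A state consists of the registers and the memory; \<open>exec w c st t st'\<close> says that on a
  machine with \<open>w\<close>-bit words, \<open>c\<close> started in \<open>st\<close> halts in \<open>st'\<close> after \<open>t\<close> steps. Each
  instruction and each test of a register takes one step.\<close>

type_synonym state = "(reg \<Rightarrow> nat) \<times> (nat \<Rightarrow> nat)"

inductive exec :: "nat \<Rightarrow> com \<Rightarrow> state \<Rightarrow> nat \<Rightarrow> state \<Rightarrow> bool" for w where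
  Skip: "exec w Skip st 0 st"
| Const: "exec w (Const x k) (R, M) 1 (R(x := k mod 2 ^ w), M)"
| Op: "exec w (Op x f y z) (R, M) 1 (R(x := word_op w f (R y) (R z)), M)"
| Load: "exec w (Load x y) (R, M) 1 (R(x := M (R y)), M)"
| Store: "exec w (Store x y) (R, M) 1 (R, M(R x := R y))"
| Seq: "exec w c1 st t1 st' \<Longrightarrow> exec w c2 st' t2 st'' \<Longrightarrow> exec w (Seq c1 c2) st (t1 + t2) st''"
| IfTrue: "fst st x \<noteq> 0 \<Longrightarrow> exec w c1 st t st' \<Longrightarrow> exec w (If x c1 c2) st (1 + t) st'"
| IfFalse: "fst st x = 0 \<Longrightarrow> exec w c2 st t st' \<Longrightarrow> exec w (If x c1 c2) st (1 + t) st'"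
| WhileFalse: "fst st x = 0 \<Longrightarrow> exec w (While x c) st 1 st"
| WhileTrue: "fst st x \<noteq> 0 \<Longrightarrow> exec w c st t1 st' \<Longrightarrow> exec w (While x c) st' t2 st'' \<Longrightarrow>
    exec w (While x c) st (1 + t1 + t2) st''"


section \<open>Memory representation of input and output\<close>

text \<open>Bit sequences are packed \<open>w\<close> bits per word, least significant bit first; the padding
  bits in the last word are unspecified.\<close>

definition bits_at :: "nat \<Rightarrow> (nat \<Rightarrow> nat) \<Rightarrow> nat \<Rightarrow> bool list \<Rightarrow> bool" where
  "bits_at w M p bs \<longleftrightarrow>
     (\<forall>i < length bs. p + i div w < 2 ^ w \<and> bit (M (p + i div w)) (i mod w) = bs ! i)"

text \<open>The packed string: \<open>ceillog2 \<sigma>\<close> bits per character, characters in consecutive bits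
  (possibly crossing a word boundary).\<close>

definition char_width :: "nat \<Rightarrow> nat" where
  "char_width \<sigma> = ceillog2 \<sigma>"

definition string_bits :: "nat \<Rightarrow> nat list \<Rightarrow> bool list" where
  "string_bits \<sigma> s = concat (map (\<lambda>a. map (bit a) [0..<char_width \<sigma>]) s)"

text \<open>The tree as a linked structure: a node is a record of three words whose first word
  distinguishes leaves (0, then the character) from internal nodes (1, then the addresses of the
  two children). The records lie in \<open>V\<close>, in any order.\<close>

fun tree_at :: "nat set \<Rightarrow> (nat \<Rightarrow> nat) \<Rightarrow> nat \<Rightarrow> ctree \<Rightarrow> bool" where
  "tree_at V M p (Lf a) \<longleftrightarrow> p \<in> V \<and> M p = 0 \<and> M (p + 1) = a"
| "tree_at V M p (Nd l r) \<longleftrightarrow>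
     p \<in> V \<and> M p = 1 \<and> tree_at V M (M (p + 1)) l \<and> tree_at V M (M (p + 2)) r"

text \<open>Initial memory: a header (\<open>n\<close>, \<open>\<sigma>\<close>, the address of the root of the tree, the address of
  the first free cell), the packed string from cell 4 on, the \<open>2 * \<sigma> - 1\<close> records of the tree,
  and zeros in the remaining address space.\<close>

definition input_memory :: "nat \<Rightarrow> nat \<Rightarrow> nat list \<Rightarrow> ctree \<Rightarrow> (nat \<Rightarrow> nat) \<Rightarrow> bool" where
  "input_memory w \<sigma> s T M \<longleftrightarrow>
     (let n = length s;
          q = 4 + nat \<lceil>real (n * char_width \<sigma>) / real w\<rceil>;
          N = 2 * \<sigma> - 1;
          free = q + 3 * N
      in (\<forall>a. M a < 2 ^ w) \<and>
         M 0 = n \<and> M 1 = \<sigma> \<and> M 3 = free \<and>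
         bits_at w M 4 (string_bits \<sigma> s) \<and>
         tree_at {q + 3 * i | i. i < N} M (M 2) T \<and>
         (\<forall>a \<in> {free..<2 ^ w}. M a = 0))"

text \<open>The wavelet tree as a linked structure of the same shape as \<open>T\<close>: the record of an internal
  node holds the address of its bitmask and the addresses of the records of its two children.
  Leaves carry no data.\<close>

fun wavelet_at :: "nat \<Rightarrow> (nat \<Rightarrow> nat) \<Rightarrow> nat list \<Rightarrow> nat \<Rightarrow> ctree \<Rightarrow> bool" where
  "wavelet_at w M s p (Lf a) \<longleftrightarrow> True"
| "wavelet_at w M s p (Nd l r) \<longleftrightarrow>
     p + 2 < 2 ^ w \<and> bits_at w M (M p) (bitmask s l r) \<and>
     wavelet_at w M s (M (p + 1)) l \<and> wavelet_at w M s (M (p + 2)) r"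

text \<open>On every valid input memory, \<open>P\<close> (started with all registers 0) halts within \<open>\<tau>\<close> steps,
  leaving in cell 0 the address of the wavelet tree.\<close>

definition constructs_wavelet_tree ::
    "com \<Rightarrow> nat \<Rightarrow> nat \<Rightarrow> nat list \<Rightarrow> ctree \<Rightarrow> real \<Rightarrow> bool" where
  "constructs_wavelet_tree P w \<sigma> s T \<tau> \<longleftrightarrow>
     (\<forall>M. input_memory w \<sigma> s T M \<longrightarrow>
        (\<exists>t R' M'. exec w P (\<lambda>_. 0, M) t (R', M') \<and> real t \<le> \<tau> \<and> wavelet_at w M' s (M' 0) T))"

text \<open>Words of \<open>log n\<close> bits, up to an additive constant \<open>d\<close> that lets a word address a memory of
  \<open>O(n)\<close> cells.\<close>

definition word_length :: "nat \<Rightarrow> nat \<Rightarrow> nat" where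
  "word_length d n = ceillog2 n + d"

text \<open>The bound \<open>n * log \<sigma> / sqrt (log n)\<close> is at least 1 for \<open>2 \<le> \<sigma> \<le> n\<close>; the maximum with 1
  only matters for \<open>\<sigma> = 1\<close>, where the quotient is 0.\<close>

definition time_bound :: "nat \<Rightarrow> nat \<Rightarrow> real" where
  "time_bound \<sigma> n = max 1 (real n * log 2 (real \<sigma>) / sqrt (log 2 (real n)))"

end

(* With t = Theta(sqrt(log n)), a word has room for t codes of f <= t bits each. The levels of the
   tree are processed in rounds of f levels. At the beginning of a round a scan of s appends to a
   list at each node of the first level the local codes of its characters, i.e. the next f
   branching bits on the path to their leaves. Within the round, a list of codes packed t per word
   is translated word by word: tables indexed by a whole word, of size 2^(t * f) <= sqrt(2^w), give
   the packed first bits (which extend the bitmask of the node) and the packed remainders of the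
   codes going left and of those going right (the lists of the children). A level costs O(n / t)
   word operations plus O(1) per node, so all levels cost O(n log(sigma) / t + sigma).
   There are O(log(sigma) / t) scans of O(n) steps if the height exceeds t; otherwise f is the height,
   a single scan suffices, and it reads g = t div f characters at a time by means of a further
   table, again in O(n log(sigma) / t) steps. *)

theory Submission
  imports Defs "HOL-Library.Multiset"
begin

section \<open>A structured language on top of the word RAM\<close>

text \<open>The obstacle is the last word of a list: a table is indexed by a whole word and cannot
  see how many of its fields belong to the list. Missing fields are masked to zero, and a zero bit
  branches left. Padding therefore only adds bits at the end of the bitmask and of the left list,
  where they do no harm, whereas the right list has its exact length; this length yields the sizes
  of both children. For the same reason the string may be filled up with the character 0 to a
  multiple of \<open>g\<close>. Nodes are stored in breadth-first order. Every traversal of the tree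
  is then a linear sweep in which parents precede their children, no recursion stack is required,
  and every loop has a number of iterations that is known beforehand. The lists of one round take
  O(n) cells, since about \<open>t\<close> levels with n / \<open>t\<close> cells each are alive;
  their memory is reused in the next round. Only the bitmasks accumulate. The constant
  \<open>d\<close> must be large enough for all of this to be addressable, which also keeps the
  arithmetic on addresses free of overflow.\<close>

datatype exp = N nat | V reg | B binop exp exp | Ld exp

datatype stm =
    Skp
  | Asg reg exp
  | Sto exp exp
  | Sq stm stm
  | IfE exp stm stm
  | Whl exp stm

text \<open>Registers from 100 on hold the intermediate results of expressions; variables are the
  registers below 100.\<close>

fun cexp :: "exp \<Rightarrow> nat \<Rightarrow> com" where
  "cexp (N c) k = Const k c"
| "cexp (V x) k = Op k Or x x"
| "cexp (B g a b) k = Seq (cexp a k) (Seq (cexp b (Suc k)) (Op k g k (Suc k)))"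
| "cexp (Ld a) k = Seq (cexp a k) (Load k k)"

fun compile :: "stm \<Rightarrow> com" where
  "compile Skp = Skip"
| "compile (Asg x e) = Seq (cexp e 100) (Op x Or 100 100)"
| "compile (Sto a e) = Seq (cexp a 100) (Seq (cexp e 101) (Store 100 101))"
| "compile (Sq c1 c2) = Seq (compile c1) (compile c2)"
| "compile (IfE e c1 c2) = Seq (cexp e 100) (If 100 (compile c1) (compile c2))"
| "compile (Whl e c) = Seq (cexp e 100) (While 100 (Seq (compile c) (cexp e 100)))"

text \<open>Sums, differences and products are evaluated exactly; \<open>safe\<close> expresses that no
  intermediate result leaves the range of a machine word.\<close>

fun nop :: "nat \<Rightarrow> binop \<Rightarrow> nat \<Rightarrow> nat \<Rightarrow> nat" where
  "nop w Add x y = x + y"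
| "nop w Sub x y = x - y"
| "nop w Mul x y = x * y"
| "nop w Div x y = x div y"
| "nop w Mod x y = x mod y"
| "nop w And x y = x AND y"
| "nop w Or x y = x OR y"
| "nop w Xor x y = x XOR y"
| "nop w Shl x y = (x * 2 ^ y) mod 2 ^ w"
| "nop w Shr x y = x div 2 ^ y"
| "nop w Eq x y = of_bool (x = y)"
| "nop w Less x y = of_bool (x < y)"

fun nval :: "nat \<Rightarrow> (nat \<Rightarrow> nat) \<Rightarrow> (nat \<Rightarrow> nat) \<Rightarrow> exp \<Rightarrow> nat" where
  "nval w \<rho> M (N c) = c"
| "nval w \<rho> M (V x) = \<rho> x"
| "nval w \<rho> M (B g a b) = nop w g (nval w \<rho> M a) (nval w \<rho> M b)"
| "nval w \<rho> M (Ld a) = M (nval w \<rho> M a)"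

fun in_range :: "nat \<Rightarrow> binop \<Rightarrow> nat \<Rightarrow> nat \<Rightarrow> bool" where
  "in_range w Add x y = (x + y < 2 ^ w)"
| "in_range w Sub x y = (y \<le> x \<and> x < 2 ^ w)"
| "in_range w Mul x y = (x * y < 2 ^ w)"
| "in_range w _ x y = True"

fun safe :: "nat \<Rightarrow> (nat \<Rightarrow> nat) \<Rightarrow> (nat \<Rightarrow> nat) \<Rightarrow> exp \<Rightarrow> bool" where
  "safe w \<rho> M (N c) = (c < 2 ^ w)"
| "safe w \<rho> M (V x) = (x < 100)"
| "safe w \<rho> M (B g a b) =
     (safe w \<rho> M a \<and> safe w \<rho> M b \<and> in_range w g (nval w \<rho> M a) (nval w \<rho> M b))"
| "safe w \<rho> M (Ld a) = safe w \<rho> M a"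

fun cost :: "exp \<Rightarrow> nat" where
  "cost (N c) = 1"
| "cost (V x) = 1"
| "cost (B g a b) = cost a + cost b + 1"
| "cost (Ld a) = cost a + 1"

lemma word_op_nop: "in_range w g x y \<Longrightarrow> word_op w g x y = nop w g x y"
proof (cases g)
  case Sub
  assume "in_range w g x y"
  then have "y \<le> x" "x < 2 ^ w" using Sub by auto
  then have "(int x - int y) mod 2 ^ w = int (x - y)"
    by (metis less_imp_diff_less mod_less of_nat_diff of_nat_mod of_nat_numeral of_nat_power)
  then show ?thesis using Sub by simp
qed (auto simp: push_bit_eq_mult drop_bit_eq_div)

text \<open>Intermediate results form a stack: an evaluation at \<open>k\<close> writes only
  registers from \<open>k\<close> on. So the left operand, kept in \<open>k\<close>, survives the
  evaluation of the right one at \<open>Suc k\<close>, and the variables below 100 are never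
  disturbed.\<close>

lemma exec_cexp:
  assumes "safe w \<rho> M e" "\<forall>x < 100. R x = \<rho> x" "100 \<le> k"
  shows "\<exists>R'. exec w (cexp e k) (R, M) (cost e) (R', M) \<and> (\<forall>x < k. R' x = R x) \<and> R' k = nval w \<rho> M e"
  using assms
proof (induction e arbitrary: R k)
  case (N c)
  then have "exec w (cexp (N c) k) (R, M) (cost (N c)) (R(k := c), M)"
    using exec.Const[of w k c R M] by simp
  moreover have "(R(k := c)) k = nval w \<rho> M (N c)" "\<forall>x < k. (R(k := c)) x = R x" by simp_all
  ultimately show ?case by blast
next
  case (V x)
  have "exec w (cexp (V x) k) (R, M) (cost (V x)) (R(k := R x), M)"
    using exec.Op[of w k Or x x R M] by simp
  moreover have "(R(k := R x)) k = nval w \<rho> M (V x)" "\<forall>y < k. (R(k := R x)) y = R y"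
    using V by simp_all
  ultimately show ?case by blast
next
  case (B g a b)
  from B.IH(1)[of R k] B.prems obtain R1 where R1: "exec w (cexp a k) (R, M) (cost a) (R1, M)"
    "\<forall>x < k. R1 x = R x" "R1 k = nval w \<rho> M a" by auto
  have "\<forall>x < 100. R1 x = \<rho> x" using R1 B.prems by auto
  with B.IH(2)[of R1 "Suc k"] B.prems obtain R2 where
    R2: "exec w (cexp b (Suc k)) (R1, M) (cost b) (R2, M)"
    "\<forall>x < Suc k. R2 x = R1 x" "R2 (Suc k) = nval w \<rho> M b" by auto
  define R3 where "R3 = R2(k := word_op w g (R2 k) (R2 (Suc k)))"
  have "exec w (Op k g k (Suc k)) (R2, M) 1 (R3, M)" unfolding R3_def by (rule exec.Op)
  from exec.Seq[OF R1(1) exec.Seq[OF R2(1) this]]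
  have "exec w (cexp (B g a b) k) (R, M) (cost (B g a b)) (R3, M)" by (simp add: add.assoc)
  moreover have "R3 k = nval w \<rho> M (B g a b)"
    using R1 R2 B.prems by (simp add: R3_def word_op_nop)
  moreover have "\<forall>x < k. R3 x = R x" using R1 R2 by (simp add: R3_def)
  ultimately show ?case by blast
next
  case (Ld a)
  from Ld.IH[of R k] Ld.prems obtain R1 where R1: "exec w (cexp a k) (R, M) (cost a) (R1, M)"
    "\<forall>x < k. R1 x = R x" "R1 k = nval w \<rho> M a" by auto
  have "exec w (cexp (Ld a) k) (R, M) (cost (Ld a)) (R1(k := M (R1 k)), M)"
    using exec.Seq[OF R1(1) exec.Load[of w k k R1 M]] by simp
  moreover have "(R1(k := M (R1 k))) k = nval w \<rho> M (Ld a)"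
    "\<forall>x < k. (R1(k := M (R1 k))) x = R x" using R1 by simp_all
  ultimately show ?case by blast
qed

text \<open>The clock charges exactly the steps of the compiled code, and the scratch registers are
  hidden. All later reasoning can stay on this level without losing a constant factor.\<close>

inductive hexec :: "nat \<Rightarrow> stm \<Rightarrow> (nat \<Rightarrow> nat) \<Rightarrow> (nat \<Rightarrow> nat) \<Rightarrow> nat \<Rightarrow> (nat \<Rightarrow> nat) \<Rightarrow> (nat \<Rightarrow> nat) \<Rightarrow> bool"
  for w where
  HSkp: "hexec w Skp \<rho> M 0 \<rho> M"
| HAsg: "safe w \<rho> M e \<Longrightarrow> x < 100 \<Longrightarrow> hexec w (Asg x e) \<rho> M (cost e + 1) (\<rho>(x := nval w \<rho> M e)) M"
| HSto: "safe w \<rho> M a \<Longrightarrow> safe w \<rho> M e \<Longrightarrow>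
    hexec w (Sto a e) \<rho> M (cost a + cost e + 1) \<rho> (M(nval w \<rho> M a := nval w \<rho> M e))"
| HSq: "hexec w c1 \<rho> M t1 \<rho>' M' \<Longrightarrow> hexec w c2 \<rho>' M' t2 \<rho>'' M'' \<Longrightarrow>
    hexec w (Sq c1 c2) \<rho> M (t1 + t2) \<rho>'' M''"
| HIfT: "safe w \<rho> M e \<Longrightarrow> nval w \<rho> M e \<noteq> 0 \<Longrightarrow> hexec w c1 \<rho> M t \<rho>' M' \<Longrightarrow>
    hexec w (IfE e c1 c2) \<rho> M (cost e + 1 + t) \<rho>' M'"
| HIfF: "safe w \<rho> M e \<Longrightarrow> nval w \<rho> M e = 0 \<Longrightarrow> hexec w c2 \<rho> M t \<rho>' M' \<Longrightarrow>
    hexec w (IfE e c1 c2) \<rho> M (cost e + 1 + t) \<rho>' M'"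
| HWhlF: "safe w \<rho> M e \<Longrightarrow> nval w \<rho> M e = 0 \<Longrightarrow> hexec w (Whl e c) \<rho> M (cost e + 1) \<rho> M"
| HWhlT: "safe w \<rho> M e \<Longrightarrow> nval w \<rho> M e \<noteq> 0 \<Longrightarrow> hexec w c \<rho> M t1 \<rho>' M' \<Longrightarrow>
    hexec w (Whl e c) \<rho>' M' t2 \<rho>'' M'' \<Longrightarrow> hexec w (Whl e c) \<rho> M (cost e + 1 + t1 + t2) \<rho>'' M''"

inductive_cases hexec_SkpE: "hexec w Skp \<rho> M k \<rho>' M'"
inductive_cases hexec_AsgE: "hexec w (Asg x e) \<rho> M k \<rho>' M'"
inductive_cases hexec_StoE: "hexec w (Sto a e) \<rho> M k \<rho>' M'"
inductive_cases hexec_SqE: "hexec w (Sq a b) \<rho> M k \<rho>' M'"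
inductive_cases hexec_IfE: "hexec w (IfE e a b) \<rho> M k \<rho>' M'"
inductive_cases exec_SeqE: "exec w (Seq a b) st k st'"

lemma exec_move:
  "exec w (Op x Or k k) (R, M) 1 (R(x := R k), M)"
  using exec.Op[of w x Or k k R M] by simp

lemma exec_compile:
  assumes "hexec w c \<rho> M t \<rho>' M'" "\<forall>x < 100. R x = \<rho> x"
  shows "\<exists>R'. exec w (compile c) (R, M) t (R', M') \<and> (\<forall>x < 100. R' x = \<rho>' x)"
  using assms
proof (induction arbitrary: R rule: hexec.induct)
  case (HSkp \<rho> M)
  then show ?case using exec.Skip[of w "(R, M)"] by auto
next
  case (HAsg \<rho> M e x)
  from exec_cexp[OF HAsg(1) HAsg(3), of 100] obtain R1 where R1:
    "exec w (cexp e 100) (R, M) (cost e) (R1, M)" "\<forall>x < 100. R1 x = R x" "R1 100 = nval w \<rho> M e"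
    by auto
  from exec.Seq[OF R1(1) exec_move[of w x 100 R1 M]] R1 HAsg show ?case by auto
next
  case (HSto \<rho> M a e)
  from exec_cexp[OF HSto(1) HSto(3), of 100] obtain R1 where R1:
    "exec w (cexp a 100) (R, M) (cost a) (R1, M)" "\<forall>x < 100. R1 x = R x" "R1 100 = nval w \<rho> M a"
    by auto
  then have "\<forall>x < 100. R1 x = \<rho> x" using HSto by auto
  from exec_cexp[OF HSto(2) this, of 101] obtain R2 where R2:
    "exec w (cexp e 101) (R1, M) (cost e) (R2, M)" "\<forall>x < 101. R2 x = R1 x" "R2 101 = nval w \<rho> M e"
    by auto
  from exec.Seq[OF R1(1) exec.Seq[OF R2(1) exec.Store[of w 100 101 R2 M]]] R1 R2 HSto
  have "exec w (compile (Sto a e)) (R, M) (cost a + cost e + 1)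
      (R2, M(nval w \<rho> M a := nval w \<rho> M e))" "\<forall>x < 100. R2 x = \<rho> x"
    by (simp_all add: add.assoc)
  then show ?case by blast
next
  case (HSq c1 \<rho> M t1 \<rho>' M' c2 t2 \<rho>'' M'')
  from HSq.IH(1)[OF HSq.prems] obtain R1 where R1: "exec w (compile c1) (R, M) t1 (R1, M')"
    "\<forall>x < 100. R1 x = \<rho>' x" by auto
  from HSq.IH(2)[OF R1(2)] obtain R2 where R2: "exec w (compile c2) (R1, M') t2 (R2, M'')"
    "\<forall>x < 100. R2 x = \<rho>'' x" by auto
  from exec.Seq[OF R1(1) R2(1)] R2(2) show ?case by auto
next
  case (HIfT \<rho> M e c1 t \<rho>' M' c2)
  from exec_cexp[OF HIfT(1) HIfT.prems, of 100] obtain R1 where R1: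
    "exec w (cexp e 100) (R, M) (cost e) (R1, M)" "\<forall>x < 100. R1 x = R x" "R1 100 = nval w \<rho> M e"
    by auto
  then have "\<forall>x < 100. R1 x = \<rho> x" using HIfT by auto
  from HIfT.IH[OF this] obtain R2 where R2: "exec w (compile c1) (R1, M) t (R2, M')"
    "\<forall>x < 100. R2 x = \<rho>' x" by auto
  have "exec w (If 100 (compile c1) (compile c2)) (R1, M) (1 + t) (R2, M')"
    using R1 HIfT by (intro exec.IfTrue R2) auto
  from exec.Seq[OF R1(1) this] R2(2) show ?case by (auto simp: add.assoc)
next
  case (HIfF \<rho> M e c2 t \<rho>' M' c1)
  from exec_cexp[OF HIfF(1) HIfF.prems, of 100] obtain R1 where R1:
    "exec w (cexp e 100) (R, M) (cost e) (R1, M)" "\<forall>x < 100. R1 x = R x" "R1 100 = nval w \<rho> M e"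
    by auto
  then have "\<forall>x < 100. R1 x = \<rho> x" using HIfF by auto
  from HIfF.IH[OF this] obtain R2 where R2: "exec w (compile c2) (R1, M) t (R2, M')"
    "\<forall>x < 100. R2 x = \<rho>' x" by auto
  have "exec w (If 100 (compile c1) (compile c2)) (R1, M) (1 + t) (R2, M')"
    using R1 HIfF by (intro exec.IfFalse R2) auto
  from exec.Seq[OF R1(1) this] R2(2) show ?case by (auto simp: add.assoc)
next
  case (HWhlF \<rho> M e c)
  from exec_cexp[OF HWhlF(1) HWhlF.prems, of 100] obtain R1 where R1:
    "exec w (cexp e 100) (R, M) (cost e) (R1, M)" "\<forall>x < 100. R1 x = R x" "R1 100 = nval w \<rho> M e"
    by auto
  have "exec w (While 100 (Seq (compile c) (cexp e 100))) (R1, M) 1 (R1, M)"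
    using R1 HWhlF by (intro exec.WhileFalse) auto
  from exec.Seq[OF R1(1) this] R1(2) HWhlF.prems show ?case by auto
next
  case (HWhlT \<rho> M e c t1 \<rho>' M' t2 \<rho>'' M'')
  let ?W = "While 100 (Seq (compile c) (cexp e 100))"
  from exec_cexp[OF HWhlT(1) HWhlT.prems, of 100] obtain R1 where R1:
    "exec w (cexp e 100) (R, M) (cost e) (R1, M)" "\<forall>x < 100. R1 x = R x" "R1 100 = nval w \<rho> M e"
    by auto
  then have "\<forall>x < 100. R1 x = \<rho> x" using HWhlT by auto
  from HWhlT.IH(1)[OF this] obtain R2 where R2: "exec w (compile c) (R1, M) t1 (R2, M')"
    "\<forall>x < 100. R2 x = \<rho>' x" by auto
  from HWhlT.IH(2)[OF R2(2)] obtain R3 where R3: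
    "exec w (Seq (cexp e 100) ?W) (R2, M') t2 (R3, M'')" "\<forall>x < 100. R3 x = \<rho>'' x" by auto
  \<comment> \<open>The induction hypothesis supplies a run of the test followed by the loop. In the
    compiled program this test is the end of the loop body, so the run is cut behind it and
    regrouped.\<close>
  from R3(1) obtain u1 u2 st where u: "exec w (cexp e 100) (R2, M') u1 st"
    "exec w ?W st u2 (R3, M'')" "t2 = u1 + u2" by (auto elim: exec_SeqE)
  have "exec w ?W (R1, M) (1 + (t1 + u1) + u2) (R3, M'')"
    using R1 HWhlT(2) by (intro exec.WhileTrue[OF _ exec.Seq[OF R2(1) u(1)] u(2)]) auto
  from exec.Seq[OF R1(1) this] R3(2) u(3) show ?case by (auto simp: algebra_simps)
qed

text \<open>Weakest preconditions for total correctness; the last argument of the postcondition is a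
  clock.\<close>

definition wp :: "nat \<Rightarrow> stm \<Rightarrow> ((nat \<Rightarrow> nat) \<Rightarrow> (nat \<Rightarrow> nat) \<Rightarrow> nat \<Rightarrow> bool) \<Rightarrow>
    (nat \<Rightarrow> nat) \<Rightarrow> (nat \<Rightarrow> nat) \<Rightarrow> nat \<Rightarrow> bool" where
  "wp w c Q \<rho> M t \<longleftrightarrow> (\<exists>k \<rho>' M'. hexec w c \<rho> M k \<rho>' M' \<and> Q \<rho>' M' (t + k))"

lemma wp_Skp [simp]: "wp w Skp Q \<rho> M t \<longleftrightarrow> Q \<rho> M t"
  unfolding wp_def using HSkp[of w \<rho> M] by (metis add_0_right hexec_SkpE)

lemma wp_Asg [simp]: "wp w (Asg x e) Q \<rho> M t \<longleftrightarrow>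
   safe w \<rho> M e \<and> x < 100 \<and> Q (\<rho>(x := nval w \<rho> M e)) M (t + cost e + 1)"
  unfolding wp_def
  by (rule iffI) (auto elim!: hexec_AsgE intro!: exI HAsg simp: add.assoc, (metis add.assoc HAsg Suc_eq_plus1 add_Suc_right)?)

lemma wp_Sto [simp]: "wp w (Sto a e) Q \<rho> M t \<longleftrightarrow> safe w \<rho> M a \<and> safe w \<rho> M e \<and>
   Q \<rho> (M(nval w \<rho> M a := nval w \<rho> M e)) (t + cost a + cost e + 1)"
  unfolding wp_def
  by (rule iffI) (auto elim!: hexec_StoE simp: add.assoc, (metis add.assoc HSto Suc_eq_plus1 add_Suc_right)?)

lemma wp_Sq [simp]: "wp w (Sq a b) Q \<rho> M t \<longleftrightarrow> wp w a (wp w b Q) \<rho> M t"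
  unfolding wp_def by (rule iffI; elim exE conjE hexec_SqE)
    (auto simp: add.assoc intro!: exI HSq)

lemma wp_If [simp]: "wp w (IfE e a b) Q \<rho> M t \<longleftrightarrow> safe w \<rho> M e \<and>
   (if nval w \<rho> M e \<noteq> 0 then wp w a Q \<rho> M (t + cost e + 1) else wp w b Q \<rho> M (t + cost e + 1))"
proof
  show "wp w (IfE e a b) Q \<rho> M t \<Longrightarrow> safe w \<rho> M e \<and>
   (if nval w \<rho> M e \<noteq> 0 then wp w a Q \<rho> M (t + cost e + 1) else wp w b Q \<rho> M (t + cost e + 1))"
    unfolding wp_def by (elim exE conjE hexec_IfE) (auto simp: add.assoc)
  assume a: "safe w \<rho> M e \<and>
   (if nval w \<rho> M e \<noteq> 0 then wp w a Q \<rho> M (t + cost e + 1) else wp w b Q \<rho> M (t + cost e + 1))"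
  show "wp w (IfE e a b) Q \<rho> M t"
  proof (cases "nval w \<rho> M e = 0")
    case True
    with a obtain k \<rho>' M' where "hexec w b \<rho> M k \<rho>' M'" "Q \<rho>' M' (t + cost e + 1 + k)"
      unfolding wp_def by auto
    with HIfF[of w \<rho> M e b k \<rho>' M' a] a True show ?thesis unfolding wp_def
      by (metis add.assoc)
  next
    case False
    with a obtain k \<rho>' M' where "hexec w a \<rho> M k \<rho>' M'" "Q \<rho>' M' (t + cost e + 1 + k)"
      unfolding wp_def by auto
    with HIfT[of w \<rho> M e a k \<rho>' M' b] a False show ?thesis unfolding wp_def
      by (metis add.assoc)
  qed
qed

text \<open>The number \<open>m\<close> of iterations is fixed in advance, so an invariant indexed
  by the iteration replaces a variant, and with the clock as an argument of the invariant it also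
  yields the running time. The clock after the test is named by an equation so that triples for an
  arbitrary clock apply directly.\<close>

lemma wp_Whl:
  assumes init: "I 0 \<rho> M t"
    and test: "\<And>k \<rho> M t. k \<le> m \<Longrightarrow> I k \<rho> M t \<Longrightarrow> safe w \<rho> M e \<and> (nval w \<rho> M e \<noteq> 0 \<longleftrightarrow> k < m)"
    and body: "\<And>k \<rho> M t t'. k < m \<Longrightarrow> I k \<rho> M t \<Longrightarrow> t' = t + cost e + 1 \<Longrightarrow> wp w c (I (Suc k)) \<rho> M t'"
    and exit: "\<And>\<rho> M t t'. I m \<rho> M t \<Longrightarrow> t' = t + cost e + 1 \<Longrightarrow> Q \<rho> M t'"
  shows "wp w (Whl e c) Q \<rho> M t"
proof -
  have "k \<le> m \<Longrightarrow> I k \<rho> M t \<Longrightarrow> wp w (Whl e c) Q \<rho> M t" for k \<rho> M t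
  proof (induction "m - k" arbitrary: k \<rho> M t)
    case 0
    then have "k = m" and I: "I m \<rho> M t" by simp_all
    then have "hexec w (Whl e c) \<rho> M (cost e + 1) \<rho> M"
      using test[OF order_refl I] by (intro HWhlF) auto
    moreover have "Q \<rho> M (t + (cost e + 1))" using exit[OF I refl] by (simp add: add.assoc)
    ultimately show ?case unfolding wp_def by blast
  next
    case (Suc d)
    then have "k < m" by simp
    note Ik = Suc.prems(2)
    from body[OF \<open>k < m\<close> Ik refl] obtain k1 \<rho>' M' where 1:
      "hexec w c \<rho> M k1 \<rho>' M'" "I (Suc k) \<rho>' M' (t + cost e + 1 + k1)" unfolding wp_def by blast
    have 0: "safe w \<rho> M e" "nval w \<rho> M e \<noteq> 0" using test[OF _ Ik] \<open>k < m\<close> by auto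
    have "wp w (Whl e c) Q \<rho>' M' (t + cost e + 1 + k1)"
      using Suc.hyps(2) \<open>k < m\<close> by (intro Suc.hyps(1)[OF _ _ 1(2)]) auto
    then obtain k2 \<rho>'' M'' where 2: "hexec w (Whl e c) \<rho>' M' k2 \<rho>'' M''" "Q \<rho>'' M'' (t + cost e + 1 + k1 + k2)"
      unfolding wp_def by auto
    have "Q \<rho>'' M'' (t + (cost e + 1 + k1 + k2))" using 2(2) by (simp add: add.assoc)
    then show ?case unfolding wp_def using HWhlT[OF 0 1(1) 2(1)] by blast
  qed
  from this[of 0] init show ?thesis by simp
qed

abbreviation (input) e_add (infixl "\<oplus>" 65) where "a \<oplus> b \<equiv> B Add a b"
abbreviation (input) e_sub (infixl "\<ominus>" 65) where "a \<ominus> b \<equiv> B Sub a b"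
abbreviation (input) e_mul (infixl "\<otimes>" 70) where "a \<otimes> b \<equiv> B Mul a b"
abbreviation (input) e_div (infixl "\<oslash>" 70) where "a \<oslash> b \<equiv> B Div a b"
abbreviation (input) e_shl (infixl "\<lless>" 60) where "a \<lless> b \<equiv> B Shl a b"
abbreviation (input) e_shr (infixl "\<ggreater>" 60) where "a \<ggreater> b \<equiv> B Shr a b"
abbreviation (input) e_less (infix "\<prec>" 50) where "a \<prec> b \<equiv> B Less a b"
abbreviation (input) e_eq (infix "\<doteq>" 50) where "a \<doteq> b \<equiv> B Eq a b"
abbreviation (input) s_asg (infix "\<leftarrow>" 45) where "x \<leftarrow> e \<equiv> Asg x e"
abbreviation (input) s_sto ("[_] \<leftarrow> _" [46, 46] 45) where "[a] \<leftarrow> e \<equiv> Sto a e"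
abbreviation (input) s_seq (infixr ";;" 40) where "c ;; d \<equiv> Sq c d"

section \<open>Packed lists and streams\<close>

fun pack :: "nat \<Rightarrow> nat list \<Rightarrow> nat" where
  "pack f [] = 0"
| "pack f (z # zs) = z + 2 ^ f * pack f zs"

definition fields :: "nat \<Rightarrow> nat list \<Rightarrow> bool" where
  "fields f zs \<longleftrightarrow> (\<forall>z \<in> set zs. z < 2 ^ f)"

lemma fields_simps [simp]:
  "fields f []" "fields f (z # zs) \<longleftrightarrow> z < 2 ^ f \<and> fields f zs"
  "fields f (xs @ ys) \<longleftrightarrow> fields f xs \<and> fields f ys"
  by (auto simp: fields_def)

lemma fields_take: "fields f zs \<Longrightarrow> fields f (take k zs)"
  by (auto simp: fields_def dest: in_set_takeD)

lemma fields_drop: "fields f zs \<Longrightarrow> fields f (drop k zs)"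
  by (auto simp: fields_def dest: in_set_dropD)

lemma pack_append: "pack f (xs @ ys) = pack f xs + 2 ^ (f * length xs) * pack f ys"
  by (induction xs) (simp_all add: algebra_simps power_add)

lemma pack_less: "fields f zs \<Longrightarrow> pack f zs < 2 ^ (f * length zs)"
proof (induction zs)
  case (Cons z zs)
  then have "z < 2 ^ f" "Suc (pack f zs) \<le> 2 ^ (f * length zs)" by auto
  then have "z + 2 ^ f * pack f zs < 2 ^ f * Suc (pack f zs)" by simp
  also have "\<dots> \<le> 2 ^ f * 2 ^ (f * length zs)"
    by (rule mult_le_mono2) fact
  finally show ?case by (simp add: power_add)
qed simp

lemma pack_replicate_0 [simp]: "pack f (replicate k 0) = 0"
  by (induction k) auto

lemma pack_div:
  assumes "fields f zs"
  shows "pack f zs div 2 ^ (f * k) = pack f (drop k zs)"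
proof (cases "k \<le> length zs")
  case True
  have "pack f zs = pack f (take k zs) + 2 ^ (f * k) * pack f (drop k zs)"
    using pack_append[of f "take k zs" "drop k zs"] True by (simp add: min_def)
  moreover have "pack f (take k zs) < 2 ^ (f * k)"
    using pack_less[OF fields_take[OF assms, of k]] True by (simp add: min.absorb2)
  ultimately show ?thesis by simp
next
  case False
  have "pack f zs < 2 ^ (f * length zs)" using pack_less[OF assms] .
  also have "\<dots> \<le> 2 ^ (f * k)" using False by (intro power_increasing) auto
  finally show ?thesis using False by simp
qed

lemma pack_mod:
  assumes "fields f zs"
  shows "pack f zs mod 2 ^ (f * k) = pack f (take k zs)"
proof (cases "k \<le> length zs")
  case True
  have "pack f zs = pack f (take k zs) + 2 ^ (f * k) * pack f (drop k zs)"
    using pack_append[of f "take k zs" "drop k zs"] True by (simp add: min_def)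
  moreover have "pack f (take k zs) < 2 ^ (f * k)"
    using pack_less[OF fields_take[OF assms, of k]] True by (simp add: min.absorb2)
  ultimately show ?thesis by simp
next
  case False
  have "pack f zs < 2 ^ (f * length zs)" using pack_less[OF assms] .
  also have "\<dots> \<le> 2 ^ (f * k)" using False by (intro power_increasing) auto
  finally show ?thesis using False by simp
qed

lemma pack_nth:
  assumes "fields f zs" "k < length zs"
  shows "pack f zs div 2 ^ (f * k) mod 2 ^ f = zs ! k"
proof -
  have "pack f (drop k zs) mod 2 ^ (f * 1) = pack f (take 1 (drop k zs))"
    by (rule pack_mod) (simp add: assms fields_drop)
  moreover have "take 1 (drop k zs) = [zs ! k]"
    using assms by (simp add: take_Suc hd_drop_conv_nth)
  ultimately show ?thesis by (simp add: pack_div assms)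
qed

section \<open>Binary digits of shifted sums and of packed lists\<close>

lemma bit_add_shift:
  assumes "(S::nat) < 2 ^ p"
  shows "bit (S + 2 ^ p * Y) i = (if i < p then bit S i else bit Y (i - p))"
proof (cases "i < p")
  case True
  have "bit (S + 2 ^ p * Y) i = bit (take_bit p (S + 2 ^ p * Y)) i"
    using True by (simp add: bit_take_bit_iff)
  also have "take_bit p (S + 2 ^ p * Y) = S" using assms by (simp add: take_bit_eq_mod)
  finally show ?thesis using True by simp
next
  case False
  then have "i = p + (i - p)" by simp
  then have "(S + 2 ^ p * Y) div 2 ^ i = (S + 2 ^ p * Y) div 2 ^ p div 2 ^ (i - p)"
    by (metis div_mult2_eq power_add)
  also have "\<dots> = Y div 2 ^ (i - p)" using assms by simp
  finally show ?thesis using False by (simp add: bit_iff_odd)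
qed

lemma div_mod_eqI: "(x::nat) = q * c + r \<Longrightarrow> r < c \<Longrightarrow> x div c = q \<and> x mod c = r"
  by simp

lemma not_bit_less: "(x::nat) < 2 ^ m \<Longrightarrow> m \<le> i \<Longrightarrow> \<not> bit x i"
  by (metis bit_take_bit_iff leD take_bit_nat_eq_self)

lemma and_mask_nat: "(x::nat) AND (2 ^ m - 1) = x mod 2 ^ m"
  by (metis mask_eq_exp_minus_1 take_bit_eq_mask take_bit_eq_mod)

lemma bit_mod_pow: "bit ((x::nat) mod 2 ^ m) i \<longleftrightarrow> i < m \<and> bit x i"
  by (metis bit_take_bit_iff take_bit_eq_mod)

lemma bit_div_pow: "bit ((x::nat) div 2 ^ m) i \<longleftrightarrow> bit x (m + i)"
  by (metis bit_drop_bit_eq comp_apply drop_bit_eq_div)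

lemma bit_mult_pow: "bit ((x::nat) * 2 ^ m) i \<longleftrightarrow> m \<le> i \<and> bit x (i - m)"
  using bit_add_shift[of 0 m x i] by (auto simp: mult.commute)

lemma or_less_pow: "(x::nat) < 2 ^ m \<Longrightarrow> y < 2 ^ m \<Longrightarrow> x OR y < 2 ^ m"
  by (metis take_bit_nat_eq_self take_bit_nat_less_exp take_bit_or)

lemma nat_bit_eqI: "(\<And>i. bit (x::nat) i = bit y i) \<Longrightarrow> x = y"
  by (rule bit_eqI) auto

lemma bit_pack:
  assumes "fields f zs" "0 < f"
  shows "bit (pack f zs) i \<longleftrightarrow> i div f < length zs \<and> bit (zs ! (i div f)) (i mod f)"
  using assms(1)
proof (induction zs arbitrary: i)
  case (Cons z zs)
  have eq: "bit (pack f (z # zs)) i = (if i < f then bit z i else bit (pack f zs) (i - f))"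
    using Cons.prems bit_add_shift[of z f "pack f zs" i] by simp
  show ?case
  proof (cases "i < f")
    case False
    then have "i div f = Suc ((i - f) div f)" "i mod f = (i - f) mod f"
      using assms(2) by (simp_all add: le_div_geq le_mod_geq)
    then show ?thesis using eq False Cons.IH[of "i - f"] Cons.prems by simp
  qed (use eq in simp)
qed simp

text \<open>The parameter \<open>c\<close> is the number of bits used per cell: \<open>w\<close> for
  the input string and the bitmasks, but \<open>t * f\<close> for lists of codes, so that no code
  crosses a cell boundary and the content of a cell can serve as a table index. Higher bits of a
  cell are ignored.\<close>

definition holds :: "nat \<Rightarrow> (nat \<Rightarrow> nat) \<Rightarrow> nat \<Rightarrow> nat \<Rightarrow> nat \<Rightarrow> bool" where
  "holds c M p m S \<longleftrightarrow> (\<forall>i < m. bit (M (p + i div c)) (i mod c) = bit S i)"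

lemma holds_mono: "holds c M p m S \<Longrightarrow> m' \<le> m \<Longrightarrow> holds c M p m' S"
  by (auto simp: holds_def)

lemma holds_cong:
  assumes "holds c M p m S" "\<And>a. p \<le> a \<Longrightarrow> a < p + (m + c - 1) div c \<Longrightarrow> M' a = M a" "0 < c"
  shows "holds c M' p m S"
  unfolding holds_def
proof (intro allI impI)
  fix i assume i: "i < m"
  have "i div c < (m + c - 1) div c"
  proof -
    have "i div c + 1 = (i + c) div c" using assms(3) by simp
    also have "\<dots> \<le> (m + c - 1) div c" using i by (intro div_le_mono) auto
    finally show ?thesis by simp
  qed
  then have "M' (p + i div c) = M (p + i div c)" by (intro assms) auto
  then show "bit (M' (p + i div c)) (i mod c) = bit S i" using assms(1) i by (simp add: holds_def)
qed

lemma holds_cell: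
  assumes "holds c M p m S" "k * c + L \<le> m" "L \<le> c" "0 < c"
  shows "M (p + k) mod 2 ^ L = S div 2 ^ (k * c) mod 2 ^ L"
proof (rule nat_bit_eqI)
  fix i
  show "bit (M (p + k) mod 2 ^ L) i = bit (S div 2 ^ (k * c) mod 2 ^ L) i"
  proof (cases "i < L")
    case True
    then have "k * c + i < m" "(k * c + i) div c = k" "(k * c + i) mod c = i"
      using assms by auto
    then have "bit (M (p + k)) i = bit S (k * c + i)" using assms(1) unfolding holds_def by metis
    then show ?thesis by (simp add: bit_mod_pow bit_div_pow True)
  qed (simp add: bit_mod_pow)
qed

text \<open>If the field ends within the first cell, the second one contributes only from position
  \<open>w - o'\<close> on, and the final mask removes this. The bound on the first cell ensures
  that nothing above bit \<open>w\<close> collides with the bits coming from the second.\<close>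

lemma holds_read:
  assumes h: "holds w M p m S" and r: "k * w + o' + L \<le> m" and "o' < w" "L \<le> w"
    and word: "M (p + k) < 2 ^ w"
  shows "(M (p + k) div 2 ^ o' OR M (p + k + 1) * 2 ^ (w - o') mod 2 ^ w) mod 2 ^ L
    = S div 2 ^ (k * w + o') mod 2 ^ L"
proof (rule nat_bit_eqI)
  fix i
  show "bit ((M (p + k) div 2 ^ o' OR M (p + k + 1) * 2 ^ (w - o') mod 2 ^ w) mod 2 ^ L) i
    = bit (S div 2 ^ (k * w + o') mod 2 ^ L) i"
  proof (cases "i < L")
    case True
    have S: "bit (M (p + (k * w + o' + i) div w)) ((k * w + o' + i) mod w) = bit S (k * w + o' + i)"
      using h True r by (simp add: holds_def)
    show ?thesis
    proof (cases "o' + i < w")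
      case True2: True
      then have "(k * w + o' + i) div w = k" "(k * w + o' + i) mod w = o' + i"
        by (simp_all add: add.assoc)
      moreover have "\<not> w - o' \<le> i" using True2 by linarith
      ultimately show ?thesis using S True True2
        by (simp add: bit_mod_pow bit_div_pow bit_or_iff bit_mult_pow)
    next
      case False
      have e: "k * w + o' + i = (k + 1) * w + (o' + i - w)" using False by simp
      have "o' + i - w < w" using \<open>o' < w\<close> \<open>L \<le> w\<close> True by simp
      then have "(k * w + o' + i) div w = k + 1" "(k * w + o' + i) mod w = o' + i - w"
        using div_mod_eqI[OF e] by simp_all
      moreover have "i - (w - o') = o' + i - w" using \<open>o' < w\<close> False by simp
      moreover have "\<not> bit (M (p + k)) (o' + i)" using False word by (intro not_bit_less) auto
      moreover have "w - o' \<le> i" using False by linarith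
      ultimately show ?thesis using S True False \<open>L \<le> w\<close>
        by (simp add: bit_mod_pow bit_div_pow bit_or_iff bit_mult_pow add.assoc)
    qed
  qed (simp add: bit_mod_pow)
qed

text \<open>A stream under construction: the cell at the current position contains no bits beyond the
  position, so that new bits can be added by a disjunction.\<close>

definition stream :: "nat \<Rightarrow> (nat \<Rightarrow> nat) \<Rightarrow> nat \<Rightarrow> nat \<Rightarrow> nat \<Rightarrow> bool" where
  "stream c M p m S \<longleftrightarrow> holds c M p m S \<and> S < 2 ^ m \<and> M (p + m div c) < 2 ^ (m mod c)"

lemma stream_empty: "M p = 0 \<Longrightarrow> stream c M p 0 0"
  by (simp add: stream_def holds_def)

lemma stream_cong:
  assumes "stream c M p m S" "\<And>a. p \<le> a \<Longrightarrow> a \<le> p + m div c \<Longrightarrow> M' a = M a"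
  shows "stream c M' p m S"
proof -
  have "i div c \<le> m div c" if "i < m" for i using that by (intro div_le_mono) auto
  then show ?thesis using assms by (auto simp: stream_def holds_def)
qed

text \<open>For \<open>c < w\<close> the bits of \<open>Y\<close> that overflow position
  \<open>c\<close> also stay in the cell just filled; they are invisible to \<open>holds\<close>, so
  no masking is required. The next cell is overwritten, even with 0 when \<open>Y\<close> fills the
  cell exactly. This clears remnants of earlier rounds and establishes the condition on the new last
  cell.\<close>

lemma stream_append:
  assumes st: "stream c M p m S" and Y: "Y < 2 ^ L" and L: "L \<le> c" and c: "c \<le> w" "0 < c"
    and M1: "M1 = M(p + m div c := M (p + m div c) OR (Y * 2 ^ (m mod c) mod 2 ^ w))"
    and M2: "M2 = (if m mod c + L < c then M1 else M1(p + m div c + 1 := Y div 2 ^ (c - m mod c)))"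
  shows "stream c M2 p (m + L) (S + 2 ^ m * Y)"
proof -
  let ?A = "p + m div c" and ?F = "m mod c"
  have h: "\<And>i. i < m \<Longrightarrow> bit (M (p + i div c)) (i mod c) = bit S i" and S: "S < 2 ^ m"
    and tail: "M ?A < 2 ^ ?F" using st by (auto simp: stream_def holds_def)
  have F: "?F < c" using c by simp
  have m: "m = (m div c) * c + ?F" by simp
  have qA: "(m + L) div c = m div c \<and> (m + L) mod c = ?F + L" if "?F + L < c"
  proof -
    have "m + L = (m div c) * c + (?F + L)" by simp
    then show ?thesis using that by (metis add.commute add_cancel_right_left div_less div_mult_self3 c(2) less_not_refl2 mod_less mod_mult_self3)
  qed
  have qB: "(m + L) div c = m div c + 1 \<and> (m + L) mod c = ?F + L - c" if "\<not> ?F + L < c"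
  proof -
    have "m + L = (m div c + 1) * c + (?F + L - c)" using that m by simp
    moreover have "?F + L - c < c" using F L by simp
    ultimately show ?thesis by (metis add.commute add_cancel_right_left div_less div_mult_self3 c(2) less_not_refl2 mod_less mod_mult_self3)
  qed
  have A2: "M2 ?A = M ?A OR (Y * 2 ^ ?F mod 2 ^ w)" by (simp add: M2 M1)
  have bitA: "bit (M2 ?A) k = (if k < ?F then bit (M ?A) k else bit Y (k - ?F))" if "k < c" for k
    unfolding A2 using that c not_bit_less[OF tail, of k]
    by (auto simp: bit_or_iff bit_mod_pow bit_mult_pow)
  have "S + 2 ^ m * Y < 2 ^ (m + L)"
  proof -
    have "S + 2 ^ m * Y < 2 ^ m * (Y + 1)" using S by simp
    also have "\<dots> \<le> 2 ^ m * 2 ^ L" using Y by (intro mult_le_mono2) auto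
    finally show ?thesis by (simp add: power_add)
  qed
  moreover have "M2 (p + (m + L) div c) < 2 ^ ((m + L) mod c)"
  proof (cases "?F + L < c")
    case True
    have "Y * 2 ^ ?F < 2 ^ (?F + L)" using Y by (simp add: power_add mult.commute)
    moreover have "?F + L < w" using True c by simp
    then have "Y * 2 ^ ?F < 2 ^ w"
      using calculation by (meson less_trans one_less_numeral_iff power_strict_increasing semiring_norm(76))
    moreover have "M ?A < 2 ^ (?F + L)"
      using tail by (meson le_add1 less_le_trans one_le_numeral power_increasing)
    moreover have "Y * 2 ^ ?F mod 2 ^ w = Y * 2 ^ ?F" using calculation(2) by simp
    ultimately have "M ?A OR (Y * 2 ^ ?F mod 2 ^ w) < 2 ^ (?F + L)"
      by (simp add: or_less_pow)
    then show ?thesis using qA[OF True] A2 by simp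
  next
    case False
    have "Y div 2 ^ (c - ?F) < 2 ^ (L - (c - ?F))"
    proof -
      have "L = (c - ?F) + (L - (c - ?F))" using False F by simp
      then have "(2::nat) ^ L = 2 ^ (c - ?F) * 2 ^ (L - (c - ?F))" by (metis power_add)
      then show ?thesis using Y by (simp add: less_mult_imp_div_less mult.commute)
    qed
    moreover have "L - (c - ?F) = ?F + L - c" using F by simp
    ultimately show ?thesis using qB[OF False] False by (simp add: M2)
  qed
  moreover have "bit (M2 (p + i div c)) (i mod c) = bit (S + 2 ^ m * Y) i" if i: "i < m + L" for i
  proof (cases "i < m")
    case True
    have le: "i div c \<le> m div c" using True by (intro div_le_mono) auto
    show ?thesis
    proof (cases "i div c = m div c")
      case eq: True
      have "i mod c < ?F" using True eq by (metis add_less_cancel_left div_mult_mod_eq)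
      then have "bit (M2 ?A) (i mod c) = bit (M ?A) (i mod c)" using bitA[of "i mod c"] c by simp
      then show ?thesis using h[OF True] eq True bit_add_shift[OF S] by simp
    next
      case False
      then have "M2 (p + i div c) = M (p + i div c)" using le by (auto simp: M2 M1)
      then show ?thesis using h[OF True] True bit_add_shift[OF S] by simp
    qed
  next
    case False
    have R: "bit (S + 2 ^ m * Y) i = bit Y (i - m)" using bit_add_shift[OF S] False by simp
    show ?thesis
    proof (cases "i div c = m div c")
      case eq: True
      have "i mod c = ?F + (i - m)" using eq False m
        by (metis add_diff_inverse_nat add_left_cancel div_mult_mod_eq group_cancel.add1)
      then have "bit (M2 ?A) (i mod c) = bit Y (i - m)" using bitA[of "i mod c"] mod_less_divisor[OF c(2), of i] by simp
      then show ?thesis using R eq by simp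
    next
      case neq: False
      have "m div c \<le> i div c" "i div c \<le> (m + L) div c" using False i by (auto intro!: div_le_mono)
      then have n: "\<not> ?F + L < c" using qA neq by auto
      then have q: "i div c = m div c + 1"
        using qB[OF n] \<open>m div c \<le> i div c\<close> \<open>i div c \<le> (m + L) div c\<close> neq by simp
      then have "i = (m div c + 1) * c + i mod c" by (metis div_mult_mod_eq)
      then have "i = (m div c) * c + c + i mod c" by simp
      then have "c - ?F + i mod c = i - m" using m F by linarith
      then have "bit (M2 (p + i div c)) (i mod c) = bit Y (i - m)"
        using n q by (simp add: M2 bit_div_pow)
      then show ?thesis using R by simp
    qed
  qed
  ultimately show ?thesis by (simp add: stream_def holds_def)
qed

section \<open>The program\<close>

text \<open>The program treats \<open>f\<close> levels of the tree per round (register \<open>rf\<close>), starting at the level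
  \<open>J\<close> (\<open>vJ\<close>), and packs \<open>t\<close> local codes of \<open>f\<close> bits into a word (\<open>rt\<close>, \<open>rW = t * f\<close>); the scan reads
  \<open>g\<close> characters at a time (\<open>rg\<close>). The registers \<open>rCB\<close>, \<open>rRB\<close>, \<open>rTB\<close>, \<open>rAB\<close> and \<open>vOP\<close> hold the
  addresses of the code of every character, of the codes of \<open>g\<close>-tuples of characters, of the
  translation tables, of the lists of codes of the current round, and of the next bitmask.

  From \<open>rNB\<close> up to \<open>rE\<close> every node has a record of 16 words, in breadth-first order: (0) the record
  in the input; (1) the record of the left child, immediately followed by that of the right child
  (0 for a leaf); (2) the depth; (3) the number of characters; (4) the address of the list of
  codes; (5, 13) address and bit offset at which this list is extended; (6, 7, 8) the code of the
  node relative to its ancestor at level \<open>J\<close>, the record of this ancestor, and the weight of the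
  next bit of the code; (9) the character of a leaf; (10, 11, 12) the record in the output.\<close>

abbreviation (input) "rn \<equiv> 2 :: nat"
abbreviation (input) "rsg \<equiv> 3 :: nat"
abbreviation (input) "rNB \<equiv> 4 :: nat"
abbreviation (input) "rb \<equiv> 5 :: nat"
abbreviation (input) "rw \<equiv> 6 :: nat"
abbreviation (input) "rt \<equiv> 7 :: nat"
abbreviation (input) "rf \<equiv> 8 :: nat"
abbreviation (input) "rg \<equiv> 9 :: nat"
abbreviation (input) "rW \<equiv> 10 :: nat"
abbreviation (input) "rCB \<equiv> 11 :: nat"
abbreviation (input) "rRB \<equiv> 12 :: nat"
abbreviation (input) "rTB \<equiv> 13 :: nat"
abbreviation (input) "rAB \<equiv> 14 :: nat"
abbreviation (input) "rh \<equiv> 15 :: nat"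
abbreviation (input) "rn1 \<equiv> 16 :: nat"
abbreviation (input) "rrt \<equiv> 17 :: nat"
abbreviation (input) "rE \<equiv> 18 :: nat"
abbreviation (input) "rq \<equiv> 19 :: nat"
abbreviation (input) "vJ \<equiv> 30 :: nat"
abbreviation (input) "vAP \<equiv> 31 :: nat"
abbreviation (input) "vOP \<equiv> 32 :: nat"
abbreviation (input) "vp \<equiv> 45 :: nat"
abbreviation (input) "vk \<equiv> 46 :: nat"
abbreviation (input) "vcd \<equiv> 47 :: nat"
abbreviation (input) "van \<equiv> 48 :: nat"
abbreviation (input) "vbw \<equiv> 49 :: nat"
abbreviation (input) "vx \<equiv> 50 :: nat"
abbreviation (input) "vy \<equiv> 51 :: nat"
abbreviation (input) "vi \<equiv> 52 :: nat"
abbreviation (input) "vv \<equiv> 53 :: nat"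
abbreviation (input) "vc \<equiv> 54 :: nat"
abbreviation (input) "vz \<equiv> 55 :: nat"
abbreviation (input) "vll \<equiv> 56 :: nat"
abbreviation (input) "vrl \<equiv> 57 :: nat"
abbreviation (input) "vrv \<equiv> 58 :: nat"
abbreviation (input) "vu \<equiv> 59 :: nat"
abbreviation (input) "sB \<equiv> 60 :: nat"
abbreviation (input) "cN \<equiv> 61 :: nat"
abbreviation (input) "tB \<equiv> 62 :: nat"
abbreviation (input) "vI \<equiv> 63 :: nat"
abbreviation (input) "vm \<equiv> 64 :: nat"
abbreviation (input) "vX \<equiv> 65 :: nat"
abbreviation (input) "oB \<equiv> 80 :: nat"
abbreviation (input) "oA \<equiv> 81 :: nat"
abbreviation (input) "oF \<equiv> 82 :: nat"
abbreviation (input) "oY \<equiv> 83 :: nat"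
abbreviation (input) "oL \<equiv> 84 :: nat"
abbreviation (input) "oC \<equiv> 85 :: nat"

abbreviation (input) e_mask ("_ \<restriction> _" [60, 61] 60) where
  "e \<restriction> m \<equiv> B And e ((N 1 \<lless> m) \<ominus> N 1)"

definition append :: stm where
  "append =
    ([V oA] \<leftarrow> B Or (Ld (V oA)) (V oY \<lless> V oF);;
     IfE (V oF \<oplus> V oL \<prec> V oC)
       (oF \<leftarrow> V oF \<oplus> V oL)
       ([V oA \<oplus> N 1] \<leftarrow> (V oY \<ggreater> (V oC \<ominus> V oF));;
        oA \<leftarrow> V oA \<oplus> N 1;;
        oF \<leftarrow> V oF \<oplus> V oL \<ominus> V oC))"

text \<open>The mask cuts off what lies behind the end of the list in its last cell, so that the
  missing fields of the table index are zero.\<close>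

definition pass_body :: stm where
  "pass_body =
    (vm \<leftarrow> V cN \<ominus> V vI \<otimes> V rt;;
     IfE (V rt \<prec> V vm) (vm \<leftarrow> V rt) Skp;;
     vX \<leftarrow> (Ld (V sB \<oplus> V vI)) \<restriction> (V vm \<otimes> V rf);;
     oY \<leftarrow> Ld (V tB \<oplus> N 2 \<otimes> V vX);;
     oL \<leftarrow> Ld (V tB \<oplus> N 2 \<otimes> V vX \<oplus> N 1);;
     append;;
     vI \<leftarrow> V vI \<oplus> N 1)"

definition pass :: stm where
  "pass = ([V oB] \<leftarrow> N 0;; oA \<leftarrow> V oB;; oF \<leftarrow> N 0;; vI \<leftarrow> N 0;;
     Whl (V vI \<otimes> V rt \<prec> V cN) pass_body)"

text \<open>The program is the same for all word lengths and must measure \<open>w\<close>: it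
  doubles 1 until the result wraps around to 0. On the way it counts the powers of two below
  \<sigma>, which gives the character width, and maintains the largest \<open>t\<close> with
  \<open>4 * t * t \<le> w\<close> (at least 1).\<close>

definition find_params :: stm where
  "find_params =
    (vx \<leftarrow> N 1;; rw \<leftarrow> N 0;; rt \<leftarrow> N 1;; rb \<leftarrow> N 0;;
     Whl (V vx)
      (IfE (V vx \<prec> V rsg) (rb \<leftarrow> V rb \<oplus> N 1) Skp;;
       vx \<leftarrow> (V vx \<lless> N 1);;
       rw \<leftarrow> V rw \<oplus> N 1;;
       IfE (V rw \<prec> N 4 \<otimes> (V rt \<oplus> N 1) \<otimes> (V rt \<oplus> N 1)) Skp (rt \<leftarrow> V rt \<oplus> N 1)))"

definition number_body :: stm where
  "number_body =
    (IfE (V rh \<prec> Ld (V vp \<oplus> N 2)) (rh \<leftarrow> Ld (V vp \<oplus> N 2)) Skp;;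
     vu \<leftarrow> Ld (V vp);;
     IfE (Ld (V vu))
      ([V vp \<oplus> N 1] \<leftarrow> V rE;;
       [V vp \<oplus> N 11] \<leftarrow> V rE \<oplus> N 10;;
       [V vp \<oplus> N 12] \<leftarrow> V rE \<oplus> N 26;;
       [V rE] \<leftarrow> Ld (V vu \<oplus> N 1);;
       [V rE \<oplus> N 2] \<leftarrow> Ld (V vp \<oplus> N 2) \<oplus> N 1;;
       [V rE \<oplus> N 16] \<leftarrow> Ld (V vu \<oplus> N 2);;
       [V rE \<oplus> N 18] \<leftarrow> Ld (V vp \<oplus> N 2) \<oplus> N 1;;
       rE \<leftarrow> V rE \<oplus> N 32)
      ([V vp \<oplus> N 1] \<leftarrow> N 0;;
       [V vp \<oplus> N 9] \<leftarrow> Ld (V vu \<oplus> N 1));;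
     vp \<leftarrow> V vp \<oplus> N 16)"

definition number_nodes :: stm where
  "number_nodes =
    ([V rNB] \<leftarrow> V rrt;; [V rNB \<oplus> N 2] \<leftarrow> N 0;; vp \<leftarrow> V rNB;; rE \<leftarrow> V rNB \<oplus> N 16;; rh \<leftarrow> N 0;;
     Whl (V vp \<prec> V rE) number_body)"

text \<open>Every table entry has two words, a value and a length or a pointer. Three translation
  tables therefore give the factor 6, and \<open>32 * \<sigma>\<close> words accommodate fewer than
  \<open>2 * \<sigma>\<close> node records of 16 words.\<close>

definition set_params :: stm where
  "set_params =
    (IfE (V rh \<prec> V rt) (rf \<leftarrow> V rh) (rf \<leftarrow> V rt);;
     rg \<leftarrow> V rt \<oslash> V rf;;
     rW \<leftarrow> V rt \<otimes> V rf;;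
     rq \<leftarrow> (N 1 \<lless> V rg \<otimes> V rb);;
     rCB \<leftarrow> V rNB \<oplus> N 32 \<otimes> V rsg;;
     rRB \<leftarrow> V rCB \<oplus> N 2 \<otimes> (N 1 \<lless> V rb);;
     rTB \<leftarrow> V rRB \<oplus> N 2 \<otimes> V rq;;
     rAB \<leftarrow> V rTB \<oplus> N 6 \<otimes> (N 1 \<lless> V rW);;
     rn1 \<leftarrow> (V rn \<oplus> V rg \<ominus> N 1) \<oslash> V rg;;
     vOP \<leftarrow> V rAB \<oplus> N 8 \<otimes> (V rn1 \<otimes> V rg \<oplus> V rsg))"

definition table_field :: stm where
  "table_field =
    (vc \<leftarrow> ((V vy \<restriction> V rf) \<ggreater> N 1);;
     IfE (B And (V vy) (N 1))
       (vrv \<leftarrow> V vrv \<oplus> (V vc \<lless> V vrl);; vrl \<leftarrow> V vrl \<oplus> V rf;; vv \<leftarrow> V vv \<oplus> (N 1 \<lless> V vi))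
       (vz \<leftarrow> V vz \<oplus> (V vc \<lless> V vll);; vll \<leftarrow> V vll \<oplus> V rf);;
     vy \<leftarrow> (V vy \<ggreater> V rf);;
     vi \<leftarrow> V vi \<oplus> N 1)"

definition table_entry :: stm where
  "table_entry =
    (vy \<leftarrow> V vx;; vv \<leftarrow> N 0;; vz \<leftarrow> N 0;; vll \<leftarrow> N 0;; vrv \<leftarrow> N 0;; vrl \<leftarrow> N 0;; vi \<leftarrow> N 0;;
     Whl (V vi \<prec> V rt) table_field;;
     vu \<leftarrow> V rTB \<oplus> N 2 \<otimes> V vx;;
     [V vu] \<leftarrow> V vv;; [V vu \<oplus> N 1] \<leftarrow> V rt;;
     vu \<leftarrow> V vu \<oplus> N 2 \<otimes> (N 1 \<lless> V rW);;
     [V vu] \<leftarrow> V vz;; [V vu \<oplus> N 1] \<leftarrow> V vll;;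
     vu \<leftarrow> V vu \<oplus> N 2 \<otimes> (N 1 \<lless> V rW);;
     [V vu] \<leftarrow> V vrv;; [V vu \<oplus> N 1] \<leftarrow> V vrl;;
     vx \<leftarrow> V vx \<oplus> N 1)"

definition make_tables :: stm where
  "make_tables = (vx \<leftarrow> N 0;; Whl (V vx \<prec> (N 1 \<lless> V rW)) table_entry)"

text \<open>The mask on the weight is what ends a code after \<open>f\<close> levels: the weight
  becomes 0 and later branchings add nothing. Above level \<open>J\<close> code, ancestor and weight
  are all 0; the ancestor 0 marks characters whose leaf lies above \<open>J\<close>, which the scan
  skips.\<close>

definition codes_body :: stm where
  "codes_body =
    (vcd \<leftarrow> Ld (V vp \<oplus> N 6);; van \<leftarrow> Ld (V vp \<oplus> N 7);; vbw \<leftarrow> Ld (V vp \<oplus> N 8);;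
     IfE (Ld (V vp \<oplus> N 2) \<doteq> V vJ)
      (van \<leftarrow> V vp;; vbw \<leftarrow> N 1;;
       [V vp \<oplus> N 4] \<leftarrow> V vAP;; [V vp \<oplus> N 5] \<leftarrow> V vAP;; [V vp \<oplus> N 13] \<leftarrow> N 0;;
       [V vAP] \<leftarrow> N 0;;
       vAP \<leftarrow> V vAP \<oplus> Ld (V vp \<oplus> N 3) \<oslash> V rt \<oplus> N 3)
      Skp;;
     vk \<leftarrow> Ld (V vp \<oplus> N 1);;
     IfE (V vk)
      ([V vk \<oplus> N 6] \<leftarrow> V vcd;; [V vk \<oplus> N 7] \<leftarrow> V van;;
       [V vk \<oplus> N 22] \<leftarrow> V vcd \<oplus> V vbw;; [V vk \<oplus> N 23] \<leftarrow> V van;;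
       vbw \<leftarrow> (V vbw \<otimes> N 2) \<restriction> V rf;;
       [V vk \<oplus> N 8] \<leftarrow> V vbw;; [V vk \<oplus> N 24] \<leftarrow> V vbw)
      (vu \<leftarrow> V rCB \<oplus> N 2 \<otimes> Ld (V vp \<oplus> N 9);;
       [V vu] \<leftarrow> V vcd;; [V vu \<oplus> N 1] \<leftarrow> V van);;
     vp \<leftarrow> V vp \<oplus> N 16)"

definition make_codes :: stm where
  "make_codes =
    (vAP \<leftarrow> V rAB;; [V rNB \<oplus> N 6] \<leftarrow> N 0;; [V rNB \<oplus> N 7] \<leftarrow> N 0;; [V rNB \<oplus> N 8] \<leftarrow> N 0;;
     vp \<leftarrow> V rNB;;
     Whl (V vp \<prec> V rE) codes_body)"

definition recode_field :: stm where
  "recode_field =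
    (vv \<leftarrow> V vv \<oplus> ((Ld (V rCB \<oplus> N 2 \<otimes> (V vy \<restriction> V rb)) \<restriction> V rf) \<lless> V vi);;
     vy \<leftarrow> (V vy \<ggreater> V rb);;
     vi \<leftarrow> V vi \<oplus> V rf)"

text \<open>The first character of a tuple determines the target list. This suffices because tuples
  of several characters occur only when the root has the only list.\<close>

definition recode_entry :: stm where
  "recode_entry =
    (vy \<leftarrow> V vx;; vv \<leftarrow> N 0;; vi \<leftarrow> N 0;;
     Whl (V vi \<prec> V rg \<otimes> V rf) recode_field;;
     [V rRB \<oplus> N 2 \<otimes> V vx] \<leftarrow> V vv;;
     [V rRB \<oplus> N 2 \<otimes> V vx \<oplus> N 1] \<leftarrow> Ld (V rCB \<oplus> N 2 \<otimes> (V vx \<restriction> V rb) \<oplus> N 1);;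
     vx \<leftarrow> V vx \<oplus> N 1)"

definition make_recode :: stm where
  "make_recode = (vx \<leftarrow> N 0;; Whl (V vx \<prec> V rq) recode_entry)"

definition scan_body :: stm where
  "scan_body =
    (vu \<leftarrow> V rn \<ominus> V vi \<otimes> V rg;;
     IfE (V rg \<prec> V vu) (vu \<leftarrow> V rg) Skp;;
     vx \<leftarrow> (B Or (Ld (V vk) \<ggreater> V vc) (Ld (V vk \<oplus> N 1) \<lless> (V rw \<ominus> V vc))) \<restriction> (V vu \<otimes> V rb);;
     van \<leftarrow> Ld (V rRB \<oplus> N 2 \<otimes> V vx \<oplus> N 1);;
     IfE (V van)
      (oA \<leftarrow> Ld (V van \<oplus> N 5);; oF \<leftarrow> Ld (V van \<oplus> N 13);;
       oY \<leftarrow> Ld (V rRB \<oplus> N 2 \<otimes> V vx);; oL \<leftarrow> V rg \<otimes> V rf;; oC \<leftarrow> V rW;;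
       append;;
       [V van \<oplus> N 5] \<leftarrow> V oA;; [V van \<oplus> N 13] \<leftarrow> V oF)
      Skp;;
     vc \<leftarrow> V vc \<oplus> V rg \<otimes> V rb;;
     IfE (V vc \<prec> V rw) Skp (vc \<leftarrow> V vc \<ominus> V rw;; vk \<leftarrow> V vk \<oplus> N 1);;
     vi \<leftarrow> V vi \<oplus> N 1)"

definition scan :: stm where
  "scan = (vk \<leftarrow> N 4;; vc \<leftarrow> N 0;; vi \<leftarrow> N 0;; Whl (V vi \<prec> V rn1) scan_body)"

text \<open>The number of codes going right is read off the position at which the last stream ends,
  and the number going left follows by subtraction. The other two streams cannot be used for
  counting, since they may end in padding.\<close>

definition split :: stm where
  "split =
    ([V vp \<oplus> N 10] \<leftarrow> V vOP;;
     sB \<leftarrow> Ld (V vp \<oplus> N 4);; cN \<leftarrow> Ld (V vp \<oplus> N 3);;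
     tB \<leftarrow> V rTB;; oB \<leftarrow> V vOP;; oC \<leftarrow> V rw;;
     pass;;
     vOP \<leftarrow> V oA \<oplus> N 1;;
     [V vk \<oplus> N 4] \<leftarrow> V vAP;;
     tB \<leftarrow> V rTB \<oplus> N 2 \<otimes> (N 1 \<lless> V rW);; oB \<leftarrow> V vAP;; oC \<leftarrow> V rW;;
     pass;;
     vAP \<leftarrow> V oA \<oplus> N 1;;
     [V vk \<oplus> N 20] \<leftarrow> V vAP;;
     tB \<leftarrow> V rTB \<oplus> N 4 \<otimes> (N 1 \<lless> V rW);; oB \<leftarrow> V vAP;; oC \<leftarrow> V rW;;
     pass;;
     vy \<leftarrow> (V oA \<ominus> V vAP) \<otimes> V rt \<oplus> V oF \<oslash> V rf;;
     vAP \<leftarrow> V oA \<oplus> N 1;;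
     [V vk \<oplus> N 19] \<leftarrow> V vy;;
     [V vk \<oplus> N 3] \<leftarrow> V cN \<ominus> V vy)"

definition split_body :: stm where
  "split_body =
    (vk \<leftarrow> Ld (V vp \<oplus> N 1);; vy \<leftarrow> Ld (V vp \<oplus> N 2);;
     IfE (V vk) (IfE (V vy \<prec> V vJ) Skp (IfE (V vy \<prec> V vJ \<oplus> V rf) split Skp)) Skp;;
     vp \<leftarrow> V vp \<oplus> N 16)"

definition split_nodes :: stm where
  "split_nodes = (vp \<leftarrow> V rNB;; Whl (V vp \<prec> V rE) split_body)"

definition round :: stm where
  "round = (make_codes;; make_recode;; scan;; split_nodes;; vJ \<leftarrow> V vJ \<oplus> V rf)"

text \<open>For a single character the tree is a leaf, which carries no data. Words 10 to 12 of the
  node records are the output, hence the result \<open>rNB\<close> + 10; the size entered for the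
  root is that of the padded string.\<close>

definition wavelet_program :: stm where
  "wavelet_program =
    (rn \<leftarrow> Ld (N 0);; rsg \<leftarrow> Ld (N 1);; rrt \<leftarrow> Ld (N 2);; rNB \<leftarrow> Ld (N 3);;
     IfE (N 1 \<prec> V rsg)
      (find_params;; number_nodes;; set_params;; make_tables;;
       [V rNB \<oplus> N 3] \<leftarrow> V rn1 \<otimes> V rg;;
       vJ \<leftarrow> N 0;;
       Whl (V vJ \<prec> V rh) round;;
       [N 0] \<leftarrow> V rNB \<oplus> N 10)
      Skp)"

section \<open>Appending to a stream, and translating a packed list\<close>

lemma wp_append:
  assumes st: "stream c M p m S"
    and \<rho>: "\<rho> oA = p + m div c" "\<rho> oF = m mod c" "\<rho> oY = Y" "\<rho> oL = L" "\<rho> oC = c"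
    and Y: "Y < 2 ^ L" and L: "L \<le> c" and c: "c \<le> w" "0 < c"
    and r: "p + m div c + 1 < 2 ^ w" "2 * c < 2 ^ w"
    and Q: "\<And>\<rho>' M' \<tau>'. \<lbrakk>stream c M' p (m + L) (S + 2 ^ m * Y);
      \<rho>' oA = p + (m + L) div c; \<rho>' oF = (m + L) mod c;
      \<And>x. x \<noteq> 81 \<Longrightarrow> x \<noteq> 82 \<Longrightarrow> \<rho>' x = \<rho> x;
      \<And>a. a \<noteq> p + m div c \<Longrightarrow> a \<noteq> p + (m + L) div c \<Longrightarrow> M' a = M a;
      \<tau>' \<le> \<tau> + 40\<rbrakk> \<Longrightarrow> Q \<rho>' M' \<tau>'"
  shows "wp w append Q \<rho> M \<tau>"
proof -
  have F: "m mod c < c" using c by simp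
  have q: "(m + L) div c = (if m mod c + L < c then m div c else m div c + 1)"
    "(m + L) mod c = (if m mod c + L < c then m mod c + L else m mod c + L - c)"
  proof -
    have "m + L = (m div c) * c + (m mod c + L)" by simp
    moreover have "m + L = (m div c + 1) * c + (m mod c + L - c)" if "\<not> m mod c + L < c"
    proof -
      have "m = (m div c) * c + m mod c" by simp
      then show ?thesis using that unfolding add_mult_distrib by linarith
    qed
    moreover have "m mod c + L - c < c" using F L by linarith
    ultimately show "(m + L) div c = (if m mod c + L < c then m div c else m div c + 1)"
      "(m + L) mod c = (if m mod c + L < c then m mod c + L else m mod c + L - c)"
      using div_mod_eqI[of "m + L" _ c] by metis+
  qed
  note sa = stream_append[OF st Y L c refl refl]
  have r1: "m mod c + L < 2 ^ w" "c < 2 ^ w" "(1::nat) < 2 ^ w" using F L r c by linarith+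
  show ?thesis
  proof (cases "m mod c + L < c")
    case True
    with sa q r r1 \<rho> F show ?thesis unfolding append_def
      by (simp, intro Q) simp_all
  next
    case False
    with sa q r r1 \<rho> F show ?thesis unfolding append_def
      by (simp, intro Q) (simp_all)
  qed
qed

text \<open>The number \<open>dl\<close> tells whether a missing field produces an output field: 1
  for the bits and for the left branch, 0 for the right branch. The packed value is the same in
  either case, because the extra fields are zero; only the recorded length differs.\<close>

definition table_ok :: "(nat \<Rightarrow> nat) \<Rightarrow> nat \<Rightarrow> nat \<Rightarrow> nat \<Rightarrow> nat \<Rightarrow> (nat list \<Rightarrow> nat list) \<Rightarrow> nat \<Rightarrow> bool" where
  "table_ok M t f tb e G dl \<longleftrightarrow> (\<forall>ys. length ys \<le> t \<longrightarrow> fields f ys \<longrightarrow>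
     M (tb + 2 * pack f ys) = pack e (G ys) \<and>
     M (tb + 2 * pack f ys + 1) = e * (length (G ys) + dl * (t - length ys)))"

text \<open>A homomorphism with respect to concatenation can be applied to a list one word at a
  time; it does not lengthen lists, so the output never outgrows the input.\<close>

definition translator :: "nat \<Rightarrow> nat \<Rightarrow> (nat list \<Rightarrow> nat list) \<Rightarrow> bool" where
  "translator f e G \<longleftrightarrow> G [] = [] \<and> (\<forall>a b. G (a @ b) = G a @ G b) \<and>
     (\<forall>ys. length (G ys) \<le> length ys) \<and> (\<forall>ys. fields f ys \<longrightarrow> fields e (G ys))"

lemma and_mask_Suc: "(x::nat) AND (2 ^ m - Suc 0) = x mod 2 ^ m"
  using and_mask_nat by simp

lemma wp_pass_body:
  assumes \<rho>: "\<rho> sB = src" "\<rho> cN = length zs" "\<rho> tB = tb" "\<rho> rt = t" "\<rho> rf = f" "\<rho> vI = k"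
    and k: "k * t < length zs"
    and src: "holds (t * f) M src (f * length zs) (pack f zs)" and zs: "fields f zs"
    and tab: "table_ok M t f tb e G dl"
    and pos: "0 < t" "0 < f"
    and r: "length zs < 2 ^ w" "t * f < w" "src + k < 2 ^ w" "tb + 2 * 2 ^ (t * f) < 2 ^ w" "w < 2 ^ w"
    and ys: "ys = take t (drop (k * t) zs)"
    and Q: "\<And>\<rho>' \<tau>'. \<lbrakk>\<rho>' oY = pack e (G ys); \<rho>' oL = e * (length (G ys) + dl * (t - length ys));
      \<rho>' oA = \<rho> oA; \<rho>' oF = \<rho> oF; \<rho>' oC = \<rho> oC; \<rho>' oB = \<rho> oB; \<rho>' vI = k;
      \<And>x. x < 63 \<Longrightarrow> \<rho>' x = \<rho> x; \<tau>' \<le> \<tau> + 45\<rbrakk> \<Longrightarrow> wp w (append;; vI \<leftarrow> V vI \<oplus> N 1) Q \<rho>' M \<tau>'"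
  shows "wp w pass_body Q \<rho> M \<tau>"
proof -
  define m where "m = length ys"
  have m: "m = min t (length zs - k * t)" by (simp add: m_def ys min.commute)
  have mt: "m \<le> t" by (simp add: m)
  have fy: "fields f ys" unfolding ys by (intro fields_take fields_drop zs)
  have "M (src + k) mod 2 ^ (f * m) = pack f zs div 2 ^ (k * (t * f)) mod 2 ^ (f * m)"
  proof (rule holds_cell[OF src])
    have "k * t + m \<le> length zs" using k m by simp
    then have "(k * t + m) * f \<le> length zs * f" by (rule mult_le_mono1)
    then show "k * (t * f) + f * m \<le> f * length zs" by (simp add: algebra_simps)
    show "f * m \<le> t * f" using mt by simp
    show "0 < t * f" using pos by simp
  qed
  also have "pack f zs div 2 ^ (k * (t * f)) = pack f (drop (k * t) zs)"
    using pack_div[OF zs, of "k * t"] by (simp add: mult.commute mult.left_commute)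
  also have "\<dots> mod 2 ^ (f * m) = pack f (take m (drop (k * t) zs))"
    by (rule pack_mod[OF fields_drop[OF zs]])
  also have "take m (drop (k * t) zs) = ys" unfolding ys m by (simp add: min_def)
  finally have X: "M (src + k) mod 2 ^ (m * f) = pack f ys" by (simp add: mult.commute)
  have mf: "m * f < w" using mult_le_mono1[OF mt, of f] r by linarith
  have T: "M (tb + 2 * pack f ys) = pack e (G ys)"
    "M (tb + 2 * pack f ys + 1) = e * (length (G ys) + dl * (t - length ys))"
    using tab mt fy unfolding table_ok_def m_def by blast+
  have "pack f ys < 2 ^ (f * m)" unfolding m_def by (rule pack_less[OF fy])
  also have "\<dots> \<le> 2 ^ (t * f)" using mt by (intro power_increasing) auto
  finally have Xl: "pack f ys < 2 ^ (t * f)" .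
  have one: "Suc 0 < 2 ^ w" "2 < (2::nat) ^ w" using r(2,5) pos by (cases w; cases "w - 1"; auto)+
  have pw: "(2::nat) ^ (m * f) < 2 ^ w" using mf by simp
  have kt: "k * t < 2 ^ w" "m * f < 2 ^ w" using k r mf by linarith+
  show ?thesis
  proof (cases "t < length zs - k * t")
    case True
    then have "m = t" using m by simp
    with True show ?thesis unfolding pass_body_def
      using \<rho> k r X T Xl mf one pw kt
      by (simp add: and_mask_Suc, intro Q[simplified], simp_all)
  next
    case False
    then have "m = length zs - k * t" using m by simp
    with False show ?thesis unfolding pass_body_def
      using \<rho> k r X T Xl mf one pw kt
      by (simp add: and_mask_Suc, intro Q[simplified], simp_all)
  qed
qed


text \<open>The number \<open>d\<close> counts the padding fields caused by an incomplete last word.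
  As \<open>e * t \<le> c\<close>, each cell read opens at most one cell of output, which bounds the
  output region; source and table lie below \<open>ob\<close> and are not overwritten.\<close>

lemma wp_pass:
  assumes \<rho>: "\<rho> sB = src" "\<rho> cN = length zs" "\<rho> tB = tb" "\<rho> rt = t" "\<rho> rf = f"
      "\<rho> oB = ob" "\<rho> oC = c"
    and src: "holds (t * f) M src (f * length zs) (pack f zs)" and zs: "fields f zs"
    and tab: "table_ok M t f tb e G dl" and G: "translator f e G" and dl: "dl \<le> 1"
    and pos: "0 < t" "0 < f" "0 < e" and c: "e * t \<le> c" "c \<le> w"
    and below: "src + (length zs + t - 1) div t \<le> ob" "tb + 2 * 2 ^ (t * f) \<le> ob"
    and r: "length zs + t < 2 ^ w" "t * f < w" "ob + length zs div t + 3 < 2 ^ w" "2 * w < 2 ^ w"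
    and Q: "\<And>\<rho>' M' \<tau>' d. \<lbrakk>\<And>x. x < 63 \<Longrightarrow> \<rho>' x = \<rho> x;
      \<rho>' oA = ob + e * (length (G zs) + dl * d) div c; \<rho>' oF = e * (length (G zs) + dl * d) mod c;
      d \<le> t;
      \<And>a. a < ob \<or> ob + e * (length (G zs) + dl * d) div c < a \<Longrightarrow> M' a = M a;
      stream c M' ob (e * (length (G zs) + dl * d)) (pack e (G zs));
      \<tau>' \<le> \<tau> + 100 * (length zs div t + 2)\<rbrakk> \<Longrightarrow> Q \<rho>' M' \<tau>'"
  shows "wp w pass Q \<rho> M \<tau>"
proof -
  define n where "n = length zs"
  define nb where "nb = (n + t - 1) div t"
  \<comment> \<open>The bit position after \<open>k\<close> words. The difference
    \<open>k * t - min n (k * t)\<close> is 0 until the last word, so padding counts only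
    there.\<close>
  define pos_at where "pos_at k = e * (length (G (take (k * t) zs)) + dl * (k * t - min n (k * t)))" for k
  have G0: "G [] = []" and Gapp: "\<And>a b. G (a @ b) = G a @ G b"
    and Glen: "\<And>ys. length (G ys) \<le> length ys" and Gf: "\<And>ys. fields f ys \<Longrightarrow> fields e (G ys)"
    using G unfolding translator_def by blast+
  have c0: "0 < c" using c pos by (metis mult_pos_pos less_le_trans)
  have et: "t \<le> e * t" using pos by simp
  have tw: "t \<le> w" using c et by linarith
  have nb: "k < nb \<longleftrightarrow> k * t < n" for k
  proof -
    have "k < nb \<longleftrightarrow> Suc k * t \<le> n + t - 1"
      unfolding nb_def using pos by (metis Suc_le_eq less_eq_div_iff_mult_less_eq)
    also have "\<dots> \<longleftrightarrow> k * t < n" using pos by auto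
    finally show ?thesis .
  qed
  have nbt: "n \<le> nb * t" using nb[of nb] by simp
  have nble: "nb \<le> n div t + 1"
  proof -
    have "nb \<le> (n + t) div t" unfolding nb_def by (intro div_le_mono) simp
    then show ?thesis using pos by simp
  qed
  have nb_upper: "nb * t \<le> n + t - 1" unfolding nb_def by simp
  \<comment> \<open>A word of \<open>t\<close> fields yields at most \<open>t\<close> output fields,
    padding included, because \<open>dl \<le> 1\<close>.\<close>
  have pos_le: "pos_at k div c \<le> k" for k
  proof -
    have "length (G (take (k * t) zs)) + dl * (k * t - min n (k * t)) \<le> k * t"
    proof -
      have "length (G (take (k * t) zs)) \<le> min n (k * t)" using Glen[of "take (k * t) zs"] by (simp add: n_def)
      moreover have "dl * (k * t - min n (k * t)) \<le> k * t - min n (k * t)" using dl by (cases dl) auto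
      ultimately show ?thesis by linarith
    qed
    then have "pos_at k \<le> e * (k * t)" unfolding pos_at_def by (intro mult_le_mono2)
    also have "\<dots> = k * (e * t)" by (simp add: algebra_simps)
    also have "\<dots> \<le> k * c" using c by (intro mult_le_mono2)
    finally have "pos_at k div c \<le> k * c div c" by (rule div_le_mono)
    then show ?thesis using c0 by simp
  qed
  have one: "1 < (2::nat) ^ w" using r(4) pos tw by linarith
  define I where "I k \<rho>' M' \<tau>' \<longleftrightarrow> \<rho>' vI = k \<and> \<rho>' oA = ob + pos_at k div c \<and> \<rho>' oF = pos_at k mod c \<and>
      (\<forall>x < 63. \<rho>' x = \<rho> x) \<and> \<rho>' oB = ob \<and> \<rho>' oC = c \<and>
      stream c M' ob (pos_at k) (pack e (G (take (k * t) zs))) \<and>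
      (\<forall>a. a < ob \<or> ob + pos_at k div c < a \<longrightarrow> M' a = M a) \<and> \<tau>' \<le> \<tau> + 9 + k * 95"
    for k and \<rho>' M' :: "nat \<Rightarrow> nat" and \<tau>'
  have p0: "pos_at 0 = 0" by (simp add: pos_at_def G0)
  have "wp w (Whl (V vI \<otimes> V rt \<prec> V cN) pass_body) Q
      (\<rho>(oA := ob, oF := 0, vI := 0)) (M(ob := 0)) \<tau>0" if \<tau>0: "\<tau>0 \<le> \<tau> + 9" for \<tau>0
  proof (rule wp_Whl[where I = I and m = nb])
    show "I 0 (\<rho>(oA := ob, oF := 0, vI := 0)) (M(ob := 0)) \<tau>0"
      using \<tau>0 \<rho> stream_empty[of "M(ob := 0)" ob c] by (simp add: I_def p0 G0)
  next
    fix k \<rho>1 M1 \<tau>1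
    assume k: "k \<le> nb" and I1: "I k \<rho>1 M1 \<tau>1"
    have "\<rho>1 vI = k" "\<rho>1 rt = t" "\<rho>1 cN = n" using I1 \<rho> by (simp_all add: I_def n_def)
    moreover have "k * t < 2 ^ w" using mult_le_mono1[OF k, of t] nb_upper r unfolding n_def by linarith
    ultimately show "safe w \<rho>1 M1 (V vI \<otimes> V rt \<prec> V cN) \<and>
        (nval w \<rho>1 M1 (V vI \<otimes> V rt \<prec> V cN) \<noteq> 0 \<longleftrightarrow> k < nb)"
      using nb[of k] by simp
  next
    fix k \<rho>1 M1 \<tau>1 \<tau>1'
    assume k: "k < nb" and I1: "I k \<rho>1 M1 \<tau>1" and \<tau>1': "\<tau>1' = \<tau>1 + cost (V vI \<otimes> V rt \<prec> V cN) + 1"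
    then have kn: "k * t < length zs" using nb by (simp add: n_def)
    have fr: "\<And>a. a < ob \<Longrightarrow> M1 a = M a" using I1 by (simp add: I_def)
    have cells: "src + k < ob" using k below(1) unfolding nb_def n_def by linarith
    have src1: "holds (t * f) M1 src (f * length zs) (pack f zs)"
    proof (rule holds_cong[OF src])
      fix a assume a: "src \<le> a" "a < src + (f * length zs + t * f - 1) div (t * f)"
      have "(f * length zs + t * f - 1) div (t * f) \<le> (length zs + t - 1) div t"
      proof -
        have "f * length zs + t * f - 1 = (f * (length zs + t - 1)) + (f - 1)"
          using pos by (cases t; cases f) (auto simp: algebra_simps)
        moreover have "(f * (length zs + t - 1) + (f - 1)) div f = length zs + t - 1"
          using pos by (subst mult.commute, intro conjunct1[OF div_mod_eqI[OF refl]]) linarith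
        ultimately show ?thesis by (metis div_mult2_eq mult.commute order_refl)
      qed
      then show "M1 a = M a" using a below by (intro fr) linarith
    qed (use pos in simp)
    have tab1: "table_ok M1 t f tb e G dl"
      unfolding table_ok_def
    proof (intro allI impI)
      fix ys assume y: "length ys \<le> t" "fields f ys"
      have "pack f ys < 2 ^ (f * length ys)" by (rule pack_less[OF y(2)])
      also have "\<dots> \<le> 2 ^ (t * f)" using y by (intro power_increasing) auto
      finally have "tb + 2 * pack f ys + 1 < ob" using below(2) by linarith
      then show "M1 (tb + 2 * pack f ys) = pack e (G ys) \<and>
          M1 (tb + 2 * pack f ys + 1) = e * (length (G ys) + dl * (t - length ys))"
        using fr[of "tb + 2 * pack f ys"] fr[of "tb + 2 * pack f ys + 1"] tab y
        unfolding table_ok_def by simp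
    qed
    define ys where "ys = take t (drop (k * t) zs)"
    have tk: "take (Suc k * t) zs = take (k * t) zs @ ys"
      using take_add[of "k * t" t zs] unfolding ys_def by (simp add: add.commute)
    have ly: "length ys = min t (n - k * t)" by (simp add: ys_def n_def min.commute)
    have fy: "fields f ys" unfolding ys_def by (intro fields_take fields_drop zs)
    define L where "L = e * (length (G ys) + dl * (t - length ys))"
    \<comment> \<open>As long as there is something left to read, all words before were complete, so
      the output written so far has no padding.\<close>
    have pk: "pos_at k = e * length (G (take (k * t) zs))"
      using kn by (simp add: pos_at_def n_def)
    have pS: "pos_at (Suc k) = pos_at k + L"
    proof -
      have "Suc k * t - min n (Suc k * t) = t - length ys" using kn by (auto simp: ly n_def min_def)
      then show ?thesis unfolding pk unfolding pos_at_def tk L_def by (simp add: Gapp algebra_simps)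
    qed
    have S: "pack e (G (take (Suc k * t) zs)) = pack e (G (take (k * t) zs)) + 2 ^ pos_at k * pack e (G ys)"
      unfolding tk Gapp pack_append pk by simp
    have Lc: "L \<le> c"
    proof -
      have "dl * (t - length ys) \<le> t - length ys" using dl by (cases dl) auto
      then have "length (G ys) + dl * (t - length ys) \<le> t"
      proof -
        have "length (G ys) \<le> length ys" "length ys \<le> t" using Glen[of ys] ly by simp_all
        then show ?thesis using \<open>dl * (t - length ys) \<le> t - length ys\<close> by linarith
      qed
      then have "L \<le> e * t" unfolding L_def by (rule mult_le_mono2)
      then show ?thesis using c by simp
    qed
    have YL: "pack e (G ys) < 2 ^ L"
    proof -
      have "pack e (G ys) < 2 ^ (e * length (G ys))" by (rule pack_less[OF Gf[OF fy]])
      also have "\<dots> \<le> 2 ^ L" unfolding L_def by (intro power_increasing) auto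
      finally show ?thesis .
    qed
    have st1: "stream c M1 ob (pos_at k) (pack e (G (take (k * t) zs)))" using I1 by (simp add: I_def)
    have kle: "k \<le> n div t" using k nble by simp
    show "wp w pass_body (I (Suc k)) \<rho>1 M1 \<tau>1'"
    proof (rule wp_pass_body[OF _ _ _ _ _ _ kn src1 zs tab1 pos(1,2) _ _ _ _ _ ys_def])
      show "\<rho>1 sB = src" "\<rho>1 cN = length zs" "\<rho>1 tB = tb" "\<rho>1 rt = t" "\<rho>1 rf = f" "\<rho>1 vI = k"
        using I1 \<rho> by (simp_all add: I_def)
      show "length zs < 2 ^ w" "t * f < w" "src + k < 2 ^ w" "tb + 2 * 2 ^ (t * f) < 2 ^ w" "w < 2 ^ w"
        using r below cells by linarith+
      fix \<rho>2 \<tau>2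
      assume 2: "\<rho>2 oY = pack e (G ys)" "\<rho>2 oL = e * (length (G ys) + dl * (t - length ys))"
        "\<rho>2 oA = \<rho>1 oA" "\<rho>2 oF = \<rho>1 oF" "\<rho>2 oC = \<rho>1 oC" "\<rho>2 oB = \<rho>1 oB" "\<rho>2 vI = k"
        "\<And>x. x < 63 \<Longrightarrow> \<rho>2 x = \<rho>1 x" "\<tau>2 \<le> \<tau>1' + 45"
      have "wp w append (wp w (vI \<leftarrow> V vI \<oplus> N 1) (I (Suc k))) \<rho>2 M1 \<tau>2"
      proof (rule wp_append[OF st1 _ _ 2(1) 2(2)[folded L_def] _ YL Lc c(2) c0])
        show "\<rho>2 oA = ob + pos_at k div c" "\<rho>2 oF = pos_at k mod c" "\<rho>2 oC = c"
          using 2 I1 by (simp_all add: I_def)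
        show "ob + pos_at k div c + 1 < 2 ^ w" using pos_le[of k] kle r(3) unfolding n_def by linarith
        show "2 * c < 2 ^ w" using c r by linarith
        fix \<rho>3 M3 \<tau>3
        assume 3: "stream c M3 ob (pos_at k + L) (pack e (G (take (k * t) zs)) + 2 ^ pos_at k * pack e (G ys))"
          "\<rho>3 oA = ob + (pos_at k + L) div c" "\<rho>3 oF = (pos_at k + L) mod c"
          "\<And>x. x \<noteq> 81 \<Longrightarrow> x \<noteq> 82 \<Longrightarrow> \<rho>3 x = \<rho>2 x"
          "\<And>a. a \<noteq> ob + pos_at k div c \<Longrightarrow> a \<noteq> ob + (pos_at k + L) div c \<Longrightarrow> M3 a = M1 a"
          "\<tau>3 \<le> \<tau>2 + 40"
        have "pos_at k div c \<le> (pos_at k + L) div c" by (intro div_le_mono) simp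
        then have "\<forall>a. a < ob \<or> ob + pos_at (Suc k) div c < a \<longrightarrow> M3 a = M a"
          using 3(5) I1 unfolding pS I_def by auto
        moreover have "\<tau>1 \<le> \<tau> + 9 + k * 95" "\<rho>1 oB = ob" "\<rho>1 oC = c" "\<forall>x < 63. \<rho>1 x = \<rho> x"
          using I1 by (simp_all add: I_def)
        moreover have "Suc k < 2 ^ w" using kle nble r div_le_dividend[of n t] unfolding n_def by linarith
        moreover have "\<tau>3 + 4 \<le> \<tau> + 9 + Suc k * 95"
          using 3(6) 2(9) \<tau>1' \<open>\<tau>1 \<le> \<tau> + 9 + k * 95\<close> by simp
        ultimately show "wp w (vI \<leftarrow> V vI \<oplus> N 1) (I (Suc k)) \<rho>3 M3 \<tau>3"
          using 3(1-4) 2(1-8) one S pS by (simp add: I_def)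
      qed
      then show "wp w (append;; vI \<leftarrow> V vI \<oplus> N 1) (I (Suc k)) \<rho>2 M1 \<tau>2" by simp
    qed
  next
    fix \<rho>1 M1 \<tau>1 \<tau>1'
    assume I1: "I nb \<rho>1 M1 \<tau>1" and \<tau>1': "\<tau>1' = \<tau>1 + cost (V vI \<otimes> V rt \<prec> V cN) + 1"
    have tk: "take (nb * t) zs = zs" using nbt by (simp add: n_def)
    define d where "d = nb * t - n"
    have pN: "pos_at nb = e * (length (G zs) + dl * d)" using nbt by (simp add: pos_at_def tk d_def)
    have "nb * 95 \<le> (n div t + 1) * 95" using nble by (rule mult_le_mono1)
    then have "\<tau>1' \<le> \<tau> + 100 * (length zs div t + 2)" using I1 \<tau>1' by (simp add: I_def n_def)
    moreover have "d \<le> t" using nb_upper unfolding d_def by linarith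
    moreover have "M1 a = M a" if "a < ob \<or> ob + e * (length (G zs) + dl * d) div c < a" for a
      using I1 that unfolding I_def pN by blast
    ultimately show "Q \<rho>1 M1 \<tau>1'"
      using I1 unfolding I_def pN tk by (intro Q[of \<rho>1 d M1]) blast+
  qed
  then show ?thesis unfolding pass_def using \<rho> one by (simp add: add.commute)
qed

section \<open>The translation tables\<close>

definition low_bits :: "nat list \<Rightarrow> nat list" where
  "low_bits = map (\<lambda>z. z mod 2)"

definition branch :: "bool \<Rightarrow> nat list \<Rightarrow> nat list" where
  "branch b zs = map (\<lambda>z. z div 2) (filter (\<lambda>z. odd z = b) zs)"

lemma low_bits_simps [simp]:
  "low_bits [] = []" "low_bits (xs @ ys) = low_bits xs @ low_bits ys" "length (low_bits xs) = length xs"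
  "low_bits [z] = [z mod 2]" "low_bits (replicate k 0) = replicate k 0"
  by (simp_all add: low_bits_def)

lemma branch_simps [simp]:
  "branch b [] = []" "branch b (xs @ ys) = branch b xs @ branch b ys"
  "branch b [z] = (if odd z = b then [z div 2] else [])"
  by (simp_all add: branch_def)

lemma branch_replicate [simp]: "branch b (replicate k 0) = (if b then [] else replicate k 0)"
  by (simp add: branch_def)

lemma length_branch: "length (branch b xs) \<le> length xs"
  by (simp add: branch_def)

lemma fields_low_bits: "fields 1 (low_bits zs)"
  by (auto simp: fields_def low_bits_def)

lemma fields_branch: "fields f zs \<Longrightarrow> fields f (branch b zs)"
  by (auto simp: fields_def branch_def intro: le_less_trans[OF div_le_dividend])

lemma translator_low_bits: "translator f 1 low_bits"
  using fields_low_bits by (simp add: translator_def)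

lemma translator_branch: "translator f f (branch b)"
  by (simp add: translator_def length_branch fields_branch)

definition digits :: "nat \<Rightarrow> nat \<Rightarrow> nat \<Rightarrow> nat list" where
  "digits t f x = map (\<lambda>i. x div 2 ^ (f * i) mod 2 ^ f) [0..<t]"

lemma fields_digits: "fields f (digits t f x)"
  by (auto simp: digits_def fields_def)

lemma length_digits [simp]: "length (digits t f x) = t"
  by (simp add: digits_def)

lemma digits_pack:
  assumes "fields f ys" "length ys \<le> t"
  shows "digits t f (pack f ys) = ys @ replicate (t - length ys) 0"
proof (rule nth_equalityI)
  fix i assume i: "i < length (digits t f (pack f ys))"
  show "digits t f (pack f ys) ! i = (ys @ replicate (t - length ys) 0) ! i"
  proof (cases "i < length ys")
    case True
    then show ?thesis using i assms by (simp add: digits_def pack_nth nth_append)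
  next
    case False
    then have "pack f ys div 2 ^ (f * i) = 0" using assms by (simp add: pack_div)
    then show ?thesis using False i by (simp add: digits_def nth_append)
  qed
qed (use assms in simp)

definition entry_ok :: "(nat \<Rightarrow> nat) \<Rightarrow> nat \<Rightarrow> nat \<Rightarrow> nat \<Rightarrow> nat \<Rightarrow> bool" where
  "entry_ok M t f tb x \<longleftrightarrow> (let zs = digits t f x; W = 2 ^ (t * f) in
     M (tb + 2 * x) = pack 1 (low_bits zs) \<and> M (tb + 2 * x + 1) = t \<and>
     M (tb + 2 * W + 2 * x) = pack f (branch False zs) \<and>
     M (tb + 2 * W + 2 * x + 1) = f * length (branch False zs) \<and>
     M (tb + 4 * W + 2 * x) = pack f (branch True zs) \<and>
     M (tb + 4 * W + 2 * x + 1) = f * length (branch True zs))"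

definition tables_ok :: "(nat \<Rightarrow> nat) \<Rightarrow> nat \<Rightarrow> nat \<Rightarrow> nat \<Rightarrow> bool" where
  "tables_ok M t f tb \<longleftrightarrow> table_ok M t f tb 1 low_bits 1 \<and>
     table_ok M t f (tb + 2 * 2 ^ (t * f)) f (branch False) 1 \<and>
     table_ok M t f (tb + 4 * 2 ^ (t * f)) f (branch True) 0"

text \<open>The entry for a short list is computed from its digits up to \<open>t\<close>, that is,
  from the list filled up with zeros. Each zero has low bit 0: it adds a zero to the bits and to the
  left branch but nothing to the right branch, whence the values 1, 1 and 0 of
  \<open>dl\<close>.\<close>

lemma tables_okI:
  assumes "\<And>x. x < 2 ^ (t * f) \<Longrightarrow> entry_ok M t f tb x"
  shows "tables_ok M t f tb"
proof -
  have e: "entry_ok M t f tb (pack f ys)" if "length ys \<le> t" "fields f ys" for ys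
  proof (rule assms)
    have "pack f ys < 2 ^ (f * length ys)" by (rule pack_less) fact
    also have "\<dots> \<le> 2 ^ (t * f)" using that by (intro power_increasing) auto
    finally show "pack f ys < 2 ^ (t * f)" .
  qed
  show ?thesis
    unfolding tables_ok_def table_ok_def
    using e by (auto simp: entry_ok_def Let_def digits_pack pack_append)
qed

lemma less_pow_weaken: "(x::nat) < 2 ^ a \<Longrightarrow> a \<le> b \<Longrightarrow> x < 2 ^ b"
  by (meson less_le_trans one_le_numeral power_increasing)

lemma wp_table_field:
  assumes \<rho>: "\<rho> rf = f" "\<rho> vi = i" "\<rho> vy = x div 2 ^ (f * i)"
      "\<rho> vv = pack 1 (low_bits ds)" "\<rho> vz = pack f (branch False ds)" "\<rho> vll = f * length (branch False ds)"
      "\<rho> vrv = pack f (branch True ds)" "\<rho> vrl = f * length (branch True ds)"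
    and ds: "ds = take i (digits t f x)" and i: "i < t" and f: "0 < f" and W: "t * f < w"
    and Q: "\<And>\<rho>' \<tau>' ds'. \<lbrakk>ds' = take (Suc i) (digits t f x); \<rho>' vi = Suc i; \<rho>' vy = x div 2 ^ (f * Suc i);
      \<rho>' vv = pack 1 (low_bits ds'); \<rho>' vz = pack f (branch False ds'); \<rho>' vll = f * length (branch False ds');
      \<rho>' vrv = pack f (branch True ds'); \<rho>' vrl = f * length (branch True ds');
      \<And>x. x \<le> 50 \<Longrightarrow> \<rho>' x = \<rho> x; \<tau>' \<le> \<tau> + 50\<rbrakk> \<Longrightarrow> Q \<rho>' M \<tau>'"
  shows "wp w table_field Q \<rho> M \<tau>"
proof -
  define y where "y = x div 2 ^ (f * i)"
  define z where "z = y mod 2 ^ f"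
  have z: "z = digits t f x ! i" using i by (simp add: z_def y_def digits_def)
  have ds': "take (Suc i) (digits t f x) = ds @ [z]"
    using i by (simp add: ds z take_Suc_conv_app_nth)
  have fd: "fields f ds" unfolding ds by (intro fields_take fields_digits)
  have ld: "length ds = i" using i by (simp add: ds)
  have "y AND 1 = y mod 2" by (simp add: and_one_eq)
  also have "y mod 2 = z mod 2" unfolding z_def using f
    by (metis dvd_power mod_mod_cancel)
  finally have odd: "y AND Suc 0 = of_bool (odd z)" by (simp add: mod_2_eq_odd)
  have y': "y div 2 ^ f = x div 2 ^ (f * Suc i)"
    unfolding y_def by (simp add: div_mult2_eq[symmetric] power_add[symmetric] add.commute)
  have le: "f * length (branch b ds) + f \<le> t * f" for b
  proof -
    have "length (branch b ds) + 1 \<le> t" using length_branch[of b ds] ld i by linarith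
    then have "(length (branch b ds) + 1) * f \<le> t * f" by (rule mult_le_mono1)
    then show ?thesis by (simp add: algebra_simps)
  qed
  have z2: "z div 2 < 2 ^ f" using fields_digits[of f t x] i z
    by (metis div_le_dividend fields_def le_less_trans length_digits nth_mem)
  have sh: "z div 2 * 2 ^ (f * length (branch b ds)) < 2 ^ w" for b
  proof (rule less_pow_weaken)
    show "z div 2 * 2 ^ (f * length (branch b ds)) < 2 ^ (f * length (branch b ds) + f)"
      using z2 by (simp add: power_add mult.commute)
  qed (use le[of b] W in linarith)
  have sum: "pack f (branch b ds) + z div 2 * 2 ^ (f * length (branch b ds)) < 2 ^ w" for b
  proof -
    have fl: "fields f (branch b ds @ [z div 2])" using fields_branch[OF fd] z2 by simp
    have "pack f (branch b ds @ [z div 2]) < 2 ^ (f * length (branch b ds @ [z div 2]))"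
      by (rule pack_less[OF fl])
    moreover have "f * length (branch b ds @ [z div 2]) \<le> w" using le[of b] W by (simp add: algebra_simps)
    ultimately have "pack f (branch b ds @ [z div 2]) < 2 ^ w" by (rule less_pow_weaken)
    then show ?thesis by (simp add: pack_append mult.commute)
  qed
  have tw: "t \<le> t * f" using f by simp
  have bits: "pack 1 (low_bits ds) + 2 ^ i < 2 ^ w"
  proof -
    have "pack 1 (low_bits ds @ [1]) < 2 ^ (1 * length (low_bits ds @ [1]))"
      using fields_low_bits by (intro pack_less) simp
    moreover have "Suc i \<le> w" using i tw W by linarith
    then have "1 * length (low_bits ds @ [1]) \<le> w" using ld by simp
    ultimately have "pack 1 (low_bits ds @ [1]) < 2 ^ w" by (rule less_pow_weaken)
    then show ?thesis by (simp add: pack_append ld)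
  qed
  have i2: "2 ^ i mod (2::nat) ^ w = 2 ^ i" "(2::nat) ^ f mod 2 ^ w = 2 ^ f" "(2::nat) ^ f < 2 ^ w"
  proof -
    have "f \<le> t * f" using i by simp
    then have "f < w" using W by linarith
    then show "(2::nat) ^ f mod 2 ^ w = 2 ^ f" "(2::nat) ^ f < 2 ^ w" by simp_all
    have "i < w" using i tw W by linarith
    then show "2 ^ i mod (2::nat) ^ w = 2 ^ i" by simp
  qed
  have ww: "w < 2 ^ w" by simp
  have len: "f * length (branch b ds) + f < 2 ^ w" for b using le[of b] W ww by linarith
  have si: "Suc i < 2 ^ w" "Suc 0 < 2 ^ w" using i tw W ww by linarith+
  have yy: "\<rho> vy = y" by (simp add: y_def \<rho>)
  have zz: "y AND (2 ^ f - Suc 0) = z" by (simp add: and_mask_Suc z_def)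
  note \<rho>' = \<rho>(1,2,4-8)
  show ?thesis
  proof (cases "odd z")
    case True
    then show ?thesis unfolding table_field_def
      using \<rho>' yy odd zz y' len[of True] si i2 sum[of True] sh[of True] bits
      by (simp, intro Q[OF refl]) (simp_all add: ds' pack_append ld mult.commute algebra_simps mod_2_eq_odd)
  next
    case False
    then show ?thesis unfolding table_field_def
      using \<rho>' yy odd zz y' len[of False] si i2 sum[of False] sh[of False] bits
      by (simp, intro Q[OF refl]) (simp_all add: ds' pack_append ld mult.commute algebra_simps mod_2_eq_odd)
  qed
qed


lemma wp_table_entry:
  assumes \<rho>: "\<rho> rt = t" "\<rho> rf = f" "\<rho> rW = t * f" "\<rho> rTB = tb" "\<rho> vx = x"
    and x: "x < 2 ^ (t * f)" and f: "0 < f" "0 < t" and W: "t * f < w"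
    and r: "tb + 6 * 2 ^ (t * f) < 2 ^ w"
    and Q: "\<And>\<rho>' M' \<tau>'. \<lbrakk>entry_ok M' t f tb x; \<rho>' vx = Suc x; \<And>x. x < 50 \<Longrightarrow> \<rho>' x = \<rho> x;
      \<And>a. a < tb \<or> tb + 6 * 2 ^ (t * f) \<le> a \<Longrightarrow> M' a = M a;
      \<And>x'. x' < x \<Longrightarrow> entry_ok M t f tb x' \<Longrightarrow> entry_ok M' t f tb x'; \<tau>' \<le> \<tau> + 60 * t + 80\<rbrakk> \<Longrightarrow> Q \<rho>' M' \<tau>'"
  shows "wp w table_entry Q \<rho> M \<tau>"
proof -
  define D where "D = digits t f x"
  define I where "I i \<rho>' M' \<tau>' \<longleftrightarrow> M' = M \<and> (\<forall>x \<le> 50. \<rho>' x = \<rho> x) \<and> \<rho>' vi = i \<and> \<rho>' vy = x div 2 ^ (f * i) \<and>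
      \<rho>' vv = pack 1 (low_bits (take i D)) \<and> \<rho>' vz = pack f (branch False (take i D)) \<and>
      \<rho>' vll = f * length (branch False (take i D)) \<and>
      \<rho>' vrv = pack f (branch True (take i D)) \<and> \<rho>' vrl = f * length (branch True (take i D)) \<and>
      \<tau>' \<le> \<tau> + 14 + 60 * i" for i \<rho>' and M' :: "nat \<Rightarrow> nat" and \<tau>'
  let ?W = "2 ^ (t * f) :: nat"
  define rest where "rest = (
     vu \<leftarrow> V rTB \<oplus> N 2 \<otimes> V vx;;
     [V vu] \<leftarrow> V vv;; [V vu \<oplus> N 1] \<leftarrow> V rt;;
     vu \<leftarrow> V vu \<oplus> N 2 \<otimes> (N 1 \<lless> V rW);;
     [V vu] \<leftarrow> V vz;; [V vu \<oplus> N 1] \<leftarrow> V vll;;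
     vu \<leftarrow> V vu \<oplus> N 2 \<otimes> (N 1 \<lless> V rW);;
     [V vu] \<leftarrow> V vrv;; [V vu \<oplus> N 1] \<leftarrow> V vrl;;
     vx \<leftarrow> V vx \<oplus> N 1)"
  have W1: "1 \<le> ?W" by simp
  have Wm: "2 ^ (t * f) mod (2::nat) ^ w = ?W" using W by simp
  have bounds: "tb + 2 * x + 1 < 2 ^ w" "tb + 2 * ?W + 2 * x + 1 < 2 ^ w" "tb + 4 * ?W + 2 * x + 1 < 2 ^ w"
    "2 * x < 2 ^ w" "2 * ?W < 2 ^ w" "2 < (2::nat) ^ w" "1 < (2::nat) ^ w" "x + 1 < 2 ^ w"
    using x r W1 by linarith+
  have rest: "wp w rest Q \<rho>1 M1 \<tau>1" if "I t \<rho>1 M1 \<tau>0" "\<tau>1 = \<tau>0 + 4" for \<rho>1 M1 \<tau>0 \<tau>1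
  proof -
    have D: "take t D = D" by (simp add: D_def)
    have I: "M1 = M" "\<forall>x \<le> 50. \<rho>1 x = \<rho> x" "\<rho>1 vv = pack 1 (low_bits D)" "\<rho>1 vz = pack f (branch False D)"
      "\<rho>1 vll = f * length (branch False D)" "\<rho>1 vrv = pack f (branch True D)"
      "\<rho>1 vrl = f * length (branch True D)" "\<tau>0 \<le> \<tau> + 14 + 60 * t"
      using that unfolding I_def D by auto
    define M2 where "M2 = M(tb + 2 * x := pack 1 (low_bits D), tb + 2 * x + 1 := t,
      tb + 2 * ?W + 2 * x := pack f (branch False D), tb + 2 * ?W + 2 * x + 1 := f * length (branch False D),
      tb + 4 * ?W + 2 * x := pack f (branch True D), tb + 4 * ?W + 2 * x + 1 := f * length (branch True D))"
    have v: "\<rho>1 rTB = tb" "\<rho>1 vx = x" "\<rho>1 rt = t" "\<rho>1 rW = t * f" using I \<rho> by simp_all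
    have "Q (\<rho>1(vu := tb + 4 * ?W + 2 * x, vx := Suc x)) M2 \<tau>2" if "\<tau>2 \<le> \<tau>1 + 61" for \<tau>2
    proof (rule Q)
      show "entry_ok M2 t f tb x"
        unfolding entry_ok_def Let_def D_def[symmetric] M2_def using x by simp
      show "\<And>a. a < tb \<or> tb + 6 * 2 ^ (t * f) \<le> a \<Longrightarrow> M2 a = M a"
        unfolding M2_def using x by auto
      show "entry_ok M2 t f tb x'" if "x' < x" "entry_ok M t f tb x'" for x'
        using that x unfolding entry_ok_def Let_def M2_def by simp
      show "\<tau>2 \<le> \<tau> + 60 * t + 80" using that I \<open>\<tau>1 = \<tau>0 + 4\<close> by linarith
    qed (use I in auto)
    then show ?thesis
      unfolding rest_def using I v bounds Wm
      by (simp add: M2_def algebra_simps)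
  qed
  have "wp w (Whl (V vi \<prec> V rt) table_field) (wp w rest Q)
      (\<rho>(vy := x, vv := 0, vz := 0, vll := 0, vrv := 0, vrl := 0, vi := 0)) M \<tau>0"
    if "\<tau>0 \<le> \<tau> + 14" for \<tau>0
  proof (rule wp_Whl[where I = I and m = t])
    show "I 0 (\<rho>(vy := x, vv := 0, vz := 0, vll := 0, vrv := 0, vrl := 0, vi := 0)) M \<tau>0"
      using that by (simp add: I_def)
  next
    fix i \<rho>1 M1 \<tau>1 assume "i \<le> t" "I i \<rho>1 M1 \<tau>1"
    then show "safe w \<rho>1 M1 (V vi \<prec> V rt) \<and> (nval w \<rho>1 M1 (V vi \<prec> V rt) \<noteq> 0 \<longleftrightarrow> i < t)"
      using \<rho> by (auto simp: I_def)
  next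
    fix i \<rho>1 M1 \<tau>1 \<tau>2 assume i: "i < t" and I: "I i \<rho>1 M1 \<tau>1" and "\<tau>2 = \<tau>1 + cost (V vi \<prec> V rt) + 1"
    then have \<tau>2: "\<tau>2 \<le> \<tau> + 14 + 60 * i + 4" by (simp add: I_def)
    show "wp w table_field (I (Suc i)) \<rho>1 M1 \<tau>2"
    proof (rule wp_table_field[OF _ _ _ _ _ _ _ _ refl i f(1) W])
      show "\<rho>1 rf = f" using I \<rho> by (simp add: I_def)
    next
      fix \<rho>2 \<tau>3 ds'
      assume a: "ds' = take (Suc i) (digits t f x)" "\<rho>2 vi = Suc i" "\<rho>2 vy = x div 2 ^ (f * Suc i)"
        "\<rho>2 vv = pack 1 (low_bits ds')" "\<rho>2 vz = pack f (branch False ds')"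
        "\<rho>2 vll = f * length (branch False ds')"
        "\<rho>2 vrv = pack f (branch True ds')" "\<rho>2 vrl = f * length (branch True ds')"
        "\<And>x. x \<le> 50 \<Longrightarrow> \<rho>2 x = \<rho>1 x" "\<tau>3 \<le> \<tau>2 + 50"
      have "M1 = M" "\<forall>x \<le> 50. \<rho>1 x = \<rho> x" using I by (auto simp: I_def)
      with a \<tau>2 show "I (Suc i) \<rho>2 M1 \<tau>3" unfolding I_def D_def by simp
    qed (use I in \<open>simp_all add: I_def D_def\<close>)
  next
    fix \<rho>1 M1 \<tau>1 \<tau>2 assume I: "I t \<rho>1 M1 \<tau>1" and "\<tau>2 = \<tau>1 + cost (V vi \<prec> V rt) + 1"
    then have "\<tau>2 = \<tau>1 + 4" by simp
    then show "wp w rest Q \<rho>1 M1 \<tau>2" using rest[OF I] by simp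
  qed
  then show ?thesis
    unfolding table_entry_def rest_def using \<rho> by simp
qed

lemma wp_make_tables:
  assumes \<rho>: "\<rho> rt = t" "\<rho> rf = f" "\<rho> rW = t * f" "\<rho> rTB = tb"
    and f: "0 < f" "0 < t" and W: "t * f < w"
    and r: "tb + 6 * 2 ^ (t * f) < 2 ^ w"
    and Q: "\<And>\<rho>' M' \<tau>'. \<lbrakk>tables_ok M' t f tb; \<And>x. x < 50 \<Longrightarrow> \<rho>' x = \<rho> x;
      \<And>a. a < tb \<or> tb + 6 * 2 ^ (t * f) \<le> a \<Longrightarrow> M' a = M a;
      \<tau>' \<le> \<tau> + 2 ^ (t * f) * (60 * t + 90) + 20\<rbrakk> \<Longrightarrow> Q \<rho>' M' \<tau>'"
  shows "wp w make_tables Q \<rho> M \<tau>"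
proof -
  let ?W = "2 ^ (t * f) :: nat" and ?e = "V vx \<prec> (N 1 \<lless> V rW)"
  define I where "I x \<rho>' M' \<tau>' \<longleftrightarrow> \<rho>' vx = x \<and> (\<forall>x < 50. \<rho>' x = \<rho> x) \<and>
      (\<forall>a. a < tb \<or> tb + 6 * ?W \<le> a \<longrightarrow> M' a = M a) \<and> (\<forall>y < x. entry_ok M' t f tb y) \<and>
      \<tau>' \<le> \<tau> + 2 + x * (60 * t + 90)" for x \<rho>' and M' :: "nat \<Rightarrow> nat" and \<tau>'
  have W1: "1 \<le> ?W" by simp
  have Wm: "2 ^ (t * f) mod (2::nat) ^ w = ?W" using W by simp
  have one: "1 < (2::nat) ^ w" using r W1 by linarith
  have "wp w (Whl ?e table_entry) Q (\<rho>(vx := 0)) M \<tau>0" if "\<tau>0 \<le> \<tau> + 2" for \<tau>0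
  proof (rule wp_Whl[where I = I and m = ?W])
    show "I 0 (\<rho>(vx := 0)) M \<tau>0" using that by (simp add: I_def)
  next
    fix x \<rho>1 M1 \<tau>1 assume "I x \<rho>1 M1 \<tau>1"
    then show "safe w \<rho>1 M1 ?e \<and> (nval w \<rho>1 M1 ?e \<noteq> 0 \<longleftrightarrow> x < ?W)"
      using \<rho> one Wm by (simp add: I_def)
  next
    fix x \<rho>1 M1 \<tau>1 \<tau>2 assume x: "x < ?W" and I: "I x \<rho>1 M1 \<tau>1" and "\<tau>2 = \<tau>1 + cost ?e + 1"
    then have \<tau>2: "\<tau>2 = \<tau>1 + 6" by simp
    show "wp w table_entry (I (Suc x)) \<rho>1 M1 \<tau>2"
    proof (rule wp_table_entry[OF _ _ _ _ _ x f W r])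
      fix \<rho>2 M2 \<tau>3
      assume a: "entry_ok M2 t f tb x" "\<rho>2 vx = Suc x" "\<And>x. x < 50 \<Longrightarrow> \<rho>2 x = \<rho>1 x"
        "\<And>a. a < tb \<or> tb + 6 * ?W \<le> a \<Longrightarrow> M2 a = M1 a"
        "\<And>x'. x' < x \<Longrightarrow> entry_ok M1 t f tb x' \<Longrightarrow> entry_ok M2 t f tb x'" "\<tau>3 \<le> \<tau>2 + 60 * t + 80"
      have "\<forall>y < Suc x. entry_ok M2 t f tb y" using a(1,5) I unfolding I_def by (metis less_Suc_eq)
      moreover have "\<tau>3 \<le> \<tau> + 2 + Suc x * (60 * t + 90)" using a(6) \<tau>2 I unfolding I_def by simp
      ultimately show "I (Suc x) \<rho>2 M2 \<tau>3" using I a(2-4) unfolding I_def by auto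
    qed (use I \<rho> in \<open>simp_all add: I_def\<close>)
  next
    fix \<rho>1 M1 \<tau>1 \<tau>2 assume I: "I ?W \<rho>1 M1 \<tau>1" and "\<tau>2 = \<tau>1 + cost ?e + 1"
    then have \<tau>2: "\<tau>2 = \<tau>1 + 6" by simp
    show "Q \<rho>1 M1 \<tau>2"
      using I \<tau>2 unfolding I_def by (intro Q tables_okI) auto
  qed
  then show ?thesis unfolding make_tables_def by simp
qed

section \<open>Numbering the nodes of the tree\<close>

fun kids :: "ctree \<times> nat \<Rightarrow> (ctree \<times> nat) list" where
  "kids (Lf a, d) = []"
| "kids (Nd l r, d) = [(l, Suc d), (r, Suc d)]"

text \<open>The queue of a breadth-first traversal after \<open>i\<close> nodes have been expanded; expanded nodes
  stay in the list.\<close>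

fun bfs :: "ctree \<Rightarrow> nat \<Rightarrow> (ctree \<times> nat) list" where
  "bfs T 0 = [(T, 0)]"
| "bfs T (Suc i) = bfs T i @ kids (bfs T i ! i)"

fun node_count :: "ctree \<Rightarrow> nat" where
  "node_count (Lf a) = 1"
| "node_count (Nd l r) = 1 + node_count l + node_count r"

fun label :: "ctree \<Rightarrow> nat list" where
  "label (Lf a) = [a]"
| "label (Nd l r) = []"

lemma leaves_nonempty [simp]: "leaves T \<noteq> []"
  by (induction T) auto

lemma node_count_pos: "0 < node_count T"
  by (induction T) auto

lemma node_count_leaves: "node_count T + 1 = 2 * length (leaves T)"
  by (induction T) auto

lemma kids_sum: "sum_list (map (\<lambda>x. node_count (fst x)) (kids x)) + 1 = node_count (fst x)"
  by (cases x rule: kids.cases) auto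

text \<open>Expanding a node replaces its subtree in the queue by the subtrees of its children, so
  the number of expanded nodes plus the sizes of the waiting subtrees is invariant. Hence the queue
  runs empty after exactly \<open>node_count T\<close> expansions.\<close>

lemma bfs_count:
  "i \<le> node_count T \<Longrightarrow> i \<le> length (bfs T i) \<and>
     i + sum_list (map (\<lambda>x. node_count (fst x)) (drop i (bfs T i))) = node_count T"
proof (induction i)
  case (Suc i)
  then have IH: "i \<le> length (bfs T i)"
    "i + sum_list (map (\<lambda>x. node_count (fst x)) (drop i (bfs T i))) = node_count T" by auto
  then have "drop i (bfs T i) \<noteq> []" using Suc.prems by auto
  then have i: "i < length (bfs T i)" by simp
  then have "drop i (bfs T i) = bfs T i ! i # drop (Suc i) (bfs T i)" by (rule Cons_nth_drop_Suc[symmetric])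
  then have "Suc i + sum_list (map (\<lambda>x. node_count (fst x)) (drop (Suc i) (bfs T (Suc i)))) = node_count T"
    using IH(2) kids_sum[of "bfs T i ! i"] i by simp
  then show ?case using i by simp
qed simp

lemma bfs_length_gt:
  assumes "i < node_count T"
  shows "i < length (bfs T i)"
proof (rule ccontr)
  assume "\<not> ?thesis"
  then show False using bfs_count[of i T] assms by simp
qed

lemma bfs_length_final: "length (bfs T (node_count T)) = node_count T"
proof (rule ccontr)
  assume a: "\<not> ?thesis"
  have c: "node_count T \<le> length (bfs T (node_count T))"
    "sum_list (map (\<lambda>x. node_count (fst x)) (drop (node_count T) (bfs T (node_count T)))) = 0"
    using bfs_count[of "node_count T" T] by auto
  with a have "drop (node_count T) (bfs T (node_count T)) \<noteq> []" by simp
  then obtain x xs where "drop (node_count T) (bfs T (node_count T)) = x # xs" by (meson neq_Nil_conv)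
  with c(2) node_count_pos[of "fst x"] show False by simp
qed

lemma bfs_prefix: "i \<le> j \<Longrightarrow> \<exists>ys. bfs T j = bfs T i @ ys"
  by (induction j rule: dec_induct) auto

lemma bfs_nth: "i \<le> j \<Longrightarrow> k < length (bfs T i) \<Longrightarrow> bfs T j ! k = bfs T i ! k"
  using bfs_prefix[of i j T] by (auto simp: nth_append)

lemma bfs_length_mono: "i \<le> j \<Longrightarrow> length (bfs T i) \<le> length (bfs T j)"
  using bfs_prefix[of i j T] by auto

section \<open>Nodes, children and parents as indices in breadth-first order\<close>

definition nd :: "ctree \<Rightarrow> nat \<Rightarrow> ctree" where
  "nd T k = fst (bfs T (node_count T) ! k)"

definition dep :: "ctree \<Rightarrow> nat \<Rightarrow> nat" where
  "dep T k = snd (bfs T (node_count T) ! k)"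

text \<open>The length of the queue when \<open>k\<close> is expanded is the index at which its left
  child is appended; the right child comes next. For a leaf it is merely the place of the next
  children, which makes the function monotone on all indices.\<close>

definition kid :: "ctree \<Rightarrow> nat \<Rightarrow> nat" where
  "kid T k = length (bfs T k)"

definition inner :: "ctree \<Rightarrow> bool" where
  "inner T \<longleftrightarrow> (\<exists>l r. T = Nd l r)"

text \<open>The choice is unique by \<open>kid_inj\<close> and exists for every index except that of
  the root.\<close>

definition par :: "ctree \<Rightarrow> nat \<Rightarrow> nat" where
  "par T k = (SOME i. i < node_count T \<and> inner (nd T i) \<and> (k = kid T i \<or> k = Suc (kid T i)))"

lemma inner_simps [simp]: "inner (Nd l r)" "\<not> inner (Lf a)"
  by (auto simp: inner_def)

lemma bfs_nd: "i \<le> node_count T \<Longrightarrow> k < length (bfs T i) \<Longrightarrow> bfs T i ! k = (nd T k, dep T k)"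
  using bfs_nth[of i "node_count T" k T] by (simp add: nd_def dep_def)

lemma nd_0 [simp]: "nd T 0 = T" "dep T 0 = 0"
  using bfs_nd[of 0 T 0] by simp_all

lemma kid_gt: "i < node_count T \<Longrightarrow> i < kid T i"
  unfolding kid_def by (rule bfs_length_gt)

lemma kid_Suc: "i < node_count T \<Longrightarrow> kid T (Suc i) = (if inner (nd T i) then kid T i + 2 else kid T i)"
  using bfs_nd[of i T i] bfs_length_gt[of i T]
  by (cases "nd T i") (simp_all add: kid_def inner_def)

lemma kid_node_count: "kid T (node_count T) = node_count T"
  unfolding kid_def by (rule bfs_length_final)

lemma kid_mono: "i \<le> j \<Longrightarrow> kid T i \<le> kid T j"
  unfolding kid_def by (rule bfs_length_mono)

lemma kid_less:
  assumes "i < node_count T" "nd T i = Nd l r"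
  shows "Suc (kid T i) < node_count T"
  using kid_Suc[OF assms(1)] assms kid_mono[of "Suc i" "node_count T" T] by (simp add: kid_node_count)

lemma nd_kid:
  assumes "i < node_count T" "nd T i = Nd l r"
  shows "nd T (kid T i) = l" "nd T (Suc (kid T i)) = r"
    "dep T (kid T i) = Suc (dep T i)" "dep T (Suc (kid T i)) = Suc (dep T i)"
proof -
  have i: "i < length (bfs T i)" "bfs T i ! i = (Nd l r, dep T i)"
    using assms bfs_length_gt bfs_nd[of i T i] by auto
  then have "bfs T (Suc i) = bfs T i @ [(l, Suc (dep T i)), (r, Suc (dep T i))]" by simp
  then have "bfs T (Suc i) ! kid T i = (l, Suc (dep T i))" "bfs T (Suc i) ! Suc (kid T i) = (r, Suc (dep T i))"
    "Suc (kid T i) < length (bfs T (Suc i))"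
    by (simp_all add: kid_def nth_append)
  then show "nd T (kid T i) = l" "nd T (Suc (kid T i)) = r"
    "dep T (kid T i) = Suc (dep T i)" "dep T (Suc (kid T i)) = Suc (dep T i)"
    using bfs_nd[of "Suc i" T "kid T i"] bfs_nd[of "Suc i" T "Suc (kid T i)"] assms(1) by simp_all
qed

text \<open>Each inner node advances the end of the queue by 2, so the pairs of child indices of
  different inner nodes are disjoint.\<close>

lemma kid_inj:
  assumes "i < node_count T" "inner (nd T i)" "j < node_count T" "inner (nd T j)"
    "kid T i + a = kid T j + b" "a \<le> 1" "b \<le> 1"
  shows "i = j"
proof (rule ccontr)
  assume "i \<noteq> j"
  then consider "i < j" | "j < i" by linarith
  then show False
  proof cases
    case 1
    then show False using kid_Suc[of i T] kid_mono[of "Suc i" j T] assms by simp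
  next
    case 2
    then show False using kid_Suc[of j T] kid_mono[of "Suc j" i T] assms by simp
  qed
qed

lemma par_kid:
  assumes "i < node_count T" "inner (nd T i)"
  shows "par T (kid T i) = i" "par T (Suc (kid T i)) = i"
proof -
  have u: "j = i" if "j < node_count T \<and> inner (nd T j) \<and> (k = kid T j \<or> k = Suc (kid T j))"
    "k = kid T i + b" "b \<le> 1" for j k b
  proof (cases "k = kid T j")
    case True
    then show ?thesis using kid_inj[of j T i 0 b] that assms by simp
  next
    case False
    then show ?thesis using kid_inj[of j T i 1 b] that assms by simp
  qed
  show "par T (kid T i) = i"
    unfolding par_def by (rule some_equality) (use assms in simp, rule u[where b = 0], simp_all)
  show "par T (Suc (kid T i)) = i"
    unfolding par_def by (rule some_equality) (use assms in simp, rule u[where b = 1], simp_all)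
qed

lemma par_props:
  assumes "0 < k" "k < node_count T"
  shows "par T k < k" "inner (nd T (par T k))" "k = kid T (par T k) \<or> k = Suc (kid T (par T k))"
proof -
  \<comment> \<open>Generalised to every stage of the traversal: whatever the queue contains besides
    the root was appended by a node already expanded.\<close>
  have "i \<le> node_count T \<Longrightarrow> 0 < k \<Longrightarrow> k < kid T i \<Longrightarrow>
      \<exists>i' < i. inner (nd T i') \<and> (k = kid T i' \<or> k = Suc (kid T i'))" for i
  proof (induction i)
    case 0
    then show ?case by (simp add: kid_def)
  next
    case (Suc i)
    show ?case
    proof (cases "k < kid T i")
      case True
      then show ?thesis using Suc by (meson Suc_leD less_SucI)
    next
      case False
      then have "inner (nd T i)" "k = kid T i \<or> k = Suc (kid T i)"
        using Suc.prems kid_Suc[of i T] by (auto split: if_splits)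
      then show ?thesis by blast
    qed
  qed
  from this[of "node_count T"] assms obtain i where i: "i < node_count T" "inner (nd T i)"
    "k = kid T i \<or> k = Suc (kid T i)" by (auto simp: kid_node_count)
  then have p: "par T k = i" using par_kid by blast
  then show "inner (nd T (par T k))" "k = kid T (par T k) \<or> k = Suc (kid T (par T k))" using i by auto
  show "par T k < k" using p i kid_gt[of i T] by auto
qed

lemma dep_par: "0 < k \<Longrightarrow> k < node_count T \<Longrightarrow> dep T k = Suc (dep T (par T k))"
  using par_props[of k T] nd_kid[of "par T k" T] by (auto simp: inner_def)

lemma leaves_par:
  assumes "0 < k" "k < node_count T"
  shows "set (leaves (nd T k)) \<subseteq> set (leaves (nd T (par T k)))"
  using par_props[OF assms] nd_kid[of "par T k" T] assms by (auto simp: inner_def)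

lemma height_nd: "k < node_count T \<Longrightarrow> height (nd T k) + dep T k \<le> height T"
proof (induction k rule: less_induct)
  case (less k)
  show ?case
  proof (cases "k = 0")
    case False
    then have p: "par T k < k" "inner (nd T (par T k))" "k = kid T (par T k) \<or> k = Suc (kid T (par T k))"
      using par_props less.prems by auto
    then obtain l r where lr: "nd T (par T k) = Nd l r" by (auto simp: inner_def)
    have "nd T k = l \<or> nd T k = r" using nd_kid[OF _ lr] p less.prems by auto
    then have "height (nd T k) + 1 \<le> height (nd T (par T k))" using lr by auto
    moreover have "height (nd T (par T k)) + dep T (par T k) \<le> height T" using p less by auto
    ultimately show ?thesis using dep_par[of k T] False less.prems by simp
  qed simp
qed

lemma kids_leaves: "concat (map (\<lambda>x. leaves (fst x)) (kids x)) @ label (fst x) = leaves (fst x)"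
  by (cases x rule: kids.cases) auto

text \<open>The labels of expanded leaves together with the leaves of the waiting subtrees are
  invariant. Multisets are used because the order changes while the multiplicities, which decide the
  uniqueness of a leaf, must be kept.\<close>

lemma bfs_leaves:
  "i \<le> node_count T \<Longrightarrow> mset (concat (map (\<lambda>x. label (fst x)) (take i (bfs T i)))) +
     mset (concat (map (\<lambda>x. leaves (fst x)) (drop i (bfs T i)))) = mset (leaves T)"
proof (induction i)
  case (Suc i)
  then have i: "i < length (bfs T i)" using bfs_length_gt by simp
  then have d: "drop i (bfs T i) = bfs T i ! i # drop (Suc i) (bfs T i)" by (rule Cons_nth_drop_Suc[symmetric])
  have t: "take (Suc i) (bfs T (Suc i)) = take i (bfs T i) @ [bfs T i ! i]"
    using i by (simp add: take_Suc_conv_app_nth)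
  have d': "drop (Suc i) (bfs T (Suc i)) = drop (Suc i) (bfs T i) @ kids (bfs T i ! i)" using i by simp
  have k: "mset (leaves (fst (bfs T i ! i))) = mset (concat (map (\<lambda>x. leaves (fst x)) (kids (bfs T i ! i)))) +
      mset (label (fst (bfs T i ! i)))"
    using kids_leaves[of "bfs T i ! i"] by (metis mset_append)
  have IH: "mset (concat (map (\<lambda>x. label (fst x)) (take i (bfs T i)))) +
     mset (concat (map (\<lambda>x. leaves (fst x)) (drop i (bfs T i)))) = mset (leaves T)" using Suc by simp
  show ?case unfolding t d' using IH unfolding d by (simp add: k add_ac)
qed simp

lemma labels_mset:
  "mset (concat (map (\<lambda>k. label (nd T k)) [0..<node_count T])) = mset (leaves T)"
proof -
  let ?ns = "bfs T (node_count T)"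
  have "?ns = map (\<lambda>k. ?ns ! k) [0..<node_count T]"
    by (metis bfs_length_final map_nth)
  then have "map (\<lambda>x. label (fst x)) ?ns = map (\<lambda>k. label (nd T k)) [0..<node_count T]"
    by (metis (no_types, lifting) comp_def list.map_comp map_cong nd_def)
  then show ?thesis using bfs_leaves[of "node_count T" T] by (simp add: bfs_length_final)
qed

lemma leaf_ex:
  assumes "a \<in> set (leaves T)"
  shows "\<exists>k < node_count T. nd T k = Lf a"
proof -
  have "a \<in> set (concat (map (\<lambda>k. label (nd T k)) [0..<node_count T]))"
    using assms labels_mset[of T] by (metis set_mset_mset)
  then obtain k where "k < node_count T" "a \<in> set (label (nd T k))" by auto
  then show ?thesis by (cases "nd T k") auto
qed

lemma leaf_unique:
  assumes "distinct (leaves T)" "i < node_count T" "j < node_count T" "nd T i = Lf a" "nd T j = Lf a"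
  shows "i = j"
proof (rule ccontr)
  assume "i \<noteq> j"
  have d: "distinct (concat (map (\<lambda>k. label (nd T k)) [0..<node_count T]))"
    using assms(1) labels_mset[of T] by (metis mset_eq_imp_distinct_iff)
  have w: False if "i < j" "j < node_count T" "nd T i = Lf a" "nd T j = Lf a" for i j
  proof -
    \<comment> \<open>Cutting the index range at \<open>j\<close> puts the two leaves into different
      parts, and distinctness makes the labels of the parts disjoint.\<close>
    have "[0..<node_count T] = [0..<j] @ [j..<node_count T]"
      using that by (metis le_add_diff_inverse less_imp_le upt_add_eq_append zero_le)
    then have "(\<Union>x\<in>{0..<j}. set (label (nd T x))) \<inter> (\<Union>x\<in>{j..<node_count T}. set (label (nd T x))) = {}"
      using d by simp
    moreover have "a \<in> (\<Union>x\<in>{0..<j}. set (label (nd T x)))" using that by (intro UN_I[of i]) auto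
    moreover have "a \<in> (\<Union>x\<in>{j..<node_count T}. set (label (nd T x)))" using that by (intro UN_I[of j]) auto
    ultimately show False by blast
  qed
  show False using w[of i j] w[of j i] \<open>i \<noteq> j\<close> assms by linarith
qed

section \<open>Node records\<close>

definition cell :: "nat \<Rightarrow> nat \<Rightarrow> nat \<Rightarrow> nat" where
  "cell A i c = A + 16 * i + c"

lemma cell_eq [simp]: "c < 16 \<Longrightarrow> c' < 16 \<Longrightarrow> cell A i c = cell A j c' \<longleftrightarrow> i = j \<and> c = c'"
  unfolding cell_def by presburger

lemma cell_add [simp]: "cell A i c + numeral k = cell A i (c + numeral k)" "Suc (cell A i c) = cell A i (Suc c)"
  "numeral k + cell A i c = cell A i (c + numeral k)"
  by (simp_all add: cell_def)

lemma cell_2 [simp]: "cell A i (Suc (Suc 0)) = cell A i 2"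
  by (simp add: numeral_2_eq_2)

text \<open>Siblings are adjacent, so the program reaches the right child through offsets from 16 on
  relative to the record of the left one.\<close>

lemma cell_next [simp]:
  "cell A i 16 = cell A (Suc i) 0" "cell A i 18 = cell A (Suc i) 2" "cell A i 19 = cell A (Suc i) 3"
  "cell A i 20 = cell A (Suc i) 4" "cell A i 22 = cell A (Suc i) 6" "cell A i 23 = cell A (Suc i) 7"
  "cell A i 24 = cell A (Suc i) 8" "cell A i 26 = cell A (Suc i) 10" "cell A i 32 = cell A (Suc (Suc i)) 0"
  by (simp_all add: cell_def)

lemma cell_less_iff [simp]: "cell A i 0 < cell A j 0 \<longleftrightarrow> i < j"
  by (simp add: cell_def)

lemma cell_base: "cell A 0 0 = A"
  by (simp add: cell_def)

lemma cell_ge [simp]: "a < A \<Longrightarrow> a \<noteq> cell A i c" "a < A \<Longrightarrow> cell A i c \<noteq> a" "A \<le> cell A i c"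
  by (simp_all add: cell_def)

lemma cell_upper: "i < n \<Longrightarrow> c < 16 \<Longrightarrow> cell A i c < A + 16 * n"
  by (simp add: cell_def)

lemma cell_frame: "a < A \<or> A + 16 * n \<le> a \<Longrightarrow> i < n \<Longrightarrow> c < 16 \<Longrightarrow> a \<noteq> cell A i c"
  using cell_upper[of i n c A] cell_ge(3)[of A i c] by linarith

definition record_ok :: "ctree \<Rightarrow> nat \<Rightarrow> (nat \<Rightarrow> nat) \<Rightarrow> nat \<Rightarrow> bool" where
  "record_ok T A M k \<longleftrightarrow> M (cell A k 2) = dep T k \<and>
     (case nd T k of
        Lf a \<Rightarrow> M (cell A k (Suc 0)) = 0 \<and> M (cell A k 9) = a
      | Nd l r \<Rightarrow> M (cell A k (Suc 0)) = cell A (kid T k) 0 \<and> M (cell A k 11) = cell A (kid T k) 10 \<and>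
          M (cell A k 12) = cell A (Suc (kid T k)) 10)"

lemma record_ok_cong:
  assumes "record_ok T A M k" "M' (cell A k 2) = M (cell A k 2)" "M' (cell A k (Suc 0)) = M (cell A k (Suc 0))"
    "M' (cell A k 9) = M (cell A k 9)" "M' (cell A k 11) = M (cell A k 11)" "M' (cell A k 12) = M (cell A k 12)"
  shows "record_ok T A M' k"
  using assms unfolding record_ok_def by (auto split: ctree.splits)

lemma tree_at_in: "tree_at S M p T \<Longrightarrow> p \<in> S"
  by (cases T) auto

text \<open>The memory \<open>M0\<close> is that before the traversal: the input tree lies below
  \<open>A\<close> and is never written, so the subtrees still to be visited can be described with
  respect to it.\<close>

lemma wp_number_body:
  fixes A :: nat
  assumes \<rho>: "\<rho> vp = cell A i 0" "\<rho> rE = cell A (kid T i) 0"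
    and i: "i < node_count T"
    and tr: "tree_at S M0 (M (cell A i 0)) (nd T i)" and S: "\<And>p. p \<in> S \<Longrightarrow> p + 2 < A"
    and M: "\<And>a. a < A \<Longrightarrow> M a = M0 a" and d: "M (cell A i 2) = dep T i"
    and r: "A + 16 * node_count T + 32 < 2 ^ w" "\<And>k. k < node_count T \<Longrightarrow> dep T k < 2 ^ w"
    and Q: "\<And>\<rho>' M' \<tau>'. \<lbrakk>\<rho>' vp = cell A (Suc i) 0; \<rho>' rE = cell A (kid T (Suc i)) 0; \<rho>' rh = max (\<rho> rh) (dep T i);
      \<And>x. x < 45 \<Longrightarrow> x \<noteq> 15 \<Longrightarrow> x \<noteq> 18 \<Longrightarrow> \<rho>' x = \<rho> x;
      record_ok T A M' i; \<And>k. k < i \<Longrightarrow> record_ok T A M k \<Longrightarrow> record_ok T A M' k;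
      \<And>k. i < k \<Longrightarrow> k < kid T i \<Longrightarrow> M' (cell A k 0) = M (cell A k 0) \<and> M' (cell A k 2) = M (cell A k 2);
      \<And>k. kid T i \<le> k \<Longrightarrow> k < kid T (Suc i) \<Longrightarrow> tree_at S M0 (M' (cell A k 0)) (nd T k) \<and> M' (cell A k 2) = dep T k;
      \<And>a. a < A \<or> A + 16 * node_count T \<le> a \<Longrightarrow> M' a = M a; \<tau>' \<le> \<tau> + 80\<rbrakk> \<Longrightarrow> Q \<rho>' M' \<tau>'"
  shows "wp w number_body Q \<rho> M \<tau>"
proof -
  define p where "p = M (cell A i 0)"
  have p: "p + 2 < A" using S[OF tree_at_in[OF tr]] by (simp add: p_def)
  have pM: "M p = M0 p" "M (Suc p) = M0 (Suc p)" "M (p + 2) = M0 (p + 2)" using M p by simp_all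
  have cw: "cell A k c < 2 ^ w" if "k \<le> node_count T" "c < 32" for k c
    using that r(1) unfolding cell_def by linarith
  have kg: "i < kid T i" by (rule kid_gt[OF i])
  have one: "Suc 0 < 2 ^ w" "2 < (2::nat) ^ w" "9 < (2::nat) ^ w" "10 < (2::nat) ^ w" "11 < (2::nat) ^ w" "12 < (2::nat) ^ w" "16 < (2::nat) ^ w"
     "18 < (2::nat) ^ w" "26 < (2::nat) ^ w" "32 < (2::nat) ^ w" "p + 2 < 2 ^ w" "Suc p < 2 ^ w"
    using r p by linarith+
  show ?thesis
  proof (cases "nd T i")
    case (Lf a)
    have Mp: "M p = 0" "M (Suc p) = a" using tr Lf pM by (simp_all add: p_def[symmetric])
    have ks: "kid T (Suc i) = kid T i" using kid_Suc[OF i] Lf by simp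
    define M' where "M' = M(cell A i (Suc 0) := 0, cell A i 9 := a)"
    have ne: "Suc p \<noteq> cell A j c" for j c using p by (intro cell_ge) simp
    have Q': "Q \<rho>' M' \<tau>'" if "\<rho>' vp = cell A (Suc i) 0" "\<rho>' rE = cell A (kid T i) 0" "\<rho>' rh = max (\<rho> rh) (dep T i)"
      "\<And>x. x < 45 \<Longrightarrow> x \<noteq> 15 \<Longrightarrow> x \<noteq> 18 \<Longrightarrow> \<rho>' x = \<rho> x" "\<tau>' \<le> \<tau> + 80" for \<rho>' \<tau>'
    proof (rule Q)
      show "record_ok T A M' i" using Lf d by (simp add: record_ok_def M'_def)
      show "record_ok T A M' k" if "k < i" "record_ok T A M k" for k
        using that(2) by (rule record_ok_cong) (use that in \<open>simp_all add: M'_def\<close>)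
      show "M' a = M a" if "a < A \<or> A + 16 * node_count T \<le> a" for a
        using cell_frame[OF that i] by (simp add: M'_def)
    qed (use that ks in \<open>auto simp: M'_def\<close>)
    show ?thesis unfolding number_body_def
      using \<rho> one cw[of i] cw[of "Suc i" 0] i d Mp ne
      by (cases "\<rho> rh < dep T i") (simp add: p_def[symmetric], intro Q'[unfolded M'_def], simp_all)+
  next
    case (Nd l r)
    let ?k = "kid T i"
    have k: "Suc ?k < node_count T" by (rule kid_less[OF i Nd])
    have Mp: "M p = 1" "tree_at S M0 (M0 (Suc p)) l" "tree_at S M0 (M0 (p + 2)) r"
      using tr Nd pM by (simp_all add: p_def[symmetric])
    have ks: "kid T (Suc i) = kid T i + 2" using kid_Suc[OF i] Nd by simp
    have ne: "Suc p \<noteq> cell A j c" "p + 2 \<noteq> cell A j c" for j c using p by (auto intro!: cell_ge)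
    define M' where "M' = M(cell A i (Suc 0) := cell A ?k 0, cell A i 11 := cell A ?k 10,
      cell A i 12 := cell A (Suc ?k) 10, cell A ?k 0 := M0 (Suc p), cell A ?k 2 := Suc (dep T i),
      cell A (Suc ?k) 0 := M0 (Suc (Suc p)), cell A (Suc ?k) 2 := Suc (dep T i))"
    have dS: "Suc (dep T i) < 2 ^ w" using r(2)[of ?k] k nd_kid[OF i Nd] by simp
    have Q': "Q \<rho>' M' \<tau>'" if "\<rho>' vp = cell A (Suc i) 0" "\<rho>' rE = cell A (?k + 2) 0" "\<rho>' rh = max (\<rho> rh) (dep T i)"
      "\<And>x. x < 45 \<Longrightarrow> x \<noteq> 15 \<Longrightarrow> x \<noteq> 18 \<Longrightarrow> \<rho>' x = \<rho> x" "\<tau>' \<le> \<tau> + 80" for \<rho>' \<tau>'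
    proof (rule Q)
      show "record_ok T A M' i" using Nd d kg by (simp add: record_ok_def M'_def)
      show "record_ok T A M' k" if "k < i" "record_ok T A M k" for k
        using that(2) by (rule record_ok_cong) (use that kg in \<open>simp_all add: M'_def\<close>)
      show "M' (cell A k 0) = M (cell A k 0) \<and> M' (cell A k 2) = M (cell A k 2)" if "i < k" "k < ?k" for k
        using that by (simp add: M'_def)
      show "tree_at S M0 (M' (cell A k 0)) (nd T k) \<and> M' (cell A k 2) = dep T k"
        if "?k \<le> k" "k < kid T (Suc i)" for k
      proof -
        have "k = ?k \<or> k = Suc ?k" using that ks by linarith
        then show ?thesis using Mp nd_kid[OF i Nd] by (auto simp: M'_def)
      qed
      show "M' a = M a" if "a < A \<or> A + 16 * node_count T \<le> a" for a
        using cell_frame[OF that i] cell_frame[OF that k] cell_frame[OF that, of ?k] k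
        by (simp add: M'_def)
    qed (use that ks in auto)
    show ?thesis unfolding number_body_def
      using \<rho> one cw[of i] cw[of "Suc i" 0] cw[of ?k] cw[of "Suc ?k"] cw[of "Suc (Suc ?k)" 0] i k d Mp ne kg pM dS
      by (cases "\<rho> rh < dep T i") (simp add: p_def[symmetric], intro Q'[unfolded M'_def], simp_all)+
  qed
qed

text \<open>Following the higher child down ends in a deepest leaf; thus the maximum of the depths,
  which the numbering loop computes, is the height.\<close>

lemma dep_height_ex:
  assumes "k < node_count T"
  shows "\<exists>j < node_count T. dep T j = dep T k + height (nd T k)"
  using assms
proof (induction "node_count T - k" arbitrary: k rule: less_induct)
  case less
  show ?case
  proof (cases "nd T k")
    case (Lf a)
    then show ?thesis using less.prems by auto
  next
    case (Nd l r)
    note kk = nd_kid[OF less.prems Nd] kid_gt[OF less.prems] kid_less[OF less.prems Nd]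
    have IH: "\<exists>j < node_count T. dep T j = dep T c + height (nd T c)" if "c = kid T k \<or> c = Suc (kid T k)" for c
      by (rule less.hyps) (use that kk less.prems in auto)
    show ?thesis using IH[of "kid T k"] IH[of "Suc (kid T k)"] kk Nd by (auto simp: max_def)
  qed
qed

lemma dep_le_height: "k < node_count T \<Longrightarrow> dep T k \<le> height T"
  using height_nd[of k T] by simp

lemma wp_number_nodes:
  assumes \<rho>: "\<rho> rNB = A" "\<rho> rrt = rt0"
    and tr: "tree_at S M rt0 T" and S: "\<And>p. p \<in> S \<Longrightarrow> p + 2 < A"
    and r: "A + 16 * node_count T + 32 < 2 ^ w" "height T < 2 ^ w"
    and Q: "\<And>\<rho>' M' \<tau>'. \<lbrakk>\<rho>' rE = cell A (node_count T) 0; \<rho>' rh = height T;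
      \<And>x. x < 45 \<Longrightarrow> x \<noteq> 15 \<Longrightarrow> x \<noteq> 18 \<Longrightarrow> \<rho>' x = \<rho> x;
      \<And>k. k < node_count T \<Longrightarrow> record_ok T A M' k;
      \<And>a. a < A \<or> A + 16 * node_count T \<le> a \<Longrightarrow> M' a = M a; \<tau>' \<le> \<tau> + 100 * node_count T + 30\<rbrakk> \<Longrightarrow> Q \<rho>' M' \<tau>'"
  shows "wp w number_nodes Q \<rho> M \<tau>"
proof -
  let ?n = "node_count T" and ?e = "V vp \<prec> V rE"
  define I where "I i \<rho>' M' \<tau>' \<longleftrightarrow> \<rho>' vp = cell A i 0 \<and> \<rho>' rE = cell A (kid T i) 0 \<and>
      (\<forall>k < i. dep T k \<le> \<rho>' rh) \<and> \<rho>' rh \<le> height T \<and>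
      (\<forall>x < 45. x \<noteq> 15 \<longrightarrow> x \<noteq> 18 \<longrightarrow> \<rho>' x = \<rho> x) \<and> (\<forall>k < i. record_ok T A M' k) \<and>
      (\<forall>k. i \<le> k \<and> k < kid T i \<longrightarrow> tree_at S M (M' (cell A k 0)) (nd T k) \<and> M' (cell A k 2) = dep T k) \<and>
      (\<forall>a. a < A \<or> A + 16 * ?n \<le> a \<longrightarrow> M' a = M a) \<and> \<tau>' \<le> \<tau> + 20 + i * 90"
    for i and \<rho>' M' :: "nat \<Rightarrow> nat" and \<tau>'
  let ?r0 = "\<rho>(vp := A, rE := A + 16, rh := 0)" and ?M0 = "M(A := rt0, A + 2 := 0)"
  have n1: "0 < ?n" by (rule node_count_pos)
  have k0: "kid T 0 = 1" by (simp add: kid_def)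
  have "wp w (Whl ?e number_body) Q ?r0 ?M0 \<tau>0" if "\<tau>0 \<le> \<tau> + 20" for \<tau>0
  proof (rule wp_Whl[where I = I and m = ?n])
    have "M' a = M a" if "a < A \<or> A + 16 * ?n \<le> a" "M' = ?M0" for M' a
      using that n1 by auto
    then show "I 0 ?r0 ?M0 \<tau>0"
      using that tr by (simp add: I_def k0 cell_base cell_def)
  next
    fix k \<rho>1 M1 \<tau>1 assume "k \<le> ?n" "I k \<rho>1 M1 \<tau>1"
    moreover have "k < kid T k \<longleftrightarrow> k < ?n" if "k \<le> ?n"
      using that kid_gt[of k T] kid_node_count[of T] by (cases "k = ?n") auto
    ultimately show "safe w \<rho>1 M1 ?e \<and> (nval w \<rho>1 M1 ?e \<noteq> 0 \<longleftrightarrow> k < ?n)"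
      by (auto simp: I_def)
  next
    fix i \<rho>1 M1 \<tau>1 \<tau>2 assume i: "i < ?n" and I: "I i \<rho>1 M1 \<tau>1" and "\<tau>2 = \<tau>1 + cost ?e + 1"
    then have \<tau>2: "\<tau>2 = \<tau>1 + 4" by simp
    have kg: "i < kid T i" by (rule kid_gt[OF i])
    have I1: "\<rho>1 vp = cell A i 0" "\<rho>1 rE = cell A (kid T i) 0" "\<forall>k < i. dep T k \<le> \<rho>1 rh" "\<rho>1 rh \<le> height T"
      "\<And>x. x < 45 \<Longrightarrow> x \<noteq> 15 \<Longrightarrow> x \<noteq> 18 \<Longrightarrow> \<rho>1 x = \<rho> x" "\<And>k. k < i \<Longrightarrow> record_ok T A M1 k"
      "\<And>k. i \<le> k \<Longrightarrow> k < kid T i \<Longrightarrow> tree_at S M (M1 (cell A k 0)) (nd T k) \<and> M1 (cell A k 2) = dep T k"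
      "\<And>a. a < A \<or> A + 16 * ?n \<le> a \<Longrightarrow> M1 a = M a" "\<tau>1 \<le> \<tau> + 20 + i * 90"
      using I unfolding I_def by blast+
    show "wp w number_body (I (Suc i)) \<rho>1 M1 \<tau>2"
    proof (rule wp_number_body[OF I1(1,2) i _ S _ _ r(1)])
      show "tree_at S M (M1 (cell A i 0)) (nd T i)" "M1 (cell A i 2) = dep T i"
        using I1(7)[of i] kg by auto
      show "\<And>a. a < A \<Longrightarrow> M1 a = M a" using I1(8) by blast
      show "dep T k < 2 ^ w" if "k < ?n" for k using dep_le_height[OF that] r(2) by simp
      fix \<rho>2 M2 \<tau>3
      assume a: "\<rho>2 vp = cell A (Suc i) 0" "\<rho>2 rE = cell A (kid T (Suc i)) 0" "\<rho>2 rh = max (\<rho>1 rh) (dep T i)"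
        "\<And>x. x < 45 \<Longrightarrow> x \<noteq> 15 \<Longrightarrow> x \<noteq> 18 \<Longrightarrow> \<rho>2 x = \<rho>1 x"
        "record_ok T A M2 i" "\<And>k. k < i \<Longrightarrow> record_ok T A M1 k \<Longrightarrow> record_ok T A M2 k"
        "\<And>k. i < k \<Longrightarrow> k < kid T i \<Longrightarrow> M2 (cell A k 0) = M1 (cell A k 0) \<and> M2 (cell A k 2) = M1 (cell A k 2)"
        "\<And>k. kid T i \<le> k \<Longrightarrow> k < kid T (Suc i) \<Longrightarrow> tree_at S M (M2 (cell A k 0)) (nd T k) \<and> M2 (cell A k 2) = dep T k"
        "\<And>a. a < A \<or> A + 16 * ?n \<le> a \<Longrightarrow> M2 a = M1 a" "\<tau>3 \<le> \<tau>2 + 80"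
      have "\<forall>k < Suc i. dep T k \<le> \<rho>2 rh" using I1(3) a(3) by (auto simp: less_Suc_eq)
      moreover have "\<rho>2 rh \<le> height T" using I1(4) a(3) dep_le_height[OF i] by simp
      moreover have "\<forall>k < Suc i. record_ok T A M2 k" using I1(6) a(5,6) by (auto simp: less_Suc_eq)
      moreover have "tree_at S M (M2 (cell A k 0)) (nd T k) \<and> M2 (cell A k 2) = dep T k"
        if "Suc i \<le> k" "k < kid T (Suc i)" for k
      proof (cases "k < kid T i")
        case True
        then show ?thesis using a(7)[of k] I1(7)[of k] that by simp
      next
        case False
        then show ?thesis using a(8)[of k] that by simp
      qed
      moreover have "\<tau>3 \<le> \<tau> + 20 + Suc i * 90" using a(10) \<tau>2 I1(9) by simp
      ultimately show "I (Suc i) \<rho>2 M2 \<tau>3"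
        using a(1,2,4,9) I1(5,8) unfolding I_def by auto
    qed
  next
    fix \<rho>1 M1 \<tau>1 \<tau>2 assume I: "I ?n \<rho>1 M1 \<tau>1" and "\<tau>2 = \<tau>1 + cost ?e + 1"
    then have \<tau>2: "\<tau>2 = \<tau>1 + 4" by simp
    obtain j where "j < ?n" "dep T j = height T" using dep_height_ex[OF n1] by auto
    then have "\<rho>1 rh = height T" using I unfolding I_def by (metis le_antisym)
    then show "Q \<rho>1 M1 \<tau>2" using I \<tau>2 unfolding I_def by (intro Q) (auto simp: kid_node_count)
  qed
  moreover have "A + 16 < 2 ^ w" "16 < (2::nat) ^ w" "2 < (2::nat) ^ w" "A + 2 < 2 ^ w" using r by linarith+
  ultimately show ?thesis unfolding number_nodes_def using \<rho> by (simp add: fun_upd_twist)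
qed

section \<open>Word length, character width and block length\<close>

lemma power2_shift: "i < w \<Longrightarrow> 2 ^ i * 2 mod (2::nat) ^ w = (if Suc i < w then 2 ^ Suc i else 0)"
proof (cases "Suc i < w")
  case True
  then have "(2::nat) ^ Suc i < 2 ^ w" by (intro power_strict_increasing) auto
  then show ?thesis using True by (simp add: mult.commute)
next
  case False
  assume "i < w"
  then have "w = Suc i" using False by simp
  then show ?thesis by simp
qed

lemma less_ceillog2_iff: "0 < \<sigma> \<Longrightarrow> i < ceillog2 \<sigma> \<longleftrightarrow> 2 ^ i < \<sigma>"
  using ceillog2_le_iff[of \<sigma> i] by linarith

text \<open>Guarantees that the product in the test of the parameter search does not overflow: as
  \<open>t + 1 \<le> 2 * t\<close> for positive \<open>t\<close>, it is at most
  \<open>4 * w\<close>.\<close>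

lemma square_bound:
  assumes "t = 1 \<or> 4 * t * t \<le> w" "20 \<le> (w::nat)"
  shows "4 * (t + 1) * (t + 1) < 2 ^ w"
proof -
  have w8: "16 + 4 * w < 2 ^ w"
    using assms(2)
  proof (induction w rule: dec_induct)
    case (step w)
    then show ?case by simp
  qed simp
  show ?thesis
  proof (cases "t = 0")
    case True
    then show ?thesis using w8 by simp
  next
    case False
    then have "t + 1 \<le> 2 * t" by simp
    from mult_le_mono2[OF mult_le_mono[OF this this], of 4]
    have "4 * (t + 1) * (t + 1) \<le> 4 * (2 * t * (2 * t))" by (simp only: mult.assoc)
    also have "\<dots> = 4 * (4 * t * t)" by simp
    finally have "4 * (t + 1) * (t + 1) \<le> 4 * (4 * t * t)" .
    moreover have "4 * t * t \<le> w" using assms by auto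
    ultimately show ?thesis using w8 by linarith
  qed
qed

lemma wp_find_params:
  assumes \<rho>: "\<rho> rsg = \<sigma>" and \<sigma>: "0 < \<sigma>" "\<sigma> \<le> 2 ^ w" and w: "20 \<le> w"
    and Q: "\<And>\<rho>' \<tau>' t. \<lbrakk>\<rho>' rw = w; \<rho>' rb = ceillog2 \<sigma>; \<rho>' rt = t; 0 < t; t = 1 \<or> 4 * t * t \<le> w;
      w < 4 * (t + 1) * (t + 1); \<And>x. x < 45 \<Longrightarrow> x \<noteq> 5 \<Longrightarrow> x \<noteq> 6 \<Longrightarrow> x \<noteq> 7 \<Longrightarrow> \<rho>' x = \<rho> x;
      \<tau>' \<le> \<tau> + 40 * w + 20\<rbrakk> \<Longrightarrow> Q \<rho>' M \<tau>'"
  shows "wp w find_params Q \<rho> M \<tau>"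
proof -
  \<comment> \<open>The alternative that the block length is 1 covers the first iterations, in which
    \<open>4 * 1 * 1\<close> still exceeds the count \<open>i\<close>.\<close>
  define I where "I i \<rho>' M' \<tau>' \<longleftrightarrow> M' = M \<and> \<rho>' vx = (if i < w then 2 ^ i else 0) \<and> \<rho>' rw = i \<and>
      \<rho>' rb = min i (ceillog2 \<sigma>) \<and> 0 < \<rho>' rt \<and> (\<rho>' rt = 1 \<or> 4 * \<rho>' rt * \<rho>' rt \<le> i) \<and> i < 4 * (\<rho>' rt + 1) * (\<rho>' rt + 1) \<and>
      (\<forall>x < 45. x \<noteq> 5 \<longrightarrow> x \<noteq> 6 \<longrightarrow> x \<noteq> 7 \<longrightarrow> \<rho>' x = \<rho> x) \<and> \<tau>' \<le> \<tau> + 10 + 40 * i"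
    for i and \<rho>' M' :: "nat \<Rightarrow> nat" and \<tau>'
  let ?r0 = "\<rho>(vx := 1, rw := 0, rt := 1, rb := 0)"
  have ww: "w < 2 ^ w" by simp
  have one: "4 < (2::nat) ^ w" "1 < (2::nat) ^ w" using w ww by linarith+
  define body where "body = (IfE (V vx \<prec> V rsg) (rb \<leftarrow> V rb \<oplus> N 1) Skp;;
       vx \<leftarrow> (V vx \<lless> N 1);;
       rw \<leftarrow> V rw \<oplus> N 1;;
       IfE (V rw \<prec> N 4 \<otimes> (V rt \<oplus> N 1) \<otimes> (V rt \<oplus> N 1)) Skp (rt \<leftarrow> V rt \<oplus> N 1))"
  have "wp w (Whl (V vx) body) Q ?r0 M \<tau>0" if "\<tau>0 \<le> \<tau> + 10" for \<tau>0
  proof (rule wp_Whl[where I = I and m = w])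
    show "I 0 ?r0 M \<tau>0" using that w by (simp add: I_def)
  next
    fix i \<rho>1 M1 \<tau>1 assume "i \<le> w" "I i \<rho>1 M1 \<tau>1"
    then show "safe w \<rho>1 M1 (V vx) \<and> (nval w \<rho>1 M1 (V vx) \<noteq> 0 \<longleftrightarrow> i < w)" by (simp add: I_def)
  next
    fix i \<rho>1 M1 \<tau>1 \<tau>2 assume i: "i < w" and I: "I i \<rho>1 M1 \<tau>1" and "\<tau>2 = \<tau>1 + cost (V vx) + 1"
    then have \<tau>2: "\<tau>2 = \<tau>1 + 2" by simp
    define t where "t = \<rho>1 rt"
    have I1: "M1 = M" "\<rho>1 vx = 2 ^ i" "\<rho>1 rw = i" "\<rho>1 rb = min i (ceillog2 \<sigma>)" "\<rho>1 rt = t" "0 < t"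
      "t = 1 \<or> 4 * t * t \<le> i" "i < 4 * (t + 1) * (t + 1)" "\<tau>1 \<le> \<tau> + 10 + 40 * i"
      "\<And>x. x < 45 \<Longrightarrow> x \<noteq> 5 \<Longrightarrow> x \<noteq> 6 \<Longrightarrow> x \<noteq> 7 \<Longrightarrow> \<rho>1 x = \<rho> x"
      using I i unfolding I_def t_def by auto
    have sg: "\<rho>1 rsg = \<sigma>" using I1(10)[of rsg] \<rho> by simp
    have tb: "4 * (t + 1) * (t + 1) < 2 ^ w" using I1(7) i by (intro square_bound w) auto
    have tb': "4 * (t + 1) < 2 ^ w"
      by (rule le_less_trans[OF _ tb]) simp
    have tb2: "t + 1 < 2 ^ w" by (rule le_less_trans[OF _ tb']) simp
    have iw: "i + 1 < 2 ^ w" using i ww by linarith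
    have bw: "min i (ceillog2 \<sigma>) + 1 < 2 ^ w" using iw by linarith
    define b' where "b' = min (Suc i) (ceillog2 \<sigma>)"
    \<comment> \<open>The power \<open>2 ^ i\<close> is below \<sigma> exactly as long as
      \<open>i < ceillog2 \<sigma>\<close>, so counting such powers yields the logarithm rounded
      up.\<close>
    have b': "b' = (if 2 ^ i < \<sigma> then min i (ceillog2 \<sigma>) + 1 else min i (ceillog2 \<sigma>))"
      using less_ceillog2_iff[OF \<sigma>(1), of i] unfolding b'_def by auto
    define t' where "t' = (if Suc i < 4 * (t + 1) * (t + 1) then t else t + 1)"
    have t': "0 < t'" "t' = 1 \<or> 4 * t' * t' \<le> Suc i" "Suc i < 4 * (t' + 1) * (t' + 1)"
    proof -
      show "0 < t'" using I1 by (simp add: t'_def)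
      show "t' = 1 \<or> 4 * t' * t' \<le> Suc i" using I1 by (auto simp: t'_def)
      have "4 * (t + 1) * (t + 1) + 1 < 4 * (t + 1 + 1) * (t + 1 + 1)" by (simp add: algebra_simps)
      then show "Suc i < 4 * (t' + 1) * (t' + 1)" using I1(8) unfolding t'_def by (cases "Suc i < 4 * (t + 1) * (t + 1)") auto
    qed
    define x' where "x' = (if Suc i < w then 2 ^ Suc i else 0 :: nat)"
    have x': "2 ^ i * 2 mod 2 ^ w = x'" using power2_shift[OF i] by (simp add: x'_def)
    have Q': "I (Suc i) \<rho>' M \<tau>'" if "\<rho>' vx = x'" "\<rho>' rw = Suc i" "\<rho>' rb = b'" "\<rho>' rt = t'"
      "\<And>x. x < 45 \<Longrightarrow> x \<noteq> 5 \<Longrightarrow> x \<noteq> 6 \<Longrightarrow> x \<noteq> 7 \<Longrightarrow> \<rho>' x = \<rho>1 x" "\<tau>' \<le> \<tau>2 + 36" for \<rho>' \<tau>'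
      using that t' I1(9,10) \<tau>2 unfolding I_def b'_def x'_def by simp
    show "wp w body (I (Suc i)) \<rho>1 M1 \<tau>2"
      unfolding body_def
      using I1(1-5) sg one iw tb tb' tb2 bw x'
      by (cases "2 ^ i < \<sigma>"; cases "Suc i < 4 * (t + 1) * (t + 1)"; simp; intro Q'; simp add: b' t'_def)
  next
    fix \<rho>1 M1 \<tau>1 \<tau>2 assume I: "I w \<rho>1 M1 \<tau>1" and "\<tau>2 = \<tau>1 + cost (V vx) + 1"
    then have \<tau>2: "\<tau>2 = \<tau>1 + 2" by simp
    have "ceillog2 \<sigma> \<le> w" using \<sigma> by (simp add: ceillog2_le_iff)
    moreover have "M1 = M" using I by (simp add: I_def)
    ultimately show "Q \<rho>1 M1 \<tau>2"
      using I \<tau>2 unfolding I_def by (simp, intro Q[of \<rho>1 "\<rho>1 rt"]) auto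
  qed
  then show ?thesis unfolding find_params_def body_def using one by (simp add: fun_upd_twist)
qed

section \<open>Local codes and ancestors\<close>

text \<open>\<open>lcode m v a\<close> consists of the first \<open>m\<close> branching bits on the path from \<open>v\<close> to the leaf
  \<open>a\<close>, the topmost one being the least significant.\<close>

fun lcode :: "nat \<Rightarrow> ctree \<Rightarrow> nat \<Rightarrow> nat" where
  "lcode 0 v a = 0"
| "lcode (Suc m) (Lf c) a = 0"
| "lcode (Suc m) (Nd l r) a = (if a \<in> set (leaves r) then 1 + 2 * lcode m r a else 2 * lcode m l a)"

lemma lcode_Lf [simp]: "lcode m (Lf c) a = 0"
  by (cases m) auto

lemma lcode_less: "lcode m v a < 2 ^ m"
proof (induction m v a rule: lcode.induct)
  case (3 m l r a)
  then show ?case by (cases "a \<in> set (leaves r)") auto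
qed auto

definition anc :: "ctree \<Rightarrow> nat \<Rightarrow> nat \<Rightarrow> nat" where
  "anc T J k = (par T ^^ (dep T k - J)) k"

lemma anc_self: "dep T k \<le> J \<Longrightarrow> anc T J k = k"
  by (simp add: anc_def)

lemma anc_par:
  assumes "0 < k" "k < node_count T" "J < dep T k"
  shows "anc T J k = anc T J (par T k)"
proof -
  have "dep T k - J = Suc (dep T (par T k) - J)" using dep_par[OF assms(1,2)] assms(3) by simp
  then show ?thesis by (simp add: anc_def funpow_swap1)
qed

lemma dep_0: "k < node_count T \<Longrightarrow> dep T k = 0 \<longleftrightarrow> k = 0"
  using dep_par[of k T] by (cases "k = 0") auto

lemma anc_props:
  assumes "k < node_count T" "J \<le> dep T k"
  shows "anc T J k < node_count T \<and> dep T (anc T J k) = J \<and>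
    set (leaves (nd T k)) \<subseteq> set (leaves (nd T (anc T J k)))"
  using assms
proof (induction k rule: less_induct)
  case (less k)
  show ?case
  proof (cases "dep T k = J")
    case True
    then show ?thesis using less.prems by (simp add: anc_self)
  next
    case False
    then have k: "0 < k" "J < dep T k" using less.prems by (auto intro: gr0I)
    then have p: "par T k < k" "J \<le> dep T (par T k)" using par_props[of k T] dep_par[of k T] less.prems by auto
    then show ?thesis
      using less.IH[OF p(1)] anc_par[OF k(1) less.prems(1) k(2)] leaves_par[OF k(1) less.prems(1)] less.prems
      by auto
  qed
qed

lemma leaf_below:
  assumes "k < node_count T" "a \<in> set (leaves (nd T k))"
  shows "\<exists>j < node_count T. nd T j = Lf a \<and> dep T k \<le> dep T j \<and> anc T (dep T k) j = k"
  using assms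
proof (induction "node_count T - k" arbitrary: k rule: less_induct)
  case less
  show ?case
  proof (cases "nd T k")
    case (Lf c)
    then show ?thesis using less.prems by (intro exI[of _ k]) (auto simp: anc_self)
  next
    case (Nd l r)
    note kk = nd_kid[OF less.prems(1) Nd] kid_gt[OF less.prems(1)] kid_less[OF less.prems(1) Nd]
    have "a \<in> set (leaves l) \<or> a \<in> set (leaves r)" using Nd less.prems by auto
    then obtain c where c: "c = kid T k \<or> c = Suc (kid T k)" "a \<in> set (leaves (nd T c))" using kk by auto
    have c': "k < c" "c < node_count T" "dep T c = Suc (dep T k)" "par T c = k"
      using c kk par_kid[OF less.prems(1)] Nd by auto
    have "node_count T - c < node_count T - k" using c' by linarith
    from less.hyps[OF this c'(2) c(2)] obtain j where j: "j < node_count T" "nd T j = Lf a" "dep T c \<le> dep T j"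
      "anc T (dep T c) j = c" by blast
    have "dep T j - dep T k = Suc (dep T j - dep T c)" using j(3) c'(3) by simp
    then have "anc T (dep T k) j = par T c" using j(4) by (simp add: anc_def)
    then show ?thesis using j c' by auto
  qed
qed

text \<open>Both nodes are the ancestor, at their common depth, of the unique leaf that carries
  \<open>a\<close>.\<close>

lemma level_disjoint:
  assumes "distinct (leaves T)" "k < node_count T" "k' < node_count T" "dep T k = dep T k'"
    "a \<in> set (leaves (nd T k))" "a \<in> set (leaves (nd T k'))"
  shows "k = k'"
  using leaf_below[OF assms(2,5)] leaf_below[OF assms(3,6)] leaf_unique[OF assms(1)] assms(4) by metis

lemma distinct_nd:
  assumes "distinct (leaves T)" "k < node_count T"
  shows "distinct (leaves (nd T k))"
  using assms(2)
proof (induction k rule: less_induct)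
  case (less k)
  show ?case
  proof (cases "k = 0")
    case False
    then have p: "par T k < k" "inner (nd T (par T k))" "k = kid T (par T k) \<or> k = Suc (kid T (par T k))"
      using par_props[of k T] less.prems by auto
    then obtain l r where lr: "nd T (par T k) = Nd l r" by (auto simp: inner_def)
    then show ?thesis using less.IH[OF p(1)] p nd_kid[OF _ lr] less.prems by auto
  qed (use assms in simp)
qed

lemma sum_filter_disjoint:
  fixes L :: "'k \<Rightarrow> 'a set"
  assumes "finite K" "\<And>i j a. i \<in> K \<Longrightarrow> j \<in> K \<Longrightarrow> a \<in> L i \<Longrightarrow> a \<in> L j \<Longrightarrow> i = j"
  shows "(\<Sum>k\<in>K. length (filter (\<lambda>a. a \<in> L k) xs)) \<le> length xs"
proof (induction xs)
  case (Cons x xs)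
  have "(\<Sum>k\<in>K. length (filter (\<lambda>a. a \<in> L k) (x # xs)))
      = (\<Sum>k\<in>K. of_bool (x \<in> L k) + length (filter (\<lambda>a. a \<in> L k) xs))"
    by (intro sum.cong) auto
  also have "\<dots> = (\<Sum>k\<in>K. of_bool (x \<in> L k)) + (\<Sum>k\<in>K. length (filter (\<lambda>a. a \<in> L k) xs))"
    by (rule sum.distrib)
  also have "(\<Sum>k\<in>K. of_bool (x \<in> L k) :: nat) = card {k \<in> K. x \<in> L k}"
    using assms(1) by (simp add: Int_def)
  also have "\<dots> \<le> 1"
    using assms by (subst card_le_Suc0_iff_eq[simplified One_nat_def[symmetric]]) auto
  finally show ?case using Cons by simp
qed simp

lemma leaves_le_pow_height: "length (leaves T) \<le> 2 ^ height T"
proof (induction T)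
  case (Nd l r)
  have "(2::nat) ^ height l \<le> 2 ^ max (height l) (height r)" "(2::nat) ^ height r \<le> 2 ^ max (height l) (height r)"
    by (intro power_increasing; simp)+
  then have "length (leaves l) + length (leaves r) \<le> 2 ^ max (height l) (height r) + 2 ^ max (height l) (height r)"
    using Nd by linarith
  then show ?case by simp
qed simp

section \<open>Memory layout\<close>

text \<open>Of the block length \<open>t\<close> only the upper bound is assumed here, which governs
  memory and correctness. The lower bound enters with the analysis of the running time.\<close>

locale layout =
  fixes w n \<sigma> t A :: nat and s :: "nat list" and T :: ctree
  assumes len: "length s = n" and alph: "set s \<subseteq> {0..<\<sigma>}" and shape: "shape_for \<sigma> T"
    and sigma: "2 \<le> \<sigma>" "\<sigma> \<le> n" and w20: "20 \<le> w" and t: "0 < t" "t = 1 \<or> 4 * t * t \<le> w"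
    and A: "4 + (n * ceillog2 \<sigma> + w - 1) div w \<le> A"
begin

abbreviation "nn \<equiv> node_count T"
abbreviation "nod k \<equiv> cell A k"

definition "h = height T"
definition "f = min h t"
definition "g = t div f"
definition "b = ceillog2 \<sigma>"
definition "W = t * f"
definition "q = (2::nat) ^ (g * b)"
definition "n1 = (n + g - 1) div g"
definition "m = n1 * g"
definition "CB = A + 32 * \<sigma>"
definition "RB = CB + 2 * 2 ^ b"
definition "TB = RB + 2 * q"
definition "AB = TB + 6 * 2 ^ W"
text \<open>The lists of one round need at most \<open>2 * m + 6 * \<sigma>\<close> cells, see
  \<open>asum_le\<close>; the factor 8 leaves room for auxiliary estimates.\<close>

definition "OP0 = AB + 8 * (m + \<sigma>)"
text \<open>Bitmasks of at most \<open>h\<close> levels with \<open>m\<close> bits each, and two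
  cells per node for rounding; the remaining \<open>m + 8\<close> cells are slack for the range
  conditions of a pass.\<close>

definition "mem_end = OP0 + (h * m) div w + 4 * \<sigma> + m + 8"
text \<open>After padding every read delivers exactly \<open>g\<close> characters. As the padding is
  a suffix, it only prolongs the bitmasks behind their specified bits.\<close>

definition "sp = s @ replicate (m - n) 0"
definition "sub k = filter (\<lambda>a. a \<in> set (leaves (nd T k))) sp"
definition "cn k = length (sub k)"

lemma leaves_set: "set (leaves T) = {0..<\<sigma>}" and leaves_len: "length (leaves T) = \<sigma>"
  and leaves_distinct: "distinct (leaves T)"
proof -
  show 1: "length (leaves T) = \<sigma>" "distinct (leaves T)" using shape by (auto simp: shape_for_def)
  show "set (leaves T) = {0..<\<sigma>}"
    using shape by (intro card_subset_eq) (auto simp: shape_for_def distinct_card)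
qed

lemma nn_eq: "nn + 1 = 2 * \<sigma>"
  using node_count_leaves[of T] leaves_len by simp

lemma h_pos: "0 < h"
  unfolding h_def using sigma leaves_len by (cases T) simp_all

lemma f_pos: "0 < f" and f_le: "f \<le> t" "f \<le> h"
  using h_pos t by (auto simp: f_def)

lemma g_pos: "0 < g"
  using f_pos f_le by (simp add: g_def div_greater_zero_iff)

lemma gf_le: "g * f \<le> t"
  by (simp add: g_def)

lemma b_pos: "0 < b" and b_pow: "\<sigma> \<le> 2 ^ b" "2 ^ b < 2 * \<sigma>"
  using sigma two_power_ceillog2_gt[of \<sigma>] le_two_power_ceillog2[of \<sigma>] less_ceillog2_iff[of \<sigma> 0]
  by (auto simp: b_def)

lemma b_le_h: "b \<le> h"
  using leaves_le_pow_height[of T] sigma by (simp add: b_def h_def leaves_len ceillog2_le_iff)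

lemma W_bound: "2 * W \<le> w" "0 < W"
proof -
  have "W \<le> t * t" unfolding W_def using f_le by simp
  then show "2 * W \<le> w" using t w20 by (auto simp: algebra_simps)
  show "0 < W" using t f_pos by (simp add: W_def)
qed

lemma W_less: "W < w"
  using W_bound by simp

text \<open>If the tree is higher than \<open>t\<close>, then \<open>f = t\<close> and the quotient
  \<open>t div f\<close> is 1. So more than one character is read at a time only when a single round
  treats the whole tree.\<close>

lemma g_cases: "g = 1 \<or> f = h"
proof (cases "h \<le> t")
  case True
  then show ?thesis by (simp add: f_def)
next
  case False
  then show ?thesis using t by (simp add: g_def f_def)
qed

text \<open>For \<open>g\<close> above 1 the round covers all levels, so
  \<open>b \<le> h = f\<close> and \<open>g * b \<le> g * f \<le> t\<close>. The table of tuples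
  thus has at most \<open>2 ^ t\<close> entries, or one entry per \<open>b\<close>-bit word.\<close>

lemma gb_cases: "g * b \<le> t \<or> g = 1"
proof (cases "g = 1")
  case False
  then have "b \<le> f" using g_cases b_le_h by simp
  then have "g * b \<le> g * f" by (rule mult_le_mono2)
  then show ?thesis using gf_le by linarith
qed simp

lemma t_less_w: "t < w"
proof (cases "t = 1")
  case False
  then have "4 * t * t \<le> w" using t by simp
  moreover have "t < 4 * t * t" using t by simp
  ultimately show ?thesis by linarith
qed (use w20 in simp)

lemma n_le_m: "n \<le> m"
proof -
  have "n + g - 1 = n1 * g + (n + g - 1) mod g"
    unfolding n1_def by (rule div_mult_mod_eq[symmetric])
  moreover have "(n + g - 1) mod g < g" using g_pos by simp
  ultimately show ?thesis unfolding m_def by linarith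
qed

lemma m_le: "m \<le> n + t"
proof -
  have "m \<le> n + g - 1" unfolding m_def n1_def by simp
  moreover have "g \<le> t" by (simp add: g_def)
  ultimately show ?thesis by linarith
qed

lemma length_sp: "length sp = m"
  using n_le_m by (simp add: sp_def len)

lemma set_sp: "set sp \<subseteq> {0..<\<sigma>}"
  using alph sigma by (auto simp: sp_def)

lemma cn_0: "cn 0 = m"
proof -
  have "sub 0 = sp" unfolding sub_def using set_sp leaves_set by (intro filter_True) auto
  then show ?thesis by (simp add: cn_def length_sp)
qed

text \<open>Subtrees rooted on one level share no character, so every position of the string belongs
  to at most one of them. All bounds on space and time per level rest on this.\<close>

lemma level_sum:
  assumes "\<And>k. k \<in> K \<Longrightarrow> k < nn \<and> dep T k = d"
  shows "(\<Sum>k\<in>K. cn k) \<le> m"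
proof -
  have "finite K" using assms by (meson finite_lessThan finite_subset lessThan_iff subsetI)
  then have "(\<Sum>k\<in>K. length (filter (\<lambda>a. a \<in> set (leaves (nd T k))) sp)) \<le> length sp"
    using assms level_disjoint[OF leaves_distinct] by (intro sum_filter_disjoint) metis+
  then show ?thesis by (simp add: cn_def sub_def length_sp)
qed

lemma sum_div_le: "finite K \<Longrightarrow> (\<Sum>k\<in>K. u k div c) \<le> (\<Sum>k\<in>K. u k) div (c::nat)"
proof (induction K rule: finite_induct)
  case (insert x F)
  have "u x div c + sum u F div c \<le> (u x + sum u F) div c"
    using div_add1_eq[of "u x" "sum u F" c] by linarith
  then show ?case using insert by simp
qed simp

definition regs_ok :: "(nat \<Rightarrow> nat) \<Rightarrow> bool" where
  "regs_ok \<rho> \<longleftrightarrow> \<rho> rn = n \<and> \<rho> rsg = \<sigma> \<and> \<rho> rNB = A \<and> \<rho> rb = b \<and> \<rho> rw = w \<and> \<rho> rt = t \<and> \<rho> rf = f \<and>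
     \<rho> rg = g \<and> \<rho> rW = W \<and> \<rho> rCB = CB \<and> \<rho> rRB = RB \<and> \<rho> rTB = TB \<and> \<rho> rAB = AB \<and> \<rho> rh = h \<and>
     \<rho> rn1 = n1 \<and> \<rho> rE = nod nn 0 \<and> \<rho> rq = q"

lemma regs_okD:
  assumes "regs_ok \<rho>"
  shows "\<rho> rn = n" "\<rho> rsg = \<sigma>" "\<rho> rNB = A" "\<rho> rb = b" "\<rho> rw = w" "\<rho> rt = t" "\<rho> rf = f" "\<rho> rg = g"
    "\<rho> rW = W" "\<rho> rCB = CB" "\<rho> rRB = RB" "\<rho> rTB = TB" "\<rho> rAB = AB" "\<rho> rh = h" "\<rho> rn1 = n1"
    "\<rho> rE = nod nn 0" "\<rho> rq = q"
  using assms by (auto simp: regs_ok_def)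

lemma regs_ok_cong: "regs_ok \<rho> \<Longrightarrow> (\<And>x. x < 30 \<Longrightarrow> \<rho>' x = \<rho> x) \<Longrightarrow> regs_ok \<rho>'"
  by (simp add: regs_ok_def)

section \<open>Data that no round changes, and frame conditions\<close>

definition static_ok :: "(nat \<Rightarrow> nat) \<Rightarrow> bool" where
  "static_ok M \<longleftrightarrow> holds w M 4 (n * b) (pack b s) \<and> (\<forall>a < A. M a < 2 ^ w) \<and>
     (\<forall>k < nn. record_ok T A M k) \<and> tables_ok M t f TB"

text \<open>Memory falls into three zones: the input below \<open>A\<close> is untouched, in the
  node records only the words with offset in \<open>C\<close> may change, and behind the records
  only the addresses in \<open>X\<close>.\<close>

definition frame :: "nat set \<Rightarrow> nat set \<Rightarrow> (nat \<Rightarrow> nat) \<Rightarrow> (nat \<Rightarrow> nat) \<Rightarrow> bool" where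
  "frame C X M M' \<longleftrightarrow> (\<forall>a < A. M' a = M a) \<and>
     (\<forall>k < nn. \<forall>c < 16. c \<notin> C \<longrightarrow> M' (nod k c) = M (nod k c)) \<and>
     (\<forall>a. A + 16 * nn \<le> a \<longrightarrow> a \<notin> X \<longrightarrow> M' a = M a)"

lemma frame_refl [simp]: "frame C X M M"
  by (simp add: frame_def)

lemma frame_trans: "frame C X M1 M2 \<Longrightarrow> frame C X M2 M3 \<Longrightarrow> frame C X M1 M3"
  by (auto simp: frame_def)

lemma frame_cell: "frame C X M0 M \<Longrightarrow> k < nn \<Longrightarrow> c < 16 \<Longrightarrow> c \<in> C \<Longrightarrow> frame C X M0 (M(nod k c := v))"
  using cell_frame[of _ A nn k c] unfolding frame_def by (auto simp: cell_upper)

lemma frame_region: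
  assumes "frame C X M0 M" "A + 16 * nn \<le> a" "a \<in> X"
  shows "frame C X M0 (M(a := v))"
proof -
  have "nod k c \<noteq> a" if "k < nn" "c < 16" for k c using cell_upper[OF that, of A] assms(2) by simp
  then show ?thesis using assms unfolding frame_def by auto
qed

lemma frame_cellD: "frame C X M M' \<Longrightarrow> k < nn \<Longrightarrow> c < 16 \<Longrightarrow> c \<notin> C \<Longrightarrow> M' (nod k c) = M (nod k c)"
  by (simp add: frame_def)

lemma frame_regionD: "frame C X M M' \<Longrightarrow> A + 16 * nn \<le> a \<Longrightarrow> a \<notin> X \<Longrightarrow> M' a = M a"
  by (simp add: frame_def)

lemma regions: "A + 16 * nn \<le> CB" "CB + 2 * \<sigma> \<le> RB" "RB + 2 * q = TB" "TB + 6 * 2 ^ W = AB"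
  "AB + 8 * (m + \<sigma>) = OP0" "CB + 2 * 2 ^ b = RB" "CB \<le> RB" "RB \<le> TB" "TB \<le> AB" "AB \<le> OP0"
  using nn_eq b_pow by (simp_all add: CB_def RB_def TB_def AB_def OP0_def)

lemma tables_ok_cong:
  assumes "tables_ok M t f TB" "\<And>a. TB \<le> a \<Longrightarrow> a < AB \<Longrightarrow> M' a = M a"
  shows "tables_ok M' t f TB"
proof -
  have p: "pack f ys < 2 ^ (t * f)" if "length ys \<le> t" "fields f ys" for ys
  proof (rule less_pow_weaken[OF pack_less[OF that(2)]])
    show "f * length ys \<le> t * f" using that by simp
  qed
  have "table_ok M' t f (TB + d * 2 ^ (t * f)) e G dl" if "table_ok M t f (TB + d * 2 ^ (t * f)) e G dl" "d \<le> 4"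
    for d e G dl
    unfolding table_ok_def
  proof (intro allI impI)
    fix ys assume ys: "length ys \<le> t" "fields f ys"
    have "d * 2 ^ (t * f) \<le> 4 * 2 ^ (t * f)" using that by simp
    then have "TB + d * 2 ^ (t * f) + 2 * pack f ys + 1 < AB" using p[OF ys] regions(4) unfolding W_def by linarith
    then show "M' (TB + d * 2 ^ (t * f) + 2 * pack f ys) = pack e (G ys) \<and>
        M' (TB + d * 2 ^ (t * f) + 2 * pack f ys + 1) = e * (length (G ys) + dl * (t - length ys))"
      using that(1) ys assms(2)[of "TB + d * 2 ^ (t * f) + 2 * pack f ys"]
        assms(2)[of "TB + d * 2 ^ (t * f) + 2 * pack f ys + 1"] unfolding table_ok_def by simp
  qed
  from this[of 0] this[of 2] this[of 4] assms(1) show ?thesis unfolding tables_ok_def by simp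
qed

lemma static_frame:
  assumes "static_ok M" "frame C X M M'" "C \<inter> {Suc 0, 2, 9, 11, 12} = {}" "X \<inter> {TB..<AB} = {}"
  shows "static_ok M'"
  unfolding static_ok_def
proof (intro conjI allI impI)
  show "holds w M' 4 (n * b) (pack b s)"
    by (rule holds_cong[of w M]) (use assms(1,2) A w20 in \<open>auto simp: static_ok_def frame_def b_def\<close>)
  show "M' a < 2 ^ w" if "a < A" for a using assms(1,2) that by (simp add: static_ok_def frame_def)
  show "record_ok T A M' k" if "k < nn" for k
    by (rule record_ok_cong[of _ _ M]) (use assms(1-3) that in \<open>auto simp: static_ok_def frame_def\<close>)
  have r: "A + 16 * nn \<le> TB" using regions by linarith
  show "tables_ok M' t f TB"
  proof (rule tables_ok_cong)
    show "tables_ok M t f TB" using assms(1) by (simp add: static_ok_def)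
    show "M' a = M a" if "TB \<le> a" "a < AB" for a
      by (rule frame_regionD[OF assms(2)]) (use that r assms(4) in auto)
  qed
qed

end

section \<open>Codes of the characters\<close>

locale layout_bound = layout +
  assumes bound: "mem_end < 2 ^ w"
begin

lemma node_bound: "k \<le> nn \<Longrightarrow> c < 32 \<Longrightarrow> nod k c < 2 ^ w"
  using bound nn_eq sigma regions n_le_m unfolding cell_def mem_end_def CB_def by linarith

lemma const_bound:
  assumes "c \<le> (64::nat)"
  shows "c < 2 ^ w"
proof -
  note assms
  also have "(64::nat) < 2 ^ 20" by simp
  also have "\<dots> \<le> 2 ^ w" using w20 by (intro power_increasing) auto
  finally show ?thesis .
qed

lemma f_less_w: "f < w"
  using f_le t_less_w by simp

lemma mem_end_ge: "OP0 + m + 8 \<le> mem_end"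
  by (simp add: mem_end_def)

text \<open>The weight is 0 both above level \<open>J\<close> and from level \<open>J + f\<close>
  on, so branchings outside the round contribute nothing to a code.\<close>

definition "wgt J d = (if J \<le> d \<and> d - J < f then 2 ^ (d - J) else (0::nat))"

text \<open>The lists of level \<open>J\<close> are allocated in breadth-first order. The summand 3
  pays for the partly filled last cell, with some slack.\<close>

definition "apos J i = AB + (\<Sum>k | k < i \<and> dep T k = J. cn k div t + 3)"

lemma apos_0: "apos J 0 = AB"
  by (simp add: apos_def)

lemma apos_Suc: "apos J (Suc i) = (if dep T i = J then apos J i + cn i div t + 3 else apos J i)"
proof -
  have "{k. k < Suc i \<and> dep T k = J} = (if dep T i = J then insert i {k. k < i \<and> dep T k = J} else {k. k < i \<and> dep T k = J})"
    by (auto simp: less_Suc_eq)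
  then show ?thesis by (simp add: apos_def)
qed

lemma apos_mono: "i \<le> j \<Longrightarrow> apos J i \<le> apos J j"
  unfolding apos_def by (intro add_mono sum_mono2) auto

lemma apos_le: "i \<le> nn \<Longrightarrow> apos J i \<le> AB + m + 6 * \<sigma>"
proof -
  assume "i \<le> nn"
  then have "apos J i \<le> apos J nn" by (rule apos_mono)
  also have "apos J nn = AB + ((\<Sum>k | k < nn \<and> dep T k = J. cn k div t) + 3 * card {k. k < nn \<and> dep T k = J})"
    unfolding apos_def by (simp add: sum.distrib)
  also have "(\<Sum>k | k < nn \<and> dep T k = J. cn k div t) \<le> (\<Sum>k | k < nn \<and> dep T k = J. cn k)"
    by (intro sum_mono) simp
  also have "\<dots> \<le> m" by (rule level_sum) auto
  also have "card {k. k < nn \<and> dep T k = J} \<le> card {..<nn}" by (intro card_mono) auto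
  finally show ?thesis using nn_eq by simp
qed

lemma apos_less:
  assumes "i \<le> nn"
  shows "apos J i + 8 < OP0"
  using apos_le[OF assms, of J] sigma n_le_m regions(5)
  unfolding add_mult_distrib2 by linarith

lemma apos_ge: "AB \<le> apos J i"
  by (simp add: apos_def)

text \<open>The number \<open>v\<close> collects the branchings between level \<open>J\<close> and
  \<open>k\<close>, and \<open>wgt\<close> scales the bits still to come. At a leaf the rest is 0,
  so \<open>v\<close> is the complete code of its character.\<close>

definition "code_inv J k v \<longleftrightarrow> (if dep T k < J then v = 0 else
   \<forall>a \<in> set (leaves (nd T k)). lcode f (nd T (anc T J k)) a = v + wgt J (dep T k) * lcode (f - (dep T k - J)) (nd T k) a)"

definition "anc_ptr J k = (if dep T k < J then 0 else nod (anc T J k) 0)"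

text \<open>The comparison is with \<open>\<le>\<close> because a node on level \<open>J\<close>
  inherits zeros from its parent and starts ancestor and weight anew only when it is
  visited.\<close>

definition "pre_ok J M k \<longleftrightarrow> M (nod k 7) = (if dep T k \<le> J then 0 else anc_ptr J k) \<and>
   M (nod k 8) = (if dep T k \<le> J then 0 else wgt J (dep T k)) \<and>
   (if dep T k \<le> J then M (nod k 6) = 0 else code_inv J k (M (nod k 6)))"

text \<open>Peels off one branching bit. Once \<open>f\<close> bits are used up, both the weight and
  the remaining length are 0, so the identity persists below the last level of the round.\<close>

lemma lcode_step:
  assumes "J \<le> d" "a \<in> set (leaves l) \<or> a \<in> set (leaves r)" "set (leaves l) \<inter> set (leaves r) = {}"
  shows "wgt J d * lcode (f - (d - J)) (Nd l r) a =
    (if a \<in> set (leaves r) then wgt J d + wgt J (Suc d) * lcode (f - (Suc d - J)) r a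
     else wgt J (Suc d) * lcode (f - (Suc d - J)) l a)"
proof (cases "d - J < f")
  case True
  then have e: "f - (d - J) = Suc (f - (Suc d - J))" using assms(1) by simp
  have "wgt J (Suc d) * x = 2 * wgt J d * x" if "x < 2 ^ (f - (Suc d - J))" for x
  proof (cases "Suc d - J < f")
    case True2: True
    then show ?thesis using True assms(1) by (simp add: wgt_def Suc_diff_le)
  next
    case False
    then have "x = 0" using that by simp
    then show ?thesis by simp
  qed
  from this[OF lcode_less, of r a] this[OF lcode_less, of l a] show ?thesis
    unfolding e by (auto simp: algebra_simps)
next
  case False
  then show ?thesis using assms(1) by (simp add: wgt_def)
qed

lemma wgt_bound: "wgt J d < 2 ^ f"
  by (simp add: wgt_def)

lemma wgt_step: "(if d < J then 0 else wgt J d) * 2 mod 2 ^ f = (if Suc d \<le> J then 0 else wgt J (Suc d))"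
proof (cases "d < J")
  case False
  show ?thesis
  proof (cases "d - J < f")
    case True
    show ?thesis
    proof (cases "Suc (d - J) < f")
      case True2: True
      then have "(2::nat) * 2 ^ (d - J) < 2 ^ f"
        by (metis power_Suc power_strict_increasing one_less_numeral_iff semiring_norm(76))
      then show ?thesis using False True True2 by (simp add: wgt_def Suc_diff_le mult.commute)
    next
      case False2: False
      then have "f = Suc (d - J)" using True by simp
      then show ?thesis using False by (simp add: wgt_def Suc_diff_le mult.commute)
    qed
  qed (use False in \<open>simp add: wgt_def Suc_diff_le\<close>)
qed simp

lemma code_inv_kids:
  assumes i: "i < nn" "nd T i = Nd l r" and v: "code_inv J i v"
  shows "if dep T i < J then v = 0 else code_inv J (kid T i) v \<and> code_inv J (Suc (kid T i)) (v + wgt J (dep T i))"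
proof (cases "dep T i < J")
  case True
  then show ?thesis using v by (simp add: code_inv_def)
next
  case False
  note kk = nd_kid[OF i] kid_less[OF i] kid_gt[OF i(1)]
  have p: "par T (kid T i) = i" "par T (Suc (kid T i)) = i" using par_kid[OF i(1)] i by auto
  have a: "anc T J (kid T i) = anc T J i" "anc T J (Suc (kid T i)) = anc T J i"
    using anc_par[of "kid T i" T J] anc_par[of "Suc (kid T i)" T J] kk p False by auto
  have "distinct (leaves (nd T i))" by (rule distinct_nd[OF leaves_distinct i(1)])
  then have dj: "set (leaves l) \<inter> set (leaves r) = {}" using i by simp
  have v': "lcode f (nd T (anc T J i)) c = v + wgt J (dep T i) * lcode (f - (dep T i - J)) (Nd l r) c"
    if "c \<in> set (leaves l) \<or> c \<in> set (leaves r)" for c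
    using v that i False by (simp add: code_inv_def)
  have "code_inv J (kid T i) v"
    unfolding code_inv_def using kk a v' False dj lcode_step[OF _ _ dj, of J "dep T i"] by auto
  moreover have "code_inv J (Suc (kid T i)) (v + wgt J (dep T i))"
    unfolding code_inv_def using kk a v' False dj lcode_step[OF _ _ dj, of J "dep T i"] by auto
  ultimately show ?thesis using False by simp
qed

text \<open>Any leaf below the node extends \<open>v\<close> to a complete code of \<open>f\<close>
  bits, which is at least \<open>v\<close>.\<close>

lemma code_inv_bound:
  assumes "code_inv J i v"
  shows "v < 2 ^ f"
proof (cases "dep T i < J")
  case False
  obtain a where "a \<in> set (leaves (nd T i))" using leaves_nonempty by (metis list.set_intros(1) neq_Nil_conv)
  then have "v \<le> lcode f (nd T (anc T J i)) a" using assms False by (simp add: code_inv_def)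
  then show ?thesis using lcode_less[of f "nd T (anc T J i)" a] by simp
qed (use assms in \<open>simp add: code_inv_def\<close>)

abbreviation "codes_cells \<equiv> {4, 5, 6, 7, 8, 13 :: nat}"
abbreviation "codes_region \<equiv> {CB..<RB} \<union> {AB..<OP0}"

lemma wp_codes_body:
  assumes R: "regs_ok \<rho>" and S: "static_ok M" and i: "i < nn"
    and \<rho>: "\<rho> vp = nod i 0" "\<rho> vJ = J" "\<rho> vAP = apos J i"
    and cnt: "dep T i = J \<Longrightarrow> M (nod i 3) = cn i" and pre: "pre_ok J M i"
    and Q: "\<And>\<rho>' M' \<tau>' v. \<lbrakk>\<rho>' vp = nod (Suc i) 0; \<rho>' vAP = apos J (Suc i); \<And>x. x < 45 \<Longrightarrow> x \<noteq> 31 \<Longrightarrow> \<rho>' x = \<rho> x;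
      frame codes_cells codes_region M M'; code_inv J i v;
      dep T i = J \<Longrightarrow> M' (nod i 4) = apos J i \<and> M' (nod i 5) = apos J i \<and> M' (nod i 13) = 0 \<and> M' (apos J i) = 0;
      \<And>k. k < i \<Longrightarrow> M' (nod k 4) = M (nod k 4) \<and> M' (nod k 5) = M (nod k 5) \<and> M' (nod k 13) = M (nod k 13);
      \<And>a. AB \<le> a \<Longrightarrow> a < apos J i \<Longrightarrow> M' a = M a;
      \<And>k. inner (nd T i) \<Longrightarrow> k = kid T i \<or> k = Suc (kid T i) \<Longrightarrow> pre_ok J M' k;
      \<And>k. k < nn \<Longrightarrow> inner (nd T i) \<longrightarrow> k \<noteq> kid T i \<and> k \<noteq> Suc (kid T i) \<Longrightarrow> pre_ok J M k \<Longrightarrow> pre_ok J M' k;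
      \<And>a. nd T i = Lf a \<Longrightarrow> M' (CB + 2 * a) = v \<and> M' (CB + 2 * a + 1) = anc_ptr J i;
      \<And>a. a < \<sigma> \<Longrightarrow> nd T i \<noteq> Lf a \<Longrightarrow> M' (CB + 2 * a) = M (CB + 2 * a) \<and> M' (CB + 2 * a + 1) = M (CB + 2 * a + 1);
      \<tau>' \<le> \<tau> + 140\<rbrakk> \<Longrightarrow> Q \<rho>' M' \<tau>'"
  shows "wp w codes_body Q \<rho> M \<tau>"
proof -
  let ?D = "dep T i = J"
  define v where "v = M (nod i 6)"
  define an where "an = anc_ptr J i"
  define bw where "bw = (if dep T i < J then 0 else wgt J (dep T i))"
  define bw' where "bw' = bw * 2 mod 2 ^ f"
  have vinv: "code_inv J i v"
  proof (cases "dep T i = J")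
    case True
    then show ?thesis using pre f_pos by (simp add: pre_ok_def v_def code_inv_def anc_self wgt_def)
  next
    case False
    then show ?thesis using pre by (auto simp: pre_ok_def v_def code_inv_def split: if_splits)
  qed
  have fr0: "M (nod i 7) = (if ?D then 0 else an)" "M (nod i 8) = (if ?D then 0 else bw)"
    using pre by (auto simp: pre_ok_def an_def bw_def anc_ptr_def)
  have D1: "an = nod i 0" "bw = 1" if ?D
    using that f_pos by (simp_all add: an_def anc_ptr_def anc_self bw_def wgt_def)
  have vw: "v + bw < 2 ^ w" "bw * 2 < 2 ^ w" "bw' < 2 ^ w" "bw < 2 ^ w"
  proof -
    have b: "bw < 2 ^ f" using wgt_bound by (simp add: bw_def)
    have "(2::nat) ^ Suc f \<le> 2 ^ w" using f_less_w by (intro power_increasing) auto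
    then have "(2::nat) ^ f * 2 \<le> 2 ^ w" by simp
    then show "v + bw < 2 ^ w" "bw * 2 < 2 ^ w" "bw < 2 ^ w" using b code_inv_bound[OF vinv] by linarith+
    then show "bw' < 2 ^ w" unfolding bw'_def by (meson le_less_trans mod_less_eq_dividend)
  qed
  have rec: "record_ok T A M i" using S i by (simp add: static_ok_def)
  then have r2: "M (nod i 2) = dep T i" by (simp add: record_ok_def)
  note RR = regs_okD[OF R]
  have ap: "apos J i + 8 < OP0" "AB \<le> apos J i" using apos_less[of i J] i apos_ge by auto
  have ap': "apos J (Suc i) + 8 < OP0" using apos_less[of "Suc i" J] i by simp
  have OPw: "OP0 < 2 ^ w" using bound mem_end_ge by linarith
  have apw: "apos J i < 2 ^ w" "apos J (Suc i) < 2 ^ w" using ap ap' OPw by linarith+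
  have regle: "A + 16 * nn \<le> apos J i" using ap regions by linarith
  have ni: "nod k c \<noteq> apos J i" "apos J i \<noteq> nod k c" if "k < nn" "c < 16" for k c
    using cell_upper[OF that, of A] regle by auto
  have cw: "nod k c < 2 ^ w" if "k \<le> nn" "c < 32" for k c by (rule node_bound[OF that])
  have cs: "c < 2 ^ w" if "c \<le> 64" for c :: nat by (rule const_bound[OF that])
  have Mf: "(2::nat) ^ f mod 2 ^ w = 2 ^ f" "(2::nat) ^ f < 2 ^ w" using f_less_w by simp_all
  \<comment> \<open>The memory after the allocation of an empty list, which happens on level
    \<open>J\<close> only; from here on both cases run the same code.\<close>
  define MD where "MD = (if ?D then M(nod i 4 := apos J i, nod i 5 := apos J i, nod i 13 := 0, apos J i := 0) else M)"
  have MDc: "MD (nod k c) = M (nod k c)" if "k < nn" "c < 16" "c \<noteq> 4" "c \<noteq> 5" "c \<noteq> 13" for k c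
    using that ni by (simp add: MD_def)
  have frD: "frame codes_cells codes_region M MD"
  proof (cases ?D)
    case True
    show ?thesis unfolding MD_def if_P[OF True]
      by (rule frame_region[OF frame_cell[OF frame_cell[OF frame_cell[OF frame_refl]]]])
         (use ap i regle in auto)
  qed (simp add: MD_def)
  define rest where "rest = (
     vk \<leftarrow> Ld (V vp \<oplus> N 1);;
     IfE (V vk)
      ([V vk \<oplus> N 6] \<leftarrow> V vcd;; [V vk \<oplus> N 7] \<leftarrow> V van;;
       [V vk \<oplus> N 22] \<leftarrow> V vcd \<oplus> V vbw;; [V vk \<oplus> N 23] \<leftarrow> V van;;
       vbw \<leftarrow> (V vbw \<otimes> N 2) \<restriction> V rf;;
       [V vk \<oplus> N 8] \<leftarrow> V vbw;; [V vk \<oplus> N 24] \<leftarrow> V vbw)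
      (vu \<leftarrow> V rCB \<oplus> N 2 \<otimes> Ld (V vp \<oplus> N 9);;
       [V vu] \<leftarrow> V vcd;; [V vu \<oplus> N 1] \<leftarrow> V van);;
     vp \<leftarrow> V vp \<oplus> N 16)"
  have rest: "wp w rest Q \<rho>1 MD \<tau>1" if r1: "\<rho>1 vcd = v" "\<rho>1 van = an" "\<rho>1 vbw = bw" "\<rho>1 vp = nod i 0"
    "\<rho>1 vAP = apos J (Suc i)" "\<And>x. x < 45 \<Longrightarrow> x \<noteq> 31 \<Longrightarrow> \<rho>1 x = \<rho> x" and \<tau>1: "\<tau>1 \<le> \<tau> + 70" for \<rho>1 \<tau>1
  proof -
    have rr: "\<rho>1 rf = f" "\<rho>1 rCB = CB" using r1(6)[of rf] r1(6)[of rCB] RR by auto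
    show ?thesis
    proof (cases "nd T i")
      case (Lf a)
      have a: "a < \<sigma>"
      proof -
        have "a \<in> set (leaves (nd T i))" using Lf by simp
        then have "a \<in> set (leaves (nd T (anc T 0 i)))" using anc_props[of i T 0] i by auto
        moreover have "anc T 0 i = 0" using anc_props[of i T 0] i dep_0 by auto
        ultimately show ?thesis using leaves_set by auto
      qed
      have Mk: "M (nod i (Suc 0)) = 0" "M (nod i 9) = a" using rec Lf by (simp_all add: record_ok_def)
      define M' where "M' = MD(CB + 2 * a := v, Suc (CB + 2 * a) := an)"
      have cb: "A + 16 * nn \<le> CB + 2 * a" "Suc (CB + 2 * a) < RB" "RB \<le> AB" using regions a by linarith+
      have ne: "nod k c \<noteq> CB + 2 * a'" "nod k c \<noteq> Suc (CB + 2 * a')"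
        "CB + 2 * a' \<noteq> nod k c" "Suc (CB + 2 * a') \<noteq> nod k c" if "k < nn" "c < 16" for k c a'
        using cell_upper[OF that, of A] regions(1) by auto
      have na: "apos J i \<noteq> CB + 2 * a'" "apos J i \<noteq> Suc (CB + 2 * a')"
        "CB + 2 * a' \<noteq> apos J i" "Suc (CB + 2 * a') \<noteq> apos J i" if "a' < \<sigma>" for a'
        using regions ap that by linarith+
      have Q': "Q \<rho>' M' \<tau>'" if "\<rho>' vp = nod (Suc i) 0" "\<rho>' vAP = apos J (Suc i)" "\<And>x. x < 45 \<Longrightarrow> x \<noteq> 31 \<Longrightarrow> \<rho>' x = \<rho> x"
        "\<tau>' \<le> \<tau>1 + 70" for \<rho>' \<tau>'
      proof (rule Q[OF that(1-3) _ vinv])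
        show "frame codes_cells codes_region M M'"
          unfolding M'_def using cb by (intro frame_region frD) auto
        show "M' (nod i 4) = apos J i \<and> M' (nod i 5) = apos J i \<and> M' (nod i 13) = 0 \<and> M' (apos J i) = 0" if ?D
          using that ne[OF i] na[OF a] ni[OF i] by (simp add: M'_def MD_def)
        show "M' (nod k 4) = M (nod k 4) \<and> M' (nod k 5) = M (nod k 5) \<and> M' (nod k 13) = M (nod k 13)" if "k < i" for k
          using that ne[of k] ni[of k] i by (simp add: M'_def MD_def)
        show "M' c = M c" if "AB \<le> c" "c < apos J i" for c
        proof -
          have "c \<noteq> nod k d" if "k < nn" "d < 16" for k d
            using cell_upper[OF that, of A] \<open>AB \<le> c\<close> regions by linarith
          moreover have "c \<noteq> CB + 2 * a" "c \<noteq> Suc (CB + 2 * a)" using that cb by linarith+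
          ultimately show ?thesis using that i by (simp add: M'_def MD_def)
        qed
        show "pre_ok J M' k" if "k < nn" "pre_ok J M k" for k
          using that(2) ne[OF that(1)] MDc[OF that(1)] by (simp add: pre_ok_def M'_def)
        show "M' (CB + 2 * c) = v \<and> M' (CB + 2 * c + 1) = anc_ptr J i" if "nd T i = Lf c" for c
          using that Lf by (simp add: M'_def an_def)
        show "M' (CB + 2 * c) = M (CB + 2 * c) \<and> M' (CB + 2 * c + 1) = M (CB + 2 * c + 1)"
          if "c < \<sigma>" "nd T i \<noteq> Lf c" for c
        proof -
          have "Suc (2 * c) \<noteq> 2 * a" "Suc (2 * a) \<noteq> 2 * c" by presburger+
          then show ?thesis using that Lf ne[OF i] na[of c] unfolding M'_def MD_def by auto
        qed
        show "\<tau>' \<le> \<tau> + 140" using that \<tau>1 by simp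
      qed (use Lf in auto)
      have "2 * a < 2 ^ w" "Suc (CB + 2 * a) < 2 ^ w" using cb OPw regions by linarith+
      then show ?thesis unfolding rest_def
        using r1 rr Mk MDc[OF i] cs cw[of i] cw[of "Suc i" 0] i
        by (simp, intro Q'[unfolded M'_def], simp_all)
    next
      case (Nd l r)
      let ?k = "kid T i"
      note kk = nd_kid[OF i Nd] kid_gt[OF i] kid_less[OF i Nd]
      have Mk: "M (nod i (Suc 0)) = nod ?k 0" using rec Nd by (simp add: record_ok_def)
      define M' where "M' = MD(nod ?k 6 := v, nod ?k 7 := an, nod (Suc ?k) 6 := v + bw, nod (Suc ?k) 7 := an,
        nod ?k 8 := bw', nod (Suc ?k) 8 := bw')"
      have ne: "nod k c \<noteq> CB + 2 * a'" "nod k c \<noteq> Suc (CB + 2 * a')"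
        "CB + 2 * a' \<noteq> nod k c" "Suc (CB + 2 * a') \<noteq> nod k c" if "k < nn" "c < 16" for k c a'
        using cell_upper[OF that, of A] regions(1) by auto
      have na: "apos J i \<noteq> CB + 2 * a'" "apos J i \<noteq> Suc (CB + 2 * a')"
        "CB + 2 * a' \<noteq> apos J i" "Suc (CB + 2 * a') \<noteq> apos J i" if "a' < \<sigma>" for a'
        using regions ap that by linarith+
      have k0: "nod ?k 0 \<noteq> 0" using kk by (simp add: cell_def)
      have kn: "?k < nn" "Suc ?k < nn" using kk by auto
      have par: "par T ?k = i" "par T (Suc ?k) = i" using par_kid[OF i] Nd by auto
      have Q': "Q \<rho>' M' \<tau>'" if "\<rho>' vp = nod (Suc i) 0" "\<rho>' vAP = apos J (Suc i)" "\<And>x. x < 45 \<Longrightarrow> x \<noteq> 31 \<Longrightarrow> \<rho>' x = \<rho> x"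
        "\<tau>' \<le> \<tau>1 + 70" for \<rho>' \<tau>'
      proof (rule Q[OF that(1-3) _ vinv])
        show "frame codes_cells codes_region M M'"
          unfolding M'_def using kn by (intro frame_cell frD) auto
        show "M' (nod i 4) = apos J i \<and> M' (nod i 5) = apos J i \<and> M' (nod i 13) = 0 \<and> M' (apos J i) = 0" if ?D
          using that ni[OF i] ni[OF kn(1)] ni[OF kn(2)] kk by (simp add: M'_def MD_def)
        show "M' (nod k 4) = M (nod k 4) \<and> M' (nod k 5) = M (nod k 5) \<and> M' (nod k 13) = M (nod k 13)" if "k < i" for k
          using that ni[of k] kk i by (simp add: M'_def MD_def)
        show "M' c = M c" if "AB \<le> c" "c < apos J i" for c
        proof -
          have "c \<noteq> nod k d" if "k < nn" "d < 16" for k d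
            using cell_upper[OF that, of A] \<open>AB \<le> c\<close> regions by linarith
          then show ?thesis using that i kn by (simp add: M'_def MD_def)
        qed
        show "pre_ok J M' k" if "k = ?k \<or> k = Suc ?k" for k
        proof -
          have dk: "dep T k = Suc (dep T i)" using that kk by auto
          have ak: "anc_ptr J k = an" if "\<not> dep T k \<le> J"
          proof -
            have "anc T J k = anc T J i"
              using anc_par[of k T J] that dk \<open>k = ?k \<or> k = Suc ?k\<close> kn par kk by auto
            then show ?thesis using that dk by (simp add: an_def anc_ptr_def)
          qed
          have bk: "bw' = (if dep T k \<le> J then 0 else wgt J (dep T k))"
            unfolding bw'_def bw_def using wgt_step[of "dep T i" J] dk by simp
          have z: "an = 0" "v = 0" "bw = 0" if "dep T k \<le> J"
            using that dk vinv by (simp_all add: an_def anc_ptr_def code_inv_def bw_def)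
          have inv: "code_inv J k (if k = ?k then v else v + bw)" if "\<not> dep T k \<le> J"
            using code_inv_kids[OF i Nd vinv] that dk \<open>k = ?k \<or> k = Suc ?k\<close> by (auto simp: bw_def)
          have "M' (nod k 7) = an" "M' (nod k 8) = bw'" "M' (nod k 6) = (if k = ?k then v else v + bw)"
            using that by (auto simp: M'_def)
          then show ?thesis using ak bk z inv by (auto simp: pre_ok_def)
        qed
        show "pre_ok J M' k" if "k < nn" "inner (nd T i) \<longrightarrow> k \<noteq> ?k \<and> k \<noteq> Suc ?k" "pre_ok J M k" for k
          using that MDc[OF that(1)] Nd by (simp add: pre_ok_def M'_def)
        show "M' (CB + 2 * c) = M (CB + 2 * c) \<and> M' (CB + 2 * c + 1) = M (CB + 2 * c + 1)"
          if "c < \<sigma>" "nd T i \<noteq> Lf c" for c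
          using ne[of i _ c] ne[of ?k _ c] ne[of "Suc ?k" _ c] na[OF that(1)] kn i
          unfolding M'_def MD_def by simp
        show "\<tau>' \<le> \<tau> + 140" using that \<tau>1 by simp
      qed (use Nd in auto)
      have "bw * 2 AND (2 ^ f - Suc 0) = bw'" by (simp add: and_mask_Suc bw'_def)
      then show ?thesis unfolding rest_def
        using r1 rr Mk MDc[OF i] k0 cs cw[of i] cw[of "Suc i" 0] cw[of ?k] cw[of "Suc ?k"] i kn Mf vw
        by (simp, intro Q'[unfolded M'_def], simp_all)
    qed
  qed
  show ?thesis
  proof (cases ?D)
    case True
    have c1: "apos J i + cn i div t + 3 = apos J (Suc i)" using True by (simp add: apos_Suc)
    then have c2: "apos J i + cn i div t < 2 ^ w" using apw by linarith
    note rT = rest[unfolded MD_def if_P[OF True]]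
    show ?thesis unfolding codes_body_def rest_def[symmetric]
      by (simp add: v_def[symmetric] \<rho> RR r2 fr0 cs cw[OF less_imp_le[OF i]] i cnt[OF True] c1 c2 apw ni[OF i] True,
          intro rT, simp_all add: D1[OF True] \<rho>)
  next
    case False
    have c1: "apos J i = apos J (Suc i)" using False by (simp add: apos_Suc)
    note rF = rest[unfolded MD_def if_not_P[OF False]]
    show ?thesis unfolding codes_body_def rest_def[symmetric]
      by (simp add: v_def[symmetric] False \<rho> RR r2 fr0 cs cw[OF less_imp_le[OF i]] i c1, intro rF, simp_all add: \<rho> c1)
  qed
qed

end

context layout_bound
begin

text \<open>In the second case the leaf of \<open>a\<close> lies above level \<open>J\<close>: its
  path is complete, and the pointer 0 makes the scan skip the character. The value 0 cannot be
  confused with a record, since records start at \<open>A\<close> or later.\<close>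

definition "char_ok J M a \<longleftrightarrow>
  (\<exists>u < nn. dep T u = J \<and> a \<in> set (leaves (nd T u)) \<and> M (CB + 2 * a + 1) = nod u 0 \<and>
     M (CB + 2 * a) = lcode f (nd T u) a) \<or>
  ((\<forall>u < nn. dep T u = J \<longrightarrow> a \<notin> set (leaves (nd T u))) \<and> M (CB + 2 * a + 1) = 0)"

lemma nod_pos: "nod k 0 \<noteq> 0"
  using A by (simp add: cell_def)

lemma char_okI:
  assumes k: "k < nn" "nd T k = Lf a" and v: "code_inv J k (M (CB + 2 * a))" "M (CB + 2 * a + 1) = anc_ptr J k"
  shows "char_ok J M a"
proof (cases "dep T k < J")
  case True
  have "a \<notin> set (leaves (nd T u))" if u: "u < nn" "dep T u = J" for u
  proof
    assume "a \<in> set (leaves (nd T u))"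
    from leaf_below[OF u(1) this] obtain j where "j < nn" "nd T j = Lf a" "dep T u \<le> dep T j" by auto
    moreover from this have "j = k" using leaf_unique[OF leaves_distinct] k by auto
    ultimately show False using u True by simp
  qed
  then show ?thesis using v True by (simp add: char_ok_def anc_ptr_def)
next
  case False
  then have "lcode f (nd T (anc T J k)) a = M (CB + 2 * a)" using v k by (simp add: code_inv_def)
  moreover have "anc T J k < nn" "dep T (anc T J k) = J" "a \<in> set (leaves (nd T (anc T J k)))"
    using anc_props[OF k(1), of J] k False by auto
  ultimately show ?thesis unfolding char_ok_def using v False by (auto simp: anc_ptr_def)
qed

definition "empty_lists J M \<longleftrightarrow> (\<forall>u < nn. dep T u = J \<longrightarrow>
  M (nod u 4) = apos J u \<and> M (nod u 5) = apos J u \<and> M (nod u 13) = 0 \<and> M (apos J u) = 0)"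

lemma apos_sep: "u < v \<Longrightarrow> dep T u = J \<Longrightarrow> apos J u + cn u div t + 3 \<le> apos J v"
  using apos_Suc[of J u] apos_mono[of "Suc u" v J] by simp

lemma wp_make_codes:
  assumes R: "regs_ok \<rho>" and S: "static_ok M" and J: "\<rho> vJ = J"
    and cnt: "\<And>k. k < nn \<Longrightarrow> dep T k = J \<Longrightarrow> M (nod k 3) = cn k"
    and Q: "\<And>\<rho>' M' \<tau>'. \<lbrakk>\<rho>' vAP = apos J nn; \<And>x. x < 45 \<Longrightarrow> x \<noteq> 31 \<Longrightarrow> \<rho>' x = \<rho> x;
      frame codes_cells codes_region M M'; empty_lists J M'; \<And>a. a < \<sigma> \<Longrightarrow> char_ok J M' a;
      \<tau>' \<le> \<tau> + 40 + 150 * nn\<rbrakk> \<Longrightarrow> Q \<rho>' M' \<tau>'"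
  shows "wp w make_codes Q \<rho> M \<tau>"
proof -
  let ?e = "V vp \<prec> V rE"
  \<comment> \<open>The inherited code of a node is valid as soon as its parent has been visited;
    parents precede children, so this is the case before the node's own turn.\<close>
  define I where "I i \<rho>' M' \<tau>' \<longleftrightarrow> \<rho>' vp = nod i 0 \<and> \<rho>' vAP = apos J i \<and>
      (\<forall>x < 45. x \<noteq> 31 \<longrightarrow> \<rho>' x = \<rho> x) \<and> frame codes_cells codes_region M M' \<and>
      (\<forall>k < nn. k = 0 \<or> par T k < i \<longrightarrow> pre_ok J M' k) \<and>
      (\<forall>u < i. dep T u = J \<longrightarrow> M' (nod u 4) = apos J u \<and> M' (nod u 5) = apos J u \<and> M' (nod u 13) = 0 \<and> M' (apos J u) = 0) \<and>
      (\<forall>k < i. \<forall>a. nd T k = Lf a \<longrightarrow> code_inv J k (M' (CB + 2 * a)) \<and> M' (CB + 2 * a + 1) = anc_ptr J k) \<and>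
      \<tau>' \<le> \<tau> + 30 + i * 150" for i and \<rho>' M' :: "nat \<Rightarrow> nat" and \<tau>'
  let ?M0 = "M(nod 0 6 := 0, nod 0 7 := 0, nod 0 8 := 0)" and ?r0 = "\<rho>(vAP := AB, vp := A)"
  note RR = regs_okD[OF R]
  have n1: "0 < nn" by (rule node_count_pos)
  have "wp w (Whl ?e codes_body) Q ?r0 ?M0 \<tau>0" if "\<tau>0 \<le> \<tau> + 30" for \<tau>0
  proof (rule wp_Whl[where I = I and m = nn])
    have "frame codes_cells codes_region M ?M0" using n1 by (intro frame_cell frame_refl) auto
    moreover have "pre_ok J ?M0 0" by (simp add: pre_ok_def)
    ultimately show "I 0 ?r0 ?M0 \<tau>0" using that unfolding I_def by (simp add: apos_0 cell_base)
  next
    fix k \<rho>1 M1 \<tau>1 assume k: "k \<le> nn" and I: "I k \<rho>1 M1 \<tau>1"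
    have "\<rho>1 rE = nod nn 0" "\<rho>1 vp = nod k 0" using I RR unfolding I_def by auto
    then show "safe w \<rho>1 M1 ?e \<and> (nval w \<rho>1 M1 ?e \<noteq> 0 \<longleftrightarrow> k < nn)" by simp
  next
    fix i \<rho>1 M1 \<tau>1 \<tau>2 assume i: "i < nn" and I: "I i \<rho>1 M1 \<tau>1" and "\<tau>2 = \<tau>1 + cost ?e + 1"
    then have \<tau>2: "\<tau>2 = \<tau>1 + 4" by simp
    have I1: "\<rho>1 vp = nod i 0" "\<rho>1 vAP = apos J i" "\<And>x. x < 45 \<Longrightarrow> x \<noteq> 31 \<Longrightarrow> \<rho>1 x = \<rho> x"
      "frame codes_cells codes_region M M1" "\<And>k. k < nn \<Longrightarrow> k = 0 \<or> par T k < i \<Longrightarrow> pre_ok J M1 k"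
      "\<And>u. u < i \<Longrightarrow> dep T u = J \<Longrightarrow> M1 (nod u 4) = apos J u \<and> M1 (nod u 5) = apos J u \<and> M1 (nod u 13) = 0 \<and> M1 (apos J u) = 0"
      "\<And>k a. k < i \<Longrightarrow> nd T k = Lf a \<Longrightarrow> code_inv J k (M1 (CB + 2 * a)) \<and> M1 (CB + 2 * a + 1) = anc_ptr J k"
      "\<tau>1 \<le> \<tau> + 30 + i * 150" using I unfolding I_def by (simp_all, elim conjE disjE, simp_all)
    have R1: "regs_ok \<rho>1" by (rule regs_ok_cong[OF R]) (simp add: I1(3))
    have S1: "static_ok M1" by (rule static_frame[OF S I1(4)]) (use regions in auto)
    have J1: "\<rho>1 vJ = J" using I1(3)[of vJ] J by simp
    show "wp w codes_body (I (Suc i)) \<rho>1 M1 \<tau>2"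
    proof (rule wp_codes_body[OF R1 S1 i I1(1) J1 I1(2)])
      show "M1 (nod i 3) = cn i" if "dep T i = J" using frame_cellD[OF I1(4) i, of 3] cnt[OF i that] by simp
      show "pre_ok J M1 i" using I1(5)[OF i] par_props(1)[of i T] i by (cases "i = 0") auto
      fix \<rho>2 M2 \<tau>3 v
      assume a: "\<rho>2 vp = nod (Suc i) 0" "\<rho>2 vAP = apos J (Suc i)" "\<And>x. x < 45 \<Longrightarrow> x \<noteq> 31 \<Longrightarrow> \<rho>2 x = \<rho>1 x"
        "frame codes_cells codes_region M1 M2" "code_inv J i v"
        "dep T i = J \<Longrightarrow> M2 (nod i 4) = apos J i \<and> M2 (nod i 5) = apos J i \<and> M2 (nod i 13) = 0 \<and> M2 (apos J i) = 0"
        "\<And>k. k < i \<Longrightarrow> M2 (nod k 4) = M1 (nod k 4) \<and> M2 (nod k 5) = M1 (nod k 5) \<and> M2 (nod k 13) = M1 (nod k 13)"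
        "\<And>a. AB \<le> a \<Longrightarrow> a < apos J i \<Longrightarrow> M2 a = M1 a"
        "\<And>k. inner (nd T i) \<Longrightarrow> k = kid T i \<or> k = Suc (kid T i) \<Longrightarrow> pre_ok J M2 k"
        "\<And>k. k < nn \<Longrightarrow> inner (nd T i) \<longrightarrow> k \<noteq> kid T i \<and> k \<noteq> Suc (kid T i) \<Longrightarrow> pre_ok J M1 k \<Longrightarrow> pre_ok J M2 k"
        "\<And>a. nd T i = Lf a \<Longrightarrow> M2 (CB + 2 * a) = v \<and> M2 (CB + 2 * a + 1) = anc_ptr J i"
        "\<And>a. a < \<sigma> \<Longrightarrow> nd T i \<noteq> Lf a \<Longrightarrow> M2 (CB + 2 * a) = M1 (CB + 2 * a) \<and> M2 (CB + 2 * a + 1) = M1 (CB + 2 * a + 1)"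
        "\<tau>3 \<le> \<tau>2 + 140"
      have "pre_ok J M2 k" if k: "k < nn" "k = 0 \<or> par T k < Suc i" for k
      proof (cases "inner (nd T i) \<and> (k = kid T i \<or> k = Suc (kid T i))")
        case True
        then show ?thesis using a(9) by blast
      next
        case False
        have "k = 0 \<or> par T k < i"
        proof (cases "k = 0")
          case k0: False
          have "par T k \<noteq> i" using par_props(2,3)[of k T] False k k0 by auto
          then show ?thesis using k by (auto simp: less_Suc_eq)
        qed simp
        then show ?thesis using a(10)[of k] I1(5)[of k] False k by blast
      qed
      moreover have "M2 (nod u 4) = apos J u \<and> M2 (nod u 5) = apos J u \<and> M2 (nod u 13) = 0 \<and> M2 (apos J u) = 0"
        if "u < Suc i" "dep T u = J" for u
      proof (cases "u = i")
        case False
        then have u: "u < i" using that by simp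
        have "apos J u < apos J i" using apos_sep[OF u that(2)] by simp
        then show ?thesis using I1(6)[OF u that(2)] a(7)[OF u] a(8)[of "apos J u"] apos_ge by simp
      qed (use a that in simp)
      moreover have "code_inv J k (M2 (CB + 2 * c)) \<and> M2 (CB + 2 * c + 1) = anc_ptr J k"
        if "k < Suc i" "nd T k = Lf c" for k c
      proof (cases "k = i")
        case False
        then have k: "k < i" using that by simp
        have "nd T i \<noteq> Lf c" using leaf_unique[OF leaves_distinct i, of k c] that k i by auto
        moreover have "c < \<sigma>"
        proof -
          have kn: "k < nn" using k i by simp
          have "c \<in> set (leaves (nd T (anc T 0 k)))" using anc_props[OF kn, of 0] that by auto
          moreover have "anc T 0 k = 0" using anc_props[OF kn, of 0] dep_0 by auto
          ultimately show ?thesis using leaves_set by auto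
        qed
        ultimately show ?thesis using I1(7)[OF k that(2)] a(12)[of c] by simp
      qed (use a(5) a(11)[of c] that in simp)
      moreover have "frame codes_cells codes_region M M2" by (rule frame_trans[OF I1(4) a(4)])
      moreover have "\<tau>3 \<le> \<tau> + 30 + Suc i * 150" using a(13) \<tau>2 I1(8) by simp
      moreover have "\<forall>x < 45. x \<noteq> 31 \<longrightarrow> \<rho>2 x = \<rho> x" using a(3) I1(3) by simp
      ultimately show "I (Suc i) \<rho>2 M2 \<tau>3" unfolding I_def using a(1,2) by blast
    qed
  next
    fix \<rho>1 M1 \<tau>1 \<tau>2 assume I: "I nn \<rho>1 M1 \<tau>1" and "\<tau>2 = \<tau>1 + cost ?e + 1"
    then have \<tau>2: "\<tau>2 = \<tau>1 + 4" by simp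
    show "Q \<rho>1 M1 \<tau>2"
    proof (rule Q)
      show "\<rho>1 vAP = apos J nn" "\<And>x. x < 45 \<Longrightarrow> x \<noteq> 31 \<Longrightarrow> \<rho>1 x = \<rho> x" "frame codes_cells codes_region M M1"
        using I unfolding I_def by blast+
      show "empty_lists J M1" using I unfolding I_def empty_lists_def by simp
      show "\<tau>2 \<le> \<tau> + 40 + 150 * nn" using I \<tau>2 unfolding I_def by simp
      fix a assume "a < \<sigma>"
      then obtain k where "k < nn" "nd T k = Lf a" using leaf_ex[of a T] leaves_set by auto
      then show "char_ok J M1 a" using I unfolding I_def by (intro char_okI) auto
    qed
  qed
  then show ?thesis
    unfolding make_codes_def
    using node_bound[of 0 6] node_bound[of 0 7] node_bound[of 0 8]
    by (simp add: RR const_bound cell_def)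
qed

lemma b_less_w: "b < w"
proof -
  have "2 ^ b < (2::nat) ^ w" using regions bound mem_end_ge by linarith
  then show ?thesis by simp
qed

lemma gb_less_w: "g * b < w"
proof -
  have "q < (2::nat) ^ w" using regions bound mem_end_ge by linarith
  then show ?thesis unfolding q_def by simp
qed

section \<open>The table of codes for tuples of characters\<close>

lemma wp_recode_field:
  assumes R: "regs_ok \<rho>" and \<rho>: "\<rho> vi = p * f" "\<rho> vy = x div 2 ^ (b * p)"
    and zs: "zs = map (\<lambda>c. M (CB + 2 * c) mod 2 ^ f) (digits g b x)" and v: "\<rho> vv = pack f (take p zs)"
    and p: "p < g"
    and Q: "\<And>\<rho>' \<tau>'. \<lbrakk>\<rho>' vi = Suc p * f; \<rho>' vy = x div 2 ^ (b * Suc p); \<rho>' vv = pack f (take (Suc p) zs);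
      \<And>x. x < 51 \<Longrightarrow> \<rho>' x = \<rho> x; \<tau>' \<le> \<tau> + 50\<rbrakk> \<Longrightarrow> Q \<rho>' M \<tau>'"
  shows "wp w recode_field Q \<rho> M \<tau>"
proof -
  define y where "y = x div 2 ^ (b * p)"
  define c where "c = y mod 2 ^ b"
  define z where "z = M (CB + 2 * c) mod 2 ^ f"
  note RR = regs_okD[OF R]
  have lz: "length zs = g" by (simp add: zs)
  have fz: "fields f zs" by (auto simp: zs fields_def)
  have zz: "z = zs ! p" using p by (simp add: zs z_def c_def y_def digits_def)
  have tk: "take (Suc p) zs = take p zs @ [z]" using p lz by (simp add: zz take_Suc_conv_app_nth)
  have y': "y div 2 ^ b = x div 2 ^ (b * Suc p)"
    unfolding y_def by (simp add: div_mult2_eq[symmetric] power_add[symmetric] add.commute)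
  have cb: "CB + 2 * c < 2 ^ w" "2 * c < 2 ^ w"
  proof -
    have "c < 2 ^ b" by (simp add: c_def)
    then show "CB + 2 * c < 2 ^ w" using regions bound mem_end_ge by linarith
    then show "2 * c < 2 ^ w" by linarith
  qed
  have pf: "f * Suc p \<le> t" using mult_le_mono2[of "Suc p" g f] p gf_le by (simp add: mult.commute)
  have pp: "pack f (take (Suc p) zs) < 2 ^ (f * Suc p)"
    using pack_less[OF fields_take[OF fz, of "Suc p"]] p lz by (simp add: min.absorb2)
  have e: "pack f (take (Suc p) zs) = pack f (take p zs) + z * 2 ^ (p * f)"
    unfolding tk pack_append using p lz by (simp add: min.absorb2 mult.commute)
  have "f * Suc p < w" using pf t_less_w by simp
  then have w1: "pack f (take p zs) + z * 2 ^ (p * f) < 2 ^ w" using pp less_pow_weaken[of _ "f * Suc p" w] e by simp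
  then have w2: "z * 2 ^ (p * f) mod 2 ^ w = z * 2 ^ (p * f)" by simp
  have w3: "p * f + f < 2 ^ w"
  proof -
    have "p * f + f = f * Suc p" by (simp add: algebra_simps)
    also have "\<dots> < w" by fact
    also have "w < 2 ^ w" by simp
    finally show ?thesis .
  qed
  have pw: "(2::nat) ^ b mod 2 ^ w = 2 ^ b" "(2::nat) ^ b < 2 ^ w" "(2::nat) ^ f mod 2 ^ w = 2 ^ f" "(2::nat) ^ f < 2 ^ w"
    using b_less_w f_less_w by simp_all
  have yy: "\<rho> vy = y" by (simp add: y_def \<rho>)
  show ?thesis unfolding recode_field_def
    by (simp add: \<rho>(1) yy v RR const_bound pw and_mask_Suc c_def[symmetric] z_def[symmetric] cb w1 w2 w3,
        intro Q, simp_all add: e y' algebra_simps)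
qed

definition "recode_ok M0 M x \<longleftrightarrow> M (RB + 2 * x) = pack f (map (\<lambda>c. M0 (CB + 2 * c) mod 2 ^ f) (digits g b x)) \<and>
  M (RB + 2 * x + 1) = M0 (CB + 2 * (x mod 2 ^ b) + 1)"

lemma wp_recode_entry:
  assumes R: "regs_ok \<rho>" and \<rho>: "\<rho> vx = x" and x: "x < q"
    and M0: "\<And>a. a < RB \<Longrightarrow> M a = M0 a"
    and Q: "\<And>\<rho>' M' \<tau>'. \<lbrakk>recode_ok M0 M' x; \<rho>' vx = Suc x; \<And>x. x < 50 \<Longrightarrow> \<rho>' x = \<rho> x;
      \<And>a. a \<noteq> RB + 2 * x \<Longrightarrow> a \<noteq> Suc (RB + 2 * x) \<Longrightarrow> M' a = M a; \<tau>' \<le> \<tau> + 60 * g + 80\<rbrakk> \<Longrightarrow> Q \<rho>' M' \<tau>'"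
  shows "wp w recode_entry Q \<rho> M \<tau>"
proof -
  let ?e = "V vi \<prec> V rg \<otimes> V rf"
  define zs where "zs = map (\<lambda>c. M (CB + 2 * c) mod 2 ^ f) (digits g b x)"
  define I where "I i \<rho>' M' \<tau>' \<longleftrightarrow> M' = M \<and> (\<forall>x < 51. \<rho>' x = \<rho> x) \<and> \<rho>' vi = i * f \<and> \<rho>' vy = x div 2 ^ (b * i) \<and>
      \<rho>' vv = pack f (take i zs) \<and> \<tau>' \<le> \<tau> + 8 + 60 * i" for i \<rho>' and M' :: "nat \<Rightarrow> nat" and \<tau>'
  note RR = regs_okD[OF R]
  have gfw: "g * f < 2 ^ w"
    by (rule le_less_trans[OF gf_le less_trans[OF t_less_w]]) simp
  define rest where "rest = ([V rRB \<oplus> N 2 \<otimes> V vx] \<leftarrow> V vv;;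
     [V rRB \<oplus> N 2 \<otimes> V vx \<oplus> N 1] \<leftarrow> Ld (V rCB \<oplus> N 2 \<otimes> (V vx \<restriction> V rb) \<oplus> N 1);;
     vx \<leftarrow> V vx \<oplus> N 1)"
  have zs0: "zs = map (\<lambda>c. M0 (CB + 2 * c) mod 2 ^ f) (digits g b x)"
    unfolding zs_def
  proof (rule map_cong[OF refl])
    fix c assume "c \<in> set (digits g b x)"
    then have "c < 2 ^ b" using fields_digits by (auto simp: fields_def)
    then have "CB + 2 * c < RB" using regions by linarith
    then show "M (CB + 2 * c) mod 2 ^ f = M0 (CB + 2 * c) mod 2 ^ f" using M0 by simp
  qed
  have xb: "CB + 2 * (x mod 2 ^ b) + 1 < RB"
  proof -
    have "x mod 2 ^ b < 2 ^ b" by simp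
    then show ?thesis using regions by linarith
  qed
  have rest: "wp w rest Q \<rho>1 M1 \<tau>1" if I: "I g \<rho>1 M1 \<tau>0" "\<tau>1 = \<tau>0 + 6" for \<rho>1 M1 \<tau>0 \<tau>1
  proof -
    have I1: "M1 = M" "\<And>x. x < 51 \<Longrightarrow> \<rho>1 x = \<rho> x" "\<rho>1 vv = pack f zs" "\<tau>0 \<le> \<tau> + 8 + 60 * g"
      using I unfolding I_def by (auto simp: zs_def)
    have rr: "\<rho>1 rRB = RB" "\<rho>1 rCB = CB" "\<rho>1 vx = x" "\<rho>1 rb = b" using I1(2) RR \<rho> by simp_all
    have Q': "Q \<rho>' (M(RB + 2 * x := pack f zs, Suc (RB + 2 * x) := M (Suc (CB + 2 * (x mod 2 ^ b))))) \<tau>'"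
      if "\<rho>' vx = Suc x" "\<And>x. x < 50 \<Longrightarrow> \<rho>' x = \<rho> x" "\<tau>' \<le> \<tau>1 + 50" for \<rho>' \<tau>'
    proof (rule Q)
      show "recode_ok M0 (M(RB + 2 * x := pack f zs, Suc (RB + 2 * x) := M (Suc (CB + 2 * (x mod 2 ^ b))))) x"
        unfolding recode_ok_def using zs0 M0[OF xb] by simp
      show "\<tau>' \<le> \<tau> + 60 * g + 80" using that I1 \<open>\<tau>1 = \<tau>0 + 6\<close> by linarith
    qed (use that in auto)
    have ne: "Suc (CB + 2 * (x mod 2 ^ b)) \<noteq> RB + 2 * x" using xb by simp
    have bnd: "RB + 2 * x < 2 ^ w" "Suc (RB + 2 * x) < 2 ^ w" "2 * x < 2 ^ w" "Suc x < 2 ^ w" "CB + 2 * (x mod 2 ^ b) < 2 ^ w"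
      "Suc (CB + 2 * (x mod 2 ^ b)) < 2 ^ w" "2 * (x mod 2 ^ b) < 2 ^ w"
      using x xb regions bound mem_end_ge by linarith+
    have pw: "(2::nat) ^ b mod 2 ^ w = 2 ^ b" "(2::nat) ^ b < 2 ^ w" using b_less_w by simp_all
    show ?thesis unfolding rest_def I1(1)
      by (simp add: I1(3) rr const_bound bnd pw and_mask_Suc ne, intro Q', simp_all add: I1(2))
  qed
  have "wp w (Whl ?e recode_field) (wp w rest Q) (\<rho>(vy := x, vv := 0, vi := 0)) M \<tau>0" if "\<tau>0 \<le> \<tau> + 8" for \<tau>0
  proof (rule wp_Whl[where I = I and m = g])
    show "I 0 (\<rho>(vy := x, vv := 0, vi := 0)) M \<tau>0" using that by (simp add: I_def)
  next
    fix i \<rho>1 M1 \<tau>1 assume "i \<le> g" "I i \<rho>1 M1 \<tau>1"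
    then show "safe w \<rho>1 M1 ?e \<and> (nval w \<rho>1 M1 ?e \<noteq> 0 \<longleftrightarrow> i < g)"
      using RR gfw f_pos by (auto simp: I_def)
  next
    fix i \<rho>1 M1 \<tau>1 \<tau>2 assume i: "i < g" and I: "I i \<rho>1 M1 \<tau>1" and "\<tau>2 = \<tau>1 + cost ?e + 1"
    then have \<tau>2: "\<tau>2 = \<tau>1 + 6" by simp
    have R1: "regs_ok \<rho>1" by (rule regs_ok_cong[OF R]) (use I in \<open>simp add: I_def\<close>)
    have M1: "M1 = M" using I by (simp add: I_def)
    show "wp w recode_field (I (Suc i)) \<rho>1 M1 \<tau>2"
      unfolding M1
    proof (rule wp_recode_field[OF R1 _ _ zs_def _ i])
      fix \<rho>2 \<tau>3
      assume "\<rho>2 vi = Suc i * f" "\<rho>2 vy = x div 2 ^ (b * Suc i)" "\<rho>2 vv = pack f (take (Suc i) zs)"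
        "\<And>x. x < 51 \<Longrightarrow> \<rho>2 x = \<rho>1 x" "\<tau>3 \<le> \<tau>2 + 50"
      then show "I (Suc i) \<rho>2 M \<tau>3" using I \<tau>2 unfolding I_def by simp
    qed (use I in \<open>simp_all add: I_def\<close>)
  next
    fix \<rho>1 M1 \<tau>1 \<tau>2 assume I: "I g \<rho>1 M1 \<tau>1" and "\<tau>2 = \<tau>1 + cost ?e + 1"
    then have "\<tau>2 = \<tau>1 + 6" by simp
    then show "wp w rest Q \<rho>1 M1 \<tau>2" using rest[OF I] by simp
  qed
  then show ?thesis unfolding recode_entry_def rest_def by (simp add: \<rho>)
qed

lemma wp_make_recode:
  assumes R: "regs_ok \<rho>"
    and Q: "\<And>\<rho>' M' \<tau>'. \<lbrakk>\<And>x. x < q \<Longrightarrow> recode_ok M M' x; \<And>x. x < 50 \<Longrightarrow> \<rho>' x = \<rho> x;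
      frame {} {RB..<TB} M M'; \<tau>' \<le> \<tau> + 10 + q * (60 * g + 90)\<rbrakk> \<Longrightarrow> Q \<rho>' M' \<tau>'"
  shows "wp w make_recode Q \<rho> M \<tau>"
proof -
  let ?e = "V vx \<prec> V rq"
  define I where "I i \<rho>' M' \<tau>' \<longleftrightarrow> (\<forall>x < 50. \<rho>' x = \<rho> x) \<and> \<rho>' vx = i \<and> (\<forall>x < i. recode_ok M M' x) \<and>
      frame {} {RB..<TB} M M' \<and> (\<forall>a < RB. M' a = M a) \<and> \<tau>' \<le> \<tau> + 3 + i * (60 * g + 90)"
    for i \<rho>' and M' :: "nat \<Rightarrow> nat" and \<tau>'
  note RR = regs_okD[OF R]
  have "wp w (Whl ?e recode_entry) Q (\<rho>(vx := 0)) M \<tau>0" if "\<tau>0 \<le> \<tau> + 3" for \<tau>0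
  proof (rule wp_Whl[where I = I and m = q])
    show "I 0 (\<rho>(vx := 0)) M \<tau>0" using that by (simp add: I_def)
  next
    fix i \<rho>1 M1 \<tau>1 assume "i \<le> q" "I i \<rho>1 M1 \<tau>1"
    then show "safe w \<rho>1 M1 ?e \<and> (nval w \<rho>1 M1 ?e \<noteq> 0 \<longleftrightarrow> i < q)" using RR by (auto simp: I_def)
  next
    fix i \<rho>1 M1 \<tau>1 \<tau>2 assume i: "i < q" and I: "I i \<rho>1 M1 \<tau>1" and "\<tau>2 = \<tau>1 + cost ?e + 1"
    then have \<tau>2: "\<tau>2 = \<tau>1 + 4" by simp
    have R1: "regs_ok \<rho>1" by (rule regs_ok_cong[OF R]) (use I in \<open>simp add: I_def\<close>)
    have I1: "\<rho>1 vx = i" "\<And>a. a < RB \<Longrightarrow> M1 a = M a" "\<And>x. x < 50 \<Longrightarrow> \<rho>1 x = \<rho> x" "\<And>x. x < i \<Longrightarrow> recode_ok M M1 x"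
      "frame {} {RB..<TB} M M1" "\<tau>1 \<le> \<tau> + 3 + i * (60 * g + 90)" using I unfolding I_def by simp_all
    show "wp w recode_entry (I (Suc i)) \<rho>1 M1 \<tau>2"
    proof (rule wp_recode_entry[OF R1 I1(1) i I1(2)])
      fix \<rho>2 M2 \<tau>3
      assume a: "recode_ok M M2 i" "\<rho>2 vx = Suc i" "\<And>x. x < 50 \<Longrightarrow> \<rho>2 x = \<rho>1 x"
        "\<And>a. a \<noteq> RB + 2 * i \<Longrightarrow> a \<noteq> Suc (RB + 2 * i) \<Longrightarrow> M2 a = M1 a" "\<tau>3 \<le> \<tau>2 + 60 * g + 80"
      have M2: "M2 = M1(RB + 2 * i := M2 (RB + 2 * i), Suc (RB + 2 * i) := M2 (Suc (RB + 2 * i)))"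
        using a(4) by (auto simp: fun_eq_iff)
      have rb: "Suc (RB + 2 * i) < TB" using i regions(3) by linarith
      have "frame {} {RB..<TB} M M2"
        by (subst M2, intro frame_region I1(5)) (use rb regions in auto)
      moreover have "recode_ok M M2 x" if "x < Suc i" for x
      proof (cases "x = i")
        case False
        then have "x < i" using that by simp
        then have "M2 (RB + 2 * x) = M1 (RB + 2 * x)" "M2 (RB + 2 * x + 1) = M1 (RB + 2 * x + 1)"
          by (intro a(4); presburger)+
        then show ?thesis using I1(4)[OF \<open>x < i\<close>] by (simp add: recode_ok_def)
      qed (use a(1) in simp)
      moreover have "\<forall>a < RB. M2 a = M a" using a(4) I1(2) by simp
      moreover have "\<tau>3 \<le> \<tau> + 3 + Suc i * (60 * g + 90)" using a(5) I1(6) \<tau>2 by simp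
      ultimately show "I (Suc i) \<rho>2 M2 \<tau>3" using a(2,3) I1(3) unfolding I_def by simp
    qed
  next
    fix \<rho>1 M1 \<tau>1 \<tau>2 assume I: "I q \<rho>1 M1 \<tau>1" and "\<tau>2 = \<tau>1 + cost ?e + 1"
    then have "\<tau>2 = \<tau>1 + 4" by simp
    then show "Q \<rho>1 M1 \<tau>2" using I unfolding I_def by (intro Q) auto
  qed
  then show ?thesis unfolding make_recode_def by simp
qed

end

lemma div_mod_add_cases:
  assumes "L \<le> c" "0 < (c::nat)"
  shows "(x + L) div c = (if x mod c + L < c then x div c else x div c + 1)"
    "(x + L) mod c = (if x mod c + L < c then x mod c + L else x mod c + L - c)"
proof -
  have F: "x mod c < c" using assms by simp
  have "x + L = (x div c) * c + (x mod c + L)" by simp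
  moreover have "x + L = (x div c + 1) * c + (x mod c + L - c)" if "\<not> x mod c + L < c"
  proof -
    have "x = (x div c) * c + x mod c" by simp
    then show ?thesis using that unfolding add_mult_distrib by linarith
  qed
  moreover have "x mod c + L - c < c" using F assms by linarith
  ultimately show "(x + L) div c = (if x mod c + L < c then x div c else x div c + 1)"
    "(x + L) mod c = (if x mod c + L < c then x mod c + L else x mod c + L - c)"
    using div_mod_eqI[of "x + L" _ c] by metis+
qed

context layout_bound
begin

section \<open>Scanning the string\<close>

definition "chunk i = take g (drop (i * g) sp)"

lemma chunk_props:
  assumes "i < n1"
  shows "length (chunk i) = g" "set (chunk i) \<subseteq> {0..<\<sigma>}" "fields b (chunk i)"
    "take (Suc i * g) sp = take (i * g) sp @ chunk i"
proof -
  have "Suc i * g \<le> m" using assms unfolding m_def by (intro mult_le_mono1) simp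
  then show "length (chunk i) = g" by (simp add: chunk_def length_sp)
  show s: "set (chunk i) \<subseteq> {0..<\<sigma>}" unfolding chunk_def using set_sp by (meson in_set_dropD in_set_takeD subset_iff)
  show "fields b (chunk i)" unfolding fields_def using s b_pow(1) by (meson atLeastLessThan_iff less_le_trans subset_iff)
  show "take (Suc i * g) sp = take (i * g) sp @ chunk i"
    using take_add[of "i * g" g sp] by (simp add: chunk_def add.commute)
qed

lemma chunk_less: "i < n1 \<Longrightarrow> i * g < n"
proof -
  assume "i < n1"
  then have "Suc i \<le> n1" by simp
  then have "Suc i * g \<le> n + g - 1" unfolding n1_def using g_pos by (simp add: less_eq_div_iff_mult_less_eq)
  then show "i * g < n" using g_pos by simp
qed

text \<open>Zeros on top do not change a packed number, so masking the incomplete last read already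
  amounts to padding with the character 0.\<close>

lemma chunk_pack: "i < n1 \<Longrightarrow> pack b (take (min g (n - i * g)) (drop (i * g) s)) = pack b (chunk i)"
proof -
  assume "i < n1"
  then have "i * g \<le> length s" using chunk_less len by (simp add: less_imp_le)
  then have "chunk i = take g (drop (i * g) s) @ replicate (min (g - (length s - i * g)) (m - n)) 0"
    by (simp add: chunk_def sp_def)
  moreover have "take g (drop (i * g) s) = take (min g (n - i * g)) (drop (i * g) s)"
    by (simp add: len min_def)
  ultimately show ?thesis by (simp add: pack_append)
qed

lemma fields_s: "fields b s"
  unfolding fields_def using alph b_pow(1) by (meson atLeastLessThan_iff less_le_trans subset_iff)

lemma chunk_read:
  assumes i: "i < n1" and S: "static_ok M" and u: "u = min g (n - i * g)" and P: "P = i * (g * b)"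
  shows "(M (4 + P div w) div 2 ^ (P mod w) OR M (4 + P div w + 1) * 2 ^ (w - P mod w) mod 2 ^ w) mod 2 ^ (u * b)
    = pack b (chunk i)"
proof -
  have ig: "i * g < n" by (rule chunk_less[OF i])
  have ub: "i * g + u \<le> n" using ig u by simp
  have Pw: "P div w * w + P mod w = P" by simp
  have w0: "0 < w" using w20 by simp
  have le: "P + u * b \<le> n * b" using mult_le_mono1[OF ub, of b] by (simp add: P algebra_simps)
  have Pn: "P < n * b" using ig b_pos by (simp add: P)
  have "(M (4 + P div w) div 2 ^ (P mod w) OR M (4 + P div w + 1) * 2 ^ (w - P mod w) mod 2 ^ w) mod 2 ^ (u * b)
    = pack b s div 2 ^ (P div w * w + P mod w) mod 2 ^ (u * b)"
  proof (rule holds_read)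
    show "holds w M 4 (n * b) (pack b s)" using S by (simp add: static_ok_def)
    show "P div w * w + P mod w + u * b \<le> n * b" using le by simp
    show "P mod w < w" using w0 by simp
    have "u * b \<le> g * b" using u by (intro mult_le_mono1) simp
    then show "u * b \<le> w" using gb_less_w by linarith
    have "P div w < (n * b + w - 1) div w"
    proof -
      have "P div w + 1 = (P + w) div w" using w0 by simp
      also have "\<dots> \<le> (n * b + w - 1) div w" using Pn by (intro div_le_mono) simp
      finally show ?thesis by simp
    qed
    then have "4 + P div w < A" using A unfolding b_def by linarith
    then show "M (4 + P div w) < 2 ^ w" using S by (simp add: static_ok_def)
  qed
  also have "P div w * w + P mod w = b * (i * g)" using Pw by (simp add: P algebra_simps)
  also have "pack b s div 2 ^ (b * (i * g)) mod 2 ^ (u * b) = pack b (take u (drop (i * g) s))"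
    using pack_mod[OF fields_drop[OF fields_s], of "i * g" u] by (simp add: pack_div fields_s mult.commute)
  finally show ?thesis using chunk_pack[OF i] u by simp
qed

lemma n1_le: "n1 \<le> m"
  unfolding m_def using g_pos by simp

text \<open>A step of \<open>g * b < w\<close> bits crosses at most one word boundary, so a
  comparison and a subtraction keep quotient and remainder of the position up to date.\<close>

lemma wp_scan_tail:
  assumes R: "regs_ok \<rho>" and i: "i < n1" and P: "P = i * (g * b)"
    and \<rho>: "\<rho> vc = P mod w" "\<rho> vk = 4 + P div w" "\<rho> vi = i"
    and Q: "\<And>\<rho>' \<tau>'. \<lbrakk>\<rho>' vc = (P + g * b) mod w; \<rho>' vk = 4 + (P + g * b) div w; \<rho>' vi = Suc i;
      \<And>x. x < 45 \<Longrightarrow> \<rho>' x = \<rho> x; \<tau>' \<le> \<tau> + 30\<rbrakk> \<Longrightarrow> Q \<rho>' M \<tau>'"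
  shows "wp w (vc \<leftarrow> V vc \<oplus> V rg \<otimes> V rb;;
     IfE (V vc \<prec> V rw) Skp (vc \<leftarrow> V vc \<ominus> V rw;; vk \<leftarrow> V vk \<oplus> N 1);; vi \<leftarrow> V vi \<oplus> N 1) Q \<rho> M \<tau>"
proof -
  note RR = regs_okD[OF R]
  have w0: "0 < w" "w < 2 ^ w" using w20 by simp_all
  have gb: "g * b \<le> w" using gb_less_w by simp
  note dm = div_mod_add_cases[OF gb w0(1), of P]
  have "P mod w < w" using w0 by simp
  moreover have "2 * w < 2 ^ w"
  proof -
    have "2 * w < 2 ^ w"
      using w20 by (induction w rule: dec_induct) simp_all
    then show ?thesis .
  qed
  ultimately have b1: "P mod w + g * b < 2 ^ w" "g * b < 2 ^ w" using gb w0 by linarith+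
  have "P div w \<le> i"
  proof -
    have "P \<le> i * w" unfolding P using gb by (rule mult_le_mono2)
    then have "P div w \<le> i * w div w" by (rule div_le_mono)
    then show ?thesis using w0 by simp
  qed
  then have b2: "Suc (4 + P div w) < 2 ^ w" "Suc i < 2 ^ w" using i n1_le bound mem_end_ge by linarith+
  show ?thesis
  proof (cases "P mod w + g * b < w")
    case True
    then show ?thesis
      by (simp add: \<rho> RR b1 b2 const_bound, intro Q, simp_all add: dm \<rho>)
  next
    case False
    then show ?thesis using b2
      by (simp add: \<rho> RR b1 const_bound, intro Q, simp_all add: dm \<rho>)
  qed
qed

definition "zs J u i = map (lcode f (nd T u)) (filter (\<lambda>a. a \<in> set (leaves (nd T u))) (take (i * g) sp))"

definition "lists_upto J i M \<longleftrightarrow> (\<forall>u < nn. dep T u = J \<longrightarrow>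
   stream W M (apos J u) (f * length (zs J u i)) (pack f (zs J u i)) \<and> M (nod u 4) = apos J u \<and>
   M (nod u 5) = apos J u + f * length (zs J u i) div W \<and> M (nod u 13) = f * length (zs J u i) mod W)"

lemma length_zs: "length (zs J u i) \<le> cn u"
proof -
  have "filter (\<lambda>a. a \<in> set (leaves (nd T u))) (take (i * g) sp @ drop (i * g) sp)
      = filter (\<lambda>a. a \<in> set (leaves (nd T u))) (take (i * g) sp) @ filter (\<lambda>a. a \<in> set (leaves (nd T u))) (drop (i * g) sp)"
    by (rule filter_append)
  then have "length (filter (\<lambda>a. a \<in> set (leaves (nd T u))) (take (i * g) sp)) \<le> length (sub u)"
    unfolding sub_def by (metis append_take_drop_id le_add1 length_append)
  then show ?thesis by (simp add: zs_def cn_def)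
qed

lemma cell_index: "f * k div W = k div t" "f * k mod W = f * (k mod t)"
  unfolding W_def by (metis div_mult_mult1 f_pos less_not_refl2 mult.commute, metis mult.commute mult_mod_right)

lemma cells_below: "k \<le> cn u \<Longrightarrow> apos J u + f * k div W \<le> apos J u + cn u div t"
  by (simp add: cell_index div_le_mono)

lemma char_ok_cong:
  assumes "char_ok J M a" "a < \<sigma>" "\<And>x. CB \<le> x \<Longrightarrow> x < TB \<Longrightarrow> M' x = M x"
  shows "char_ok J M' a"
proof -
  have "CB + 2 * a + 1 < TB" using assms(2) regions by linarith
  then show ?thesis using assms(1) assms(3)[of "CB + 2 * a"] assms(3)[of "CB + 2 * a + 1"] by (simp add: char_ok_def)
qed

lemma recode_ok_cong:
  assumes "recode_ok M M x" "x < q" "\<And>y. CB \<le> y \<Longrightarrow> y < TB \<Longrightarrow> M' y = M y"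
  shows "recode_ok M' M' x"
proof -
  have c: "CB + 2 * c + 1 < TB" if "c < 2 ^ b" for c using that regions by linarith
  have "RB + 2 * x + 1 < TB" using assms(2) regions by linarith
  then have e: "M' (RB + 2 * x) = M (RB + 2 * x)" "M' (RB + 2 * x + 1) = M (RB + 2 * x + 1)"
    "M' (CB + 2 * (x mod 2 ^ b) + 1) = M (CB + 2 * (x mod 2 ^ b) + 1)"
    using regions c[of "x mod 2 ^ b"] by (auto intro!: assms(3))
  have mp: "map (\<lambda>c. M' (CB + 2 * c) mod 2 ^ f) (digits g b x) = map (\<lambda>c. M (CB + 2 * c) mod 2 ^ f) (digits g b x)"
    using fields_digits[of b g x] Suc_lessD[OF c[simplified Suc_eq_plus1[symmetric]]] by (intro map_cong refl) (auto simp: fields_def intro!: arg_cong2[of _ _ _ _ "(mod)"] assms(3))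
  show ?thesis using assms(1) unfolding recode_ok_def mp e .
qed

text \<open>Either a superchar is a single character, or there is only one list to append to.\<close>

lemma chunk_target:
  assumes i: "i < n1" and J: "g = 1 \<or> J = 0" and ch: "\<And>a. a < \<sigma> \<Longrightarrow> char_ok J M a"
    and an: "an = M (CB + 2 * (chunk i ! 0) + 1)"
  shows "if an = 0 then \<forall>u < nn. dep T u = J \<longrightarrow> (\<forall>a \<in> set (chunk i). a \<notin> set (leaves (nd T u)))
    else \<exists>u < nn. dep T u = J \<and> an = nod u 0 \<and>
      (\<forall>a \<in> set (chunk i). a \<in> set (leaves (nd T u)) \<and> M (CB + 2 * a) = lcode f (nd T u) a)"
proof -
  note ck = chunk_props[OF i]
  have c0: "chunk i ! 0 \<in> set (chunk i)" using ck(1) g_pos by (intro nth_mem) simp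
  then have c0s: "chunk i ! 0 < \<sigma>" using ck(2) by auto
  show ?thesis
  proof (cases "g = 1")
    case True
    then have s: "set (chunk i) = {chunk i ! 0}" using ck(1) by (cases "chunk i") auto
    show ?thesis unfolding s using ch[OF c0s] an by (auto simp: char_ok_def nod_pos)
  next
    case False
    then have J0: "J = 0" using J by simp
    have all: "M (CB + 2 * a + 1) = nod 0 0 \<and> M (CB + 2 * a) = lcode f (nd T 0) a" if "a < \<sigma>" for a
    proof -
      have "0 < nn" by (rule node_count_pos)
      moreover have "a \<in> set (leaves (nd T 0))" using that leaves_set by simp
      ultimately show ?thesis using ch[OF that] J0 dep_0 unfolding char_ok_def by auto
    qed
    then have "an = nod 0 0" using an c0s by simp
    moreover have "\<forall>a \<in> set (chunk i). a \<in> set (leaves (nd T 0)) \<and> M (CB + 2 * a) = lcode f (nd T 0) a"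
      using all ck(2) leaves_set by auto
    ultimately show ?thesis using nod_pos[of 0] J0 node_count_pos[of T] by auto
  qed
qed

lemma wp_scan_body:
  assumes R: "regs_ok \<rho>" and S: "static_ok M" and i: "i < n1" and J: "g = 1 \<or> J = 0"
    and P: "P = i * (g * b)" and \<rho>: "\<rho> vc = P mod w" "\<rho> vk = 4 + P div w" "\<rho> vi = i"
    and ch: "\<And>a. a < \<sigma> \<Longrightarrow> char_ok J M a" and rc: "\<And>x. x < q \<Longrightarrow> recode_ok M M x"
    and L: "lists_upto J i M"
    and Q: "\<And>\<rho>' M' \<tau>'. \<lbrakk>\<rho>' vc = (P + g * b) mod w; \<rho>' vk = 4 + (P + g * b) div w; \<rho>' vi = Suc i;
      \<And>x. x < 45 \<Longrightarrow> \<rho>' x = \<rho> x; lists_upto J (Suc i) M'; frame {5, 13} {AB..<OP0} M M';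
      \<tau>' \<le> \<tau> + 200\<rbrakk> \<Longrightarrow> Q \<rho>' M' \<tau>'"
  shows "wp w scan_body Q \<rho> M \<tau>"
proof -
  note RR = regs_okD[OF R] and ck = chunk_props[OF i]
  define u where "u = min g (n - i * g)"
  define x where "x = pack b (chunk i)"
  have rd: "(M (4 + P div w) div 2 ^ (P mod w) OR M (4 + P div w + 1) * 2 ^ (w - P mod w) mod 2 ^ w) mod 2 ^ (u * b) = x"
    unfolding x_def by (rule chunk_read[OF i S u_def P])
  have ig: "i * g < n" by (rule chunk_less[OF i])
  have x: "x < q" unfolding x_def q_def using pack_less[OF ck(3)] ck(1) by (simp add: mult.commute)
  have dg: "digits g b x = chunk i" unfolding x_def using digits_pack[OF ck(3), of g] ck(1) by simp
  have x0: "x mod 2 ^ b = chunk i ! 0"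
    unfolding x_def using pack_nth[OF ck(3), of 0] ck(1) g_pos by simp
  define an where "an = M (CB + 2 * (chunk i ! 0) + 1)"
  have rv: "M (RB + 2 * x) = pack f (map (\<lambda>c. M (CB + 2 * c) mod 2 ^ f) (chunk i))" "M (Suc (RB + 2 * x)) = an"
    using rc[OF x] unfolding recode_ok_def dg x0 an_def by simp_all
  define tail where "tail = (vc \<leftarrow> V vc \<oplus> V rg \<otimes> V rb;;
     IfE (V vc \<prec> V rw) Skp (vc \<leftarrow> V vc \<ominus> V rw;; vk \<leftarrow> V vk \<oplus> N 1);; vi \<leftarrow> V vi \<oplus> N 1)"
  define rest where "rest = (van \<leftarrow> Ld (V rRB \<oplus> N 2 \<otimes> V vx \<oplus> N 1);;
     IfE (V van)
      (oA \<leftarrow> Ld (V van \<oplus> N 5);; oF \<leftarrow> Ld (V van \<oplus> N 13);;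
       oY \<leftarrow> Ld (V rRB \<oplus> N 2 \<otimes> V vx);; oL \<leftarrow> V rg \<otimes> V rf;; oC \<leftarrow> V rW;;
       append;;
       [V van \<oplus> N 5] \<leftarrow> V oA;; [V van \<oplus> N 13] \<leftarrow> V oF)
      Skp;; tail)"
  have w0: "0 < w" "w < 2 ^ w" using w20 by simp_all
  have rb: "RB + 2 * x < 2 ^ w" "Suc (RB + 2 * x) < 2 ^ w" "2 * x < 2 ^ w"
    using x regions bound mem_end_ge by linarith+
  have gfW: "g * f \<le> W" unfolding W_def by (rule mult_le_mono1) (simp add: g_def)
  have tail: "wp w tail Q \<rho>1 M1 \<tau>1" if "\<rho>1 vc = P mod w" "\<rho>1 vk = 4 + P div w" "\<rho>1 vi = i"
    "\<And>x. x < 45 \<Longrightarrow> \<rho>1 x = \<rho> x" "lists_upto J (Suc i) M1" "frame {5, 13} {AB..<OP0} M M1" "\<tau>1 \<le> \<tau> + 170"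
    for \<rho>1 M1 \<tau>1
    unfolding tail_def
  proof (rule wp_scan_tail[OF _ i P that(1-3)])
    show "regs_ok \<rho>1" by (rule regs_ok_cong[OF R]) (simp add: that(4))
  qed (use that in \<open>auto intro!: Q\<close>)
  have rest: "wp w rest Q \<rho>1 M \<tau>1" if r1: "\<rho>1 vx = x" "\<rho>1 vc = P mod w" "\<rho>1 vk = 4 + P div w" "\<rho>1 vi = i"
    "\<And>x. x < 45 \<Longrightarrow> \<rho>1 x = \<rho> x" and \<tau>1: "\<tau>1 \<le> \<tau> + 60" for \<rho>1 \<tau>1
  proof (cases "an = 0")
    case True
    have "zs J u (Suc i) = zs J u i" if "u < nn" "dep T u = J" for u
    proof -
      have "\<forall>a \<in> set (chunk i). a \<notin> set (leaves (nd T u))"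
        using chunk_target[OF i J ch an_def] True that by simp
      then show ?thesis unfolding zs_def ck(4) by (simp add: filter_empty_conv)
    qed
    then have L': "lists_upto J (Suc i) M" using L unfolding lists_upto_def by simp
    show ?thesis unfolding rest_def
      by (simp add: r1 RR rb rv const_bound True, intro tail, use L' \<tau>1 in \<open>simp_all add: r1\<close>)
  next
    case False
    then obtain v where v: "v < nn" "dep T v = J" "an = nod v 0"
      "\<forall>a \<in> set (chunk i). a \<in> set (leaves (nd T v)) \<and> M (CB + 2 * a) = lcode f (nd T v) a"
      using chunk_target[OF i J ch an_def] by auto
    define Z where "Z = map (lcode f (nd T v)) (chunk i)"
    \<comment> \<open>The masking to \<open>f\<close> bits in the table has no effect here, since
      the entries concerned are codes below \<open>2 ^ f\<close>.\<close>
    have Z: "M (RB + 2 * x) = pack f Z" unfolding rv Z_def using v(4) lcode_less[of f]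
      by (intro arg_cong[of _ _ "pack f"] map_cong) auto
    have fZ: "fields f Z" unfolding Z_def fields_def using lcode_less by auto
    have lZ: "length Z = g" using ck(1) by (simp add: Z_def)
    have zv: "zs J v (Suc i) = zs J v i @ Z"
    proof -
      have "filter (\<lambda>a. a \<in> set (leaves (nd T v))) (chunk i) = chunk i" using v(4) by (intro filter_True) auto
      then show ?thesis unfolding zs_def ck(4) Z_def by simp
    qed
    have zu: "zs J u (Suc i) = zs J u i" if "u < nn" "dep T u = J" "u \<noteq> v" for u
    proof -
      have "\<forall>a \<in> set (chunk i). a \<notin> set (leaves (nd T u))"
        using v that level_disjoint[OF leaves_distinct that(1) v(1)] by auto
      then show ?thesis unfolding zs_def ck(4) by (simp add: filter_empty_conv)
    qed
    define p where "p = f * length (zs J v i)"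
    have st: "stream W M (apos J v) p (pack f (zs J v i))" "M (nod v 5) = apos J v + p div W" "M (nod v 13) = p mod W"
      using L v unfolding lists_upto_def p_def by auto
    have pg: "p + g * f = f * length (zs J v (Suc i))" unfolding p_def zv using lZ by (simp add: algebra_simps)
    have cb: "apos J v + p div W \<le> apos J v + cn v div t" "apos J v + (p + g * f) div W \<le> apos J v + cn v div t"
      unfolding pg unfolding p_def by (rule cells_below[OF length_zs])+
    have top: "apos J v + cn v div t + 3 < OP0"
      using apos_Suc[of J v] v(2) apos_less[of "Suc v" J] v(1) by simp
    have OPw: "OP0 < 2 ^ w" using bound mem_end_ge by linarith
    have c16: "nod v c < 2 ^ w" if "c < 32" for c using node_bound[of v c] v(1) that by simp
    have gfw: "g * f < 2 ^ w"
      by (rule le_less_trans[OF gf_le less_trans[OF t_less_w]]) simp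
    have app: "wp w append (wp w ([V van \<oplus> N 5] \<leftarrow> V oA;; [V van \<oplus> N 13] \<leftarrow> V oF) (wp w tail Q)) \<rho>2 M \<tau>2"
      if r2: "\<rho>2 oA = apos J v + p div W" "\<rho>2 oF = p mod W" "\<rho>2 oY = pack f Z" "\<rho>2 oL = g * f" "\<rho>2 oC = W"
        "\<rho>2 van = nod v 0" "\<rho>2 vc = P mod w" "\<rho>2 vk = 4 + P div w" "\<rho>2 vi = i" "\<And>x. x < 45 \<Longrightarrow> \<rho>2 x = \<rho> x"
        "\<tau>2 \<le> \<tau> + 100" for \<rho>2 \<tau>2
    proof (rule wp_append[OF st(1) r2(1-5)])
      show "pack f Z < 2 ^ (g * f)" using pack_less[OF fZ] lZ by (simp add: mult.commute)
      show "g * f \<le> W" by (rule gfW)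
      show "W \<le> w" "0 < W" using W_bound by simp_all
      show "apos J v + p div W + 1 < 2 ^ w" using cb top OPw by linarith
      show "2 * W < 2 ^ w" using W_bound(1) w0 by linarith
      fix \<rho>3 M3 \<tau>3
      assume a: "stream W M3 (apos J v) (p + g * f) (pack f (zs J v i) + 2 ^ p * pack f Z)"
        "\<rho>3 oA = apos J v + (p + g * f) div W" "\<rho>3 oF = (p + g * f) mod W"
        "\<And>x. x \<noteq> 81 \<Longrightarrow> x \<noteq> 82 \<Longrightarrow> \<rho>3 x = \<rho>2 x"
        "\<And>a. a \<noteq> apos J v + p div W \<Longrightarrow> a \<noteq> apos J v + (p + g * f) div W \<Longrightarrow> M3 a = M a" "\<tau>3 \<le> \<tau>2 + 40"
      define M4 where "M4 = M3(nod v 5 := apos J v + (p + g * f) div W, nod v 13 := (p + g * f) mod W)"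
      let ?a1 = "apos J v + p div W" and ?a2 = "apos J v + (p + g * f) div W"
      \<comment> \<open>Only these two cells can have changed; written as an update, the new memory
        falls under the frame rule for single cells.\<close>
      have M3: "M3 = M(?a1 := M3 ?a1, ?a2 := M3 ?a2)" using a(5) by (auto simp: fun_eq_iff)
      have inr: "A + 16 * nn \<le> AB" using regions by linarith
      have rg: "AB \<le> ?a1" "AB \<le> ?a2" "?a1 < OP0" "?a2 < OP0" using apos_ge[of J v] cb top by linarith+
      have nn': "nod k c \<noteq> ?a1" "nod k c \<noteq> ?a2" if "k < nn" "c < 16" for k c
        using cell_upper[OF that, of A] rg inr by linarith+
      have M4n: "M4 (nod k c) = M (nod k c)" if "k < nn" "c < 16" "k \<noteq> v \<or> c \<noteq> 5 \<and> c \<noteq> 13" for k c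
        using that a(5)[OF nn'[OF that(1,2)]] by (auto simp: M4_def)
      have M4r: "M4 a = M3 a" if "AB \<le> a" for a
      proof -
        have "a \<noteq> nod v c" if "c < 16" for c using \<open>AB \<le> a\<close> cell_upper[OF v(1) that, of A] inr by linarith
        then show ?thesis by (simp add: M4_def)
      qed
      have "lists_upto J (Suc i) M4"
        unfolding lists_upto_def
      proof (intro allI impI)
        fix u assume u: "u < nn" "dep T u = J"
        show "stream W M4 (apos J u) (f * length (zs J u (Suc i))) (pack f (zs J u (Suc i))) \<and>
          M4 (nod u 4) = apos J u \<and> M4 (nod u 5) = apos J u + f * length (zs J u (Suc i)) div W \<and>
          M4 (nod u 13) = f * length (zs J u (Suc i)) mod W"
        proof (cases "u = v")
          case True
          have "pack f (zs J v (Suc i)) = pack f (zs J v i) + 2 ^ p * pack f Z"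
            unfolding zv pack_append p_def by simp
          moreover have "stream W M4 (apos J v) (p + g * f) (pack f (zs J v i) + 2 ^ p * pack f Z)"
            by (rule stream_cong[OF a(1)]) (use M4r apos_ge[of J v] in simp)
          moreover have "M4 (nod v 4) = apos J v"
            using M4n[OF v(1), of 4] L v unfolding lists_upto_def by simp
          ultimately show ?thesis unfolding True pg[symmetric] by (simp add: M4_def)
        next
          case False
          have Lu: "stream W M (apos J u) (f * length (zs J u i)) (pack f (zs J u i))" "M (nod u 4) = apos J u"
            "M (nod u 5) = apos J u + f * length (zs J u i) div W" "M (nod u 13) = f * length (zs J u i) mod W"
            using L u unfolding lists_upto_def by auto
          have "stream W M4 (apos J u) (f * length (zs J u i)) (pack f (zs J u i))"
          proof (rule stream_cong[OF Lu(1)])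
            fix a' assume a': "apos J u \<le> a'" "a' \<le> apos J u + f * length (zs J u i) div W"
            have "a' \<le> apos J u + cn u div t" using a' cells_below[OF length_zs] by (meson le_trans)
            \<comment> \<open>The blocks of two nodes on the same level are disjoint, whichever of
              them was allocated first.\<close>
            moreover have "apos J u + cn u div t + 3 \<le> apos J v \<or> apos J v + cn v div t + 3 \<le> apos J u"
              using apos_sep[of u v J] apos_sep[of v u J] u v False by (cases "u < v") auto
            ultimately have "a' \<noteq> ?a1" "a' \<noteq> ?a2" using a' cb by linarith+
            then show "M4 a' = M a'" using M4r[of a'] a(5) a' apos_ge[of J u] by simp
          qed
          then show ?thesis unfolding zu[OF u False] using Lu M4n[OF u(1)] False by simp
        qed
      qed
      moreover have "frame {5, 13} {AB..<OP0} M M4"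
      proof -
        have "frame {5, 13} {AB..<OP0} M M3"
          by (subst M3) (intro frame_region frame_refl; use rg inr in simp)
        then show ?thesis unfolding M4_def using v(1) by (intro frame_cell) auto
      qed
      ultimately have "wp w tail Q \<rho>3 M4 \<tau>4" if "\<tau>4 \<le> \<tau> + 160" for \<tau>4
        using that r2 a(4) by (intro tail) simp_all
      moreover have "\<rho>3 van = nod v 0" using a(4) r2 by simp
      ultimately show "wp w ([V van \<oplus> N 5] \<leftarrow> V oA;; [V van \<oplus> N 13] \<leftarrow> V oF) (wp w tail Q) \<rho>3 M3 \<tau>3"
        using a(2,3,6) r2(11) c16 by (simp add: M4_def const_bound)
    qed
    show ?thesis unfolding rest_def
      by (simp add: r1 RR rb rv(2) Z const_bound False v(3) c16 st(2,3) gfw nod_pos, intro app, use \<tau>1 in \<open>simp_all add: r1\<close>)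
  qed
  have pw: "(2::nat) ^ (u * b) mod 2 ^ w = 2 ^ (u * b)" "(2::nat) ^ (u * b) < 2 ^ w" "u * b < 2 ^ w"
  proof -
    have "u * b \<le> g * b" unfolding u_def by (intro mult_le_mono1) simp
    then have "u * b < w" using gb_less_w by linarith
    then show "(2::nat) ^ (u * b) mod 2 ^ w = 2 ^ (u * b)" "(2::nat) ^ (u * b) < 2 ^ w" by simp_all
    show "u * b < 2 ^ w" using \<open>u * b < w\<close> w0(2) by (rule less_trans)
  qed
  have nw: "n < 2 ^ w" using n_le_m bound mem_end_ge by linarith
  have igw: "i * g < 2 ^ w" using ig nw by linarith
  have Pm: "P mod w \<le> w" using w0 by (simp add: less_imp_le)
  have Pd: "Suc (4 + P div w) < 2 ^ w"
  proof -
    have "P \<le> i * w" unfolding P using gb_less_w by (intro mult_le_mono2) simp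
    then have "P div w \<le> i * w div w" by (rule div_le_mono)
    then show ?thesis using w0 i n1_le bound mem_end_ge by simp
  qed
  have Pd': "5 + P div w < 2 ^ w" using Pd by simp
  have rd': "(M (4 + P div w) div 2 ^ (P mod w) OR M (Suc (4 + P div w)) * 2 ^ (w - P mod w) mod 2 ^ w) mod 2 ^ (u * b) = x"
    using rd by simp
  have fr: "wp w rest Q (\<rho>(vu := u, vx := x)) M \<tau>1" if "\<tau>1 \<le> \<tau> + 60" for \<tau>1
    using that by (intro rest) (simp_all add: \<rho>)
  show ?thesis
  proof (cases "g < n - i * g")
    case True
    then have u: "u = g" by (simp add: u_def)
    show ?thesis unfolding scan_body_def tail_def[symmetric] rest_def[symmetric]
      using fr pw rd' unfolding u
      by (simp add: \<rho> RR True ig less_imp_le nw igw Pm Pd Pd' w0 and_mask_Suc const_bound)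
  next
    case False
    then have u: "u = n - i * g" by (simp add: u_def)
    show ?thesis unfolding scan_body_def tail_def[symmetric] rest_def[symmetric]
      using fr pw rd' unfolding u
      by (simp add: \<rho> RR False ig less_imp_le nw igw Pm Pd Pd' w0 and_mask_Suc const_bound)
  qed
qed

lemma wp_scan:
  assumes R: "regs_ok \<rho>" and S: "static_ok M" and J: "g = 1 \<or> J = 0"
    and ch: "\<And>a. a < \<sigma> \<Longrightarrow> char_ok J M a" and rc: "\<And>x. x < q \<Longrightarrow> recode_ok M M x"
    and E: "empty_lists J M"
    and Q: "\<And>\<rho>' M' \<tau>'. \<lbrakk>\<And>x. x < 45 \<Longrightarrow> \<rho>' x = \<rho> x; lists_upto J n1 M'; frame {5, 13} {AB..<OP0} M M';
      \<tau>' \<le> \<tau> + 20 + 210 * n1\<rbrakk> \<Longrightarrow> Q \<rho>' M' \<tau>'"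
  shows "wp w scan Q \<rho> M \<tau>"
proof -
  let ?e = "V vi \<prec> V rn1"
  define I where "I i \<rho>' M' \<tau>' \<longleftrightarrow> \<rho>' vc = i * (g * b) mod w \<and> \<rho>' vk = 4 + i * (g * b) div w \<and> \<rho>' vi = i \<and>
      (\<forall>x < 45. \<rho>' x = \<rho> x) \<and> lists_upto J i M' \<and> frame {5, 13} {AB..<OP0} M M' \<and> \<tau>' \<le> \<tau> + 10 + i * 210"
    for i and \<rho>' M' :: "nat \<Rightarrow> nat" and \<tau>'
  note RR = regs_okD[OF R]
  have "wp w (Whl ?e scan_body) Q (\<rho>(vk := 4, vc := 0, vi := 0)) M \<tau>0" if "\<tau>0 \<le> \<tau> + 10" for \<tau>0
  proof (rule wp_Whl[where I = I and m = n1])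
    have "zs J u 0 = []" for u by (simp add: zs_def)
    then have "lists_upto J 0 M" using E unfolding lists_upto_def empty_lists_def by (simp add: stream_empty)
    then show "I 0 (\<rho>(vk := 4, vc := 0, vi := 0)) M \<tau>0" using that by (simp add: I_def)
  next
    fix i \<rho>1 M1 \<tau>1 assume "i \<le> n1" "I i \<rho>1 M1 \<tau>1"
    then show "safe w \<rho>1 M1 ?e \<and> (nval w \<rho>1 M1 ?e \<noteq> 0 \<longleftrightarrow> i < n1)" using RR by (auto simp: I_def)
  next
    fix i \<rho>1 M1 \<tau>1 \<tau>2 assume i: "i < n1" and I: "I i \<rho>1 M1 \<tau>1" and "\<tau>2 = \<tau>1 + cost ?e + 1"
    then have \<tau>2: "\<tau>2 = \<tau>1 + 4" by simp
    have I1: "\<rho>1 vc = i * (g * b) mod w" "\<rho>1 vk = 4 + i * (g * b) div w" "\<rho>1 vi = i"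
      "\<And>x. x < 45 \<Longrightarrow> \<rho>1 x = \<rho> x" "lists_upto J i M1" "frame {5, 13} {AB..<OP0} M M1" "\<tau>1 \<le> \<tau> + 10 + i * 210"
      using I unfolding I_def by simp_all
    have R1: "regs_ok \<rho>1" by (rule regs_ok_cong[OF R]) (simp add: I1(4))
    have S1: "static_ok M1" by (rule static_frame[OF S I1(6)]) auto
    have eq: "M1 a = M a" if "CB \<le> a" "a < TB" for a
      by (rule frame_regionD[OF I1(6)]) (use that regions in auto)
    show "wp w scan_body (I (Suc i)) \<rho>1 M1 \<tau>2"
    proof (rule wp_scan_body[OF R1 S1 i J refl I1(1-3) char_ok_cong[OF ch _ eq] recode_ok_cong[OF rc _ eq] I1(5)])
      fix \<rho>2 M2 \<tau>3
      assume a: "\<rho>2 vc = (i * (g * b) + g * b) mod w" "\<rho>2 vk = 4 + (i * (g * b) + g * b) div w" "\<rho>2 vi = Suc i"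
        "\<And>x. x < 45 \<Longrightarrow> \<rho>2 x = \<rho>1 x" "lists_upto J (Suc i) M2" "frame {5, 13} {AB..<OP0} M1 M2" "\<tau>3 \<le> \<tau>2 + 200"
      have "frame {5, 13} {AB..<OP0} M M2" by (rule frame_trans[OF I1(6) a(6)])
      moreover have "\<tau>3 \<le> \<tau> + 10 + Suc i * 210" using a(7) \<tau>2 I1(7) by simp
      moreover have "\<forall>x < 45. \<rho>2 x = \<rho> x" using a(4) I1(4) by simp
      moreover have "i * (g * b) + g * b = Suc i * (g * b)" by simp
      ultimately show "I (Suc i) \<rho>2 M2 \<tau>3" unfolding I_def using a(1-3,5) by metis
    qed
  next
    fix \<rho>1 M1 \<tau>1 \<tau>2 assume I: "I n1 \<rho>1 M1 \<tau>1" and "\<tau>2 = \<tau>1 + cost ?e + 1"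
    then have "\<tau>2 = \<tau>1 + 4" by simp
    then show "Q \<rho>1 M1 \<tau>2" using I unfolding I_def by (intro Q) simp_all
  qed
  then show ?thesis unfolding scan_def by (simp add: const_bound)
qed

end

section \<open>One node: from a list of codes to a bitmask and two lists\<close>

lemma lcode_children:
  assumes "distinct (leaves (Nd l r))" "\<And>a. a \<in> set xs \<Longrightarrow> a \<in> set (leaves (Nd l r))"
  shows "low_bits (map (lcode (Suc j) (Nd l r)) xs) = map (\<lambda>a. of_bool (a \<in> set (leaves r))) xs"
    "branch False (map (lcode (Suc j) (Nd l r)) xs) = map (lcode j l) (filter (\<lambda>a. a \<in> set (leaves l)) xs)"
    "branch True (map (lcode (Suc j) (Nd l r)) xs) = map (lcode j r) (filter (\<lambda>a. a \<in> set (leaves r)) xs)"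
proof -
  have lr: "a \<in> set (leaves l) \<longleftrightarrow> a \<notin> set (leaves r)" if "a \<in> set xs" for a
    using assms(1) assms(2)[OF that] by auto
  show "low_bits (map (lcode (Suc j) (Nd l r)) xs) = map (\<lambda>a. of_bool (a \<in> set (leaves r))) xs"
    by (auto simp: low_bits_def)
  show "branch False (map (lcode (Suc j) (Nd l r)) xs) = map (lcode j l) (filter (\<lambda>a. a \<in> set (leaves l)) xs)"
    using lr by (induction xs) (auto simp: branch_def)
  show "branch True (map (lcode (Suc j) (Nd l r)) xs) = map (lcode j r) (filter (\<lambda>a. a \<in> set (leaves r)) xs)"
    by (induction xs) (auto simp: branch_def)
qed

context layout_bound
begin

text \<open>At depth \<open>dep T k\<close> the first \<open>dep T k - J\<close> bits of the local
  codes have been consumed. The fields keep their width \<open>f\<close>, so one set of tables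
  serves all levels of a round.\<close>

definition "zl J k = map (lcode (f - (dep T k - J)) (nd T k)) (sub k)"

definition bits :: "nat \<Rightarrow> nat list" where
  "bits k = (case nd T k of Lf a \<Rightarrow> [] | Nd l r \<Rightarrow> map (\<lambda>a. of_bool (a \<in> set (leaves r))) (sub k))"

lemma length_zl [simp]: "length (zl J k) = cn k"
  by (simp add: zl_def cn_def)

lemma fields_zl: "fields f (zl J k)"
proof -
  have "lcode (f - (dep T k - J)) (nd T k) a < 2 ^ f" for a
    by (rule less_pow_weaken[OF lcode_less]) simp
  then show ?thesis by (auto simp: zl_def fields_def)
qed

lemma sub_kids:
  assumes "k < nn" "nd T k = Nd l r"
  shows "sub (kid T k) = filter (\<lambda>a. a \<in> set (leaves l)) (sub k)"
    "sub (Suc (kid T k)) = filter (\<lambda>a. a \<in> set (leaves r)) (sub k)"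
  unfolding sub_def nd_kid[OF assms] assms(2) filter_filter
  by (intro filter_cong refl; auto)+

text \<open>The lowest bit of a code is the branching at \<open>k\<close> itself, and halving a code
  turns it into the code relative to the child. So the three table translations produce the bitmask
  and the lists of both children.\<close>

lemma zl_kids:
  assumes k: "k < nn" "nd T k = Nd l r" "J \<le> dep T k" "dep T k < J + f"
  shows "low_bits (zl J k) = bits k" "branch False (zl J k) = zl J (kid T k)"
    "branch True (zl J k) = zl J (Suc (kid T k))"
proof -
  have e: "f - (dep T k - J) = Suc (f - (Suc (dep T k) - J))" using k by simp
  have d: "distinct (leaves (Nd l r))" using distinct_nd[OF leaves_distinct k(1)] k(2) by simp
  have i: "a \<in> set (leaves (Nd l r))" if "a \<in> set (sub k)" for a using that k(2) by (simp add: sub_def)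
  note lc = lcode_children[OF d i, where xs = "sub k"]
  show "low_bits (zl J k) = bits k" unfolding zl_def bits_def e k(2) using lc(1) by simp
  show "branch False (zl J k) = zl J (kid T k)" unfolding zl_def e k(2) nd_kid[OF k(1,2)] sub_kids[OF k(1,2)] by (rule lc(2))
  show "branch True (zl J k) = zl J (Suc (kid T k))" unfolding zl_def e k(2) nd_kid[OF k(1,2)] sub_kids[OF k(1,2)] by (rule lc(3))
qed

lemma cn_kids:
  assumes "k < nn" "nd T k = Nd l r"
  shows "cn k = cn (kid T k) + cn (Suc (kid T k))"
proof -
  have d: "distinct (leaves (Nd l r))" using distinct_nd[OF leaves_distinct assms(1)] assms(2) by simp
  have "\<forall>a \<in> set (sub k). a \<in> set (leaves r) \<longleftrightarrow> \<not> a \<in> set (leaves l)" using d assms(2) by (auto simp: sub_def)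
  then have "filter (\<lambda>a. a \<in> set (leaves r)) (sub k) = filter (\<lambda>a. \<not> a \<in> set (leaves l)) (sub k)"
    by (intro filter_cong) auto
  then show ?thesis unfolding cn_def sub_kids[OF assms]
    using sum_length_filter_compl[of "\<lambda>a. a \<in> set (leaves l)" "sub k"] by simp
qed

lemma cn_le: "cn k \<le> m"
  unfolding cn_def sub_def using length_filter_le[of _ sp] length_sp by metis

lemma ceil_cells: "(f * k + W - 1) div W = (k + t - 1) div t"
proof -
  have "f * k + W - 1 = f * (k + t - 1) + (f - 1)"
    unfolding W_def using f_pos t(1) by (cases t; cases f) (auto simp: algebra_simps)
  moreover have "(f * (k + t - 1) + (f - 1)) div f = k + t - 1"
    using f_pos by (subst mult.commute, intro conjunct1[OF div_mod_eqI[OF refl]]) linarith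
  ultimately show ?thesis unfolding W_def by (metis div_mult2_eq mult.commute)
qed

lemma ceil_le: "0 < (c::nat) \<Longrightarrow> (k + c - 1) div c \<le> (k + d) div c + 1"
proof -
  assume "0 < c"
  have "(k + c - 1) div c \<le> (k + d + c) div c" by (intro div_le_mono) simp
  then show ?thesis using \<open>0 < c\<close> by simp
qed

text \<open>Uses \<open>holds\<close> instead of \<open>stream\<close> because padding may follow
  the last code of a left list. Only the cells with valid codes are counted here.\<close>

definition "lst J M ap k \<longleftrightarrow> AB \<le> M (nod k 4) \<and> M (nod k 4) + (cn k + t - 1) div t \<le> ap \<and>
  holds W M (M (nod k 4)) (f * cn k) (pack f (zl J k))"

lemma lst_cong:
  assumes "lst J M ap k" "M' (nod k 4) = M (nod k 4)" "\<And>a. AB \<le> a \<Longrightarrow> a < ap \<Longrightarrow> M' a = M a" "ap \<le> ap'"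
  shows "lst J M' ap' k"
proof -
  have "holds W M' (M (nod k 4)) (f * cn k) (pack f (zl J k))"
    by (rule holds_cong[of W M]) (use assms W_bound in \<open>auto simp: lst_def ceil_cells[unfolded One_nat_def]\<close>)
  then show ?thesis using assms by (simp add: lst_def)
qed

definition "bm M op k \<longleftrightarrow> OP0 \<le> M (nod k 10) \<and> M (nod k 10) + (cn k + w - 1) div w \<le> op \<and>
  holds w M (M (nod k 10)) (cn k) (pack 1 (bits k))"

lemma bm_cong:
  assumes "bm M op k" "M' (nod k 10) = M (nod k 10)" "\<And>a. OP0 \<le> a \<Longrightarrow> a < op \<Longrightarrow> M' a = M a" "op \<le> op'"
  shows "bm M' op' k"
proof -
  have "holds w M' (M (nod k 10)) (cn k) (pack 1 (bits k))"
    by (rule holds_cong[of w M]) (use assms w20 in \<open>auto simp: bm_def\<close>)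
  then show ?thesis using assms by (simp add: bm_def)
qed

lemma t_le_OP0: "t + 2 * cn k \<le> OP0 + m"
proof -
  have "t \<le> W" unfolding W_def using f_pos by simp
  also have "W \<le> 2 ^ W" by (simp add: less_imp_le)
  finally show ?thesis using regions cn_le[of k] unfolding add_mult_distrib2 by linarith
qed

lemma w_double: "2 * w < 2 ^ w"
  using w20 by (induction w rule: dec_induct) simp_all

lemma wp_split:
  assumes R: "regs_ok \<rho>" and S: "static_ok M" and i: "i < nn" "nd T i = Nd l r"
    and J: "J \<le> dep T i" "dep T i < J + f"
    and \<rho>: "\<rho> vp = nod i 0" "\<rho> vk = nod (kid T i) 0" "\<rho> vAP = ap" "\<rho> vOP = op"
    and li: "lst J M ap i" and ci: "M (nod i 3) = cn i"
    and bap: "AB \<le> ap" "ap + cn (kid T i) div t + cn (Suc (kid T i)) div t + 6 \<le> OP0"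
    and bop: "OP0 \<le> op" "op + m + 3 < 2 ^ w"
    and Q: "\<And>\<rho>' M' \<tau>' ap' op'. \<lbrakk>\<rho>' vAP = ap'; \<rho>' vOP = op';
      \<And>x. x < 60 \<Longrightarrow> x \<noteq> 31 \<Longrightarrow> x \<noteq> 32 \<Longrightarrow> x \<noteq> 51 \<Longrightarrow> \<rho>' x = \<rho> x;
      ap \<le> ap'; ap' \<le> ap + cn (kid T i) div t + cn (Suc (kid T i)) div t + 6; op \<le> op'; op' \<le> op + cn i div w + 2;
      frame {3, 4, 10} {AB..} M M'; \<And>a. AB \<le> a \<Longrightarrow> a < ap \<or> OP0 \<le> a \<and> a < op \<Longrightarrow> M' a = M a;
      \<And>k c. k < nn \<Longrightarrow> c < 16 \<Longrightarrow> (k = i \<longrightarrow> c \<noteq> 10) \<Longrightarrow>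
        (k = kid T i \<or> k = Suc (kid T i) \<longrightarrow> c \<noteq> 3 \<and> c \<noteq> 4) \<Longrightarrow> M' (nod k c) = M (nod k c);
      bm M' op' i; \<And>k. k = kid T i \<or> k = Suc (kid T i) \<Longrightarrow> M' (nod k 3) = cn k \<and> lst J M' ap' k;
      \<tau>' \<le> \<tau> + 300 * (cn i div t + 2) + 150\<rbrakk> \<Longrightarrow> Q \<rho>' M' \<tau>'"
  shows "wp w split Q \<rho> M \<tau>"
proof -
  let ?l = "kid T i" and ?r = "Suc (kid T i)"
  note RR = regs_okD[OF R] and Z = zl_kids[OF i J] and kk = kid_gt[OF i(1)] kid_less[OF i]
  have kn: "?l < nn" "?r < nn" using kk by auto
  define src where "src = M (nod i 4)"
  have src: "AB \<le> src" "src + (cn i + t - 1) div t \<le> ap" "holds W M src (f * cn i) (pack f (zl J i))"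
    using li by (auto simp: lst_def src_def)
  have tok: "tables_ok M t f TB" using S by (simp add: static_ok_def)
  have inr: "A + 16 * nn \<le> AB" using regions by linarith
  have dis: "nod k c \<noteq> a" "a \<noteq> nod k c" if "k < nn" "c < 16" "AB \<le> a" for k c a
    using cell_upper[OF that(1,2), of A] that(3) inr by linarith+
  have cw: "nod k c < 2 ^ w" if "k < nn" "c < 32" for k c using node_bound[of k c] that by simp
  have OPw: "OP0 + m + 8 < 2 ^ w" using bound mem_end_ge by linarith
  have Wp: "(2::nat) ^ W mod 2 ^ w = 2 ^ W" "(2::nat) ^ W < 2 ^ w" using W_less by simp_all
  have tbl: "TB + 2 * 2 ^ W + 2 * 2 ^ W \<le> AB" "TB + 4 * 2 ^ W + 2 * 2 ^ W = AB" "TB + 2 * 2 ^ W \<le> AB"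
    "TB + 4 * 2 ^ W \<le> AB" using regions(4) by linarith+
  have tw: "TB + 2 * 2 ^ W < 2 ^ w" "TB + 4 * 2 ^ W < 2 ^ w" "2 * 2 ^ W < (2::nat) ^ w" "4 * 2 ^ W < (2::nat) ^ w"
    using tbl bap OPw by linarith+
  have cnt: "cn i + t < 2 ^ w" using t_le_OP0[of i] OPw by linarith
  have cle: "cn i div t \<le> m" "cn i \<le> m" using cn_le[of i] div_le_dividend[of "cn i" t] by linarith+
  have csum: "cn i = cn ?l + cn ?r" by (rule cn_kids[OF i])
  have cdiv: "cn i div t \<le> cn ?l div t + cn ?r div t + 1"
  proof -
    have "cn i div t = cn ?l div t + cn ?r div t + (cn ?l mod t + cn ?r mod t) div t"
      unfolding csum by (rule div_add1_eq)
    moreover have "cn ?l mod t < t" "cn ?r mod t < t" using t(1) by simp_all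
    then have "cn ?l mod t + cn ?r mod t < 2 * t" by linarith
    then have "(cn ?l mod t + cn ?r mod t) div t < 2" by (simp add: less_mult_imp_div_less)
    ultimately show ?thesis by linarith
  qed
  \<comment> \<open>The program is cut behind each pass, and the pieces are verified from the last
    to the first, as the weakest precondition of a piece refers to what comes after it.\<close>
  define after3 where "after3 = (vy \<leftarrow> (V oA \<ominus> V vAP) \<otimes> V rt \<oplus> V oF \<oslash> V rf;; vAP \<leftarrow> V oA \<oplus> N 1;; [V vk \<oplus> N 19] \<leftarrow> V vy;; [V vk \<oplus> N 3] \<leftarrow> V cN \<ominus> V vy)"
  define seg3 where "seg3 = ([V vk \<oplus> N 20] \<leftarrow> V vAP;; tB \<leftarrow> V rTB \<oplus> N 4 \<otimes> (N 1 \<lless> V rW);; oB \<leftarrow> V vAP;; oC \<leftarrow> V rW;; pass;; after3)"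
  define seg2 where "seg2 = (vAP \<leftarrow> V oA \<oplus> N 1;; seg3)"
  define full2 where "full2 = (vOP \<leftarrow> V oA \<oplus> N 1;; [V vk \<oplus> N 4] \<leftarrow> V vAP;; tB \<leftarrow> V rTB \<oplus> N 2 \<otimes> (N 1 \<lless> V rW);; oB \<leftarrow> V vAP;; oC \<leftarrow> V rW;; pass;; seg2)"
  have rest3: "wp w after3 Q \<rho>3 M3 \<tau>3"
    if r3: "\<And>x. x < 60 \<Longrightarrow> x \<noteq> 31 \<Longrightarrow> x \<noteq> 32 \<Longrightarrow> \<rho>3 x = \<rho> x" "\<rho>3 vAP = ap2" "\<rho>3 vOP = op1" "\<rho>3 cN = cn i"
      "\<rho>3 oA = ap2 + f * cn ?r div W" "\<rho>3 oF = f * cn ?r mod W"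
      and ap2: "ap \<le> ap2" "ap2 \<le> ap + cn ?l div t + 3" and op1: "op \<le> op1" "op1 \<le> op + cn i div w + 2"
      and fr: "frame {3, 4, 10} {AB..} M M3" and fa: "\<And>a. AB \<le> a \<Longrightarrow> a < ap \<or> OP0 \<le> a \<and> a < op \<Longrightarrow> M3 a = M a"
      and fc: "\<And>k c. k < nn \<Longrightarrow> c < 16 \<Longrightarrow> (k = i \<longrightarrow> c \<noteq> 10) \<Longrightarrow> (k = ?l \<or> k = ?r \<longrightarrow> c \<noteq> 4) \<Longrightarrow> M3 (nod k c) = M (nod k c)"
      and bi: "bm M3 op1 i" and ll: "lst J M3 ap2 ?l" and rr: "M3 (nod ?r 4) = ap2"
      "holds W M3 ap2 (f * cn ?r) (pack f (zl J ?r))" and \<tau>3: "\<tau>3 \<le> \<tau> + 300 * (cn i div t + 2) + 120"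
    for \<rho>3 M3 \<tau>3 ap2 op1
  proof -
    define M4 where "M4 = M3(nod ?r 3 := cn ?r, nod ?l 3 := cn ?l)"
    \<comment> \<open>Every full cell accounts for \<open>t\<close> codes and every \<open>f\<close>
      bits of the offset for one more. This is exact because the right branch gets no
      padding.\<close>
    have vy: "f * cn ?r div W * t + f * cn ?r mod W div f = cn ?r"
      unfolding cell_index using f_pos by simp
    have M4r: "M4 a = M3 a" if "AB \<le> a" for a using dis[OF _ _ that] kn by (simp add: M4_def)
    have M4c: "M4 (nod k c) = M3 (nod k c)" if "c < 16" "k = ?l \<or> k = ?r \<longrightarrow> c \<noteq> 3" for k c
      using that by (auto simp: M4_def)
    define ap3 where "ap3 = ap2 + f * cn ?r div W + 1"
    have Q': "Q \<rho>' M4 \<tau>'" if "\<rho>' vAP = ap3" "\<rho>' vOP = op1" "\<tau>' \<le> \<tau>3 + 30"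
      "\<And>x. x < 60 \<Longrightarrow> x \<noteq> 31 \<Longrightarrow> x \<noteq> 32 \<Longrightarrow> x \<noteq> 51 \<Longrightarrow> \<rho>' x = \<rho> x" for \<rho>' \<tau>'
    proof (rule Q[OF that(1,2,4)])
      show "ap \<le> ap3" "ap3 \<le> ap + cn ?l div t + cn ?r div t + 6"
        using ap2 unfolding ap3_def cell_index by linarith+
      show "op \<le> op1" "op1 \<le> op + cn i div w + 2" by (fact op1)+
      show "frame {3, 4, 10} {AB..} M M4" unfolding M4_def by (intro frame_cell fr kn) auto
      show "M4 a = M a" if "AB \<le> a" "a < ap \<or> OP0 \<le> a \<and> a < op" for a using fa[OF that] M4r that by simp
      show "M4 (nod k c) = M (nod k c)"
        if "k < nn" "c < 16" "k = i \<longrightarrow> c \<noteq> 10" "k = ?l \<or> k = ?r \<longrightarrow> c \<noteq> 3 \<and> c \<noteq> 4" for k c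
        using that fc[of k c] M4c[of c k] by auto
      show "bm M4 op1 i"
        by (rule bm_cong[OF bi]) (use M4c[of 10 i] M4r regions in auto)
      have "lst J M4 ap3 ?l"
        by (rule lst_cong[OF ll]) (use M4c[of 4 ?l] M4r in \<open>auto simp: ap3_def\<close>)
      moreover have "lst J M3 ap3 ?r"
        unfolding lst_def rr(1) using rr(2) ap2(1) bap(1) ceil_le[of t "cn ?r" 0] t(1)
        by (simp add: ap3_def cell_index)
      then have "lst J M4 ap3 ?r"
        by (rule lst_cong) (use M4c[of 4 ?r] M4r in auto)
      moreover have "M4 (nod ?l 3) = cn ?l" "M4 (nod ?r 3) = cn ?r" by (simp_all add: M4_def)
      ultimately show "M4 (nod k 3) = cn k \<and> lst J M4 ap3 k" if "k = ?l \<or> k = ?r" for k using that by auto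
      show "\<tau>' \<le> \<tau> + 300 * (cn i div t + 2) + 150" using that \<tau>3 by linarith
    qed
    have b: "ap2 + f * cn ?r div W + 1 < 2 ^ w" using ap2 bap OPw unfolding cell_index by linarith
    have b2: "f * cn ?r div W * t < 2 ^ w" "cn ?r < 2 ^ w" "cn i < 2 ^ w"
      using vy csum cnt by linarith+
    have v: "\<rho>3 rt = t" "\<rho>3 rf = f" "\<rho>3 vk = nod ?l 0" using r3(1) RR \<rho> by simp_all
    have e: "cn i - cn ?r = cn ?l" "cn ?r \<le> cn i" using csum by simp_all
    have b1: "ap2 + f * cn ?r div W < 2 ^ w" "Suc (ap2 + f * cn ?r div W) < 2 ^ w" using b by simp_all
    show ?thesis unfolding after3_def
      by (simp add: r3 v vy b1 b2 e cw kn const_bound, intro Q'[unfolded M4_def ap3_def], simp_all add: r3)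
  qed
  have pass3: "wp w seg3 Q \<rho>2 M2 \<tau>2"
    if r2: "\<And>x. x < 60 \<Longrightarrow> x \<noteq> 31 \<Longrightarrow> x \<noteq> 32 \<Longrightarrow> \<rho>2 x = \<rho> x" "\<rho>2 vAP = ap2" "\<rho>2 vOP = op1" "\<rho>2 cN = cn i" "\<rho>2 sB = src"
      and ap2: "ap \<le> ap2" "ap2 \<le> ap + cn ?l div t + 3" and op1: "op \<le> op1" "op1 \<le> op + cn i div w + 2"
      and fr: "frame {3, 4, 10} {AB..} M M2" and fa: "\<And>a. AB \<le> a \<Longrightarrow> a < ap \<or> OP0 \<le> a \<and> a < op \<Longrightarrow> M2 a = M a"
      and fc: "\<And>k c. k < nn \<Longrightarrow> c < 16 \<Longrightarrow> (k = i \<longrightarrow> c \<noteq> 10) \<Longrightarrow> (k = ?l \<or> k = ?r \<longrightarrow> c \<noteq> 4) \<Longrightarrow> M2 (nod k c) = M (nod k c)"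
      and bi: "bm M2 op1 i" and ll: "lst J M2 ap2 ?l" and \<tau>2: "\<tau>2 \<le> \<tau> + 200 * (cn i div t + 2) + 80"
    for \<rho>2 M2 \<tau>2 ap2 op1
  proof -
    define M2' where "M2' = M2(nod ?r 4 := ap2)"
    have M2r: "M2' a = M2 a" if "AB \<le> a" for a using dis[OF _ _ that] kn by (simp add: M2'_def)
    have M2c: "M2' (nod k c) = M2 (nod k c)" if "c < 16" "k \<noteq> ?r \<or> c \<noteq> 4" for k c
      using that by (auto simp: M2'_def)
    have fr': "frame {3, 4, 10} {AB..} M M2'" unfolding M2'_def by (intro frame_cell fr kn) auto
    have S2: "static_ok M2'" by (rule static_frame[OF S fr']) auto
    have src2: "holds (t * f) M2' src (f * length (zl J i)) (pack f (zl J i))"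
      unfolding length_zl W_def[symmetric]
      by (rule holds_cong[OF src(3)]) (use M2r fa src W_bound in \<open>simp_all add: ceil_cells[unfolded One_nat_def]\<close>)
    have P: "wp w pass (wp w after3 Q) \<rho>' M2' \<tau>'"
      if r': "\<And>x. x < 62 \<Longrightarrow> \<rho>' x = \<rho>2 x" "\<rho>' tB = TB + 4 * 2 ^ W" "\<rho>' oB = ap2" "\<rho>' oC = W" "\<tau>' \<le> \<tau>2 + 25" for \<rho>' \<tau>'
    proof (rule wp_pass[OF _ _ r'(2) _ _ r'(3,4) src2 fields_zl _ translator_branch[of f True] _ t(1) f_pos f_pos])
      show "\<rho>' sB = src" "\<rho>' cN = length (zl J i)" "\<rho>' rt = t" "\<rho>' rf = f"
        using r' r2 RR by simp_all
      show "table_ok M2' t f (TB + 4 * 2 ^ W) f (branch True) 0"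
        using S2 unfolding static_ok_def tables_ok_def W_def by simp
      show "(0::nat) \<le> 1" "f * t \<le> W" "W \<le> w" using W_bound by (simp_all add: W_def)
      show "src + (length (zl J i) + t - 1) div t \<le> ap2" using src ap2 by simp
      show "TB + 4 * 2 ^ W + 2 * 2 ^ (t * f) \<le> ap2" using tbl ap2 bap unfolding W_def by linarith
      show "length (zl J i) + t < 2 ^ w" using cnt by simp
      show "t * f < w" using W_less by (simp add: W_def)
      show "ap2 + length (zl J i) div t + 3 < 2 ^ w" using ap2 bap cdiv cle OPw by simp
      show "2 * w < 2 ^ w" by (rule w_double)
      fix \<rho>3 M3 \<tau>3 d
      assume a: "\<And>x. x < 63 \<Longrightarrow> \<rho>3 x = \<rho>' x"
        "\<rho>3 oA = ap2 + f * (length (branch True (zl J i)) + 0 * d) div W"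
        "\<rho>3 oF = f * (length (branch True (zl J i)) + 0 * d) mod W" "d \<le> t"
        "\<And>a. a < ap2 \<or> ap2 + f * (length (branch True (zl J i)) + 0 * d) div W < a \<Longrightarrow> M3 a = M2' a"
        "stream W M3 ap2 (f * (length (branch True (zl J i)) + 0 * d)) (pack f (branch True (zl J i)))"
        "\<tau>3 \<le> \<tau>' + 100 * (length (zl J i) div t + 2)"
      have len: "length (branch True (zl J i)) + 0 * d = cn ?r" using Z(3) by simp
      note a' = a[unfolded len, unfolded Z(3)]
      have in3: "M3 x = M2' x" if "x < ap2 \<or> OP0 \<le> x" for x
        using a'(5)[of x] that ap2 bap unfolding cell_index by linarith
      have c3: "M3 (nod k c) = M2' (nod k c)" if "k < nn" "c < 16" for k c
        using in3 cell_upper[OF that, of A] inr ap2 bap by simp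
      show "wp w after3 Q \<rho>3 M3 \<tau>3"
      proof (rule rest3[OF _ _ _ _ a'(2,3) ap2 op1])
        show "\<rho>3 x = \<rho> x" if "x < 60" "x \<noteq> 31" "x \<noteq> 32" for x using a(1) r'(1) r2(1) that by simp
        show "\<rho>3 vAP = ap2" "\<rho>3 vOP = op1" "\<rho>3 cN = cn i" using a(1) r'(1) r2 by simp_all
        have "frame {3, 4, 10} {AB..} M2' M3"
          unfolding frame_def using c3 in3 inr ap2 bap by auto
        then show "frame {3, 4, 10} {AB..} M M3" using fr' frame_trans by blast
        show "M3 x = M x" if "AB \<le> x" "x < ap \<or> OP0 \<le> x \<and> x < op" for x
          using in3[of x] M2r[of x] fa[of x] that ap2 by auto
        show "M3 (nod k c) = M (nod k c)"
          if "k < nn" "c < 16" "k = i \<longrightarrow> c \<noteq> 10" "k = ?l \<or> k = ?r \<longrightarrow> c \<noteq> 4" for k c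
          using c3[OF that(1,2)] M2c[of c k] fc[OF that] that by auto
        show "bm M3 op1 i"
          by (rule bm_cong[OF bi]) (use c3[OF i(1), of 10] M2c[of 10 i] in3 M2r regions in auto)
        show "lst J M3 ap2 ?l"
          by (rule lst_cong[OF ll]) (use c3[OF kn(1), of 4] M2c[of 4 ?l] in3 M2r in auto)
        show "M3 (nod ?r 4) = ap2" using c3[OF kn(2), of 4] by (simp add: M2'_def)
        show "holds W M3 ap2 (f * cn ?r) (pack f (zl J ?r))" using a'(6) by (simp add: stream_def)
        show "\<tau>3 \<le> \<tau> + 300 * (cn i div t + 2) + 120" using a(7) r'(5) \<tau>2 by simp
      qed
    qed
    have v: "\<rho>2 rTB = TB" "\<rho>2 rW = W" "\<rho>2 vk = nod ?l 0" using r2(1) RR \<rho> by simp_all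
    show ?thesis unfolding seg3_def
      using P[unfolded M2'_def]
      by (simp add: r2 v tw Wp cw kn const_bound)
  qed
  have pass2: "wp w full2 Q \<rho>1 M1 \<tau>1"
    if r1: "\<And>x. x < 60 \<Longrightarrow> \<rho>1 x = \<rho> x" "\<rho>1 cN = cn i" "\<rho>1 sB = src" "\<rho>1 oA + 1 = op1"
      and op1: "op \<le> op1" "op1 \<le> op + cn i div w + 2"
      and fr: "frame {3, 4, 10} {AB..} M M1" and fa: "\<And>a. AB \<le> a \<Longrightarrow> a < op \<Longrightarrow> M1 a = M a"
      and fc: "\<And>k c. k < nn \<Longrightarrow> c < 16 \<Longrightarrow> (k = i \<longrightarrow> c \<noteq> 10) \<Longrightarrow> M1 (nod k c) = M (nod k c)"
      and bi: "bm M1 op1 i" and \<tau>1: "\<tau>1 \<le> \<tau> + 100 * (cn i div t + 2) + 40"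
    for \<rho>1 M1 \<tau>1 op1
  proof -
    define M1' where "M1' = M1(nod ?l 4 := ap)"
    have M1r: "M1' a = M1 a" if "AB \<le> a" for a using dis[OF _ _ that] kn by (simp add: M1'_def)
    have M1c: "M1' (nod k c) = M1 (nod k c)" if "c < 16" "k \<noteq> ?l \<or> c \<noteq> 4" for k c
      using that by (auto simp: M1'_def)
    have fr': "frame {3, 4, 10} {AB..} M M1'" unfolding M1'_def by (intro frame_cell fr kn) auto
    have S1: "static_ok M1'" by (rule static_frame[OF S fr']) auto
    have apOP: "ap < op" using bap bop by linarith
    have src1: "holds (t * f) M1' src (f * length (zl J i)) (pack f (zl J i))"
      unfolding length_zl W_def[symmetric]
      by (rule holds_cong[OF src(3)]) (use M1r fa src W_bound apOP in \<open>simp_all add: ceil_cells[unfolded One_nat_def]\<close>)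
    have P: "wp w pass (wp w seg2 Q) \<rho>' M1' \<tau>'"
      if r': "\<And>x. x < 62 \<Longrightarrow> x \<noteq> 32 \<Longrightarrow> \<rho>' x = \<rho>1 x" "\<rho>' vOP = op1" "\<rho>' tB = TB + 2 * 2 ^ W" "\<rho>' oB = ap" "\<rho>' oC = W" "\<tau>' \<le> \<tau>1 + 25" for \<rho>' \<tau>'
    proof (rule wp_pass[OF _ _ r'(3) _ _ r'(4,5) src1 fields_zl _ translator_branch[of f False] _ t(1) f_pos f_pos])
      show "\<rho>' sB = src" "\<rho>' cN = length (zl J i)" "\<rho>' rt = t" "\<rho>' rf = f"
        using r' r1 RR by simp_all
      show "table_ok M1' t f (TB + 2 * 2 ^ W) f (branch False) 1"
        using S1 unfolding static_ok_def tables_ok_def W_def by simp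
      show "(1::nat) \<le> 1" "f * t \<le> W" "W \<le> w" using W_bound by (simp_all add: W_def)
      show "src + (length (zl J i) + t - 1) div t \<le> ap" using src by simp
      show "TB + 2 * 2 ^ W + 2 * 2 ^ (t * f) \<le> ap" using tbl bap unfolding W_def by linarith
      show "length (zl J i) + t < 2 ^ w" using cnt by simp
      show "t * f < w" using W_less by (simp add: W_def)
      show "ap + length (zl J i) div t + 3 < 2 ^ w" using bap cdiv cle OPw by simp
      show "2 * w < 2 ^ w" by (rule w_double)
      fix \<rho>2 M2 \<tau>2 d
      assume a: "\<And>x. x < 63 \<Longrightarrow> \<rho>2 x = \<rho>' x"
        "\<rho>2 oA = ap + f * (length (branch False (zl J i)) + 1 * d) div W"
        "\<rho>2 oF = f * (length (branch False (zl J i)) + 1 * d) mod W" "d \<le> t"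
        "\<And>a. a < ap \<or> ap + f * (length (branch False (zl J i)) + 1 * d) div W < a \<Longrightarrow> M2 a = M1' a"
        "stream W M2 ap (f * (length (branch False (zl J i)) + 1 * d)) (pack f (branch False (zl J i)))"
        "\<tau>2 \<le> \<tau>' + 100 * (length (zl J i) div t + 2)"
      have len: "length (branch False (zl J i)) + 1 * d = cn ?l + d" using Z(2) by simp
      note a' = a[unfolded len, unfolded Z(2) cell_index]
      \<comment> \<open>Counted from the padded end of the left list, so that the right list starts
        in a cell of its own. As \<open>d \<le> t\<close>, the padding costs at most one additional
        cell.\<close>
      define ap2 where "ap2 = ap + (cn ?l + d) div t + 1"
      have "(cn ?l + d) div t \<le> (cn ?l + t) div t" using a(4) by (intro div_le_mono) simp
      then have ap2: "ap \<le> ap2" "ap2 \<le> ap + cn ?l div t + 3" "ap2 \<le> OP0"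
        using t(1) bap by (simp_all add: ap2_def)
      have in2: "M2 x = M1' x" if "x < ap \<or> ap2 \<le> x" for x
        using a'(5)[of x] that unfolding ap2_def by linarith
      have c2: "M2 (nod k c) = M1' (nod k c)" if "k < nn" "c < 16" for k c
        using in2 cell_upper[OF that, of A] inr bap by simp
      have w2: "ap2 < 2 ^ w" using ap2 OPw by linarith
      have A': "wp w seg3 Q (\<rho>2(vAP := ap2)) M2 \<tau>2'"
        if "\<tau>2' \<le> \<tau>2 + 4" for \<tau>2'
      proof (rule pass3[OF _ _ _ _ _ ap2(1,2) op1])
        show "(\<rho>2(vAP := ap2)) x = \<rho> x" if "x < 60" "x \<noteq> 31" "x \<noteq> 32" for x
          using a(1) r'(1) r1(1) that by simp
        show "(\<rho>2(vAP := ap2)) vAP = ap2" by simp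
        show "(\<rho>2(vAP := ap2)) vOP = op1" "(\<rho>2(vAP := ap2)) cN = cn i" "(\<rho>2(vAP := ap2)) sB = src"
          using a(1) r' r1 by simp_all
        have "frame {3, 4, 10} {AB..} M1' M2"
          unfolding frame_def using c2 in2 inr bap by auto
        then show "frame {3, 4, 10} {AB..} M M2" using fr' frame_trans by blast
        show "M2 x = M x" if "AB \<le> x" "x < ap \<or> OP0 \<le> x \<and> x < op" for x
          using in2[of x] M1r[of x] fa[of x] that apOP ap2 by auto
        show "M2 (nod k c) = M (nod k c)"
          if "k < nn" "c < 16" "k = i \<longrightarrow> c \<noteq> 10" "k = ?l \<or> k = ?r \<longrightarrow> c \<noteq> 4" for k c
          using c2[OF that(1,2)] M1c[of c k] fc[OF that(1-3)] that by auto
        show "bm M2 op1 i"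
          by (rule bm_cong[OF bi]) (use c2[OF i(1), of 10] M1c[of 10 i] in2 M1r regions ap2 in auto)
        have "M2 (nod ?l 4) = ap" using c2[OF kn(1), of 4] by (simp add: M1'_def)
        moreover have "holds W M2 ap (f * cn ?l) (pack f (zl J ?l))"
          using a'(6) holds_mono[of W M2 ap "f * (cn ?l + d)" _ "f * cn ?l"] by (simp add: stream_def)
        ultimately show "lst J M2 ap2 ?l"
          unfolding lst_def using bap(1) ceil_le[of t "cn ?l" d] t(1) by (simp add: ap2_def)
        show "\<tau>2' \<le> \<tau> + 200 * (cn i div t + 2) + 80" using a(7) r'(6) \<tau>1 that by simp
      qed
      have o: "\<rho>2 oA = ap + (cn ?l + d) div t" by (rule a'(2))
      have w3: "Suc (ap + (cn ?l + d) div t) = ap2" by (simp add: ap2_def)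
      show "wp w seg2 Q \<rho>2 M2 \<tau>2"
        unfolding seg2_def using A' w2 w3 by (simp add: o const_bound)
    qed
    have v: "\<rho>1 rTB = TB" "\<rho>1 rW = W" "\<rho>1 vk = nod ?l 0" "\<rho>1 vAP = ap" using r1(1) RR \<rho> by simp_all
    have ow: "op1 < 2 ^ w"
    proof -
      have "cn i div w \<le> m" using cle div_le_dividend[of "cn i" w] by linarith
      then show ?thesis using op1 bop by linarith
    qed
    have r1': "Suc (\<rho>1 oA) = op1" using r1(4) by simp
    show ?thesis unfolding full2_def
      using P[unfolded M1'_def]
      by (simp add: r1(2,3) r1' v tw Wp cw kn const_bound ow)
  qed
  define M' where "M' = M(nod i 10 := op)"
  have Mr: "M' a = M a" if "AB \<le> a" for a using dis[OF _ _ that] i by (simp add: M'_def)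
  have Mc: "M' (nod k c) = M (nod k c)" if "c < 16" "k \<noteq> i \<or> c \<noteq> 10" for k c
    using that by (auto simp: M'_def)
  have fr': "frame {3, 4, 10} {AB..} M M'" unfolding M'_def by (intro frame_cell frame_refl i) auto
  have S': "static_ok M'" by (rule static_frame[OF S fr']) auto
  have ABop: "AB \<le> op" "ap \<le> op" using bap bop by linarith+
  have src0: "holds (t * f) M' src (f * length (zl J i)) (pack f (zl J i))"
    unfolding length_zl W_def[symmetric]
    by (rule holds_cong[OF src(3)]) (use Mr src W_bound in \<open>simp_all add: ceil_cells[unfolded One_nat_def]\<close>)
  have P: "wp w pass (wp w full2 Q) \<rho>' M' \<tau>'"
    if r': "\<And>x. x < 60 \<Longrightarrow> \<rho>' x = \<rho> x" "\<rho>' sB = src" "\<rho>' cN = cn i" "\<rho>' tB = TB" "\<rho>' oB = op" "\<rho>' oC = w" "\<tau>' \<le> \<tau> + 30" for \<rho>' \<tau>'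
  proof (rule wp_pass[OF r'(2) _ r'(4) _ _ r'(5,6) src0 fields_zl _ translator_low_bits _ t(1) f_pos])
    show "\<rho>' cN = length (zl J i)" "\<rho>' rt = t" "\<rho>' rf = f" using r' RR by simp_all
    show "table_ok M' t f TB 1 low_bits 1"
      using S' unfolding static_ok_def tables_ok_def by simp
    show "(1::nat) \<le> 1" "(0::nat) < 1" "1 * t \<le> w" "w \<le> w" using t_less_w by simp_all
    show "src + (length (zl J i) + t - 1) div t \<le> op" using src ABop by simp
    show "TB + 2 * 2 ^ (t * f) \<le> op" using tbl ABop unfolding W_def by linarith
    show "length (zl J i) + t < 2 ^ w" using cnt by simp
    show "t * f < w" using W_less by (simp add: W_def)
    show "op + length (zl J i) div t + 3 < 2 ^ w" using bop cle by simp
    show "2 * w < 2 ^ w" by (rule w_double)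
    fix \<rho>1 M1 \<tau>1 d
    assume a: "\<And>x. x < 63 \<Longrightarrow> \<rho>1 x = \<rho>' x"
      "\<rho>1 oA = op + 1 * (length (low_bits (zl J i)) + 1 * d) div w"
      "\<rho>1 oF = 1 * (length (low_bits (zl J i)) + 1 * d) mod w" "d \<le> t"
      "\<And>a. a < op \<or> op + 1 * (length (low_bits (zl J i)) + 1 * d) div w < a \<Longrightarrow> M1 a = M' a"
      "stream w M1 op (1 * (length (low_bits (zl J i)) + 1 * d)) (pack 1 (low_bits (zl J i)))"
      "\<tau>1 \<le> \<tau>' + 100 * (length (zl J i) div t + 2)"
    have len: "1 * (length (low_bits (zl J i)) + 1 * d) = cn i + d" by simp
    note a' = a[unfolded len, unfolded Z(1)]
    define op1 where "op1 = op + (cn i + d) div w + 1"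
    have w0: "0 < w" using w20 by simp
    have "(cn i + d) div w \<le> (cn i + w) div w" using a(4) t_less_w by (intro div_le_mono) simp
    then have op1: "op \<le> op1" "op1 \<le> op + cn i div w + 2" using w0 by (simp_all add: op1_def)
    have c1: "M1 (nod k c) = M' (nod k c)" if "k < nn" "c < 16" for k c
      using a'(5) cell_upper[OF that, of A] inr ABop by simp
    show "wp w full2 Q \<rho>1 M1 \<tau>1"
    proof (rule pass2[OF _ _ _ _ op1])
      show "\<rho>1 x = \<rho> x" if "x < 60" for x using a(1) r'(1) that by simp
      show "\<rho>1 cN = cn i" "\<rho>1 sB = src" using a(1) r' by simp_all
      show "\<rho>1 oA + 1 = op1" using a'(2) by (simp add: op1_def)
      have "frame {3, 4, 10} {AB..} M' M1"
        unfolding frame_def using c1 a'(5) inr ABop by auto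
      then show "frame {3, 4, 10} {AB..} M M1" using fr' frame_trans by blast
      show "M1 x = M x" if "AB \<le> x" "x < op" for x using a'(5)[of x] Mr that by simp
      show "M1 (nod k c) = M (nod k c)" if "k < nn" "c < 16" "k = i \<longrightarrow> c \<noteq> 10" for k c
        using c1[OF that(1,2)] Mc[of c k] that by auto
      have "M1 (nod i 10) = op" using c1[OF i(1), of 10] by (simp add: M'_def)
      moreover have "holds w M1 op (cn i) (pack 1 (bits i))"
        using a'(6) holds_mono[of w M1 op "cn i + d" _ "cn i"] by (simp add: stream_def)
      ultimately show "bm M1 op1 i"
        unfolding bm_def using bop(1) ceil_le[of w "cn i" d] w0 by (simp add: op1_def)
      show "\<tau>1 \<le> \<tau> + 100 * (cn i div t + 2) + 40" using a(7) r'(7) by simp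
    qed
  qed
  have mi: "M (nod i 4) = src" by (simp add: src_def)
  have sp: "split = ([V vp \<oplus> N 10] \<leftarrow> V vOP;; sB \<leftarrow> Ld (V vp \<oplus> N 4);; cN \<leftarrow> Ld (V vp \<oplus> N 3);;
     tB \<leftarrow> V rTB;; oB \<leftarrow> V vOP;; oC \<leftarrow> V rw;; pass;; full2)"
    unfolding split_def full2_def seg2_def seg3_def after3_def by (rule refl)
  show ?thesis unfolding sp
    using P[unfolded M'_def] by (simp add: \<rho> RR ci mi cw i const_bound)
qed

end

section \<open>Storage and time, summed level by level\<close>

lemma sum_fibres:
  fixes u :: "'a \<Rightarrow> nat"
  assumes "finite K" "finite D" "\<And>k. k \<in> K \<Longrightarrow> d k \<in> D" "\<And>y. y \<in> D \<Longrightarrow> (\<Sum>k | k \<in> K \<and> d k = y. u k) \<le> c"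
  shows "sum u K \<le> card D * c"
proof -
  have "sum u K = (\<Sum>y\<in>D. \<Sum>k | k \<in> K \<and> d k = y. u k)"
    using assms by (intro sum.group[symmetric]) auto
  also have "\<dots> \<le> (\<Sum>y\<in>D. c)" by (intro sum_mono assms)
  finally show ?thesis by simp
qed

lemma wp_Sq_fun: "wp w (a ;; b) Q = wp w a (wp w b Q)"
  by (intro ext) simp

lemma height_less: "height T < node_count T"
  by (induction T) auto

context layout_bound
begin

text \<open>The nodes that own a list once the first \<open>i\<close> nodes have been swept. Level
  \<open>J + f\<close> is included: its lists carry no further bits, but they come with the counts
  for the next round.\<close>

definition "D J i = {k. k < nn \<and> (dep T k = J \<or> J < dep T k \<and> dep T k \<le> J + f \<and> par T k < i)}"
text \<open>The inner nodes with a finished bitmask: those of all earlier rounds, and those of the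
  current round that the sweep has passed.\<close>

definition "Bs J i = {k. k < nn \<and> inner (nd T k) \<and> (dep T k < J \<or> k < i \<and> dep T k < J + f)}"
definition "asz k = cn k div t + 3"
definition "osz k = cn k div w + 2"
text \<open>Three passes at 100 steps per word, that is \<open>300 * (cn k div t + 2) + 150\<close>,
  the bound delivered by \<open>wp_split\<close>.\<close>

definition "tt k = 300 * (cn k div t) + 750"
definition "Rg J i = {k. k < i \<and> J \<le> dep T k \<and> dep T k < J + f}"

lemma finite_sets [simp]: "finite (D J i)" "finite (Bs J i)" "finite (Rg J i)"
  by (auto simp: D_def Bs_def Rg_def)

lemma card_nodes: "K \<subseteq> {..<nn} \<Longrightarrow> card K \<le> nn"
  using card_mono[of "{..<nn}" K] by simp

lemma level_sum_div: "(\<Sum>k | k \<in> K \<and> dep T k = d. cn k div c) \<le> m div c" if "K \<subseteq> {..<nn}"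
proof -
  have f: "finite {k. k \<in> K \<and> dep T k = d}" using that finite_subset by fastforce
  have "(\<Sum>k | k \<in> K \<and> dep T k = d. cn k div c) \<le> (\<Sum>k | k \<in> K \<and> dep T k = d. cn k) div c"
    by (rule sum_div_le[OF f])
  also have "\<dots> \<le> m div c" using that by (intro div_le_mono level_sum[where d = d]) auto
  finally show ?thesis .
qed

text \<open>The round concerns \<open>f + 1 \<le> 2 * t\<close> levels, and each of them fills at
  most \<open>m div t\<close> cells apart from rounding. The bound is linear and does not depend on
  \<open>J\<close>, so all rounds can use the same region.\<close>

lemma asum_le: "sum asz (D J i) \<le> 2 * m + 6 * \<sigma>"
proof -
  have sub: "D J i \<subseteq> {..<nn}" by (auto simp: D_def)
  have "sum asz (D J i) = (\<Sum>k\<in>D J i. cn k div t) + 3 * card (D J i)"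
    by (simp add: asz_def sum.distrib)
  also have "(\<Sum>k\<in>D J i. cn k div t) \<le> card {J..J + f} * (m div t)"
    by (rule sum_fibres[where d = "dep T"]) (use level_sum_div[OF sub] in \<open>auto simp: D_def\<close>)
  also have "card {J..J + f} * (m div t) \<le> (2 * t) * (m div t)"
    using f_le(1) t(1) by (intro mult_le_mono1) simp
  also have "\<dots> \<le> 2 * m" by simp
  also have "card (D J i) \<le> nn" by (rule card_nodes[OF sub])
  finally show ?thesis using nn_eq by simp
qed

lemma dep_le_h: "k < nn \<Longrightarrow> dep T k \<le> h"
  unfolding h_def by (rule dep_le_height)

lemma dep_inner: "k < nn \<Longrightarrow> inner (nd T k) \<Longrightarrow> dep T k < h"
  using height_nd[of k T] unfolding h_def by (auto simp: inner_def)

text \<open>Division is superadditive, so the full words of all bitmasks together are bounded by the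
  \<open>h * m\<close> bits of \<open>h\<close> levels; rounding costs two cells per node.\<close>

lemma osum_le: "sum osz (Bs J i) \<le> (h * m) div w + 4 * \<sigma>"
proof -
  have sub: "Bs J i \<subseteq> {..<nn}" by (auto simp: Bs_def)
  have "sum osz (Bs J i) = (\<Sum>k\<in>Bs J i. cn k div w) + 2 * card (Bs J i)"
    unfolding osz_def sum.distrib by simp
  also have "(\<Sum>k\<in>Bs J i. cn k div w) \<le> (\<Sum>k\<in>Bs J i. cn k) div w" by (rule sum_div_le) simp
  also have "(\<Sum>k\<in>Bs J i. cn k) \<le> card {..<h} * m"
  proof (rule sum_fibres[where d = "dep T"])
    show "(\<Sum>k | k \<in> Bs J i \<and> dep T k = y. cn k) \<le> m" for y
      by (rule level_sum[where d = y]) (auto simp: Bs_def)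
  qed (use dep_inner in \<open>auto simp: Bs_def\<close>)
  then have "(\<Sum>k\<in>Bs J i. cn k) div w \<le> (h * m) div w" by (intro div_le_mono) simp
  also have "card (Bs J i) \<le> nn" by (rule card_nodes[OF sub])
  finally show ?thesis using nn_eq by simp
qed

lemma tsum_le: "sum tt {..<nn} \<le> 600 * h * (m div t) + 1500 * \<sigma>"
proof -
  have "sum tt {..<nn} = 300 * (\<Sum>k<nn. cn k div t) + 750 * nn"
    by (simp add: tt_def sum.distrib sum_distrib_left)
  also have "(\<Sum>k<nn. cn k div t) \<le> card {..h} * (m div t)"
    by (rule sum_fibres[where d = "dep T"]) (use level_sum_div[of "{..<nn}"] dep_le_h in auto)
  also have "card {..h} * (m div t) \<le> 2 * h * (m div t)" using h_pos by (intro mult_le_mono1) simp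
  finally show ?thesis using nn_eq by simp
qed

lemma h_le: "h < nn"
  unfolding h_def by (rule height_less)

definition "prepared J i M ap \<longleftrightarrow> (\<forall>k \<in> D J i. M (nod k 3) = cn k \<and> lst J M ap k)"

text \<open>The free addresses are only bounded by sums over finished nodes: the amount of padding
  is not determined by the specification of a pass, so neither is the exact end of the
  output.\<close>

lemma wp_split_body:
  assumes R: "regs_ok \<rho>" and S: "static_ok M" and i: "i < nn" and J: "J < h"
    and \<rho>: "\<rho> vp = nod i 0" "\<rho> vJ = J" "\<rho> vAP = ap" "\<rho> vOP = op"
    and prep: "prepared J i M ap" and bms: "\<forall>k \<in> Bs J i. bm M op k"
    and ap: "AB \<le> ap" "ap \<le> AB + sum asz (D J i)" and op: "OP0 \<le> op" "op \<le> OP0 + sum osz (Bs J i)"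
    and Q: "\<And>\<rho>' M' \<tau>' ap' op'. \<lbrakk>\<rho>' vp = nod (Suc i) 0; \<rho>' vAP = ap'; \<rho>' vOP = op';
      \<And>x. x < 45 \<Longrightarrow> x \<noteq> 31 \<Longrightarrow> x \<noteq> 32 \<Longrightarrow> \<rho>' x = \<rho> x; prepared J (Suc i) M' ap'; \<forall>k \<in> Bs J (Suc i). bm M' op' k;
      AB \<le> ap'; ap' \<le> AB + sum asz (D J (Suc i)); OP0 \<le> op'; op' \<le> OP0 + sum osz (Bs J (Suc i));
      frame {3, 4, 10} {AB..} M M'; \<tau>' \<le> \<tau> + 40 + sum tt (Rg J (Suc i) - Rg J i)\<rbrakk> \<Longrightarrow> Q \<rho>' M' \<tau>'"
  shows "wp w split_body Q \<rho> M \<tau>"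
proof -
  note RR = regs_okD[OF R]
  have rec: "record_ok T A M i" using S i by (simp add: static_ok_def)
  then have r2: "M (nod i 2) = dep T i" by (simp add: record_ok_def)
  have cw: "nod k c < 2 ^ w" if "k \<le> nn" "c < 32" for k c by (rule node_bound[OF that])
  have Jf: "J + f < 2 ^ w" using J f_le(2) h_le nn_eq regions(5) bound mem_end_ge unfolding add_mult_distrib2 by linarith
  show ?thesis
  proof (cases "inner (nd T i) \<and> J \<le> dep T i \<and> dep T i < J + f")
    case False
    have D: "D J (Suc i) = D J i"
    proof -
      have "par T k \<noteq> i" if "k < nn" "J < dep T k" "dep T k \<le> J + f" for k
      proof
        assume p: "par T k = i"
        have "0 < k" using that by (auto intro!: gr0I)
        then have "inner (nd T i)" "dep T k = Suc (dep T i)" using par_props(2)[of k T] dep_par[of k T] that p by auto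
        then show False using False that by simp
      qed
      then show ?thesis unfolding D_def by (auto simp: less_Suc_eq)
    qed
    have B: "Bs J (Suc i) = Bs J i" unfolding Bs_def using False by (auto simp: less_Suc_eq)
    have Q': "Q \<rho>' M \<tau>'" if "\<rho>' vp = nod (Suc i) 0" "\<rho>' vAP = ap" "\<rho>' vOP = op"
      "\<And>x. x < 45 \<Longrightarrow> x \<noteq> 31 \<Longrightarrow> x \<noteq> 32 \<Longrightarrow> \<rho>' x = \<rho> x" "\<tau>' \<le> \<tau> + 40" for \<rho>' \<tau>'
      by (rule Q[OF that(1-4)]) (use prep bms ap op that(5) in \<open>simp_all add: D B prepared_def\<close>)
    show ?thesis
    proof (cases "nd T i")
      case (Lf a)
      have Mk: "M (nod i (Suc 0)) = 0" using rec Lf by (simp add: record_ok_def)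
      show ?thesis unfolding split_body_def
        by (simp add: \<rho> RR r2 Mk cw[OF less_imp_le[OF i]] cw[OF Suc_leI[OF i]] const_bound, intro Q', simp_all add: \<rho>)
    next
      case (Nd l r)
      have Mk: "M (nod i (Suc 0)) = nod (kid T i) 0" using rec Nd by (simp add: record_ok_def)
      consider "dep T i < J" | "\<not> dep T i < J" "\<not> dep T i < J + f" using False Nd by auto
      then show ?thesis
      proof cases
        case 1
        then show ?thesis unfolding split_body_def
          by (simp add: \<rho> RR r2 Mk nod_pos cw[OF less_imp_le[OF i]] cw[OF Suc_leI[OF i]] const_bound,
              intro Q', simp_all add: \<rho>)
      next
        case 2
        then show ?thesis unfolding split_body_def
          by (simp add: \<rho> RR r2 Mk nod_pos Jf cw[OF less_imp_le[OF i]] cw[OF Suc_leI[OF i]] const_bound,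
              intro Q', simp_all add: \<rho>)
      qed
    qed
  next
    case True
    then obtain l r where Nd: "nd T i = Nd l r" by (auto simp: inner_def)
    let ?l = "kid T i" and ?r = "Suc (kid T i)"
    note kk = kid_gt[OF i] kid_less[OF i Nd] nd_kid[OF i Nd]
    have par: "par T ?l = i" "par T ?r = i" using par_kid[OF i] Nd by auto
    have Mk: "M (nod i (Suc 0)) = nod ?l 0" using rec Nd by (simp add: record_ok_def)
    \<comment> \<open>A node strictly below level \<open>J\<close> received its list when its parent
      was split, earlier in the same sweep because the parent has a smaller index.\<close>
    have iD: "i \<in> D J i"
    proof (cases "dep T i = J")
      case False
      then have "0 < i" using True by (auto intro!: gr0I)
      then have "par T i < i" using par_props(1)[of i T] i by simp
      then show ?thesis using False True i by (simp add: D_def)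
    qed (simp add: D_def i)
    have Dk: "D J (Suc i) = insert ?l (insert ?r (D J i))" "?l \<notin> D J i" "?r \<notin> D J i"
    proof -
      have "k = ?l \<or> k = ?r" if "k < nn" "J < dep T k" "par T k = i" for k
      proof -
        have "0 < k" using that by (auto intro!: gr0I)
        then show ?thesis using par_props(3)[of k T] that by simp
      qed
      then show "D J (Suc i) = insert ?l (insert ?r (D J i))" unfolding D_def using kk par True by (auto simp: less_Suc_eq)
      show "?l \<notin> D J i" "?r \<notin> D J i" unfolding D_def using kk par True by auto
    qed
    have B: "Bs J (Suc i) = insert i (Bs J i)" "i \<notin> Bs J i" unfolding Bs_def using True i by (auto simp: less_Suc_eq)
    have Rgd: "sum tt (Rg J (Suc i) - Rg J i) = tt i"
    proof -
      have "Rg J (Suc i) - Rg J i = {i}" unfolding Rg_def using True by auto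
      then show ?thesis by simp
    qed
    have as: "sum asz (D J (Suc i)) = sum asz (D J i) + cn ?l div t + cn ?r div t + 6"
      using Dk by (simp add: asz_def)
    have os: "sum osz (Bs J (Suc i)) = sum osz (Bs J i) + cn i div w + 2"
      using B by (simp add: osz_def)
    have sp: "wp w split (wp w (vp \<leftarrow> V vp \<oplus> N 16) Q) \<rho>1 M \<tau>1"
      if r1: "\<rho>1 vk = nod ?l 0" "\<And>x. x < 46 \<Longrightarrow> \<rho>1 x = \<rho> x" "\<tau>1 \<le> \<tau> + 30" for \<rho>1 \<tau>1
    proof (rule wp_split[where i = i and l = l and r = r and J = J and ap = ap and op = op])
      show "static_ok M" "i < nn" "nd T i = Nd l r" "\<rho>1 vk = nod (kid T i) 0" by fact+
      show "regs_ok \<rho>1" by (rule regs_ok_cong[OF R]) (simp add: r1)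
      show "J \<le> dep T i" "dep T i < J + f" using True by auto
      show "\<rho>1 vp = nod i 0" "\<rho>1 vAP = ap" "\<rho>1 vOP = op" using r1(2) \<rho> by simp_all
      show "lst J M ap i" "M (nod i 3) = cn i" using prep iD by (auto simp: prepared_def)
      show "AB \<le> ap" "OP0 \<le> op" by fact+
      show "ap + cn ?l div t + cn ?r div t + 6 \<le> OP0"
        using asum_le[of J "Suc i"] as ap regions(5) unfolding add_mult_distrib2 by linarith
      show "op + m + 3 < 2 ^ w"
        using osum_le[of J i] op bound unfolding mem_end_def by linarith
      fix \<rho>2 M2 \<tau>2 ap' op'
      assume a: "\<rho>2 vAP = ap'" "\<rho>2 vOP = op'"
        "\<And>x. x < 60 \<Longrightarrow> x \<noteq> 31 \<Longrightarrow> x \<noteq> 32 \<Longrightarrow> x \<noteq> 51 \<Longrightarrow> \<rho>2 x = \<rho>1 x"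
        "ap \<le> ap'" "ap' \<le> ap + cn ?l div t + cn ?r div t + 6" "op \<le> op'" "op' \<le> op + cn i div w + 2"
        "frame {3, 4, 10} {AB..} M M2" "\<And>a. AB \<le> a \<Longrightarrow> a < ap \<or> OP0 \<le> a \<and> a < op \<Longrightarrow> M2 a = M a"
        "\<And>k c. k < nn \<Longrightarrow> c < 16 \<Longrightarrow> (k = i \<longrightarrow> c \<noteq> 10) \<Longrightarrow>
          (k = ?l \<or> k = ?r \<longrightarrow> c \<noteq> 3 \<and> c \<noteq> 4) \<Longrightarrow> M2 (nod k c) = M (nod k c)"
        "bm M2 op' i" "\<And>k. k = ?l \<or> k = ?r \<Longrightarrow> M2 (nod k 3) = cn k \<and> lst J M2 ap' k"
        "\<tau>2 \<le> \<tau>1 + 300 * (cn i div t + 2) + 150"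
      have "prepared J (Suc i) M2 ap'"
        unfolding prepared_def Dk(1)
      proof
        fix k assume k: "k \<in> insert ?l (insert ?r (D J i))"
        show "M2 (nod k 3) = cn k \<and> lst J M2 ap' k"
        proof (cases "k = ?l \<or> k = ?r")
          case False
          then have kD: "k \<in> D J i" using k by simp
          then have kn: "k < nn" by (simp add: D_def)
          have "M2 (nod k 3) = M (nod k 3)" "M2 (nod k 4) = M (nod k 4)" using False kn by (intro a(10); simp)+
          moreover have "lst J M2 ap' k"
            by (rule lst_cong[of J M ap]) (use prep kD calculation a(4,9) in \<open>auto simp: prepared_def\<close>)
          ultimately show ?thesis using prep kD by (simp add: prepared_def)
        qed (use a(12) in blast)
      qed
      moreover have "\<forall>k \<in> Bs J (Suc i). bm M2 op' k"
        unfolding B(1)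
      proof
        fix k assume k: "k \<in> insert i (Bs J i)"
        show "bm M2 op' k"
        proof (cases "k = i")
          case False
          then have kB: "k \<in> Bs J i" using k by simp
          then have kn: "k < nn" by (simp add: Bs_def)
          have "M2 (nod k 10) = M (nod k 10)" using False kn by (intro a(10)) auto
          moreover have "M2 x = M x" if "OP0 \<le> x" "x < op" for x using a(9)[of x] that regions by simp
          moreover have "bm M op k" using bms kB by blast
          ultimately show ?thesis using a(6) by (intro bm_cong[of M op k M2 op'])
        qed (use a(11) in simp)
      qed
      moreover have "\<tau>2 + 4 \<le> \<tau> + 40 + sum tt (Rg J (Suc i) - Rg J i)"
        using a(13) r1(3) unfolding Rgd tt_def by simp
      moreover have "\<rho>2 vp = nod i 0" using a(3)[of vp] r1(2)[of vp] \<rho> by simp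
      moreover have "AB \<le> ap'" "ap' \<le> AB + sum asz (D J (Suc i))" "OP0 \<le> op'" "op' \<le> OP0 + sum osz (Bs J (Suc i))"
        using a(4-7) ap op as os by linarith+
      ultimately have "Q (\<rho>2(vp := nod (Suc i) 0)) M2 \<tau>3" if "\<tau>3 \<le> \<tau>2 + 4" for \<tau>3
        using that a(1-3,8) r1(2) by (intro Q[of "\<rho>2(vp := nod (Suc i) 0)" ap' op' M2]) simp_all
      then show "wp w (vp \<leftarrow> V vp \<oplus> N 16) Q \<rho>2 M2 \<tau>2"
        using \<open>\<rho>2 vp = nod i 0\<close> cw[OF Suc_leI[OF i], of 0] by (simp add: const_bound)
    qed
    show ?thesis unfolding split_body_def
      using True by (simp add: \<rho> RR r2 Mk nod_pos Jf cw[OF less_imp_le[OF i]] const_bound, intro sp, simp_all)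
  qed
qed

lemma wp_split_nodes:
  assumes R: "regs_ok \<rho>" and S: "static_ok M" and J: "J < h"
    and \<rho>: "\<rho> vJ = J" "\<rho> vAP = ap" "\<rho> vOP = op"
    and prep: "prepared J 0 M ap" and bms: "\<forall>k \<in> Bs J 0. bm M op k"
    and ap: "AB \<le> ap" "ap \<le> AB + sum asz (D J 0)" and op: "OP0 \<le> op" "op \<le> OP0 + sum osz (Bs J 0)"
    and Q: "\<And>\<rho>' M' \<tau>' ap' op'. \<lbrakk>\<rho>' vOP = op'; \<And>x. x < 45 \<Longrightarrow> x \<noteq> 31 \<Longrightarrow> x \<noteq> 32 \<Longrightarrow> \<rho>' x = \<rho> x;
      prepared J nn M' ap'; \<forall>k \<in> Bs J nn. bm M' op' k; OP0 \<le> op'; op' \<le> OP0 + sum osz (Bs J nn);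
      frame {3, 4, 10} {AB..} M M'; \<tau>' \<le> \<tau> + 20 + 50 * nn + sum tt (Rg J nn)\<rbrakk> \<Longrightarrow> Q \<rho>' M' \<tau>'"
  shows "wp w split_nodes Q \<rho> M \<tau>"
proof -
  let ?e = "V vp \<prec> V rE"
  define I where "I i \<rho>' M' \<tau>' \<longleftrightarrow> \<rho>' vp = nod i 0 \<and> (\<forall>x < 45. x \<noteq> 31 \<longrightarrow> x \<noteq> 32 \<longrightarrow> \<rho>' x = \<rho> x) \<and>
      prepared J i M' (\<rho>' vAP) \<and> (\<forall>k \<in> Bs J i. bm M' (\<rho>' vOP) k) \<and>
      AB \<le> \<rho>' vAP \<and> \<rho>' vAP \<le> AB + sum asz (D J i) \<and> OP0 \<le> \<rho>' vOP \<and> \<rho>' vOP \<le> OP0 + sum osz (Bs J i) \<and>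
      frame {3, 4, 10} {AB..} M M' \<and> \<tau>' \<le> \<tau> + 10 + 50 * i + sum tt (Rg J i)"
    for i and \<rho>' M' :: "nat \<Rightarrow> nat" and \<tau>'
  note RR = regs_okD[OF R]
  have "wp w (Whl ?e split_body) Q (\<rho>(vp := A)) M \<tau>0" if "\<tau>0 \<le> \<tau> + 2" for \<tau>0
  proof (rule wp_Whl[where I = I and m = nn])
    show "I 0 (\<rho>(vp := A)) M \<tau>0" using that \<rho> prep bms ap op by (simp add: I_def cell_base)
  next
    fix k \<rho>1 M1 \<tau>1 assume k: "k \<le> nn" and I: "I k \<rho>1 M1 \<tau>1"
    have "\<rho>1 rE = nod nn 0" "\<rho>1 vp = nod k 0" using I RR unfolding I_def by simp_all
    then show "safe w \<rho>1 M1 ?e \<and> (nval w \<rho>1 M1 ?e \<noteq> 0 \<longleftrightarrow> k < nn)" by simp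
  next
    fix i \<rho>1 M1 \<tau>1 \<tau>2 assume i: "i < nn" and I: "I i \<rho>1 M1 \<tau>1" and "\<tau>2 = \<tau>1 + cost ?e + 1"
    then have \<tau>2: "\<tau>2 = \<tau>1 + 4" by simp
    have I1: "\<rho>1 vp = nod i 0" "\<And>x. x < 45 \<Longrightarrow> x \<noteq> 31 \<Longrightarrow> x \<noteq> 32 \<Longrightarrow> \<rho>1 x = \<rho> x"
      "prepared J i M1 (\<rho>1 vAP)" "\<forall>k \<in> Bs J i. bm M1 (\<rho>1 vOP) k"
      "AB \<le> \<rho>1 vAP" "\<rho>1 vAP \<le> AB + sum asz (D J i)" "OP0 \<le> \<rho>1 vOP" "\<rho>1 vOP \<le> OP0 + sum osz (Bs J i)"
      "frame {3, 4, 10} {AB..} M M1" "\<tau>1 \<le> \<tau> + 10 + 50 * i + sum tt (Rg J i)"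
      using I unfolding I_def by simp_all
    have R1: "regs_ok \<rho>1" by (rule regs_ok_cong[OF R]) (simp add: I1(2))
    have S1: "static_ok M1" by (rule static_frame[OF S I1(9)]) (use regions in auto)
    have J1: "\<rho>1 vJ = J" using I1(2)[of vJ] \<rho> by simp
    show "wp w split_body (I (Suc i)) \<rho>1 M1 \<tau>2"
    proof (rule wp_split_body[OF R1 S1 i J I1(1) J1 refl refl I1(3-8)])
      fix \<rho>2 M2 \<tau>3 ap' op'
      assume a: "\<rho>2 vp = nod (Suc i) 0" "\<rho>2 vAP = ap'" "\<rho>2 vOP = op'"
        "\<And>x. x < 45 \<Longrightarrow> x \<noteq> 31 \<Longrightarrow> x \<noteq> 32 \<Longrightarrow> \<rho>2 x = \<rho>1 x" "prepared J (Suc i) M2 ap'" "\<forall>k \<in> Bs J (Suc i). bm M2 op' k"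
        "AB \<le> ap'" "ap' \<le> AB + sum asz (D J (Suc i))" "OP0 \<le> op'" "op' \<le> OP0 + sum osz (Bs J (Suc i))"
        "frame {3, 4, 10} {AB..} M1 M2" "\<tau>3 \<le> \<tau>2 + 40 + sum tt (Rg J (Suc i) - Rg J i)"
      have "Rg J i \<subseteq> Rg J (Suc i)" by (auto simp: Rg_def)
      then have "sum tt (Rg J (Suc i)) = sum tt (Rg J (Suc i) - Rg J i) + sum tt (Rg J i)"
        by (intro sum.subset_diff) simp_all
      then have "\<tau>3 \<le> \<tau> + 10 + 50 * Suc i + sum tt (Rg J (Suc i))" using a(12) \<tau>2 I1(10) by simp
      moreover have "frame {3, 4, 10} {AB..} M M2" by (rule frame_trans[OF I1(9) a(11)])
      ultimately show "I (Suc i) \<rho>2 M2 \<tau>3" unfolding I_def a(2,3) using a(1,4-10) I1(2) by simp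
    qed
  next
    fix \<rho>1 M1 \<tau>1 \<tau>2 assume I: "I nn \<rho>1 M1 \<tau>1" and "\<tau>2 = \<tau>1 + cost ?e + 1"
    then have "\<tau>2 = \<tau>1 + 4" by simp
    then show "Q \<rho>1 M1 \<tau>2" using I unfolding I_def by (intro Q[of \<rho>1 "\<rho>1 vOP" M1 "\<rho>1 vAP"]) simp_all
  qed
  then show ?thesis unfolding split_nodes_def by (simp add: RR)
qed

section \<open>A complete round\<close>

definition "round_inv J \<rho> M \<longleftrightarrow> regs_ok \<rho> \<and> static_ok M \<and> \<rho> vJ = J \<and>
  (\<forall>k < nn. dep T k = J \<longrightarrow> M (nod k 3) = cn k) \<and> (\<forall>k \<in> Bs J 0. bm M (\<rho> vOP) k) \<and>
  OP0 \<le> \<rho> vOP \<and> \<rho> vOP \<le> OP0 + sum osz (Bs J 0)"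

definition "round_time = 200 * nn + q * (60 * g + 90) + 210 * n1 + 120"

lemma wp_round:
  assumes I: "round_inv J \<rho> M" and J: "J < h" "g = 1 \<or> J = 0"
    and Q: "\<And>\<rho>' M' \<tau>'. \<lbrakk>round_inv (J + f) \<rho>' M'; \<tau>' \<le> \<tau> + round_time + sum tt (Rg J nn)\<rbrakk> \<Longrightarrow> Q \<rho>' M' \<tau>'"
  shows "wp w round Q \<rho> M \<tau>"
proof -
  have R: "regs_ok \<rho>" and S: "static_ok M" and vJ: "\<rho> vJ = J" and cnt: "\<And>k. k < nn \<Longrightarrow> dep T k = J \<Longrightarrow> M (nod k 3) = cn k"
    and bms: "\<forall>k \<in> Bs J 0. bm M (\<rho> vOP) k" and op: "OP0 \<le> \<rho> vOP" "\<rho> vOP \<le> OP0 + sum osz (Bs J 0)"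
    using I unfolding round_inv_def by simp_all
  have Jf: "J + f < 2 ^ w" using J f_le(2) h_le nn_eq regions(5) bound mem_end_ge unfolding add_mult_distrib2 by linarith
  have inr: "A + 16 * nn \<le> CB" "CB \<le> RB" "RB \<le> TB" "TB \<le> AB" "AB \<le> OP0" using regions by linarith+
  have "wp w make_codes (wp w make_recode (wp w scan (wp w split_nodes (wp w (vJ \<leftarrow> V vJ \<oplus> V rf) Q)))) \<rho> M \<tau>"
  proof (rule wp_make_codes[OF R S vJ cnt])
    fix \<rho>1 M1 \<tau>1
    assume a1: "\<rho>1 vAP = apos J nn" "\<And>x. x < 45 \<Longrightarrow> x \<noteq> 31 \<Longrightarrow> \<rho>1 x = \<rho> x" "frame codes_cells codes_region M M1"
      "empty_lists J M1" "\<And>a. a < \<sigma> \<Longrightarrow> char_ok J M1 a" "\<tau>1 \<le> \<tau> + 40 + 150 * nn"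
    have R1: "regs_ok \<rho>1" by (rule regs_ok_cong[OF R]) (simp add: a1(2))
    have S1: "static_ok M1" by (rule static_frame[OF S a1(3)]) (use inr in auto)
    show "wp w make_recode (wp w scan (wp w split_nodes (wp w (vJ \<leftarrow> V vJ \<oplus> V rf) Q))) \<rho>1 M1 \<tau>1"
    proof (rule wp_make_recode[OF R1])
      fix \<rho>2 M2 \<tau>2
      assume a2: "\<And>x. x < q \<Longrightarrow> recode_ok M1 M2 x" "\<And>x. x < 50 \<Longrightarrow> \<rho>2 x = \<rho>1 x" "frame {} {RB..<TB} M1 M2"
        "\<tau>2 \<le> \<tau>1 + 10 + q * (60 * g + 90)"
      have R2: "regs_ok \<rho>2" by (rule regs_ok_cong[OF R1]) (simp add: a2(2))
      have S2: "static_ok M2" by (rule static_frame[OF S1 a2(3)]) auto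
      have M2: "M2 a = M1 a" if "A + 16 * nn \<le> a" "a < RB \<or> TB \<le> a" for a
        by (rule frame_regionD[OF a2(3) that(1)]) (use that in auto)
      have ch2: "char_ok J M2 a" if "a < \<sigma>" for a
      proof -
        have "CB + 2 * a + 1 < RB" using that regions by linarith
        then show ?thesis using a1(5)[OF that] M2[of "CB + 2 * a"] M2[of "CB + 2 * a + 1"] inr by (simp add: char_ok_def)
      qed
      have rc2: "recode_ok M2 M2 x" if "x < q" for x
      proof -
        have lt: "CB + 2 * c + 1 < RB" if "c < 2 ^ b" for c using that regions by linarith
        have e: "M2 (CB + 2 * c) = M1 (CB + 2 * c)" "M2 (CB + 2 * c + 1) = M1 (CB + 2 * c + 1)" if "c < 2 ^ b" for c
          using lt[OF that] inr by (auto intro!: M2)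
        have mp: "map (\<lambda>c. M2 (CB + 2 * c) mod 2 ^ f) (digits g b x) = map (\<lambda>c. M1 (CB + 2 * c) mod 2 ^ f) (digits g b x)"
          using fields_digits[of b g x] e(1) by (intro map_cong refl) (simp add: fields_def)
        show ?thesis using a2(1)[OF that] e(2)[of "x mod 2 ^ b"] unfolding recode_ok_def mp by simp
      qed
      have em2: "empty_lists J M2"
      proof -
        have "M2 (nod u c) = M1 (nod u c)" if "u < nn" "c < 16" for u c using frame_cellD[OF a2(3) that] by simp
        moreover have "M2 (apos J u) = M1 (apos J u)" for u using apos_ge[of J u] inr by (intro M2) auto
        ultimately show ?thesis using a1(4) unfolding empty_lists_def by simp
      qed
      show "wp w scan (wp w split_nodes (wp w (vJ \<leftarrow> V vJ \<oplus> V rf) Q)) \<rho>2 M2 \<tau>2"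
      proof (rule wp_scan[OF R2 S2 J(2) ch2 rc2 em2])
        fix \<rho>3 M3 \<tau>3
        assume a3: "\<And>x. x < 45 \<Longrightarrow> \<rho>3 x = \<rho>2 x" "lists_upto J n1 M3" "frame {5, 13} {AB..<OP0} M2 M3"
          "\<tau>3 \<le> \<tau>2 + 20 + 210 * n1"
        have R3: "regs_ok \<rho>3" by (rule regs_ok_cong[OF R2]) (simp add: a3(1))
        have S3: "static_ok M3" by (rule static_frame[OF S2 a3(3)]) auto
        have r3: "\<rho>3 vJ = J" "\<rho>3 vAP = apos J nn" "\<rho>3 vOP = \<rho> vOP" using a1(1,2) a2(2) a3(1) vJ by simp_all
        have c3: "M3 (nod k c) = M (nod k c)" if "k < nn" "c = 3 \<or> c = 10" for k c
          using frame_cellD[OF a1(3) that(1), of c] frame_cellD[OF a2(3) that(1), of c] frame_cellD[OF a3(3) that(1), of c] that(2)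
          by auto
        have o3: "M3 a = M a" if "OP0 \<le> a" for a
          using frame_regionD[OF a1(3), of a] frame_regionD[OF a2(3), of a] frame_regionD[OF a3(3), of a] inr that by auto
        have "prepared J 0 M3 (apos J nn)"
          unfolding prepared_def
        proof
          fix k assume "k \<in> D J 0"
          then have k: "k < nn" "dep T k = J" by (auto simp: D_def)
          have z: "zs J k n1 = zl J k"
            using k unfolding zs_def zl_def sub_def m_def[symmetric] by (simp add: length_sp)
          have "stream W M3 (apos J k) (f * length (zs J k n1)) (pack f (zs J k n1))" "M3 (nod k 4) = apos J k"
            using a3(2) k unfolding lists_upto_def by blast+
          then have "stream W M3 (apos J k) (f * cn k) (pack f (zl J k))" "M3 (nod k 4) = apos J k"
            unfolding z length_zl by blast+
          moreover have "apos J k + (cn k + t - 1) div t \<le> apos J nn"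
            using apos_sep[OF k] k ceil_le[OF t(1), of "cn k" 0] by simp
          ultimately have "lst J M3 (apos J nn) k" unfolding lst_def using apos_ge[of J k] by (simp add: stream_def)
          then show "M3 (nod k 3) = cn k \<and> lst J M3 (apos J nn) k" using c3[OF k(1), of 3] cnt[OF k] by simp
        qed
        moreover have "\<forall>k \<in> Bs J 0. bm M3 (\<rho> vOP) k"
        proof
          fix k assume k: "k \<in> Bs J 0"
          then have "k < nn" by (simp add: Bs_def)
          then have "M3 (nod k 10) = M (nod k 10)" by (intro c3; simp)
          moreover have "bm M (\<rho> vOP) k" using bms k by blast
          ultimately show "bm M3 (\<rho> vOP) k" using o3 by (intro bm_cong[of M "\<rho> vOP" k M3]) simp_all
        qed
        moreover have "apos J nn = AB + sum asz (D J 0)" unfolding apos_def D_def asz_def by simp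
        ultimately show "wp w split_nodes (wp w (vJ \<leftarrow> V vJ \<oplus> V rf) Q) \<rho>3 M3 \<tau>3"
        proof (intro wp_split_nodes[OF R3 S3 J(1) r3])
          fix \<rho>4 M4 \<tau>4 ap' op'
          assume a4: "\<rho>4 vOP = op'" "\<And>x. x < 45 \<Longrightarrow> x \<noteq> 31 \<Longrightarrow> x \<noteq> 32 \<Longrightarrow> \<rho>4 x = \<rho>3 x"
            "prepared J nn M4 ap'" "\<forall>k \<in> Bs J nn. bm M4 op' k" "OP0 \<le> op'" "op' \<le> OP0 + sum osz (Bs J nn)"
            "frame {3, 4, 10} {AB..} M3 M4" "\<tau>4 \<le> \<tau>3 + 20 + 50 * nn + sum tt (Rg J nn)"
          have R4: "regs_ok \<rho>4" by (rule regs_ok_cong[OF R3]) (simp add: a4(2))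
          have S4: "static_ok M4" by (rule static_frame[OF S3 a4(7)]) (use inr in auto)
          have B: "Bs (J + f) 0 = Bs J nn" by (auto simp: Bs_def)
          \<comment> \<open>Of the data on level \<open>J + f\<close> only the counts pass into the
            next round; the lists are built afresh by its scan.\<close>
          have c4: "M4 (nod k 3) = cn k" if "k < nn" "dep T k = J + f" for k
          proof -
            have "0 < k" using that f_pos by (auto intro!: gr0I)
            then have "par T k < nn" using par_props(1)[of k T] that by simp
            then have "k \<in> D J nn" using that f_pos by (simp add: D_def)
            then show ?thesis using a4(3) by (simp add: prepared_def)
          qed
          have "regs_ok (\<rho>4(vJ := J + f))" by (rule regs_ok_cong[OF R4]) simp
          then have inv: "round_inv (J + f) (\<rho>4(vJ := J + f)) M4"
            unfolding round_inv_def using S4 c4 a4(1,4-6) B by simp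
          have "\<tau>4 + 4 \<le> \<tau> + round_time + sum tt (Rg J nn)"
            using a4(8) a3(4) a2(4) a1(6) unfolding round_time_def by linarith
          then have "Q (\<rho>4(vJ := J + f)) M4 \<tau>5" if "\<tau>5 \<le> \<tau>4 + 4" for \<tau>5
            using that by (intro Q[OF inv]) linarith
          moreover have "\<rho>4 vJ = J" "\<rho>4 rf = f" using a4(2) r3 regs_okD[OF R3] by simp_all
          ultimately show "wp w (vJ \<leftarrow> V vJ \<oplus> V rf) Q \<rho>4 M4 \<tau>4" using Jf by simp
        qed (use op apos_ge in auto)
      qed
    qed
  qed
  then show ?thesis unfolding round_def wp_Sq_fun .
qed

end

context layout_bound
begin

section \<open>Parameters, the sequence of rounds, and the output\<close>

lemma wp_set_params:
  assumes \<rho>: "\<rho> rn = n" "\<rho> rsg = \<sigma>" "\<rho> rNB = A" "\<rho> rb = b" "\<rho> rw = w" "\<rho> rt = t" "\<rho> rh = h" "\<rho> rE = nod nn 0"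
    and Q: "\<And>\<rho>' \<tau>'. \<lbrakk>regs_ok \<rho>'; \<rho>' vOP = OP0; \<tau>' \<le> \<tau> + 100\<rbrakk> \<Longrightarrow> Q \<rho>' M \<tau>'"
  shows "wp w set_params Q \<rho> M \<tau>"
proof -
  define rest where "rest = (rg \<leftarrow> V rt \<oslash> V rf;;
     rW \<leftarrow> V rt \<otimes> V rf;;
     rq \<leftarrow> (N 1 \<lless> V rg \<otimes> V rb);;
     rCB \<leftarrow> V rNB \<oplus> N 32 \<otimes> V rsg;;
     rRB \<leftarrow> V rCB \<oplus> N 2 \<otimes> (N 1 \<lless> V rb);;
     rTB \<leftarrow> V rRB \<oplus> N 2 \<otimes> V rq;;
     rAB \<leftarrow> V rTB \<oplus> N 6 \<otimes> (N 1 \<lless> V rW);;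
     rn1 \<leftarrow> (V rn \<oplus> V rg \<ominus> N 1) \<oslash> V rg;;
     vOP \<leftarrow> V rAB \<oplus> N 8 \<otimes> (V rn1 \<otimes> V rg \<oplus> V rsg))"
  have OPw: "OP0 + m + 8 < 2 ^ w" using bound mem_end_ge by linarith
  have c: "CB = A + 32 * \<sigma>" "RB = CB + 2 * 2 ^ b" "TB = RB + 2 * q" "AB = TB + 6 * 2 ^ W" "OP0 = AB + 8 * (m + \<sigma>)"
    by (simp_all add: CB_def RB_def TB_def AB_def OP0_def)
  have s: "32 * \<sigma> < 2 ^ w" "CB < 2 ^ w" "2 * 2 ^ b < (2::nat) ^ w" "RB < 2 ^ w" "2 * q < 2 ^ w" "TB < 2 ^ w"
    "6 * 2 ^ W < (2::nat) ^ w" "AB < 2 ^ w" "8 * (m + \<sigma>) < 2 ^ w" "OP0 < 2 ^ w"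
    using c OPw by linarith+
  have s2: "m + \<sigma> < 2 ^ w" by (rule le_less_trans[OF _ s(9)]) simp
  have s3: "m < 2 ^ w" "n < 2 ^ w" using OPw n_le_m by linarith+
  have ww: "w < 2 ^ w" by simp
  have s4: "W < 2 ^ w" "g * b < 2 ^ w" using W_less gb_less_w ww by linarith+
  have s5: "n + g < 2 ^ w" "1 \<le> n + g"
  proof -
    have "g \<le> t" by (simp add: g_def)
    moreover have "t \<le> OP0" using t_le_OP0[of 0] cn_0 by linarith
    moreover have "n \<le> m" by (rule n_le_m)
    ultimately show "n + g < 2 ^ w" using OPw by linarith
    show "1 \<le> n + g" using g_pos by simp
  qed
  have p: "2 ^ (g * b) mod (2::nat) ^ w = q" "2 ^ b mod (2::nat) ^ w = 2 ^ b" "2 ^ W mod (2::nat) ^ w = 2 ^ W"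
    using gb_less_w b_less_w W_less by (simp_all add: q_def)
  have e: "t div f = g" "t * f = W" "(n + g - Suc 0) div g = n1" "n1 * g = m"
    by (simp_all add: g_def W_def n1_def m_def)
  have s6: "8 * m + 8 * \<sigma> < 2 ^ w" "AB + (8 * m + 8 * \<sigma>) = OP0"
    using s(9) c(5) by (simp_all add: add_mult_distrib2)
  have rest: "wp w rest Q \<rho>1 M \<tau>1" if r1: "\<rho>1 rf = f" "\<And>x. x \<noteq> 8 \<Longrightarrow> \<rho>1 x = \<rho> x" "\<tau>1 \<le> \<tau> + 10" for \<rho>1 \<tau>1
  proof -
    have v: "\<rho>1 rn = n" "\<rho>1 rsg = \<sigma>" "\<rho>1 rNB = A" "\<rho>1 rb = b" "\<rho>1 rw = w" "\<rho>1 rt = t" "\<rho>1 rh = h" "\<rho>1 rE = nod nn 0"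
      using r1(2) \<rho> by simp_all
    have tm: "\<tau>1 \<le> 40 + \<tau>" using r1(3) by simp
    show ?thesis unfolding rest_def
      using s5(2)
      by (simp add: r1(1) v e p c(1-4)[symmetric] s s2 s3 s4 s5(1) const_bound less_imp_le s6,
          intro Q, simp_all add: regs_ok_def r1(1) v tm)
  qed
  have sp: "set_params = (IfE (V rh \<prec> V rt) (rf \<leftarrow> V rh) (rf \<leftarrow> V rt);; rest)"
    by (simp add: set_params_def rest_def)
  show ?thesis
  proof (cases "h < t")
    case True
    then have "f = h" by (simp add: f_def)
    then show ?thesis unfolding sp using True by (simp add: \<rho>, intro rest) (simp_all add: \<rho>)
  next
    case False
    then have "f = t" by (simp add: f_def)
    then show ?thesis unfolding sp using False by (simp add: \<rho>, intro rest) (simp_all add: \<rho>)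
  qed
qed

text \<open>Filtering commutes with concatenation and the padding stands at the end of
  \<open>sp\<close>; hence the true bitmask is a prefix of the computed bits.\<close>

lemma bitmask_bits:
  assumes k: "k < nn" "nd T k = Nd l r" and i: "i < length (bitmask s l r)"
  shows "i < cn k \<and> bit (pack 1 (bits k)) i = bitmask s l r ! i"
proof -
  have sub: "sub k = node_string s (Nd l r) @ filter (\<lambda>a. a \<in> set (leaves (nd T k))) (replicate (m - n) 0)"
    by (simp add: sub_def sp_def node_string_def k)
  have il: "i < length (node_string s (Nd l r))" using i by (simp add: bitmask_def)
  then have ic: "i < cn k" unfolding cn_def sub by simp
  have fb: "fields 1 (bits k)" by (auto simp: bits_def fields_def split: ctree.splits)
  have "bits k ! i = of_bool (bitmask s l r ! i)"
    using il by (simp add: bits_def k sub nth_append bitmask_def)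
  moreover have "length (bits k) = cn k" by (simp add: bits_def k cn_def)
  ultimately show ?thesis using bit_pack[OF fb, of i] ic by (simp add: bit_0)
qed

text \<open>The final memory \<open>M'\<close> may differ from \<open>M\<close> in cell 0, which
  receives the address of the result. Children have larger indices, so the induction runs on
  \<open>nn - k\<close>.\<close>

lemma wavelet_at_node:
  assumes S: "static_ok M" and B: "\<And>k. k < nn \<Longrightarrow> inner (nd T k) \<Longrightarrow> bm M op k" and op: "op \<le> 2 ^ w"
    and M': "\<And>a. 0 < a \<Longrightarrow> M' a = M a" and k: "k < nn"
  shows "wavelet_at w M' s (nod k 10) (nd T k)"
  using k
proof (induction "nn - k" arbitrary: k rule: less_induct)
  case less
  show ?case
  proof (cases "nd T k")
    case (Nd l r)
    note kk = nd_kid[OF less.prems Nd] kid_gt[OF less.prems] kid_less[OF less.prems Nd]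
    have A0: "0 < A" using A by simp
    have nz: "M' (nod j c) = M (nod j c)" for j c using A0 by (intro M') (simp add: cell_def)
    have rec: "record_ok T A M k" using S less.prems by (simp add: static_ok_def)
    then have links: "M (nod k 11) = nod (kid T k) 10" "M (nod k 12) = nod (Suc (kid T k)) 10"
      using Nd by (simp_all add: record_ok_def)
    have IH: "wavelet_at w M' s (nod c 10) (nd T c)" if "c = kid T k \<or> c = Suc (kid T k)" for c
      by (rule less.hyps) (use that kk less.prems in auto)
    define p where "p = M (nod k 10)"
    have b: "OP0 \<le> p" "p + (cn k + w - 1) div w \<le> op" "holds w M p (cn k) (pack 1 (bits k))"
      using B[OF less.prems] Nd by (auto simp: bm_def p_def)
    have "bits_at w M' p (bitmask s l r)"
      unfolding bits_at_def
    proof (intro allI impI)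
      fix i assume i: "i < length (bitmask s l r)"
      note bb = bitmask_bits[OF less.prems Nd i]
      have w0: "0 < w" using w20 by simp
      have "i div w + 1 = (i + w) div w" using w0 by simp
      also have "\<dots> \<le> (cn k + w - 1) div w" using conjunct1[OF bb] by (intro div_le_mono) linarith
      finally have "p + i div w < 2 ^ w" using b op by linarith
      moreover have "bit (M (p + i div w)) (i mod w) = bit (pack 1 (bits k)) i"
        using b(3) bb unfolding holds_def by simp
      moreover have "0 < p" using b regions A0 by linarith
      then have "M' (p + i div w) = M (p + i div w)" by (intro M') simp
      ultimately show "p + i div w < 2 ^ w \<and> bit (M' (p + i div w)) (i mod w) = bitmask s l r ! i"
        using bb by simp
    qed
    moreover have "nod k 12 < 2 ^ w" using node_bound[of k 12] less.prems by simp
    ultimately show ?thesis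
      unfolding Nd wavelet_at.simps using IH[of "kid T k"] IH[of "Suc (kid T k)"] kk nz links
      by (simp add: p_def)
  qed simp
qed

definition "rounds = (h + f - 1) div f"
definition "run_time = 100 * nn + 2 ^ W * (60 * t + 90) + rounds * (round_time + 10) + 600 * h * (m div t) + 1500 * \<sigma> + 300"

lemma rounds_iff: "r < rounds \<longleftrightarrow> r * f < h"
proof -
  have "r < rounds \<longleftrightarrow> Suc r * f \<le> h + f - 1"
    unfolding rounds_def using f_pos by (metis Suc_le_eq less_eq_div_iff_mult_less_eq)
  also have "\<dots> \<longleftrightarrow> r * f < h" using f_pos by auto
  finally show ?thesis .
qed

lemma wp_rounds:
  assumes I0: "round_inv 0 \<rho> M"
    and Q: "\<And>M' \<tau>'. \<lbrakk>wavelet_at w M' s (M' 0) T; \<tau>' \<le> \<tau> + rounds * (round_time + 10) + sum tt {..<nn} + 30\<rbrakk> \<Longrightarrow> \<exists>\<rho>'. Q \<rho>' M' \<tau>'"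
    and Q': "\<And>\<rho>' \<rho>'' M' \<tau>'. Q \<rho>' M' \<tau>' \<Longrightarrow> Q \<rho>'' M' \<tau>'"
  shows "wp w (Whl (V vJ \<prec> V rh) round;; [N 0] \<leftarrow> V rNB \<oplus> N 10) Q \<rho> M \<tau>"
proof -
  let ?e = "V vJ \<prec> V rh"
  define I where "I r \<rho>' M' \<tau>' \<longleftrightarrow> round_inv (r * f) \<rho>' M' \<and>
      \<tau>' \<le> \<tau> + r * (round_time + 10) + sum tt {k. k < nn \<and> dep T k < r * f}"
    for r and \<rho>' M' :: "nat \<Rightarrow> nat" and \<tau>'
  have "wp w (Whl ?e round) (wp w ([N 0] \<leftarrow> V rNB \<oplus> N 10) Q) \<rho> M \<tau>"
  proof (rule wp_Whl[where I = I and m = rounds])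
    show "I 0 \<rho> M \<tau>" using I0 by (simp add: I_def)
  next
    fix r \<rho>1 M1 \<tau>1 assume "I r \<rho>1 M1 \<tau>1"
    then have "\<rho>1 vJ = r * f" "\<rho>1 rh = h" unfolding I_def round_inv_def by (auto dest: regs_okD)
    then show "safe w \<rho>1 M1 ?e \<and> (nval w \<rho>1 M1 ?e \<noteq> 0 \<longleftrightarrow> r < rounds)" by (simp add: rounds_iff)
  next
    fix r \<rho>1 M1 \<tau>1 \<tau>2 assume r: "r < rounds" and I: "I r \<rho>1 M1 \<tau>1" and "\<tau>2 = \<tau>1 + cost ?e + 1"
    then have \<tau>2: "\<tau>2 = \<tau>1 + 4" by simp
    have J: "r * f < h" using r by (simp add: rounds_iff)
    \<comment> \<open>If \<open>g\<close> exceeds 1 then \<open>f = h\<close>, and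
      \<open>r * f < h\<close> leaves only the round \<open>r = 0\<close>.\<close>
    have gJ: "g = 1 \<or> r * f = 0" using g_cases J by (cases "r = 0") auto
    show "wp w round (I (Suc r)) \<rho>1 M1 \<tau>2"
    proof (rule wp_round[OF _ J gJ])
      show "round_inv (r * f) \<rho>1 M1" using I by (simp add: I_def)
      fix \<rho>2 M2 \<tau>3
      assume a: "round_inv (r * f + f) \<rho>2 M2" "\<tau>3 \<le> \<tau>2 + round_time + sum tt (Rg (r * f) nn)"
      have un: "{k. k < nn \<and> dep T k < r * f} \<union> Rg (r * f) nn = {k. k < nn \<and> dep T k < Suc r * f}"
        by (auto simp: Rg_def)
      have fin: "finite {k. k < nn \<and> dep T k < r * f}" "finite (Rg (r * f) nn)"
        "{k. k < nn \<and> dep T k < r * f} \<inter> Rg (r * f) nn = {}"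
        by (auto simp: Rg_def)
      have "\<tau>1 \<le> \<tau> + r * (round_time + 10) + sum tt {k. k < nn \<and> dep T k < r * f}"
        using I by (simp add: I_def)
      then have "\<tau>3 \<le> \<tau> + Suc r * (round_time + 10) + sum tt {k. k < nn \<and> dep T k < Suc r * f}"
        using a(2) \<tau>2 sum.union_disjoint[OF fin, of tt] unfolding un mult_Suc by linarith
      then show "I (Suc r) \<rho>2 M2 \<tau>3" unfolding I_def using a(1) by (simp add: add.commute)
    qed
  next
    fix \<rho>1 M1 \<tau>1 \<tau>2 assume I: "I rounds \<rho>1 M1 \<tau>1" and "\<tau>2 = \<tau>1 + cost ?e + 1"
    then have \<tau>2: "\<tau>2 = \<tau>1 + 4" by simp
    have J: "h \<le> rounds * f" using rounds_iff[of rounds] by simp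
    have inv: "round_inv (rounds * f) \<rho>1 M1" using I by (simp add: I_def)
    then have S: "static_ok M1" and bms: "\<forall>k \<in> Bs (rounds * f) 0. bm M1 (\<rho>1 vOP) k" and R: "regs_ok \<rho>1"
      and op: "\<rho>1 vOP \<le> OP0 + sum osz (Bs (rounds * f) 0)"
      unfolding round_inv_def by simp_all
    have B: "bm M1 (\<rho>1 vOP) k" if "k < nn" "inner (nd T k)" for k
      using bms that dep_inner[OF that] J by (auto simp: Bs_def)
    have opw: "\<rho>1 vOP \<le> 2 ^ w" using osum_le[of "rounds * f" 0] op bound unfolding mem_end_def by linarith
    define M2 where "M2 = M1(0 := nod 0 10)"
    have W: "wavelet_at w M2 s (nod 0 10) (nd T 0)"
      by (rule wavelet_at_node[OF S B opw]) (simp_all add: M2_def node_count_pos)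
    then have W2: "wavelet_at w M2 s (M2 0) T" by (simp add: M2_def)
    have "sum tt {k. k < nn \<and> dep T k < rounds * f} \<le> sum tt {..<nn}" by (intro sum_mono2) auto
    then have t3: "\<tau>2 + 9 \<le> \<tau> + rounds * (round_time + 10) + sum tt {..<nn} + 30"
      using I \<tau>2 unfolding I_def by simp
    have "Q \<rho>' M2 \<tau>3" if "\<tau>3 \<le> \<tau>2 + 9" for \<rho>' \<tau>3
    proof -
      have "\<tau>3 \<le> \<tau> + rounds * (round_time + 10) + sum tt {..<nn} + 30" using that t3 by linarith
      from Q[OF W2 this] show ?thesis using Q' by blast
    qed
    then show "wp w ([N 0] \<leftarrow> V rNB \<oplus> N 10) Q \<rho>1 M1 \<tau>2"
      using node_bound[of 0 10] regs_okD(3)[OF R] by (simp add: M2_def cell_def const_bound)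
  qed
  then show ?thesis by simp
qed

lemma wp_main:
  assumes \<rho>: "\<rho> rn = n" "\<rho> rsg = \<sigma>" "\<rho> rNB = A" "\<rho> rb = b" "\<rho> rw = w" "\<rho> rt = t" "\<rho> rrt = rt0"
    and tr: "tree_at U M rt0 T" "\<And>p. p \<in> U \<Longrightarrow> p + 2 < A"
    and str: "holds w M 4 (n * b) (pack b s)" "\<And>a. a < A \<Longrightarrow> M a < 2 ^ w"
    and Q: "\<And>\<rho>' M' \<tau>'. \<lbrakk>wavelet_at w M' s (M' 0) T; \<tau>' \<le> \<tau> + run_time\<rbrakk> \<Longrightarrow> Q \<rho>' M' \<tau>'"
    and Q': "\<And>\<rho>' \<rho>'' M' \<tau>'. Q \<rho>' M' \<tau>' \<Longrightarrow> Q \<rho>'' M' \<tau>'"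
  shows "wp w (number_nodes;; set_params;; make_tables;; [V rNB \<oplus> N 3] \<leftarrow> V rn1 \<otimes> V rg;; vJ \<leftarrow> N 0;;
    Whl (V vJ \<prec> V rh) round;; [N 0] \<leftarrow> V rNB \<oplus> N 10) Q \<rho> M \<tau>"
proof -
  have inr: "A + 16 * nn \<le> TB" "TB + 6 * 2 ^ W \<le> OP0" using regions by linarith+
  have OPw: "OP0 + m + 8 < 2 ^ w" using bound mem_end_ge by linarith
  define loop where "loop = (Whl (V vJ \<prec> V rh) round;; [N 0] \<leftarrow> V rNB \<oplus> N 10)"
  have "wp w number_nodes (wp w set_params (wp w make_tables (wp w ([V rNB \<oplus> N 3] \<leftarrow> V rn1 \<otimes> V rg;; vJ \<leftarrow> N 0;; loop) Q))) \<rho> M \<tau>"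
  proof (rule wp_number_nodes[OF \<rho>(3,7) tr])
    show "A + 16 * nn + 32 < 2 ^ w"
      using regions(1,4,5,7,8,9) OPw sigma n_le_m unfolding add_mult_distrib2 by linarith
    show "height T < 2 ^ w" using height_less[of T] node_bound[of nn 0] unfolding cell_def by linarith
    fix \<rho>1 M1 \<tau>1
    assume a1: "\<rho>1 rE = nod nn 0" "\<rho>1 rh = height T" "\<And>x. x < 45 \<Longrightarrow> x \<noteq> 15 \<Longrightarrow> x \<noteq> 18 \<Longrightarrow> \<rho>1 x = \<rho> x"
      "\<And>k. k < nn \<Longrightarrow> record_ok T A M1 k" "\<And>a. a < A \<or> A + 16 * nn \<le> a \<Longrightarrow> M1 a = M a" "\<tau>1 \<le> \<tau> + 100 * nn + 30"
    show "wp w set_params (wp w make_tables (wp w ([V rNB \<oplus> N 3] \<leftarrow> V rn1 \<otimes> V rg;; vJ \<leftarrow> N 0;; loop) Q)) \<rho>1 M1 \<tau>1"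
    proof (rule wp_set_params)
      show "\<rho>1 rn = n" "\<rho>1 rsg = \<sigma>" "\<rho>1 rNB = A" "\<rho>1 rb = b" "\<rho>1 rw = w" "\<rho>1 rt = t" "\<rho>1 rh = h" "\<rho>1 rE = nod nn 0"
        using a1(1,2,3) \<rho> by (simp_all add: h_def)
      fix \<rho>2 \<tau>2
      assume R: "regs_ok \<rho>2" and OP: "\<rho>2 vOP = OP0" and \<tau>2: "\<tau>2 \<le> \<tau>1 + 100"
      note RR = regs_okD[OF R]
      show "wp w make_tables (wp w ([V rNB \<oplus> N 3] \<leftarrow> V rn1 \<otimes> V rg;; vJ \<leftarrow> N 0;; loop) Q) \<rho>2 M1 \<tau>2"
      proof (rule wp_make_tables)
        show "\<rho>2 rt = t" "\<rho>2 rf = f" "\<rho>2 rW = t * f" "\<rho>2 rTB = TB" using RR by (simp_all add: W_def)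
        show "0 < f" "0 < t" "t * f < w" using f_pos t(1) W_less by (simp_all add: W_def)
        show "TB + 6 * 2 ^ (t * f) < 2 ^ w" using inr OPw unfolding W_def by linarith
        fix \<rho>3 M3 \<tau>3
        assume a3: "tables_ok M3 t f TB" "\<And>x. x < 50 \<Longrightarrow> \<rho>3 x = \<rho>2 x"
          "\<And>a. a < TB \<or> TB + 6 * 2 ^ (t * f) \<le> a \<Longrightarrow> M3 a = M1 a"
          "\<tau>3 \<le> \<tau>2 + 2 ^ (t * f) * (60 * t + 90) + 20"
        have lowc: "nod k c < TB" if "k < nn" "c < 16" for k c using cell_upper[OF that, of A] inr by linarith
        have S3: "static_ok M3"
          unfolding static_ok_def
        proof (intro conjI allI impI)
          have Ma: "M3 a = M a" if "a < A" for a using a1(5)[of a] a3(3)[of a] that inr by simp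
          show "holds w M3 4 (n * b) (pack b s)"
            by (rule holds_cong[OF str(1)]) (use Ma A w20 in \<open>auto simp: b_def\<close>)
          show "M3 a < 2 ^ w" if "a < A" for a using Ma[OF that] str(2)[OF that] by simp
          show "record_ok T A M3 k" if "k < nn" for k
            by (rule record_ok_cong[OF a1(4)[OF that]]) (use a3(3) lowc that in auto)
          show "tables_ok M3 t f TB" by (rule a3(1))
        qed
        define M4 where "M4 = M3(nod 0 3 := m)"
        have fr: "frame {3} {} M3 M4" unfolding M4_def by (intro frame_cell frame_refl node_count_pos) auto
        have S4: "static_ok M4" by (rule static_frame[OF S3 fr]) auto
        have R3: "regs_ok \<rho>3" by (rule regs_ok_cong[OF R]) (simp add: a3(2))
        have R4: "regs_ok (\<rho>3(vJ := 0))" by (rule regs_ok_cong[OF R3]) simp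
        have c4: "M4 (nod k 3) = cn k" if "k < nn" "dep T k = 0" for k
          using that dep_0[OF that(1)] by (simp add: M4_def cn_0)
        have B0: "Bs 0 0 = {}" by (auto simp: Bs_def)
        have I4: "round_inv 0 (\<rho>3(vJ := 0)) M4"
          unfolding round_inv_def using R4 S4 c4 a3(2) OP by (simp add: B0)
        have lp: "wp w loop Q (\<rho>3(vJ := 0)) M4 \<tau>4" if \<tau>4: "\<tau>4 \<le> \<tau>3 + 20" for \<tau>4
          unfolding loop_def
        proof (rule wp_rounds[OF I4])
          fix M5 \<tau>5
          assume a5: "wavelet_at w M5 s (M5 0) T" "\<tau>5 \<le> \<tau>4 + rounds * (round_time + 10) + sum tt {..<nn} + 30"
          have "\<tau>5 \<le> \<tau> + run_time"
            using a5(2) \<tau>4 a3(4) \<tau>2 a1(6) tsum_le unfolding run_time_def W_def by linarith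
          then show "\<exists>\<rho>'. Q \<rho>' M5 \<tau>5" using Q[OF a5(1)] by blast
        qed (rule Q')
        have v: "\<rho>3 rNB = A" "\<rho>3 rn1 = n1" "\<rho>3 rg = g" using regs_okD[OF R3] by simp_all
        have "n1 * g = m" by (simp add: m_def)
        moreover have "m < 2 ^ w" "A + 3 < 2 ^ w" using OPw node_bound[of 0 3] by (simp_all add: cell_def)
        ultimately show "wp w ([V rNB \<oplus> N 3] \<leftarrow> V rn1 \<otimes> V rg;; vJ \<leftarrow> N 0;; loop) Q \<rho>3 M3 \<tau>3"
          using lp by (simp add: v const_bound M4_def cell_def)
      qed
    qed
  qed
  then show ?thesis unfolding loop_def wp_Sq_fun .
qed

end

section \<open>The time bound\<close>

text \<open>Apply \<open>ln y \<le> y - 1\<close> to \<open>y = sqrt x\<close>. The factor 4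
  combines the 2 from halving the exponent with \<open>ln 2 \<ge> 1 / 2\<close>, which follows from
  the same inequality at \<open>1 / 2\<close>.\<close>

lemma log2_le_sqrt:
  assumes "1 \<le> (x::real)"
  shows "log 2 x \<le> 4 * sqrt x"
proof -
  have "1 / 2 \<le> ln (2::real)" using ln_le_minus_one[of "1 / 2 :: real"] by (simp add: ln_div)
  moreover have l: "0 \<le> ln (sqrt x)" "ln (sqrt x) \<le> sqrt x"
    using assms ln_le_minus_one[of "sqrt x"] by simp_all
  ultimately have "ln (sqrt x) / ln 2 \<le> sqrt x / (1 / 2)" using assms by (intro frac_le) auto
  moreover have "log 2 x = 2 * (ln (sqrt x) / ln 2)" using assms by (simp add: log_def ln_sqrt)
  ultimately show ?thesis by simp
qed

text \<open>Product of three factors: \<open>d + 2\<close> bounds the word length over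
  \<open>log n\<close>, 4 comes from \<open>log n \<le> 4 * sqrt n\<close>, and
  \<open>2 ^ (d + 1)\<close> bounds the square root of \<open>2 ^ w\<close> over
  \<open>sqrt n\<close>.\<close>

definition pow_const :: "nat \<Rightarrow> real" where
  "pow_const d = 4 * (real d + 2) * 2 ^ (d + 1)"

text \<open>\<open>300 * pow_const d\<close> covers the translation tables and the tuple table with
  150 each; 10720 is 8320 for the rounds plus 2400 for the splits; 640 is \<open>40 * 16\<close>
  from measuring the word length. The rest, linear in \<sigma> or constant, fits into 20000.\<close>

definition time_const :: "nat \<Rightarrow> nat \<Rightarrow> real" where
  "time_const c0 d = 20000 + 300 * pow_const d + 10720 * real c0 + 640 * (real d + 2)"

context layout_bound
begin

definition "bnd = real n * log 2 (real \<sigma>) / sqrt (log 2 (real n))"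

lemma logs: "1 \<le> log 2 (real \<sigma>)" "log 2 (real \<sigma>) \<le> log 2 (real n)" "log 2 (real n) \<le> 4 * sqrt (real n)"
proof -
  show "1 \<le> log 2 (real \<sigma>)" using sigma by (simp add: le_log_iff)
  show "log 2 (real \<sigma>) \<le> log 2 (real n)" using sigma by simp
  show "log 2 (real n) \<le> 4 * sqrt (real n)" using sigma by (intro log2_le_sqrt) simp
qed

lemma sqrt_log: "1 \<le> sqrt (log 2 (real n))" "sqrt (log 2 (real n)) * sqrt (log 2 (real n)) = log 2 (real n)"
  "sqrt (log 2 (real n)) \<le> log 2 (real n)"
proof -
  have l: "1 \<le> log 2 (real n)" using logs by linarith
  then show 1: "1 \<le> sqrt (log 2 (real n))" by simp
  show 2: "sqrt (log 2 (real n)) * sqrt (log 2 (real n)) = log 2 (real n)" using l by simp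
  show "sqrt (log 2 (real n)) \<le> log 2 (real n)" using mult_right_mono[OF 1, of "sqrt (log 2 (real n))"] 1 2 by simp
qed

text \<open>Since \<open>log \<sigma> \<ge> 1\<close>, it suffices to stay within
  \<open>n / sqrt (log n)\<close>; terms without the logarithm of \<sigma> are estimated through
  this.\<close>

lemma le_bnd: "0 \<le> a \<Longrightarrow> x * sqrt (log 2 (real n)) \<le> a * real n \<Longrightarrow> x \<le> a * bnd"
proof -
  assume a: "0 \<le> a" "x * sqrt (log 2 (real n)) \<le> a * real n"
  have "a * real n \<le> a * real n * log 2 (real \<sigma>)" using a logs(1) mult_left_mono[of 1 "log 2 (real \<sigma>)" "a * real n"] by simp
  then show ?thesis using a(2) sqrt_log(1) unfolding bnd_def by (simp add: pos_le_divide_eq algebra_simps)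
qed

lemma bnd_ge_1: "1 \<le> 4 * bnd"
proof (rule le_bnd)
  have "sqrt (real n) \<le> sqrt (real n) * sqrt (real n)" using sigma mult_left_mono[of 1 "sqrt (real n)" "sqrt (real n)"] by simp
  then show "1 * sqrt (log 2 (real n)) \<le> 4 * real n" using sqrt_log(3) logs(3) by simp
qed simp

text \<open>If \<open>\<sigma> \<le> sqrt n\<close>, the factor \<open>sqrt (log n)\<close> is
  absorbed by another \<open>sqrt n\<close>. Otherwise \<open>log \<sigma>\<close> is at least half
  of \<open>log n\<close>, so the bound is already of order \<open>n * sqrt (log n)\<close>. Thus
  work linear in the number of nodes is affordable.\<close>

lemma sigma_le_bnd: "real \<sigma> \<le> 4 * bnd"
proof (cases "real \<sigma> \<le> sqrt (real n)")
  case True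
  show ?thesis
  proof (rule le_bnd)
    have "sqrt (log 2 (real n)) \<le> 4 * sqrt (real n)" using sqrt_log(3) logs(3) by linarith
    then have "real \<sigma> * sqrt (log 2 (real n)) \<le> sqrt (real n) * (4 * sqrt (real n))"
      using True sqrt_log(1) by (intro mult_mono) auto
    also have "\<dots> = 4 * (sqrt (real n) * sqrt (real n))" by simp
    finally show "real \<sigma> * sqrt (log 2 (real n)) \<le> 4 * real n" by simp
  qed simp
next
  case False
  have "log 2 (real n) / 2 = log 2 (sqrt (real n))" using sigma by (simp add: log_def ln_sqrt)
  also have "\<dots> \<le> log 2 (real \<sigma>)" using False sigma by simp
  finally have "log 2 (real n) \<le> 2 * log 2 (real \<sigma>)" by simp
  then have "real n * log 2 (real n) \<le> real n * (4 * log 2 (real \<sigma>))" using logs(1) by (intro mult_left_mono) auto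
  moreover have "real \<sigma> * sqrt (log 2 (real n)) \<le> real n * sqrt (log 2 (real n))" using sigma by (intro mult_right_mono) auto
  moreover have "real n * sqrt (log 2 (real n)) \<le> real n * log 2 (real n)" using sqrt_log(3) by (intro mult_left_mono) auto
  ultimately have "real \<sigma> * sqrt (log 2 (real n)) \<le> 4 * (real n * log 2 (real \<sigma>))" by simp
  then show ?thesis using sqrt_log(1) unfolding bnd_def by (simp add: pos_le_divide_eq algebra_simps)
qed

context
  fixes d c0 :: nat
  assumes wd: "w = word_length d n" and tw: "w < 4 * (t + 1) * (t + 1)" and hc: "real h \<le> real c0 * log 2 (real \<sigma>)"
begin

lemma w_log: "real w \<le> (real d + 2) * log 2 (real n)" "log 2 (real n) \<le> real w"
proof -
  have l: "1 \<le> log 2 (real n)" using logs by linarith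
  have "real w \<le> log 2 (real n) + 1 + d"
    unfolding wd word_length_def using ceillog2_less_log[of n] sigma by simp
  also have "\<dots> \<le> (real d + 2) * log 2 (real n)"
    using l mult_left_mono[OF l, of "real d"] by (simp add: algebra_simps)
  finally show "real w \<le> (real d + 2) * log 2 (real n)" .
  show "log 2 (real n) \<le> real w"
    unfolding wd word_length_def using ceillog2_ge_log[of n] sigma by simp
qed

text \<open>The maximality of \<open>t\<close> gives
  \<open>w < 4 * (t + 1) * (t + 1) \<le> 16 * t * t\<close>, and \<open>w\<close> is at least
  \<open>log n\<close>. This is where words of logarithmic length yield the saving.\<close>

lemma sqrt_log_le_t: "sqrt (log 2 (real n)) \<le> 4 * real t"
proof -
  have "(t + 1) * (t + 1) \<le> (2 * t) * (2 * t)" using t(1) by (intro mult_mono) auto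
  then have "w \<le> (4 * t) * (4 * t)" using tw by linarith
  then have "real w \<le> real ((4 * t) * (4 * t))" by (simp only: of_nat_le_iff)
  then have "log 2 (real n) \<le> (4 * real t)\<^sup>2" using w_log(2) by (simp add: power2_eq_square)
  then show ?thesis by (intro real_le_lsqrt) auto
qed

text \<open>Pays for the search of the parameters, which takes one iteration per bit of a
  word.\<close>

lemma w_le_bnd: "real w \<le> 16 * (real d + 2) * bnd"
proof (rule le_bnd)
  have s: "sqrt (log 2 (real n)) \<le> 4 * sqrt (real n)" using sqrt_log(3) logs(3) by linarith
  have "real w \<le> (real d + 2) * (4 * sqrt (real n))"
    using w_log(1) mult_left_mono[OF logs(3), of "real d + 2"] by linarith
  then have "real w * sqrt (log 2 (real n)) \<le> ((real d + 2) * (4 * sqrt (real n))) * (4 * sqrt (real n))"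
    using s sqrt_log(1) by (intro mult_mono) auto
  also have "\<dots> = 16 * (real d + 2) * (sqrt (real n) * sqrt (real n))" by (simp only: ac_simps)
  also have "\<dots> = 16 * (real d + 2) * real n" by simp
  finally show "real w * sqrt (log 2 (real n)) \<le> 16 * (real d + 2) * real n" .
qed simp

text \<open>A table with index length at most \<open>w / 2\<close> has at most
  \<open>sqrt (2 ^ w)\<close> entries, of order \<open>sqrt n\<close> for fixed \<open>d\<close>.
  The factors \<open>t\<close> and \<open>sqrt (log n)\<close> together are of order
  \<open>log n\<close>, at most another \<open>sqrt n\<close>.\<close>

lemma t_pow_le_bnd:
  assumes "2 * e \<le> w"
  shows "real t * 2 ^ e \<le> pow_const d * bnd"
proof (rule le_bnd)
  have "(2::nat) ^ e * 2 ^ e = 2 ^ (2 * e)" by (simp add: power_add[symmetric] mult_2)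
  also have "\<dots> \<le> 2 ^ w" using assms by (intro power_increasing) auto
  also have "\<dots> = 2 ^ ceillog2 n * 2 ^ d" by (simp add: wd word_length_def power_add)
  also have "\<dots> \<le> 2 * n * 2 ^ d" using two_power_ceillog2_gt[of n] sigma by (intro mult_le_mono1) simp
  finally have "real (2 ^ e * 2 ^ e) \<le> real (2 * n * 2 ^ d)" by (simp only: of_nat_le_iff)
  also have "\<dots> \<le> real n * (2 ^ (d + 1) * 2 ^ (d + 1))" 
  proof -
    have "1 \<le> (2::real) ^ d" by simp
    then have "real n * 2 ^ d * 1 \<le> real n * 2 ^ d * (2 * 2 ^ d)" by (intro mult_left_mono) (linarith, simp)
    then show ?thesis by simp
  qed
  finally have "2 ^ e * 2 ^ e \<le> real n * (2 ^ (d + 1) * 2 ^ (d + 1))" by simp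
  then have "(2 ^ e / 2 ^ (d + 1))\<^sup>2 \<le> real n" by (simp add: power2_eq_square divide_simps algebra_simps)
  then have "2 ^ e / 2 ^ (d + 1) \<le> sqrt (real n)" by (rule real_le_rsqrt)
  then have e: "2 ^ e \<le> sqrt (real n) * 2 ^ (d + 1)" by (simp add: pos_divide_le_eq)
  have "t * t \<le> w" using t w20 by auto
  then have "real (t * t) \<le> real w" by (simp only: of_nat_le_iff)
  also have "\<dots> \<le> (real d + 2) * log 2 (real n)" by (rule w_log)
  also have "\<dots> \<le> (real d + 2) * (real d + 2) * log 2 (real n)"
    using sqrt_log by (intro mult_right_mono) auto
  also have "\<dots> = ((real d + 2) * sqrt (log 2 (real n)))\<^sup>2"
    using sqrt_log(2) by (simp add: power2_eq_square algebra_simps)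
  finally have "(real t)\<^sup>2 \<le> ((real d + 2) * sqrt (log 2 (real n)))\<^sup>2"
    by (simp only: power2_eq_square of_nat_mult)
  moreover have "0 \<le> (real d + 2) * sqrt (log 2 (real n))" using sqrt_log(1) by (intro mult_nonneg_nonneg) linarith+
  ultimately have "real t \<le> (real d + 2) * sqrt (log 2 (real n))" by (rule power2_le_imp_le)
  then have "real t * sqrt (log 2 (real n)) \<le> (real d + 2) * sqrt (log 2 (real n)) * sqrt (log 2 (real n))"
    using sqrt_log(1) by (intro mult_right_mono) auto
  also have "\<dots> \<le> (real d + 2) * (4 * sqrt (real n))"
    unfolding mult.assoc sqrt_log(2) using logs(3) by (intro mult_left_mono) auto
  finally have "real t * sqrt (log 2 (real n)) \<le> (real d + 2) * (4 * sqrt (real n))" .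
  then have "real t * sqrt (log 2 (real n)) * 2 ^ e \<le> (real d + 2) * (4 * sqrt (real n)) * (sqrt (real n) * 2 ^ (d + 1))"
    by (rule mult_mono[OF _ e]) simp_all
  also have "\<dots> = 4 * (real d + 2) * 2 ^ (d + 1) * (sqrt (real n) * sqrt (real n))" by (simp only: ac_simps)
  also have "\<dots> = pow_const d * real n" by (simp add: pow_const_def)
  finally show "real t * 2 ^ e * sqrt (log 2 (real n)) \<le> pow_const d * real n" by (simp add: algebra_simps)
qed (simp add: pow_const_def)

lemma nh_le_bnd: "real n * real h / real t \<le> 4 * real c0 * bnd"
proof -
  have t0: "0 < real t" using t by simp
  have s0: "0 < sqrt (log 2 (real n))" using sqrt_log(1) by linarith
  have "real n * real h / real t \<le> real n * (real c0 * log 2 (real \<sigma>)) / (sqrt (log 2 (real n)) / 4)"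
    using hc sqrt_log_le_t s0 logs(1) by (intro frac_le mult_left_mono) auto
  also have "\<dots> = 4 * real c0 * bnd" by (simp add: bnd_def)
  finally show ?thesis .
qed

text \<open>For \<open>h \<le> t\<close> there is one round, whose cost is dominated by the tuple
  table and by about \<open>n / g\<close> reads. Otherwise \<open>g = 1\<close>, a round takes O(n)
  steps, and there are at most \<open>2 * h / t\<close> rounds.\<close>

lemma rounds_le_bnd: "real (rounds * (round_time + 10)) \<le> 700 * real \<sigma> + 150 * (pow_const d * bnd) + 8320 * (real c0 * bnd) + 340"
proof -
  have pos: "0 \<le> bnd" "0 \<le> pow_const d" using bnd_ge_1 by (simp_all add: pow_const_def)
  have nn: "real nn \<le> 2 * real \<sigma>" using nn_eq by linarith
  have qg: "real (q * (60 * g + 90)) \<le> 150 * real (q * g)"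
  proof -
    have "q * (60 * g + 90) \<le> q * (150 * g)" using g_pos by (intro mult_le_mono2) simp
    then have "q * (60 * g + 90) \<le> 150 * (q * g)" by (simp add: algebra_simps)
    then show ?thesis by linarith
  qed
  have qb: "q < 2 * \<sigma>" if "g = 1" using that b_pow by (simp add: q_def)
  have rt: "real (round_time + 10) \<le> 400 * real \<sigma> + 150 * real (q * g) + 210 * real n1 + 130"
    using nn qg unfolding round_time_def by simp
  have t0: "0 < real t" using t by simp
  show ?thesis
  proof (cases "h \<le> t")
    case True
    then have f: "f = h" by (simp add: f_def)
    have "(h + h - 1) div h = 1" using h_pos by (intro div_nat_eqI) auto
    then have r1: "rounds = 1" by (simp add: rounds_def f)
    have "real (q * g) \<le> real t * 2 ^ t + 2 * real \<sigma>"
    proof (cases "g = 1")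
      case False
      then have "q \<le> 2 ^ t" using gb_cases unfolding q_def by (intro power_increasing) auto
      moreover have "g \<le> t" by (simp add: g_def)
      ultimately have "q * g \<le> 2 ^ t * t" by (rule mult_le_mono)
      then have "real (q * g) \<le> real (2 ^ t * t)" by (simp only: of_nat_le_iff)
      then show ?thesis by (simp add: mult.commute)
    next
      case True
      then have "real q \<le> 2 * real \<sigma>" using qb by simp
      moreover have "0 \<le> real t * 2 ^ t" by simp
      ultimately have "real q \<le> real t * 2 ^ t + 2 * real \<sigma>" by linarith
      then show ?thesis using True by simp
    qed
    moreover have "real t * 2 ^ t \<le> pow_const d * bnd"
    proof (rule t_pow_le_bnd)
      show "2 * t \<le> w"
      proof (cases "t = 1")
        case False
        then have "4 * t * t \<le> w" using t by simp
        moreover have "2 * t \<le> 4 * t * t" using t by simp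
        ultimately show ?thesis by linarith
      qed (use w20 in simp)
    qed
    moreover have "real n1 \<le> 8 * (real c0 * bnd) + 1"
    proof -
      have g0: "0 < real g" using g_pos by simp
      have "real n1 \<le> real (n + g - 1) / real g" unfolding n1_def by (rule of_nat_div_le_of_nat)
      also have "\<dots> \<le> (real n + real g) / real g" using g_pos by (intro divide_right_mono) auto
      also have "\<dots> = real n / real g + 1" using g0 by (simp add: add_divide_distrib)
      finally have "real n1 \<le> real n / real g + 1" .
      \<comment> \<open>Rounding in \<open>g = t div h\<close> loses less than a factor 2:
        \<open>t < g * h + h \<le> 2 * (g * h)\<close>.\<close>
      moreover have "real n / real g \<le> 2 * (real n * real h / real t)"
      proof -
        have "t = g * h + t mod h" by (simp add: g_def f)
        moreover have "t mod h < h" using h_pos by simp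
        moreover have "h \<le> g * h" using g_pos by simp
        ultimately have "t \<le> 2 * (g * h)" by linarith
        then have "real t \<le> real (2 * (g * h))" by (simp only: of_nat_le_iff)
        then have "real n * real t \<le> real n * (2 * (real g * real h))" by (intro mult_left_mono) auto
        then show ?thesis using t0 g0 by (simp add: divide_simps algebra_simps)
      qed
      ultimately show ?thesis using nh_le_bnd by linarith
    qed
    moreover have "0 \<le> real c0 * bnd" using pos by simp
    ultimately show ?thesis using rt unfolding r1 by simp
  next
    case False
    then have f: "f = t" by (simp add: f_def)
    have g1: "g = 1" using t by (simp add: g_def f)
    have n1: "n1 = n" by (simp add: n1_def g1)
    \<comment> \<open>With \<open>\<sigma> \<le> n\<close>, \<open>q < 2 * \<sigma>\<close> and
      \<open>n1 = n\<close>, the four terms are at most 400, 300, 210 and 130 times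
      \<open>n\<close>.\<close>
    have rt': "real (round_time + 10) \<le> 1040 * real n"
      using rt qb[OF g1] sigma unfolding n1 g1 by simp
    have "real rounds \<le> real (h + t - 1) / real t" unfolding rounds_def f by (rule of_nat_div_le_of_nat)
    also have "\<dots> \<le> 2 * real h / real t" using False by (intro divide_right_mono) auto
    finally have "real rounds * real (round_time + 10) \<le> 2 * real h / real t * (1040 * real n)"
      using rt' by (intro mult_mono) auto
    also have "\<dots> = 2080 * (real n * real h / real t)" by (simp add: algebra_simps)
    finally have "real (rounds * (round_time + 10)) \<le> 8320 * (real c0 * bnd)"
      using nh_le_bnd unfolding of_nat_mult by linarith
    moreover have "0 \<le> pow_const d * bnd" using pos by simp
    ultimately show ?thesis by linarith
  qed
qed

lemma run_time_le: "real (run_time + 40 * w + 50) \<le> time_const c0 d * bnd"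
proof -
  have nn: "real nn \<le> 2 * real \<sigma>" using nn_eq by linarith
  have t0: "0 < real t" using t by simp
  have "2 ^ W * (60 * t + 90) \<le> 2 ^ W * (150 * t)" using t by (intro mult_le_mono2) simp
  then have "real (2 ^ W * (60 * t + 90)) \<le> real (2 ^ W * (150 * t))" by (simp only: of_nat_le_iff)
  also have "\<dots> = 150 * (real t * 2 ^ W)" by simp
  also have "\<dots> \<le> 150 * (pow_const d * bnd)" using t_pow_le_bnd[OF W_bound(1)] by simp
  finally have a: "real (2 ^ W * (60 * t + 90)) \<le> 150 * (pow_const d * bnd)" .
  have "real (m div t) \<le> real m / real t" by (rule of_nat_div_le_of_nat)
  also have "\<dots> \<le> (real n + real t) / real t" using m_le by (intro divide_right_mono) auto
  finally have "real h * real (m div t) \<le> real h * ((real n + real t) / real t)" by (intro mult_left_mono) auto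
  also have "\<dots> = real n * real h / real t + real h" using t0 by (simp add: field_simps)
  also have "\<dots> \<le> 4 * real c0 * bnd + 2 * real \<sigma>"
    using nh_le_bnd nn height_less[of T] unfolding h_def by linarith
  finally have b: "real (600 * h * (m div t)) \<le> 2400 * (real c0 * bnd) + 1200 * real \<sigma>" by simp
  show ?thesis
    using a b nn rounds_le_bnd w_le_bnd sigma_le_bnd bnd_ge_1
    unfolding run_time_def time_const_def of_nat_add of_nat_mult[of 100] of_nat_mult[of 1500] of_nat_mult[of 40]
    by (simp add: algebra_simps)
qed

end

end

section \<open>The memory fits into the address space\<close>

context layout
begin

text \<open>The terms linear in \<open>n\<close>, and those of order \<open>2 ^ (w div 2)\<close>
  from the tables, each take at most half of the address space. The dependence of \<open>d\<close>
  on \<open>c0\<close> is due to the bitmasks, whose size grows with the height.\<close>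

lemma mem_end_less:
  assumes wd: "w = word_length d n" and A': "A \<le> 4 + 7 * n" and hc: "h \<le> c0 * w" and d: "20 + 2 * c0 \<le> d"
  shows "mem_end < 2 ^ w"
proof -
  define e where "e = w div 2"
  define P where "P = (2::nat) ^ e"
  have t2: "2 * t \<le> w"
  proof (cases "t = 1")
    case False
    then have "4 * t * t \<le> w" using t by simp
    moreover have "2 * t \<le> 4 * t * t" using t by simp
    ultimately show ?thesis by linarith
  qed (use w20 in simp)
  then have te: "t \<le> e" "W \<le> e" using W_bound by (simp_all add: e_def)
  have P: "t \<le> P" "2 ^ t \<le> P" "2 ^ W \<le> P"
    using te less_exp[of e] unfolding P_def by (auto intro: power_increasing order_trans less_imp_le)
  have b: "2 ^ b \<le> 2 * n" using b_pow sigma by linarith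
  have q: "q \<le> P + 2 * n"
  proof (cases "g = 1")
    case False
    then have "q \<le> 2 ^ t" using gb_cases unfolding q_def by (intro power_increasing) auto
    then show ?thesis using P by linarith
  qed (use b in \<open>simp add: q_def\<close>)
  have "(h * m) div w \<le> (c0 * w * m) div w" using hc by (intro div_le_mono mult_le_mono1)
  also have "\<dots> = c0 * m" using w20 by (simp add: mult.commute mult.left_commute)
  also have "\<dots> \<le> c0 * (n + P)" using m_le P by (intro mult_le_mono2) linarith
  finally have hm: "(h * m) div w \<le> c0 * n + c0 * P" by (simp add: add_mult_distrib2)
  \<comment> \<open>With \<sigma> replaced by \<open>n\<close>, \<open>2 ^ b\<close> by
    \<open>2 * n\<close> and \<open>m\<close> by \<open>n + P\<close>, the coefficients of
    \<open>n\<close> sum to 68 and those of \<open>P\<close> to 17; the constant 12 is absorbed into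
    \<open>80 * n\<close>.\<close>
  have "mem_end \<le> 80 * n + 17 * P + (c0 * n + c0 * P)"
    using A' b q hm m_le P sigma
    unfolding mem_end_def OP0_def AB_def TB_def RB_def CB_def add_mult_distrib2 by linarith
  moreover have "2 * (80 * n + c0 * n) \<le> 2 ^ w"
  proof -
    have "2 * (80 * n + c0 * n) = (160 + 2 * c0) * n" by (simp add: add_mult_distrib)
    also have "160 + 2 * c0 \<le> 2 ^ (c0 + 8)"
    proof -
      have "(1::nat) \<le> 2 ^ c0" "(2::nat) ^ (c0 + 8) = 256 * 2 ^ c0" by (simp_all add: power_add)
      then show ?thesis using less_exp[of c0] by linarith
    qed
    then have "(160 + 2 * c0) * n \<le> 2 ^ (c0 + 8) * 2 ^ ceillog2 n"
      using le_two_power_ceillog2[of n] by (rule mult_le_mono)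
    also have "\<dots> \<le> 2 ^ w"
      unfolding wd word_length_def power_add[symmetric] using d by (intro power_increasing) auto
    finally show ?thesis .
  qed
  moreover have "2 * (17 * P + c0 * P) < 2 ^ w"
  proof -
    have "2 * (17 * P + c0 * P) = (34 + 2 * c0) * P" by (simp add: add_mult_distrib)
    also have "34 + 2 * c0 < 2 ^ (c0 + 6)"
    proof -
      have "(1::nat) \<le> 2 ^ c0" "(2::nat) ^ (c0 + 6) = 64 * 2 ^ c0" by (simp_all add: power_add)
      then show ?thesis using less_exp[of c0] by linarith
    qed
    then have "(34 + 2 * c0) * P < 2 ^ (c0 + 6) * P" by (simp add: P_def)
    also have "\<dots> = 2 ^ (c0 + 6 + e)" by (simp add: P_def power_add)
    also have "\<dots> \<le> 2 ^ w"
    proof (rule power_increasing)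
      have "d \<le> w" by (simp add: wd word_length_def)
      then show "c0 + 6 + e \<le> w" using d unfolding e_def by presburger
    qed simp
    finally show ?thesis .
  qed
  ultimately show ?thesis unfolding add_mult_distrib2 by linarith
qed

end

section \<open>The theorem\<close>

lemma length_string_bits: "length (string_bits \<sigma> s) = length s * ceillog2 \<sigma>"
  by (induction s) (simp_all add: string_bits_def char_width_def)

lemma nth_string_bits:
  assumes "i < length s * ceillog2 \<sigma>"
  shows "string_bits \<sigma> s ! i = bit (s ! (i div ceillog2 \<sigma>)) (i mod ceillog2 \<sigma>)"
  using assms
proof (induction s arbitrary: i)
  case (Cons a s)
  let ?b = "ceillog2 \<sigma>"
  have eq: "string_bits \<sigma> (a # s) = map (bit a) [0..<?b] @ string_bits \<sigma> s"
    by (simp add: string_bits_def char_width_def)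
  show ?case
  proof (cases "i < ?b")
    case False
    have b: "0 < ?b" using Cons.prems by (cases "?b = 0") auto
    have "i div ?b = Suc ((i - ?b) div ?b)" "i mod ?b = (i - ?b) mod ?b"
      using b False by (simp_all add: le_div_geq le_mod_geq)
    then show ?thesis using Cons.IH[of "i - ?b"] Cons.prems False by (simp add: eq nth_append)
  qed (simp add: eq nth_append)
qed simp

lemma holds_string:
  assumes "bits_at w M p (string_bits \<sigma> s)" "set s \<subseteq> {0..<\<sigma>}" "0 < ceillog2 \<sigma>"
  shows "holds w M p (length s * ceillog2 \<sigma>) (pack (ceillog2 \<sigma>) s)"
  unfolding holds_def
proof (intro allI impI)
  fix i assume i: "i < length s * ceillog2 \<sigma>"
  have "fields (ceillog2 \<sigma>) s"
    unfolding fields_def using assms(2) le_two_power_ceillog2[of \<sigma>] by auto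
  moreover have "i div ceillog2 \<sigma> < length s" using i assms(3) by (simp add: div_less_iff_less_mult)
  ultimately show "bit (M (p + i div w)) (i mod w) = bit (pack (ceillog2 \<sigma>) s) i"
    using assms(1,3) i unfolding bits_at_def by (simp add: length_string_bits nth_string_bits bit_pack)
qed

lemma leaves_Nil [simp]: "leaves T \<noteq> []"
  by (induction T) auto

lemma wavelet_tree_construction:
  assumes len: "length s = n" and alph: "set s \<subseteq> {0..<\<sigma>}" and sn: "\<sigma> \<le> n" and shape: "shape_for \<sigma> T"
    and height: "real (height T) \<le> C * log 2 (real \<sigma>)" and c0: "c0 = nat \<lceil>C\<rceil>" and d: "20 + 2 * c0 \<le> d"
  shows "constructs_wavelet_tree (compile wavelet_program) (word_length d n) \<sigma> s T (time_const c0 d * time_bound \<sigma> n)"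
  unfolding constructs_wavelet_tree_def
proof (intro allI impI)
  fix M assume input: "input_memory (word_length d n) \<sigma> s T M"
  define w where "w = word_length d n"
  define U where "U = {4 + nat \<lceil>real (n * ceillog2 \<sigma>) / real w\<rceil> + 3 * i | i. i < 2 * \<sigma> - 1}"
  define A where "A = M 3"
  let ?K = "time_const c0 d * time_bound \<sigma> n"
  have K: "20000 \<le> time_const c0 d" by (simp add: time_const_def pow_const_def)
  have tb: "1 \<le> time_bound \<sigma> n" by (simp add: time_bound_def)
  have M: "\<And>a. M a < 2 ^ w" "M 0 = n" "M 1 = \<sigma>"
      "M 3 = 4 + nat \<lceil>real (n * ceillog2 \<sigma>) / real w\<rceil> + 3 * (2 * \<sigma> - 1)"
      "bits_at w M 4 (string_bits \<sigma> s)" "tree_at U M (M 2) T"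
    using input unfolding input_memory_def Let_def w_def[symmetric] len char_width_def U_def by blast+
  have w20: "20 \<le> w" using d by (simp add: w_def word_length_def)
  have \<sigma>0: "0 < \<sigma>" using shape by (auto simp: shape_for_def)
  have "n \<le> 2 ^ ceillog2 n" by (rule le_two_power_ceillog2)
  also have "\<dots> \<le> 2 ^ w" by (simp add: w_def word_length_def)
  finally have \<sigma>w: "\<sigma> \<le> 2 ^ w" using sn by simp
  have "w < 2 ^ w" by simp
  then have small: "3 < (2::nat) ^ w" "2 < (2::nat) ^ w" "Suc 0 < (2::nat) ^ w" using w20 by linarith+
  define Q where "Q \<rho> M' \<tau> \<longleftrightarrow> real \<tau> \<le> ?K \<and> wavelet_at w M' s (M' 0) T"
    for \<rho> M' :: "nat \<Rightarrow> nat" and \<tau>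
  define main where "main = (number_nodes;; set_params;; make_tables;;
    [V rNB \<oplus> N 3] \<leftarrow> V rn1 \<otimes> V rg;; vJ \<leftarrow> N 0;; Whl (V vJ \<prec> V rh) round;; [N 0] \<leftarrow> V rNB \<oplus> N 10)"
  have prog: "wavelet_program = (rn \<leftarrow> Ld (N 0);; rsg \<leftarrow> Ld (N 1);; rrt \<leftarrow> Ld (N 2);; rNB \<leftarrow> Ld (N 3);;
     IfE (N 1 \<prec> V rsg) (find_params;; main) Skp)"
    by (simp only: wavelet_program_def main_def)
  have main: "wp w (find_params;; main) Q \<rho>1 M \<tau>1"
    if r: "2 \<le> \<sigma>" "\<rho>1 rn = n" "\<rho>1 rsg = \<sigma>" "\<rho>1 rNB = A" "\<rho>1 rrt = M 2" "\<tau>1 \<le> 30" for \<rho>1 \<tau>1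
    unfolding wp_Sq
  proof (rule wp_find_params[of \<rho>1 \<sigma>, OF r(3) \<sigma>0 \<sigma>w w20])
    fix \<rho>2 \<tau>2 t
    assume a: "\<rho>2 rw = w" "\<rho>2 rb = ceillog2 \<sigma>" "\<rho>2 rt = t" "0 < t" "t = 1 \<or> 4 * t * t \<le> w"
      "w < 4 * (t + 1) * (t + 1)" "\<And>x. x < 45 \<Longrightarrow> x \<noteq> 5 \<Longrightarrow> x \<noteq> 6 \<Longrightarrow> x \<noteq> 7 \<Longrightarrow> \<rho>2 x = \<rho>1 x"
      "\<tau>2 \<le> \<tau>1 + 40 * w + 20"
    have w0: "0 < real w" using w20 by simp
    define z where "z = nat \<lceil>real (n * ceillog2 \<sigma>) / real w\<rceil>"
    have "real (n * ceillog2 \<sigma>) / real w \<le> real z" unfolding z_def by (rule real_nat_ceiling_ge)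
    then have "real (n * ceillog2 \<sigma>) \<le> real (z * w)" using w0 by (simp add: pos_divide_le_eq)
    then have "n * ceillog2 \<sigma> \<le> z * w" by (simp only: of_nat_le_iff)
    \<comment> \<open>Converts the real ceiling of the input format into the integer division used
      by the layout.\<close>
    then have "(n * ceillog2 \<sigma> + w - 1) div w < z + 1" using w20 by (simp add: div_less_iff_less_mult)
    then have A1: "4 + (n * ceillog2 \<sigma> + w - 1) div w \<le> A" using M(4) by (simp add: A_def z_def)
    have cw: "ceillog2 \<sigma> \<le> w" using ceillog2_mono[OF sn] by (simp add: w_def word_length_def)
    then have "n * ceillog2 \<sigma> \<le> n * w" by simp
    then have "real (n * ceillog2 \<sigma>) \<le> real (n * w)" by (simp only: of_nat_le_iff)
    then have "real (n * ceillog2 \<sigma>) / real w \<le> real n" using w0 by (simp add: pos_divide_le_eq)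
    then have "z \<le> n" unfolding z_def by linarith
    moreover have "A = 4 + z + 3 * (2 * \<sigma> - 1)" using M(4) by (simp only: A_def z_def)
    ultimately have A2: "A \<le> 4 + 7 * n" using sn by linarith
    interpret layout w n \<sigma> t A s T
      using len alph shape r(1) sn w20 a(4,5) A1 by unfold_locales
    have hC: "real h \<le> real c0 * log 2 (real \<sigma>)"
    proof -
      have "C \<le> real c0" unfolding c0 by (rule real_nat_ceiling_ge)
      then have "C * log 2 (real \<sigma>) \<le> real c0 * log 2 (real \<sigma>)" using r(1) by (intro mult_right_mono) auto
      then show ?thesis using height unfolding h_def by linarith
    qed
    have "real h \<le> real (c0 * w)"
    proof -
      have "log 2 (real \<sigma>) \<le> real (ceillog2 \<sigma>)" using \<sigma>0 by (simp add: ceillog2_ge_log)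
      then have "log 2 (real \<sigma>) \<le> real w" using cw by linarith
      then show ?thesis using hC mult_left_mono[of "log 2 (real \<sigma>)" "real w" "real c0"] by simp
    qed
    then have hw: "h \<le> c0 * w" by (simp only: of_nat_le_iff)
    interpret layout_bound w n \<sigma> t A s T
      by unfold_locales (rule mem_end_less[OF w_def A2 hw d])
    show "wp w main Q \<rho>2 M \<tau>2"
      unfolding main_def
    proof (rule wp_main)
      show "\<rho>2 rn = n" "\<rho>2 rsg = \<sigma>" "\<rho>2 rNB = A" "\<rho>2 rb = b" "\<rho>2 rw = w" "\<rho>2 rt = t" "\<rho>2 rrt = M 2"
        using a(1,2,3,7) r by (simp_all add: b_def)
      show "tree_at U M (M 2) T" by (rule M(6))
      show "p + 2 < A" if "p \<in> U" for p using that M(4) by (auto simp: U_def A_def)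
      show "holds w M 4 (n * b) (pack b s)"
        using holds_string[OF M(5) alph] b_pos len by (simp add: b_def)
      show "M a < 2 ^ w" for a by (rule M(1))
      fix \<rho>3 M3 \<tau>3 assume e: "wavelet_at w M3 s (M3 0) T" "\<tau>3 \<le> \<tau>2 + run_time"
      have "\<tau>3 \<le> run_time + 40 * w + 50" using e(2) a(8) r(6) by linarith
      then have "real \<tau>3 \<le> real (run_time + 40 * w + 50)" by (simp only: of_nat_le_iff)
      also have "\<dots> \<le> time_const c0 d * bnd" by (rule run_time_le[OF w_def a(6) hC])
      also have "\<dots> \<le> ?K" using K by (intro mult_left_mono) (auto simp: time_bound_def bnd_def)
      finally show "Q \<rho>3 M3 \<tau>3" using e(1) by (simp add: Q_def)
    qed (simp add: Q_def)
  qed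
  have "wp w wavelet_program Q (\<lambda>_. 0) M 0"
  proof (cases "2 \<le> \<sigma>")
    case True
    then show ?thesis using M(2,3) small unfolding prog
      by (simp del: wp_Sq add: wp_Sq[of w "_ \<leftarrow> _"]) (rule main; simp add: A_def)
  next
    case False
    then have 1: "\<sigma> = Suc 0" using \<sigma>0 by simp
    have "\<exists>a. T = Lf a"
    proof (cases T)
      case (Nd l r)
      then have "length (leaves l) + length (leaves r) = 1" using shape 1 by (simp add: shape_for_def)
      then show ?thesis using leaves_Nil[of l] leaves_Nil[of r] by (cases "leaves l"; cases "leaves r") auto
    qed simp
    then obtain a where T: "T = Lf a" ..
    \<comment> \<open>For \<sigma> = 1 only the header is read and tested, which takes fewer than 40
      steps.\<close>
    have "40 \<le> ?K" using K tb mult_mono[of 40 "time_const c0 d" 1 "time_bound \<sigma> n"] by simp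
    then show ?thesis using M(2,3) small unfolding prog by (simp add: 1 Q_def T)
  qed
  then obtain k \<rho>' M' where "hexec w wavelet_program (\<lambda>_. 0) M k \<rho>' M'" "Q \<rho>' M' (0 + k)"
    unfolding wp_def by blast
  then show "\<exists>k R' M'. exec (word_length d n) (compile wavelet_program) (\<lambda>_. 0, M) k (R', M') \<and>
      real k \<le> ?K \<and> wavelet_at (word_length d n) M' s (M' 0) T"
    using exec_compile[of w wavelet_program "\<lambda>_. 0" M k \<rho>' M' "\<lambda>_. 0"] unfolding Q_def w_def by auto
qed

text \<open>One program serves all \<open>C\<close> and \<open>d\<close>, since it measures height
  and word length itself. \<open>C\<close> determines how much memory the bitmasks can take, hence
  the threshold for \<open>d\<close>, and together with \<open>d\<close> the constant of the time
  bound.\<close>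

theorem theorem2:
  shows "\<exists>P :: com. \<forall>C :: real. \<exists>d0 :: nat. \<forall>d \<ge> d0. \<exists>c :: real.
    \<forall>(n :: nat) (\<sigma> :: nat) (s :: nat list) (T :: ctree).
      length s = n \<longrightarrow> set s \<subseteq> {0..<\<sigma>} \<longrightarrow> \<sigma> \<le> n \<longrightarrow>
      shape_for \<sigma> T \<longrightarrow> real (height T) \<le> C * log 2 (real \<sigma>) \<longrightarrow>
      constructs_wavelet_tree P (word_length d n) \<sigma> s T (c * time_bound \<sigma> n)"
proof (rule exI[of _ "compile wavelet_program"], rule allI)
  fix C :: real
  show "\<exists>d0 :: nat. \<forall>d \<ge> d0. \<exists>c :: real. \<forall>n \<sigma> s T.
      length s = n \<longrightarrow> set s \<subseteq> {0..<\<sigma>} \<longrightarrow> \<sigma> \<le> n \<longrightarrow>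
      shape_for \<sigma> T \<longrightarrow> real (height T) \<le> C * log 2 (real \<sigma>) \<longrightarrow>
      constructs_wavelet_tree (compile wavelet_program) (word_length d n) \<sigma> s T (c * time_bound \<sigma> n)"
    by (intro exI[of _ "20 + 2 * nat \<lceil>C\<rceil>"] allI impI, rule exI, intro allI impI,
        rule wavelet_tree_construction) (assumption | rule refl)+
qed

end
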